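(* Suppose that the assumptions (T1), (T2), (S1)–(S4), (M1), (M2), (C1) listed in the context hold, and that there are constants $0<C_\ell\le C_u<\infty$ (independent of $h$ and $d$) with $C_\ell\le|\Delta\mu_h|\le C_u$ for all $h=1,\dots,d$. Then, as $d,n\to\infty$, $$a_d\Big(\max_{h=1}^d T_{n,h}-b_d\Big)\Longrightarrow G$$ in distribution.
   Context: Model. $\{\varepsilon_j\}_{j\in\mathbb Z}$ are i.i.d. random elements of a measurable space $\mathbb S$; for $h\in\mathbb N$, $g_h:\mathbb S^{\mathbb N}\to\mathbb R$ is measurable and $X_{j,h}=g_h(\varepsilon_j,\varepsilon_{j-1},\dots)$ is centered. For each $h\in\mathbb N$ there are constants $\mu_h^{(1)},\mu_h^{(2)}\in\mathbb R$, $t_h\in(0,1)$; $\Delta\mu_h=\mu_h^{(1)}-\mu_h^{(2)}$; $t_h:=1/2$ if $\Delta\mu_h=0$. Observations: $Z_{j,h}=\mu_{j,h}+X_{j,h}$, $1\le j\le n$, $1\le h\le d$, with $\mu_{j,h}=\mu_h^{(1)}$ for $j\le\lfloor nt_h\rfloor$ and $\mu_{j,h}=\mu_h^{(2)}$ for $j>\lfloor nt_h\rfloor$. The dimension $d=d(n)$ tends to infinity with $n$. Dependence quantities. $\varepsilon_0'$ is an independent copy of $\varepsilon_0$, $X_{j,h}'=g_h(\varepsilon_j,\dots,\varepsilon_1,\varepsilon_0',\varepsilon_{-1},\dots)$, $\vartheta_{j,h,p}=\|X_{j,h}-X_{j,h}'\|_p$ with $\|Y\|_p=(\mathbb E|Y|^p)^{1/p}$.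 $\phi_{h,i}(j)=\mathrm{Cov}(X_{0,h},X_{j,i})$, $\phi_h=\phi_{h,h}$, $\gamma_{h,i}=\sum_{j\in\mathbb Z}\phi_{h,i}(j)$, $\sigma_h^2=\gamma_{h,h}$ ($\sigma_h\geq 0$), $\rho_{h,i}=\gamma_{h,i}/(\sigma_h\sigma_i)$. Assumptions ($\lesssim$ means up to a constant independent of $n,d,j$). For some $p>4$, constants $\delta\in(0,1)$, $\sigma_\pm>0$, $B\in(0,1/2)$, $C_1,C_2,C_4,D,\eta>0$, $C_3>1$, $\rho_+>0$, $\mathbf t\in(0,1/2)$: (T1) $\sup_{h}\vartheta_{j,h,p}\lesssim\delta^j$ for $j\ge 0$. (T2) $\sigma_-\le\inf_h\sigma_h\le\sup_h\sigma_h\le\sigma_+$. (S1) $d=C_1n^D$. (S2) $0<D<\min\{p/4-1,\;p/4-B(p/2+1)-1\}$. (S3) $\sup_{|h-i|\ge1}|\rho_{h,i}|\le\rho_+<1$. (S4) $|\rho_{h,i}|\le C_2\log(|h-i|+2)^{-2-\eta}$. (M1) There is a positive sequence $(M_d)$ with $\max_{h=1}^d\mathbb E[\exp(|X_{1,h}|/M_d)]\le C_3$. (M2) $M_d\le C_4n^m$ with some $m<3/8$. (C1) $\mathbf t\le t_h\le1-\mathbf t$ for all $h$. Statistics. $\mathbb U_{n,h}(s)=\frac1n\sum_{j=1}^{\lfloor ns\rfloor}Z_{j,h}-\frac{\lfloor ns\rfloor}{n^2}\sum_{j=1}^nZ_{j,h}$, $s\in[0,1]$; $\tau(t)=\frac{2\sqrt{1+2t(1-t)}}{\sqrt5\,t(1-t)}$;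 $\mathbb M_{n,h}^2=\frac{3}{(t_h(1-t_h))^2}\int_0^1\mathbb U_{n,h}^2(s)\,ds$; $T_{n,h}=\frac{\sqrt n}{\tau(t_h)\sigma_h|\Delta\mu_h|}(\mathbb M_{n,h}^2-\Delta\mu_h^2)$. $a_d=\sqrt{2\log d}$, $b_d=a_d-\frac{\log(4\pi\log d)}{2a_d}$; $G$ is standard Gumbel: $\mathbb P(G\le x)=e^{-e^{-x}}$. *)

theory Defs
  imports "HOL-Probability.Probability"
begin

text \<open>Causal functionals of the innovations: \<open>X\<^sub>j\<^sub>,\<^sub>h = g\<^sub>h(\<epsilon>\<^sub>j, \<epsilon>\<^sub>j\<^sub>-\<^sub>1, \<dots>)\<close>. Coordinate \<open>k = 0, 1, 2, \<dots>\<close> of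
  the argument of \<open>g h\<close> is \<open>\<epsilon>\<^sub>j\<^sub>-\<^sub>k\<close>.\<close>

definition causal :: "(nat \<Rightarrow> (nat \<Rightarrow> 's) \<Rightarrow> real) \<Rightarrow> (int \<Rightarrow> 'w \<Rightarrow> 's) \<Rightarrow> int \<Rightarrow> nat \<Rightarrow> 'w \<Rightarrow> real" where
  "causal g eps j h \<omega> = g h (\<lambda>k. eps (j - int k) \<omega>)"

definition Lp_norm :: "'w measure \<Rightarrow> real \<Rightarrow> ('w \<Rightarrow> real) \<Rightarrow> real" where
  "Lp_norm M p Y = (\<integral>\<omega>. \<bar>Y \<omega>\<bar> powr p \<partial>M) powr (1 / p)"

text \<open>The coupled variable \<open>X'\<^sub>j\<^sub>,\<^sub>h\<close> is obtained by replacing the innovation \<open>\<epsilon>\<^sub>0\<close> by its copy \<open>eps'\<close>.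
  If \<open>\<bar>X\<^sub>j\<^sub>,\<^sub>h - X'\<^sub>j\<^sub>,\<^sub>h\<bar> powr p\<close> is not integrable, the value below is 0, so bounds on it have to
  be accompanied by integrability.\<close>

definition phys_dep ::
  "'w measure \<Rightarrow> (nat \<Rightarrow> (nat \<Rightarrow> 's) \<Rightarrow> real) \<Rightarrow> (int \<Rightarrow> 'w \<Rightarrow> 's) \<Rightarrow> ('w \<Rightarrow> 's) \<Rightarrow> nat \<Rightarrow> nat \<Rightarrow> real \<Rightarrow> real" where
  "phys_dep M g eps eps' j h p =
     Lp_norm M p (\<lambda>\<omega>. causal g eps (int j) h \<omega> - causal g (eps(0 := eps')) (int j) h \<omega>)"

definition covar :: "'w measure \<Rightarrow> ('w \<Rightarrow> real) \<Rightarrow> ('w \<Rightarrow> real) \<Rightarrow> real" where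
  "covar M X Y = (\<integral>\<omega>. (X \<omega> - (\<integral>v. X v \<partial>M)) * (Y \<omega> - (\<integral>v. Y v \<partial>M)) \<partial>M)"

definition cross_cov :: "'w measure \<Rightarrow> (int \<Rightarrow> nat \<Rightarrow> 'w \<Rightarrow> real) \<Rightarrow> nat \<Rightarrow> nat \<Rightarrow> int \<Rightarrow> real" where
  "cross_cov M X h i j = covar M (X 0 h) (X j i)"

definition lr_cov :: "'w measure \<Rightarrow> (int \<Rightarrow> nat \<Rightarrow> 'w \<Rightarrow> real) \<Rightarrow> nat \<Rightarrow> nat \<Rightarrow> real" where
  "lr_cov M X h i = infsum (cross_cov M X h i) UNIV"

definition lr_sd :: "'w measure \<Rightarrow> (int \<Rightarrow> nat \<Rightarrow> 'w \<Rightarrow> real) \<Rightarrow> nat \<Rightarrow> real" where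
  "lr_sd M X h = sqrt (lr_cov M X h h)"

definition lr_corr :: "'w measure \<Rightarrow> (int \<Rightarrow> nat \<Rightarrow> 'w \<Rightarrow> real) \<Rightarrow> nat \<Rightarrow> nat \<Rightarrow> real" where
  "lr_corr M X h i = lr_cov M X h i / (lr_sd M X h * lr_sd M X i)"

definition obs ::
  "nat \<Rightarrow> (nat \<Rightarrow> real) \<Rightarrow> (nat \<Rightarrow> real) \<Rightarrow> (nat \<Rightarrow> real) \<Rightarrow> (int \<Rightarrow> nat \<Rightarrow> 'w \<Rightarrow> real) \<Rightarrow> nat \<Rightarrow> nat \<Rightarrow> 'w \<Rightarrow> real" where
  "obs n \<mu>1 \<mu>2 t X j h \<omega> = (if int j \<le> \<lfloor>real n * t h\<rfloor> then \<mu>1 h else \<mu>2 h) + X (int j) h \<omega>"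

definition tau :: "real \<Rightarrow> real" where
  "tau t = 2 * sqrt (1 + 2 * t * (1 - t)) / (sqrt 5 * t * (1 - t))"

text \<open>In the following three definitions \<open>z 1, \<dots>, z n\<close> is the data of a single coordinate.\<close>

definition cusum :: "nat \<Rightarrow> (nat \<Rightarrow> real) \<Rightarrow> real \<Rightarrow> real" where
  "cusum n z s = (\<Sum>j = 1..nat \<lfloor>real n * s\<rfloor>. z j) / real n
     - of_int \<lfloor>real n * s\<rfloor> / (real n)\<^sup>2 * (\<Sum>j = 1..n. z j)"

definition msq :: "nat \<Rightarrow> real \<Rightarrow> (nat \<Rightarrow> real) \<Rightarrow> real" where
  "msq n t z = 3 / (t * (1 - t))\<^sup>2 * (LBINT s:{0..1}. (cusum n z s)\<^sup>2)"

definition tstat :: "nat \<Rightarrow> real \<Rightarrow> real \<Rightarrow> real \<Rightarrow> (nat \<Rightarrow> real) \<Rightarrow> real" where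
  "tstat n t \<sigma> \<Delta> z = sqrt (real n) / (tau t * \<sigma> * \<bar>\<Delta>\<bar>) * (msq n t z - \<Delta>\<^sup>2)"

definition gumbel_a :: "nat \<Rightarrow> real" where
  "gumbel_a d = sqrt (2 * ln (real d))"

definition gumbel_b :: "nat \<Rightarrow> real" where
  "gumbel_b d = gumbel_a d - ln (4 * pi * ln (real d)) / (2 * gumbel_a d)"

definition gumbel :: "real measure" where
  "gumbel = interval_measure (\<lambda>x. exp (- exp (- x)))"

lemma gumbel_cdf_props:
  defines "F \<equiv> \<lambda>x::real. exp (- exp (- x))"
  shows "x \<le> y \<Longrightarrow> F x \<le> F y" and "continuous (at_right a) F"
    and "(F \<longlongrightarrow> 0) at_bot" and "(F \<longlongrightarrow> 1) at_top"
proof -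
  show "x \<le> y \<Longrightarrow> F x \<le> F y" by (simp add: F_def)
  have "isCont F a" unfolding F_def by (intro continuous_intros)
  then show "continuous (at_right a) F"
    using continuous_at_imp_continuous_at_within by blast
  have "LIM x at_bot. exp (- x :: real) :> at_top"
    by (rule filterlim_compose[OF exp_at_top filterlim_uminus_at_top_at_bot])
  then have "LIM x at_bot. - exp (- x :: real) :> at_bot"
    by (simp add: filterlim_uminus_at_bot)
  then show "(F \<longlongrightarrow> 0) at_bot"
    unfolding F_def by (rule filterlim_compose[OF exp_at_bot])
  have "((\<lambda>x::real. exp (- x)) \<longlongrightarrow> 0) at_top"
    by (rule filterlim_compose[OF exp_at_bot filterlim_uminus_at_bot_at_top])
  then have "((\<lambda>x::real. exp (- exp (- x))) \<longlongrightarrow> exp (- 0)) at_top"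
    by (intro tendsto_intros)
  then show "(F \<longlongrightarrow> 1) at_top" by (simp add: F_def)
qed

lemma real_distribution_gumbel: "real_distribution gumbel"
  unfolding gumbel_def
  by (intro real_distribution_interval_measure gumbel_cdf_props)

lemma cdf_gumbel: "cdf gumbel x = exp (- exp (- x))"
  unfolding gumbel_def by (subst cdf_interval_measure) (auto intro: gumbel_cdf_props)

end

theory Submission
 imports Defs "HOL-Probability.Probability" "HOL-Real_Asymp.Real_Asymp"
begin

text \<open>With a jump bounded away from \<open>0\<close>, the integrated squared CUSUM process is linear to first order: up to
 a term quadratic in the partial sums, which the moment bounds make negligible uniformly in \<open>h\<close>,
 the statistic \<open>T h\<close> is a weighted sum \<open>\<Sum>j. w h j * X j h\<close>. Truncating \<open>X\<close> and averaging out all but the last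
 \<open>l\<close> innovations (\<open>l\<close> a small power of \<open>n\<close>) turns \<open>X\<close> into bounded \<open>l\<close>-dependent variables at a cost
 controlled by the geometric decay of the dependence. Big blocks separated by gaps of length \<open>l\<close> are then
 independent, and \<open>P (max T \<le> u)\<close> is squeezed between expectations of \<open>\<Prod>h. c (T h)\<close> with smooth cutoffs \<open>c\<close>.

 Lindeberg's exchange replaces the blocks one at a time by Gaussian vectors with \<^emph>\<open>independent\<close> coordinates,
 so no Gaussian comparison step is needed. The derivatives of \<open>c\<close> vanish to the left of the level \<open>v\<close>, hence
 the second-order error is \<open>\<Sum> h \<noteq> i\<close> of the absolute covariances times the exponential-moment bound for
 \<open>P (T h > v, T i > v)\<close>. Far pairs have covariance \<open>o (1 / log d)\<close>, and for the few close ones \<open>\<rho> < 1\<close> makes the probability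
 \<open>o (1 / d)\<close>. Third-order errors are treated the same way with triples. For independent coordinates
 the limit follows from Mills' ratio.\<close>

text \<open>The delicate quantity is the width \<open>1/b\<close> of the cutoff. It has to be of
  smaller order than \<open>1/sqrt(log d)\<close>, because a level shift of that order changes the
  Gumbel limit; so \<open>b\<close> must outgrow \<open>sqrt(log d)\<close>. But the far pairs cost
  \<open>b^2\<close> times their covariance times \<open>(d * exp(-v^2/2))^2\<close>, and since the
  exponential bound loses a factor of order \<open>v\<close> against the true Gaussian tail, the
  last factor is of order \<open>log d\<close>, not bounded. With covariances of order
  \<open>(log d)^(-2-\<eta>)\<close> the choice \<open>b = (log d)^(1/2+\<eta>/4)\<close> leaves
  \<open>(log d)^(-\<eta>/2)\<close>: this is where the decay exponent beyond 2 is spent. The other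
  errors of the exchange and of the block approximation decay at least like a power of
  \<open>n\<close> or \<open>d\<close> up to logarithms, so the remaining scales only need the right
  order. The truncation level \<open>n^(7/16)\<close> lies above the scale \<open>n^(3/8)\<close>
  allowed for the exponential moments, which makes the truncation error smaller than any power of
  \<open>n\<close>, and below \<open>sqrt n\<close>, so that a truncated block remains small after
  normalisation.\<close>

abbreviation (input) sequential_limit :: "[nat => 'a::topological_space, 'a] => bool" ("((_)/ ----> (_))" [60, 60] 60) where
 "X ----> L \<equiv> X \<longlonglongrightarrow> L"

abbreviation (input) eventually_sequentially_binder (binder "EV " 10) where
 "eventually_sequentially_binder P \<equiv> eventually P sequentially"

section \<open>Smooth product cutoffs\<close>

text \<open>Bounding the k-th derivative by \<open>b^k\<close> makes the class stable under a change
  of scale. Nothing is prescribed about the values of \<open>c\<close> beyond the range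
  \<open>[0, 1]\<close>; what the expansions use is that the derivatives vanish left of
  \<open>v\<close>. The sign of \<open>v\<close> matters because \<open>v\<close> also serves as an
  exponential tilt.\<close>

locale smooth_cutoff =
 fixes c c1 c2 c3 :: "real => real" and v b :: real
 assumes d1: "DERIV c x :> c1 x" and d2: "DERIV c1 x :> c2 x" and d3: "DERIV c2 x :> c3 x"
  and c01: "0 <= c x \<and> c x <= 1" and left: "x <= v ==> c1 x = 0 \<and> c2 x = 0 \<and> c3 x = 0"
  and bd: "abs (c1 x) <= b \<and> abs (c2 x) <= b^2 \<and> abs (c3 x) <= b^3" and b0: "0 <= b" and v0: "0 <= v"
begin

lemma borel_measurable_cutoff [measurable]: "c : borel_measurable borel" "c1 : borel_measurable borel"
 by (intro borel_measurable_continuous_onI; meson DERIV_isCont continuous_at_imp_continuous_on d1 d2)+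

lemma abs_prod_cutoff_le_1: "abs (PROD h:H. c (f h)) <= 1"
 using c01 by (simp add: abs_prod prod_le_1)

lemma rescale:
 assumes "v = 0" "0 < k" "0 <= w"
 shows "smooth_cutoff (%z. c (k * (z - w))) (%z. k * c1 (k * (z - w))) (%z. k^2 * c2 (k * (z - w))) (%z. k^3 * c3 (k * (z - w))) w (b * k)"
proof
 have ch: "((%z. f (k * (z - w))) has_real_derivative f' (k * (z - w)) * k) (at z)"
  if "\<And>x. DERIV f x :> f' x" for f f' z
  by (rule DERIV_chain2[OF that]) (auto intro!: derivative_eq_intros)
 fix z
 show "DERIV (%z. c (k * (z - w))) z :> k * c1 (k * (z - w))" using ch[OF d1] by (simp add: mult.commute)
 show "DERIV (%z. k * c1 (k * (z - w))) z :> k^2 * c2 (k * (z - w))"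
  using DERIV_cmult[OF ch[OF d2], of k] by (simp add: power2_eq_square mult_ac)
 show "DERIV (%z. k^2 * c2 (k * (z - w))) z :> k^3 * c3 (k * (z - w))"
  using DERIV_cmult[OF ch[OF d3], of "k^2"] by (simp add: power2_eq_square power3_eq_cube mult_ac)
 show "k * c1 (k * (z - w)) = 0 \<and> k^2 * c2 (k * (z - w)) = 0 \<and> k^3 * c3 (k * (z - w)) = 0" if "z <= w"
  using left[of "k * (z - w)"] that assms by (simp add: mult_nonneg_nonpos)
 show "abs (k * c1 (k * (z - w))) <= b * k \<and> abs (k^2 * c2 (k * (z - w))) <= (b * k)^2 \<and> abs (k^3 * c3 (k * (z - w))) <= (b * k)^3"
  using bd assms by (auto simp: abs_mult power_mult_distrib mult.commute[of b] mult.commute[of "b ^ _"] intro!: mult_left_mono)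
qed (use c01 b0 assms in auto)

end

text \<open>At the kink the difference quotient is at most \<open>(max 0 h) ^ k\<close>, which tends
  to 0 because \<open>k >= 1\<close>.\<close>

lemma DERIV_pos_part_power:
 fixes x :: real
 assumes "k \<ge> 1"
 shows "((%x. (max 0 x) ^ Suc k) has_real_derivative of_nat (Suc k) * (max 0 x) ^ k) (at x)"
proof (cases x "0::real" rule: linorder_cases)
 case less
 have "DERIV (%x. 0) x :> of_nat (Suc k) * (max 0 x) ^ k"
  using less assms by (simp add: max_def zero_power)
 then show ?thesis
  by (rule has_field_derivative_transform_within_open[where S="{..<0}"]) (use less in \<open>auto simp: max_def\<close>)
next
 case greater
 have "DERIV (%x. x ^ Suc k) x :> of_nat (Suc k) * (max 0 x) ^ k"
  using greater DERIV_pow[of "Suc k" x] by (simp add: max_def algebra_simps)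
 then show ?thesis
  by (rule has_field_derivative_transform_within_open[where S="{0<..}"]) (use greater in \<open>auto simp: max_def\<close>)
next
 case equal
 have "((%h. (max 0 (h::real)) ^ k) \<longlongrightarrow> (max 0 0) ^ k) (at 0)"
  by (intro tendsto_intros)
 then have 1: "((%h. (max 0 (h::real)) ^ k) \<longlongrightarrow> 0) (at 0)"
  using assms by (simp add: zero_power)
 have "((%h. ((max 0 (0 + h)) ^ Suc k - (max 0 0) ^ Suc k) / h) \<longlongrightarrow> (0::real)) (at 0)"
  using 1
 proof (rule Lim_null_comparison[rotated])
  show "\<forall>\<^sub>F h in at 0. norm (((max 0 (0 + h)) ^ Suc k - (max 0 0) ^ Suc k) / h) <= (max 0 (h::real)) ^ k"
   by (rule always_eventually) (auto simp: max_def)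
 qed
 then show ?thesis
  using assms equal by (simp add: DERIV_def zero_power)
qed

text \<open>The explicit function \<open>(1 - x_+^4)_+^4\<close> serves, with \<open>x_+\<close> the
  positive part: the fourth power of a positive part has three derivatives, hence so has the
  composition. The inner function is 1 for \<open>x <= 0\<close> and nonpositive for
  \<open>x >= 1\<close>.\<close>

lemma smooth_cutoff_exists:
 "\<exists>q q1 q2 q3 C. 0 < C \<and> smooth_cutoff q q1 q2 q3 0 C \<and> (\<forall>x\<le>0. q x = 1) \<and> (\<forall>x\<ge>1. q x = 0)"
proof -
 define r where "r k x = (max 0 x) ^ k" for k and x :: real
 have D4: "DERIV (r 4) x :> 4 * r 3 x" for x
  unfolding r_def using DERIV_pos_part_power[of 3 x] by (simp add: eval_nat_numeral)
 have D3: "DERIV (r 3) x :> 3 * r 2 x" for x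
  unfolding r_def using DERIV_pos_part_power[of 2 x] by (simp add: eval_nat_numeral)
 have D2: "DERIV (r 2) x :> 2 * r 1 x" for x
  unfolding r_def using DERIV_pos_part_power[of 1 x] by (simp add: eval_nat_numeral)
 note DD = DERIV_chain2[OF D4] DERIV_chain2[OF D3] DERIV_chain2[OF D2]
 define a where "a x = 1 - r 4 x" for x
 have Da: "DERIV a x :> - 4 * r 3 x" for x
  unfolding a_def by (auto intro!: derivative_eq_intros D4)
 define q where "q x = r 4 (a x)" for x
 define q1 where "q1 x = 4 * r 3 (a x) * (- 4 * r 3 x)" for x
 define q2 where "q2 x = 192 * (r 2 (a x) * (r 3 x)^2) - 48 * (r 3 (a x) * r 2 x)" for x
 define q3 where "q3 x = - 1536 * (r 1 (a x) * (r 3 x) ^ 3) + 1728 * (r 2 (a x) * (r 3 x * r 2 x)) - 96 * (r 3 (a x) * r 1 x)" for x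
 have dq: "DERIV q x :> q1 x" for x
  unfolding q_def[abs_def] q1_def by (rule DD(1)[OF Da])
 have dq1: "DERIV q1 x :> q2 x" for x
  unfolding q1_def[abs_def] q2_def
  by (auto intro!: derivative_eq_intros DD(2)[OF Da] D3 simp: algebra_simps power2_eq_square)
 have dq2: "DERIV q2 x :> q3 x" for x
  unfolding q2_def[abs_def] q3_def
  by (rule derivative_eq_intros DD[OF Da] D3 D2 refl)+ (simp add: algebra_simps power2_eq_square power3_eq_cube)
 have r0: "r k x = 0" if "x <= 0" "k \<ge> 1" for k x using that by (auto simp: r_def max_def)
 have r01: "0 <= r k x" for k x by (auto simp: r_def)
 have r1: "r k x <= 1" if "x <= 1" for k x using that unfolding r_def by (intro power_le_one) auto
 have a1: "a x <= 1" for x using r01[of 4 x] by (simp add: a_def)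
 have a0: "a x <= 0" if "x \<ge> 1" for x
  using that one_le_power[of x 4] by (auto simp: a_def r_def max_def)
 \<comment> \<open>For \<open>x < 1\<close> all the powers \<open>r k\<close> are at most 1 and the
   coefficients add up to 16, 240 and 3360; for \<open>x >= 1\<close> the outer factors vanish. The
   single constant 4000 covers the three orders.\<close>
 have bd: "abs (q1 x) <= 4000 \<and> abs (q2 x) <= 4000 \<and> abs (q3 x) <= 4000" for x
 proof (cases "x \<ge> 1")
  case True
  then have "r 1 (a x) = 0" "r 2 (a x) = 0" "r 3 (a x) = 0" using a0 by (auto intro!: r0)
  then show ?thesis by (simp add: q1_def q2_def q3_def)
 next
  case False
  then have rx: "abs (r k x) <= 1" for k using r01 r1[of x k] by auto
  have ra: "abs (r k (a x)) <= 1" for k using r01 r1[OF a1, of k x] by auto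
  have m: "abs (u * v) <= 1" if "abs u <= 1" "abs v <= 1" for u v :: real
   using that by (simp add: abs_mult mult_le_one)
  have p: "abs (u ^ n) <= 1" if "abs u <= 1" for u :: real and n
   using that by (simp add: power_abs power_le_one)
  have "abs (r 3 (a x) * r 3 x) <= 1" "abs (r 2 (a x) * (r 3 x)^2) <= 1" "abs (r 3 (a x) * r 2 x) <= 1"
   "abs (r 1 (a x) * (r 3 x) ^ 3) <= 1" "abs (r 2 (a x) * (r 3 x * r 2 x)) <= 1" "abs (r 3 (a x) * r 1 x) <= 1"
   by (intro m p rx ra)+
  then show ?thesis unfolding q1_def q2_def q3_def by linarith
 qed
 have "smooth_cutoff q q1 q2 q3 0 4000"
 proof
  fix x
  show "0 <= q x \<and> q x <= 1" by (simp add: q_def r01 r1 a1)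
  show "q1 x = 0 \<and> q2 x = 0 \<and> q3 x = 0" if "x <= 0" using that by (simp add: r0 q1_def q2_def q3_def)
  show "abs (q1 x) <= 4000 \<and> abs (q2 x) <= 4000^2 \<and> abs (q3 x) <= 4000^3" using bd[of x] by simp
 qed (simp_all add: dq dq1 dq2)
 moreover have "q x = 1" if "x <= 0" for x using that by (simp add: r0 q_def a_def) (simp add: r_def)
 moreover have "q x = 0" if "1 <= x" for x using a0[OF that] by (simp add: q_def r0)
 ultimately show ?thesis by (intro exI[of _ q] exI[of _ q1] exI[of _ q2] exI[of _ q3] exI[of _ 4000]) auto
qed

lemma DERIV_prod_funs:
 fixes c c1 :: "'i => real => real"
 assumes "finite A" "\<And>h. h : A ==> (DERIV (c h) s :> c1 h s)"
 shows "(DERIV (%s. PROD h:A. c h s) s :> (SUM h:A. c1 h s * (PROD k:A-{h}. c k s)))"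
 using assms
proof (induction A rule: finite_induct)
 case (insert x F)
 let ?A = "%F s. (SUM h:F. c1 h s * (PROD k:F-{h}. c k s))"
 have eq: "(SUM h:F. c1 h s * (PROD k:insert x F - {h}. c k s)) = c x s * ?A F s"
 proof -
  have "(PROD k:insert x F - {h}. c k s) = c x s * (PROD k:F-{h}. c k s)" if "h : F" for h
  proof -
   have "insert x F - {h} = insert x (F - {h})" using that insert by auto
   then show ?thesis using insert by simp
  qed
  then show ?thesis by (simp add: sum_distrib_left mult_ac)
 qed
 have "insert x F - {x} = F" using insert by auto
 then have eq2: "(SUM h:insert x F. c1 h s * (PROD k:insert x F - {h}. c k s)) =
  c1 x s * (PROD k:F. c k s) + ?A F s * c x s"
  using insert eq by (simp add: mult.commute)
 have "((%s. c x s * (PROD h:F. c h s)) has_real_derivative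
  c1 x s * (PROD k:F. c k s) + ?A F s * c x s) (at s)"
  by (rule DERIV_mult) (use insert in auto)
 then show ?case unfolding eq2 using insert by simp
qed simp

text \<open>The cutoff is constant to the left of \<open>v\<close>, so that only coordinates that can cross \<open>v\<close> within the
 step contribute to the remainder.\<close>

lemma (in smooth_cutoff) product_cutoff_taylor:
 fixes z y :: "'i => real"
 assumes fin: "finite H"
 shows "abs ((PROD h:H. c (z h + y h)) - (PROD h:H. c (z h)) - (SUM h:H. y h * c1 (z h) * (PROD k:H-{h}. c (z k)))
  - ((SUM h:H. (y h)^2 * c2 (z h) * (PROD k:H-{h}. c (z k)))
   + (SUM h:H. SUM i:H-{h}. y h * y i * (c1 (z h) * c1 (z i) * (PROD k:H-{h}-{i}. c (z k))))) / 2)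
  <= b^3 * (SUM h:H. abs (y h) * indicator {v<..} (z h + abs (y h))) ^ 3"
proof -
 let ?A = "%H. (SUM h:H. abs (y h) * indicator {v<..} (z h + abs (y h)))"
 define g where "g h s = c (z h + s * y h)" for h s
 define a where "a h s = y h * c1 (z h + s * y h)" for h s
 define a1 where "a1 h s = (y h)^2 * c2 (z h + s * y h)" for h s
 define a2 where "a2 h s = (y h)^3 * c3 (z h + s * y h)" for h s
 define P where "P A s = (PROD k:A. g k s)" for A s
 have lin: "DERIV (%s. z h + s * y h) s :> y h" for h s
  by (auto intro!: derivative_eq_intros)
 have dg: "DERIV (g h) s :> a h s" for h s
  unfolding g_def[abs_def] a_def using DERIV_chain2[OF d1 lin[of h s]] by (simp add: mult.commute)
 have da: "DERIV (a h) s :> a1 h s" for h s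
  unfolding a_def[abs_def] a1_def using DERIV_cmult[OF DERIV_chain2[OF d2 lin[of h s]], of "y h"]
  by (simp add: mult_ac power2_eq_square)
 have da1: "DERIV (a1 h) s :> a2 h s" for h s
  unfolding a1_def[abs_def] a2_def using DERIV_cmult[OF DERIV_chain2[OF d3 lin[of h s]], of "(y h)^2"]
  by (simp add: mult_ac power2_eq_square power3_eq_cube)
 have dP: "(DERIV (P A) s :> (SUM h:A. a h s * P (A-{h}) s))" if "finite A" for A s
  unfolding P_def[abs_def] by (rule DERIV_prod_funs[OF that dg])
 \<comment> \<open>\<open>F1\<close>, \<open>F2\<close>, \<open>F3\<close> are the successive
   derivatives of the product along the segment \<open>z + s * y\<close>. The recursion through
   index sets with one factor deleted avoids enumerating the mixed derivatives.\<close>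
 define F1 where "F1 A s = (SUM h:A. a h s * P (A-{h}) s)" for A s
 define F2 where "F2 A s = (SUM h:A. a1 h s * P (A-{h}) s + a h s * F1 (A-{h}) s)" for A s
 let ?B = "%h t H. abs (a2 h t * P (H-{h}) t + 2 * (a1 h t * F1 (H-{h}) t) + a h t * F2 (H-{h}) t)"
 define F3 where "F3 A s = (SUM h:A. a2 h s * P (A-{h}) s + 2 * (a1 h s * F1 (A-{h}) s) + a h s * F2 (A-{h}) s)" for A s
 have dF1: "DERIV (F1 A) s :> F2 A s" if "finite A" for A s
  apply (subst F1_def[abs_def], subst F2_def, rule DERIV_sum)
  subgoal for h using DERIV_mult[OF da[of h s] dP[of "A-{h}" s]] that
   unfolding F1_def by (simp add: mult.commute add.commute)
  done
 have dP': "DERIV (P A) s :> F1 A s" if "finite A" for A s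
  unfolding F1_def by (rule dP[OF that])
 have dF2: "DERIV (F2 A) s :> F3 A s" if "finite A" for A s
  apply (subst F2_def[abs_def], subst F3_def, rule DERIV_sum)
  subgoal for h
   by (rule DERIV_cong[OF DERIV_add[OF DERIV_mult[OF da1[of h s] dP'[of "A-{h}" s]] DERIV_mult[OF da[of h s] dF1[of "A-{h}" s]]]])
    (use that in \<open>auto simp: algebra_simps\<close>)
  done
 define diff where "diff m = (if m = 0 then P H else if m = 1 then F1 H else if m = Suc 1 then F2 H else F3 H)" for m :: nat
 have "\<exists>t>0. t < 1 \<and> P H 1 = (\<Sum>m<3. diff m 0 / fact m * 1 ^ m) + diff 3 t / fact 3 * 1 ^ 3"
 proof (rule Maclaurin)
  show "\<forall>m t. m < 3 \<and> 0 <= t \<and> t <= 1 \<longrightarrow> (DERIV (diff m) t :> diff (Suc m) t)"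
  proof (intro allI impI)
   fix m :: nat and t :: real assume "m < 3 \<and> 0 <= t \<and> t <= 1"
   then have "m = 0 \<or> m = 1 \<or> m = Suc 1" by auto
   then show "DERIV (diff m) t :> diff (Suc m) t"
    using dP[OF fin] dF1[OF fin] dF2[OF fin] by (auto simp: diff_def F1_def[symmetric])
  qed
 qed (auto simp: diff_def)
 then obtain t where t: "0 < t" "t < 1"
  and eq: "P H 1 = (\<Sum>m<3. diff m 0 / fact m * 1 ^ m) + diff 3 t / fact 3 * 1 ^ 3" by blast
 have eq': "P H 1 = P H 0 + F1 H 0 + F2 H 0 / 2 + F3 H t / 6"
  unfolding eq by (simp add: eval_nat_numeral diff_def)
 \<comment> \<open>\<open>Y h\<close> dominates the first derivative of factor \<open>h\<close> at
   the intermediate point, and its square and cube dominate the next two. Hence \<open>F1\<close>,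
   \<open>F2\<close>, \<open>F3\<close> are at most \<open>S\<close>, \<open>2 * S^2\<close>,
   \<open>5 * S^3\<close> there, and the remainder \<open>F3 / 6\<close> stays below
   \<open>S^3\<close>.\<close>
 define Y where "Y h = b * (abs (y h) * indicator {v<..} (z h + abs (y h)))" for h
 have Y0: "0 <= Y h" for h using b0 by (simp add: Y_def)
 have ind: "z h + t * y h <= v" if "\<not> z h + abs (y h) > v" for h
 proof -
  have "t * y h <= abs (y h)" using t
   by (metis abs_ge_self abs_mult abs_of_pos less_eq_real_def mult_left_le_one_le order_trans abs_ge_zero)
  then show ?thesis using that by linarith
 qed
 have aY: "abs (a h t) <= Y h" for h
 proof (cases "z h + abs (y h) > v")
  case True
  then show ?thesis using bd[of "z h + t * y h"] by (simp add: a_def Y_def abs_mult mult.commute[of b] mult_left_mono)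
 next
  case False then show ?thesis using left[OF ind[OF False]] Y0 by (simp add: a_def)
 qed
 have a1Y: "abs (a1 h t) <= (Y h)^2" for h
 proof (cases "z h + abs (y h) > v")
  case True
  then show ?thesis using bd[of "z h + t * y h"]
   by (simp add: a1_def Y_def abs_mult power_mult_distrib mult.commute[of "b^2"] mult_left_mono)
 next
  case False then show ?thesis using left[OF ind[OF False]] Y0 by (simp add: a1_def)
 qed
 have a2Y: "abs (a2 h t) <= (Y h)^3" for h
 proof (cases "z h + abs (y h) > v")
  case True
  then show ?thesis using bd[of "z h + t * y h"]
   by (simp add: a2_def Y_def abs_mult power_mult_distrib mult.commute[of "b^3"] mult_left_mono power_abs)
 next
  case False then show ?thesis using left[OF ind[OF False]] Y0 by (simp add: a2_def)
 qed
 have P1: "abs (P A t) <= 1" for A unfolding P_def g_def by (rule abs_prod_cutoff_le_1)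
 define S where "S = (SUM h:H. Y h)"
 have S0: "S \<ge> 0" using Y0 by (auto simp: S_def intro: sum_nonneg)
 have YS: "Y h <= S" if "h : H" for h using fin that Y0 unfolding S_def by (intro member_le_sum) auto
 have sub: "(SUM h:A. Y h) <= S" if "A \<subseteq> H" for A using fin that Y0 unfolding S_def by (intro sum_mono2) auto
 have F1b: "abs (F1 A t) <= S" if "A \<subseteq> H" for A
 proof -
  have "abs (F1 A t) <= (SUM h:A. abs (a h t) * abs (P (A-{h}) t))" unfolding F1_def by (metis (no_types, lifting) abs_mult sum.cong sum_abs)
  also have "... <= (SUM h:A. Y h)" using aY P1 Y0 by (intro sum_mono) (metis abs_ge_zero mult_mono mult.right_neutral)
  finally show ?thesis using sub[OF that] by simp
 qed
 have F2b: "abs (F2 A t) <= 2 * S^2" if "A \<subseteq> H" for A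
 proof -
  have "abs (F2 A t) <= (SUM h:A. abs (a1 h t * P (A-{h}) t + a h t * F1 (A-{h}) t))" unfolding F2_def by (rule sum_abs)
  also have "... <= (SUM h:A. 2 * (Y h * S))"
  proof (rule sum_mono)
   fix h assume h: "h : A"
   have "abs (a1 h t * P (A-{h}) t) <= (Y h)^2 * 1" unfolding abs_mult by (intro mult_mono a1Y P1) auto
   moreover have "(Y h)^2 <= Y h * S" using YS[of h] h that Y0 by (auto simp: power2_eq_square intro!: mult_left_mono)
   moreover have "abs (a h t * F1 (A-{h}) t) <= Y h * S" unfolding abs_mult using that Y0 by (intro mult_mono aY F1b) auto
   ultimately show "abs (a1 h t * P (A-{h}) t + a h t * F1 (A-{h}) t) <= 2 * (Y h * S)" by linarith
  qed
  also have "... = 2 * S * (SUM h:A. Y h)" by (simp add: sum_distrib_left sum_distrib_right mult_ac)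
  also have "... <= 2 * S * S" using sub[OF that] S0 by (intro mult_left_mono) auto
  finally show ?thesis by (simp add: power2_eq_square)
 qed
 have F3b: "abs (F3 H t) <= 5 * S^3"
 proof -
  have "abs (F3 H t) <= (SUM h:H. ?B h t H)"
   unfolding F3_def by (rule sum_abs)
  also have "... <= (SUM h:H. 5 * (Y h * S^2))"
  proof (rule sum_mono)
   fix h assume h: "h : H"
   have "abs (a2 h t * P (H-{h}) t) <= (Y h)^3 * 1" unfolding abs_mult using Y0 by (intro mult_mono a2Y P1) auto
   moreover have "(Y h)^3 <= Y h * S^2" using YS[OF h] Y0 S0 by (auto simp: power2_eq_square power3_eq_cube mult.assoc intro!: mult_mono)
   moreover have "abs (a1 h t * F1 (H-{h}) t) <= (Y h)^2 * S" unfolding abs_mult by (intro mult_mono a1Y F1b) auto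
   moreover have "(Y h)^2 * S <= Y h * S^2" using YS[OF h] Y0 S0 by (auto simp: power2_eq_square mult.assoc intro!: mult_mono intro: mult_left_mono mult_right_mono)
   moreover have "abs (a h t * F2 (H-{h}) t) <= Y h * (2 * S^2)" unfolding abs_mult using Y0 by (intro mult_mono aY F2b) auto
   ultimately show "?B h t H <= 5 * (Y h * S^2)"
    by linarith
  qed
  also have "... = 5 * S * S^2" unfolding S_def by (simp add: sum_distrib_left sum_distrib_right mult_ac)
  finally show ?thesis by (simp add: power2_eq_square power3_eq_cube)
 qed
 have e1: "P H 1 = (PROD h:H. c (z h + y h))" "P H 0 = (PROD h:H. c (z h))" by (simp_all add: P_def g_def)
 have e2: "F1 H 0 = (SUM h:H. y h * c1 (z h) * (PROD k:H-{h}. c (z k)))" by (simp add: F1_def P_def a_def g_def)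
 have e3: "F2 H 0 = (SUM h:H. (y h)^2 * c2 (z h) * (PROD k:H-{h}. c (z k)))
   + (SUM h:H. SUM i:H-{h}. y h * y i * (c1 (z h) * c1 (z i) * (PROD k:H-{h}-{i}. c (z k))))"
  by (simp add: F2_def F1_def P_def a_def a1_def g_def sum.distrib sum_distrib_left mult_ac)
 have "S = b * ?A H" by (simp add: S_def Y_def sum_distrib_left)
 then have S3: "S^3 = b^3 * ?A H ^ 3" by (simp add: power_mult_distrib)
 have "abs (P H 1 - P H 0 - F1 H 0 - F2 H 0 / 2) <= S^3"
  using eq' F3b S0 zero_le_power[OF S0, of 3] by linarith
 then show ?thesis unfolding e1 e2 e3 S3 .
qed

section \<open>Exchange of one block\<close>

text \<open>What the exchange has to know about the law of one block. Variances are fixed exactly,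
  so that they cancel between two laws; cross moments are only bounded. The third moment carries the
  weight \<open>exp (3 * v * |y|)\<close> because indicators of crossing \<open>v\<close> get
  replaced by exponential tilts, up to three at a time.\<close>

definition block_measure ::
 "'i set => real => real => ('i => real) => ('i => 'i => real) => ('i => real) measure => bool" where
 "block_measure H v m3 q s kp \<longleftrightarrow> 0 <= m3 \<and> prob_space kp \<and> sets kp = sets (PiM H (%_. borel)) \<and>
  (ALL h:H. integrable kp (%y. abs (y h) ^ 3 * exp (3 * v * abs (y h))) \<and>
   (LINT y|kp. abs (y h) ^ 3 * exp (3 * v * abs (y h))) <= m3 \<and> (LINT y|kp. y h) = 0 \<and> (LINT y|kp. (y h)^2) = q h) \<and>
  (ALL h:H. ALL i:H. h \<noteq> i \<longrightarrow> abs (LINT y|kp. y h * y i) <= s h i)"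

lemma exp_le_quadratic_cubic:
 fixes x :: real
 shows "exp x <= 1 + x + x^2 / 2 + abs x ^ 3 * exp (abs x)"
proof -
 have "\<exists>t. abs t <= abs x \<and> exp x = (\<Sum>m<3. x ^ m / fact m) + exp t / fact 3 * x ^ 3"
  by (rule Maclaurin_exp_le)
 then obtain t where t: "abs t <= abs x" and e: "exp x = 1 + x + x^2 / 2 + exp t / 6 * x ^ 3"
  by (auto simp: eval_nat_numeral)
 have "exp t / 6 * x ^ 3 <= exp (abs x) * abs x ^ 3"
 proof -
  have "exp t / 6 * x ^ 3 <= abs (exp t / 6 * x ^ 3)" by simp
  also have "... = exp t / 6 * abs x ^ 3" by (simp add: abs_mult power_abs)
  also have "... <= exp (abs x) * abs x ^ 3"
  proof (rule mult_right_mono)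
   have "exp t <= exp (abs x)" using t by simp
   then show "exp t / 6 <= exp (abs x)" using exp_ge_zero[of t] by linarith
  qed simp
  finally show ?thesis .
 qed
 then show ?thesis unfolding e by (simp add: mult.commute)
qed

text \<open>With at most three terms, the sum is at most three times its largest term. This is the
  origin of \<open>27 = 3^3\<close> and of the 3 in the exponent.\<close>

lemma cube_exp_sum_le:
 fixes t :: "'i => real"
 assumes "finite R" "card R <= 3" "\<And>k. k : R ==> 0 <= t k"
 shows "(SUM k:R. t k) ^ 3 * exp (SUM k:R. t k) <= 27 * (SUM k:R. t k ^ 3 * exp (3 * t k))"
proof (cases "R = {}")
 case False
 let ?A = "(SUM k:R. t k)"
 have "Max (t ` R) : t ` R" using False assms(1) by (intro Max_in) auto
 then obtain m where mR: "m : R" and "Max (t ` R) = t m" by auto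
 then have "t k <= t m" if "k : R" for k using that assms(1) by (metis Max_ge finite_imageI imageI)
 note m = mR this
 have "?A <= of_nat (card R) * t m" using m by (intro sum_bounded_above) auto
 also have "... <= 3 * t m" using assms m by (intro mult_right_mono) auto
 finally have le: "?A <= 3 * t m" .
 have "?A ^ 3 * exp ?A <= (3 * t m) ^ 3 * exp (3 * t m)"
  using le assms m(1) by (intro mult_mono power_mono) (auto intro: sum_nonneg)
 also have "... = 27 * (t m ^ 3 * exp (3 * t m))" by (simp add: power_mult_distrib)
 also have "... <= 27 * (SUM k:R. t k ^ 3 * exp (3 * t k))"
  using m assms by (intro mult_left_mono member_le_sum) auto
 finally show ?thesis .
qed simp

context
 fixes H :: "'i set" and v m3 :: real and q :: "'i => real" and s :: "'i => 'i => real"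
  and kp :: "('i => real) measure"
 assumes bm: "block_measure H v m3 q s kp" and v0: "0 <= v"
begin

interpretation K: prob_space kp using bm by (simp add: block_measure_def)

lemma block_sets: "sets kp = sets (PiM H (%_. borel))"
 using bm by (simp add: block_measure_def)

lemma block_component_measurable: "h : H ==> (%y. y h) : borel_measurable kp"
 by (subst measurable_cong_sets[OF block_sets refl]) measurable

lemma block_int_cube: "h : H ==> integrable kp (%y. abs (y h) ^ 3 * exp (3 * v * abs (y h)))"
 using bm by (simp add: block_measure_def)

lemma block_cube_dom: "x <= 1 + x ^ 3" "x^2 <= 1 + x ^ 3" "x ^ 3 <= x ^ 3 * exp (3 * v * x)" if "0 <= x" for x :: real
proof -
 show "x ^ 3 <= x ^ 3 * exp (3 * v * x)"
  using that v0 by (simp add: mult_le_cancel_left1)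
 have "x <= 1 \<or> x \<ge> 1" by auto
 moreover have "x ^ 1 <= x ^ 3 \<and> x\<^sup>2 <= x ^ 3" if "x \<ge> 1" using that by (intro conjI power_increasing) auto
 moreover have "x^2 <= 1" if "x <= 1" using that \<open>0 <= x\<close> by (simp add: power_le_one)
 ultimately have "x <= 1 + x ^ 3 \<and> x\<^sup>2 <= 1 + x ^ 3"
  using zero_le_power[OF that, of 3] by (smt (verit) power_one_right)
 then show "x <= 1 + x ^ 3" "x^2 <= 1 + x ^ 3" by auto
qed

lemma block_integrable_component: "h : H ==> integrable kp (%y. y h)"
proof (rule Bochner_Integration.integrable_bound[where f = "%y. 1 + abs (y h) ^ 3 * exp (3 * v * abs (y h))"])
 assume h: "h : H"
 note [measurable] = block_component_measurable
 from h show "integrable kp (%y. 1 + abs (y h) ^ 3 * exp (3 * v * abs (y h)))" using block_int_cube by auto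
 show "AE y in kp. norm (y h) <= norm (1 + abs (y h) ^ 3 * exp (3 * v * abs (y h)))"
  by (rule AE_I2, use block_cube_dom(1,3) in \<open>auto intro: order_trans add_left_mono\<close>)
   (smt (verit) block_cube_dom(1,3) abs_ge_zero)
 from h show "(%y. y h) : borel_measurable kp" by measurable
qed

lemma block_integrable_square: "h : H ==> integrable kp (%y. (y h)^2)"
proof (rule Bochner_Integration.integrable_bound[where f = "%y. 1 + abs (y h) ^ 3 * exp (3 * v * abs (y h))"])
 assume h: "h : H"
 note [measurable] = block_component_measurable
 from h show "integrable kp (%y. 1 + abs (y h) ^ 3 * exp (3 * v * abs (y h)))" using block_int_cube by auto
 show "AE y in kp. norm ((y h)^2) <= norm (1 + abs (y h) ^ 3 * exp (3 * v * abs (y h)))"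
 proof (rule AE_I2)
  fix y :: "'i => real"
  show "norm ((y h)^2) <= norm (1 + abs (y h) ^ 3 * exp (3 * v * abs (y h)))"
   using block_cube_dom(2,3)[of "abs (y h)"] by simp
 qed
 from h show "(%y. (y h)^2) : borel_measurable kp" by measurable
qed

lemma block_integrable_product: "h : H ==> i : H ==> integrable kp (%y. y h * y i)"
proof (rule Bochner_Integration.integrable_bound[where f = "%y. (y h)^2 + (y i)^2"])
 assume h: "h : H" "i : H"
 note [measurable] = block_component_measurable
 from h show "integrable kp (%y. (y h)^2 + (y i)^2)" using block_integrable_square by auto
 show "AE y in kp. norm (y h * y i) <= norm ((y h)^2 + (y i)^2)"
 proof (rule AE_I2)
  fix y :: "'i => real"
  have "0 <= (abs (y h) - abs (y i))^2" by simp
  then have "2 * (abs (y h) * abs (y i)) <= (y h)^2 + (y i)^2" by (simp add: power2_diff)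
  moreover have "0 <= abs (y h) * abs (y i)" by simp
  ultimately have "abs (y h) * abs (y i) <= (y h)^2 + (y i)^2" by linarith
  then show "norm (y h * y i) <= norm ((y h)^2 + (y i)^2)" by (simp add: abs_mult)
 qed
 from h show "(%y. y h * y i) : borel_measurable kp" by measurable
qed

text \<open>Second-order expansion of the exponential: the mean vanishes, the quadratic form is
  controlled by \<open>q\<close> and \<open>s\<close>, and the cubic remainder costs
  \<open>27 * 3 * v^3 * m3\<close>. Closing with \<open>1 + u <= exp u\<close> makes the bound
  multiplicative over independent blocks.\<close>

lemma block_mgf:
 assumes R: "R \<subseteq> H" "finite R" "card R <= 3" and l: "\<And>k. k : R ==> 0 <= l k \<and> l k <= v"
 shows "integrable kp (%y. exp (SUM k:R. l k * y k))"
  and "(LINT y|kp. exp (SUM k:R. l k * y k))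
   <= exp ((SUM k:R. (l k)^2 * q k + (SUM i:R-{k}. l k * l i * s k i)) / 2 + 81 * v ^ 3 * m3)"
proof -
 let ?A = "%R. (SUM k:R. (l k)^2 * q k + (SUM i:R-{k}. l k * l i * s k i))"
 define x where "x y = (SUM k:R. l k * y k)" for y :: "'i => real"
 let ?B = "LINT y|kp. (x y)^2"
 define w where "w y = 27 * v^3 * (SUM k:R. abs (y k) ^ 3 * exp (3 * v * abs (y k)))" for y :: "'i => real"
 have xm[measurable]: "x : borel_measurable kp" unfolding x_def[abs_def] using R by (intro borel_measurable_sum borel_measurable_times block_component_measurable) auto
 have ix: "integrable kp x"
  unfolding x_def[abs_def] using R block_integrable_component by (intro Bochner_Integration.integrable_sum integrable_mult_right) auto
 have x2: "(x y)^2 = (SUM k:R. SUM i:R. l k * l i * (y k * y i))" for y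
  unfolding x_def power2_eq_square sum_product by (simp add: mult_ac)
 have ix2: "integrable kp (%y. (x y)^2)"
  unfolding x2 using R block_integrable_product by (intro Bochner_Integration.integrable_sum integrable_mult_right) auto
 have iw: "integrable kp w"
  unfolding w_def[abs_def] using R block_int_cube by (intro Bochner_Integration.integrable_sum integrable_mult_right) auto
 have wx: "abs (x y) ^ 3 * exp (abs (x y)) <= w y" for y
 proof -
  have le: "abs (x y) <= (SUM k:R. v * abs (y k))"
   unfolding x_def using l by (intro order_trans[OF sum_abs] sum_mono) (auto simp: abs_mult intro!: mult_right_mono)
  have "abs (x y) ^ 3 * exp (abs (x y)) <= (SUM k:R. v * abs (y k)) ^ 3 * exp (SUM k:R. v * abs (y k))"
   using le by (intro mult_mono power_mono) (auto intro: order_trans[OF abs_ge_zero])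
  also have "... <= 27 * (SUM k:R. (v * abs (y k)) ^ 3 * exp (3 * (v * abs (y k))))"
   using R v0 by (intro cube_exp_sum_le) auto
  also have "... = w y" by (simp add: w_def sum_distrib_left power_mult_distrib mult_ac)
  finally show ?thesis .
 qed
 have dom: "exp (x y) <= 1 + x y + (x y)^2 / 2 + w y" for y
  using exp_le_quadratic_cubic[of "x y"] wx[of y] by linarith
 have idom: "integrable kp (%y. 1 + x y + (x y)^2 / 2 + w y)"
  using ix ix2 iw by auto
 show ie: "integrable kp (%y. exp (SUM k:R. l k * y k))"
  unfolding x_def[symmetric]
  by (rule Bochner_Integration.integrable_bound[OF idom]) (auto intro!: AE_I2 order_trans[OF dom abs_ge_self])
 have ex0: "(LINT y|kp. x y) = 0"
  unfolding x_def using R bm block_integrable_component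
  by (subst Bochner_Integration.integral_sum) (auto simp: block_measure_def intro!: sum.neutral)
 have "?B = (SUM k:R. SUM i:R. l k * l i * (LINT y|kp. y k * y i))"
  unfolding x2 using R block_integrable_product
  by (subst Bochner_Integration.integral_sum) (auto intro!: sum.cong Bochner_Integration.integrable_sum simp: Bochner_Integration.integral_sum subset_iff)
 also have "... = (SUM k:R. l k * l k * (LINT y|kp. y k * y k) + (SUM i:R-{k}. l k * l i * (LINT y|kp. y k * y i)))"
  using R by (intro sum.cong refl sum.remove) auto
 also have "... <= ?A R"
 proof (intro sum_mono add_mono)
  fix k assume "k : R"
  then show "l k * l k * (LINT y|kp. y k * y k) <= (l k)^2 * q k"
   using bm R unfolding block_measure_def by (auto simp: power2_eq_square)
  fix i assume "i : R - {k}"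
  then have "abs (LINT y|kp. y k * y i) <= s k i" using bm R \<open>k \<in> R\<close> unfolding block_measure_def by (metis Diff_iff insertCI subsetD)
  then show "l k * l i * (LINT y|kp. y k * y i) <= l k * l i * s k i"
   using l \<open>k \<in> R\<close> \<open>i \<in> R - {k}\<close> by (intro mult_left_mono) auto
 qed
 finally have v2: "?B <= ?A R" .
 have "(LINT y|kp. w y) = 27 * v^3 * (SUM k:R. (LINT y|kp. abs (y k) ^ 3 * exp (3 * v * abs (y k))))"
  unfolding w_def using R block_int_cube by (subst integral_mult_right_zero, subst Bochner_Integration.integral_sum) auto
 also have "... <= 27 * v^3 * (SUM k:R. m3)"
  using bm R v0 unfolding block_measure_def by (intro mult_left_mono sum_mono) auto
 also have "... <= 27 * v^3 * (3 * m3)"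
  using R v0 bm by (intro mult_left_mono) (auto simp: block_measure_def intro!: mult_right_mono)
 finally have w3: "(LINT y|kp. w y) <= 81 * v^3 * m3" by simp
 have "(LINT y|kp. exp (x y)) <= (LINT y|kp. 1 + x y + (x y)^2 / 2 + w y)"
  using ie idom dom unfolding x_def[symmetric] by (intro integral_mono) auto
 also have "... = 1 + ?B / 2 + (LINT y|kp. w y)"
  using ix ix2 iw ex0 by (simp add: K.prob_space)
 also have "... <= 1 + (?A R / 2 + 81 * v^3 * m3)"
  using v2 w3 by linarith
 also have "... <= exp (?A R / 2 + 81 * v^3 * m3)"
  by (rule exp_ge_add_one_self)
 finally show "(LINT y|kp. exp (SUM k:R. l k * y k))
   <= exp (?A R / 2 + 81 * v ^ 3 * m3)"
  unfolding x_def .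
qed

end

lemma cube_sum_expand:
 fixes a :: "'i => real"
 shows "(SUM h:H. a h) ^ 3 = (SUM h:H. SUM i:H. SUM j:H. a h * a i * a j)"
 by (simp add: power3_eq_cube sum_product sum_distrib_left sum_distrib_right mult_ac)

lemma amgm3:
 fixes a b c :: real
 assumes "0 <= a" "0 <= b" "0 <= c"
 shows "a * b * c <= (a ^ 3 + b ^ 3 + c ^ 3) / 3"
proof -
 have "a ^ 3 + b ^ 3 + c ^ 3 - 3 * (a * b * c) = (a + b + c) * ((a - b)^2 + (b - c)^2 + (c - a)^2) / 2"
  by (simp add: field_simps power2_eq_square power3_eq_cube)
 also have "... \<ge> 0" using assms by simp
 finally show ?thesis by simp
qed

text \<open>Chernoff's bound inside the cube: the indicator of a crossing is at most
  \<open>exp (v * (z + |y| - v))\<close>. Indicators outside \<open>Rf h i j\<close> are dropped, so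
  that for every triple one may keep only coordinates that are nearly uncorrelated. The
  arithmetic-geometric mean then separates the three factors that depend on
  \<open>y\<close>.\<close>

lemma crossing_cube_le:
 fixes z y :: "'i => real"
 assumes v0: "0 <= v" and Rf: "\<And>h i j. Rf h i j \<subseteq> {h, i, j}"
 defines "A \<equiv> %h. abs (y h) ^ 3 * exp (3 * v * abs (y h))"
 shows "(SUM h:H. abs (y h) * indicator {v<..} (z h + abs (y h))) ^ 3
  <= (SUM h:H. SUM i:H. SUM j:H. exp (v * (SUM k:Rf h i j. z k - v)) * ((A h + A i + A j) / 3))"
 unfolding cube_sum_expand
proof (intro sum_mono)
 fix h i j
 define J where "J k = (indicator {v<..} (z k + abs (y k)) :: real)" for k
 define R where "R = Rf h i j"
 have R: "R \<subseteq> {h, i, j}" "finite R" using Rf[of h i j] by (auto simp: R_def intro: finite_subset)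
 have J01: "0 <= J k" "J k <= 1" for k by (auto simp: J_def indicator_def)
 have "J h * J i * J j <= (PROD k:{h,i,j}. J k)"
  by (cases "h = i"; cases "i = j"; cases "h = j") (auto simp: J_def indicator_def insert_commute)
 also have "... = (PROD k:R. J k) * (PROD k:{h,i,j}-R. J k)" using R prod.subset_diff[of R "{h,i,j}" J] by (simp add: mult.commute)
 also have "... <= (PROD k:R. J k) * 1" by (intro mult_left_mono prod_le_1 prod_nonneg) (use J01 in auto)
 also have "(PROD k:R. J k) <= (PROD k:R. exp (v * (z k + abs (y k) - v)))"
  by (intro prod_mono) (use v0 in \<open>auto simp: J_def indicator_def\<close>)
 also have "... = exp (v * (SUM k:R. z k - v)) * exp (v * (SUM k:R. abs (y k)))"
  using R by (simp add: exp_sum[symmetric] exp_add[symmetric] sum_distrib_left sum.distrib[symmetric] algebra_simps)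
 also have "... <= exp (v * (SUM k:R. z k - v)) * exp (v * (abs (y h) + abs (y i) + abs (y j)))"
 proof -
  have "(SUM k:R. abs (y k)) <= (SUM k:{h,i,j}. abs (y k))" using R by (intro sum_mono2) auto
  also have "... <= abs (y h) + abs (y i) + abs (y j)"
   by (cases "h = i"; cases "i = j"; cases "h = j") (auto simp: insert_commute)
  finally show ?thesis using v0 by (intro mult_left_mono) (auto intro: mult_left_mono)
 qed
 finally have JJ: "J h * J i * J j <= exp (v * (SUM k:R. z k - v)) * exp (v * (abs (y h) + abs (y i) + abs (y j)))" by simp
 \<comment> \<open>Each of the three factors takes its own tilt; cubing it produces the weight with
   \<open>3 * v\<close>.\<close>
 define a where "a k = abs (y k) * exp (v * abs (y k))" for k
 have a3: "a k ^ 3 = A k" for k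
  by (simp add: a_def A_def power_mult_distrib exp_of_nat_mult[symmetric] mult_ac)
 have "abs (y h) * J h * (abs (y i) * J i) * (abs (y j) * J j) = abs (y h) * abs (y i) * abs (y j) * (J h * J i * J j)" by simp
 also have "... <= abs (y h) * abs (y i) * abs (y j) * (exp (v * (SUM k:R. z k - v)) * exp (v * (abs (y h) + abs (y i) + abs (y j))))"
  using JJ by (intro mult_left_mono) auto
 also have "... = exp (v * (SUM k:R. z k - v)) * (a h * a i * a j)"
  by (simp add: a_def exp_add distrib_left mult_ac)
 also have "... <= exp (v * (SUM k:R. z k - v)) * ((A h + A i + A j) / 3)"
  unfolding a3[symmetric] by (intro mult_left_mono amgm3) (auto simp: a_def)
 finally show "abs (y h) * indicator {v<..} (z h + abs (y h)) * (abs (y i) * indicator {v<..} (z i + abs (y i))) *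
   (abs (y j) * indicator {v<..} (z j + abs (y j)))
   <= exp (v * (SUM k:Rf h i j. z k - v)) * ((A h + A i + A j) / 3)"
  by (simp only: J_def R_def)
qed

text \<open>Means vanish and variances agree, so the second-order expansions under the two laws
  differ only in the off-diagonal terms, and these are zero under \<open>\<nu>\<close>. The
  third-order remainder enters once for each law.\<close>

lemma (in smooth_cutoff) block_swap:
 fixes z :: "'i => real"
 assumes fin: "finite H"
  and Rf: "\<And>h i j. Rf h i j \<subseteq> {h, i, j}"
  and mu: "block_measure H v m3 q s \<mu>" and nu: "block_measure H v m3 q s \<nu>"
  and nu0: "\<And>h i. h : H ==> i : H ==> h \<noteq> i ==> (LINT y|\<nu>. y h * y i) = 0"
 shows "abs ((LINT y|\<mu>. (PROD h:H. c (z h + y h))) - (LINT y|\<nu>. (PROD h:H. c (z h + y h))))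
  <= (SUM h:H. SUM i:H-{h}. s h i * abs (c1 (z h) * c1 (z i))) / 2
   + 2 * b^3 * m3 * (SUM h:H. SUM i:H. SUM j:H. exp (v * (SUM k:Rf h i j. z k - v)))"
proof -
 let ?C = "%H z. (SUM h:H. SUM i:H-{h}. s h i * abs (c1 (z h) * c1 (z i)))"
 define f where "f y = (PROD h:H. c (z h + y h))" for y :: "'i => real"
 define P where "P A = (PROD k:A. c (z k))" for A
 define f1 where "f1 h = c1 (z h) * P (H-{h})" for h
 define f2 where "f2 h = c2 (z h) * P (H-{h})" for h
 define g where "g h i = c1 (z h) * c1 (z i) * P (H-{h}-{i})" for h i
 let ?D = "%H kp. (SUM h:H. SUM i:H-{h}. (LINT y|kp. y h * y i) * g h i)"
 let ?B = "%H y. (SUM h:H. SUM i:H-{h}. y h * y i * g h i)"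
 define T where "T y = P H + (SUM h:H. y h * f1 h) + ((SUM h:H. (y h)^2 * f2 h)
   + ?B H y) / 2" for y :: "'i => real"
 let ?E = "%kp. abs ((LINT y|kp. f y) - (LINT y|kp. T y))"
 define A where "A y h = abs (y h) ^ 3 * exp (3 * v * abs (y h))" for y :: "'i => real" and h
 define w where "w h i j = exp (v * (SUM k:Rf h i j. z k - v))" for h i j
 let ?A = "%H. (SUM h:H. SUM i:H. SUM j:H. w h i j)"
 define r where "r y = b^3 * (SUM h:H. SUM i:H. SUM j:H. w h i j * ((A y h + A y i + A y j) / 3))" for y :: "'i => real"
 have P01: "abs (P A) <= 1" for A unfolding P_def by (rule abs_prod_cutoff_le_1)
 have tay: "abs (f y - T y) <= r y" for y
 proof -
  have "abs (f y - T y) <= b^3 * (SUM h:H. abs (y h) * indicator {v<..} (z h + abs (y h))) ^ 3"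
   using product_cutoff_taylor[where z = z and y = y, OF fin]
   unfolding f_def T_def P_def f1_def f2_def g_def by (simp add: mult_ac diff_diff_eq add.assoc)
  also have "... <= r y" unfolding r_def w_def A_def
   using b0 crossing_cube_le[where z = z and y = y and H = H, OF v0 Rf] by (intro mult_left_mono) auto
  finally show ?thesis .
 qed
 note cm = borel_measurable_cutoff(1)
 have one: "integrable kp f \<and> integrable kp T \<and> ?E kp <= b^3 * m3 * ?A H \<and>
  (LINT y|kp. T y) = P H + ((SUM h:H. q h * f2 h) + ?D H kp) / 2"
  if k: "block_measure H v m3 q s kp" for kp
 proof -
  interpret K: prob_space kp using k by (simp add: block_measure_def)
  note [measurable] = block_component_measurable[OF k v0] cm
  have m0: "0 <= m3" using k by (simp add: block_measure_def)
  have fmeas: "f : borel_measurable kp" unfolding f_def[abs_def]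
   by (intro borel_measurable_prod) measurable
  have f01: "abs (f y) <= 1" for y unfolding f_def by (rule abs_prod_cutoff_le_1)
  have fi: "integrable kp f" by (rule K.integrable_const_bound[of _ 1]) (use fmeas f01 in auto)
  note i1 = block_integrable_component[OF k v0] block_integrable_square[OF k v0] block_integrable_product[OF k v0] block_int_cube[OF k v0]
  have iT1: "integrable kp (%y. SUM h:H. y h * f1 h)" "integrable kp (%y. SUM h:H. (y h)^2 * f2 h)"
   by (intro Bochner_Integration.integrable_sum integrable_mult_left i1; simp)+
  have iT2: "integrable kp (%y. SUM h:H. SUM i:H-{h}. y h * y i * g h i)"
   by (intro Bochner_Integration.integrable_sum integrable_mult_left i1; simp)
  note iT = iT1 iT2
  have Ti: "integrable kp T" unfolding T_def[abs_def]
   by (intro Bochner_Integration.integrable_add integrable_divide iT integrable_const) simp_all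
  have Ai: "integrable kp (%y. A y h)" if "h : H" for h unfolding A_def using i1 that by auto
  have ri: "integrable kp r" unfolding r_def[abs_def]
   by (intro integrable_mult_right Bochner_Integration.integrable_sum integrable_divide Bochner_Integration.integrable_add Ai)
  have A3: "(LINT y|kp. A y h) <= m3" if "h : H" for h using k that by (simp add: A_def block_measure_def)
  have "(LINT y|kp. r y) = b^3 * (SUM h:H. SUM i:H. SUM j:H. w h i j * (((LINT y|kp. A y h) + (LINT y|kp. A y i) + (LINT y|kp. A y j)) / 3))"
   unfolding r_def using Ai by (simp add: Bochner_Integration.integral_sum)
  also have "... <= b^3 * (SUM h:H. SUM i:H. SUM j:H. w h i j * m3)"
  proof (intro mult_left_mono sum_mono)
   fix h i j assume "h : H" "i : H" "j : H"
   then have "(LINT y|kp. A y h) <= m3" "(LINT y|kp. A y i) <= m3" "(LINT y|kp. A y j) <= m3" using A3 by blast+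
   moreover have "(x + y + z) / 3 <= m3" if "x <= m3" "y <= m3" "z <= m3" for x y z :: real
    using that by (simp add: field_simps)
   ultimately show "((LINT y|kp. A y h) + (LINT y|kp. A y i) + (LINT y|kp. A y j)) / 3 <= m3" by blast
  qed (use b0 in \<open>auto simp: w_def\<close>)
  also have "... = b^3 * m3 * ?A H"
   by (simp only: sum_distrib_right[symmetric]) (simp only: mult_ac)
  finally have rb: "(LINT y|kp. r y) <= b^3 * m3 * ?A H"
   .
  have "?E kp = abs (LINT y|kp. f y - T y)" using fi Ti by simp
  also have "... <= (LINT y|kp. abs (f y - T y))" by (rule integral_abs_bound)
  also have "... <= (LINT y|kp. r y)" using fi Ti ri tay by (intro integral_mono) auto
  finally have "?E kp <= b^3 * m3 * ?A H" using rb by linarith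
  moreover have "(LINT y|kp. T y) = P H + ((SUM h:H. q h * f2 h) + ?D H kp) / 2"
  proof -
   have "(LINT y|kp. (SUM h:H. y h * f1 h)) = 0"
    using i1 k by (subst Bochner_Integration.integral_sum) (auto simp: block_measure_def)
   moreover have "(LINT y|kp. (SUM h:H. (y h)^2 * f2 h)) = (SUM h:H. q h * f2 h)"
    using i1 k by (subst Bochner_Integration.integral_sum) (auto simp: block_measure_def)
   moreover have "(LINT y|kp. ?B H y) = ?D H kp"
   proof -
    have "(LINT y|kp. ?B H y) = (SUM h:H. (LINT y|kp. (SUM i:H-{h}. y h * y i * g h i)))"
     by (intro Bochner_Integration.integral_sum Bochner_Integration.integrable_sum integrable_mult_left i1) auto
    also have "... = (SUM h:H. SUM i:H-{h}. (LINT y|kp. y h * y i * g h i))"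
     by (intro sum.cong refl Bochner_Integration.integral_sum integrable_mult_left i1) auto
    finally show ?thesis by simp
   qed
   moreover have "(LINT y|kp. T y) = P H + (LINT y|kp. (SUM h:H. y h * f1 h))
     + ((LINT y|kp. (SUM h:H. (y h)^2 * f2 h)) + (LINT y|kp. ?B H y)) / 2"
    unfolding T_def
    by (subst Bochner_Integration.integral_add integral_divide_zero;
      (intro Bochner_Integration.integrable_add integrable_divide iT)?; simp add: K.prob_space)+
   ultimately show ?thesis by simp
  qed
  ultimately show ?thesis using fi Ti by blast
 qed
 have "(LINT y|\<mu>. T y) - (LINT y|\<nu>. T y) = (SUM h:H. SUM i:H-{h}. (LINT y|\<mu>. y h * y i) * g h i) / 2"
 proof -
  have "(SUM h:H. SUM i:H-{h}. (LINT y|\<nu>. y h * y i) * g h i) = 0" using nu0 by (intro sum.neutral ballI) auto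
  then show ?thesis using one[OF mu] one[OF nu] by (simp add: field_simps)
 qed
 also have "abs (...) <= ?C H z / 2"
 proof -
  have "abs ((LINT y|\<mu>. y h * y i) * g h i) <= s h i * abs (c1 (z h) * c1 (z i))" if "h : H" "i : H - {h}" for h i
  proof -
   have 1: "abs (LINT y|\<mu>. y h * y i) <= s h i" using mu that by (auto simp: block_measure_def)
   have "abs (g h i) <= abs (c1 (z h) * c1 (z i)) * 1" unfolding g_def abs_mult[of _ "P _"] by (intro mult_left_mono P01) auto
   then show ?thesis unfolding abs_mult[of "integral\<^sup>L _ _"] using 1 by (intro mult_mono) auto
  qed
  then have "abs (SUM h:H. SUM i:H-{h}. (LINT y|\<mu>. y h * y i) * g h i) <= ?C H z"
   by (intro order_trans[OF sum_abs] sum_mono order_trans[OF sum_abs] sum_mono) auto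
  then show ?thesis by simp
 qed
 finally have "abs ((LINT y|\<mu>. T y) - (LINT y|\<nu>. T y)) <= ?C H z / 2" .
 then show ?thesis using one[OF mu] one[OF nu] unfolding f_def[symmetric] w_def[symmetric] by linarith
qed

lemma product_blocks_mgf:
 fixes kp :: "'b => ('i => real) measure"
 assumes bm: "\<And>B. block_measure H v m3 (q B) (s B) (kp B)" and v0: "0 <= v" and I: "finite I"
  and R: "R \<subseteq> H" "finite R" "card R <= 3" and l: "\<And>k. k : R ==> 0 <= l k \<and> l k <= v"
 defines "E \<equiv> %x. exp (SUM k:R. l k * (SUM B:I. x B k))"
 shows "integrable (PiM I kp) E"
  and "(LINT x|PiM I kp. E x) <= exp (SUM B:I. (SUM k:R. (l k)^2 * q B k + (SUM i:R-{k}. l k * l i * s B k i)) / 2 + 81 * v ^ 3 * m3)"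
proof -
 let ?A = "%B. (SUM k:R. (l k)^2 * q B k + (SUM i:R-{k}. l k * l i * s B k i))"
 interpret product_sigma_finite kp
  using bm by (auto simp: product_sigma_finite_def block_measure_def intro: prob_space_imp_sigma_finite)
 have E: "E = (%x. PROD B:I. exp (SUM k:R. l k * x B k))"
  unfolding E_def using I R by (auto simp: exp_sum[symmetric] sum_distrib_left intro!: ext sum.swap)
 have int: "integrable (kp B) (%y. exp (SUM k:R. l k * y k))" for B
  by (rule block_mgf(1)[OF bm v0 R l])
 show "integrable (PiM I kp) E" unfolding E by (intro product_integrable_prod I int)
 have "(LINT x|PiM I kp. E x) = (PROD B:I. (LINT y|kp B. exp (SUM k:R. l k * y k)))"
  unfolding E by (intro product_integral_prod I int)
 also have "... <= (PROD B:I. exp (?A B / 2 + 81 * v ^ 3 * m3))"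
  by (intro prod_mono conjI block_mgf(2)[OF bm v0 R l] Bochner_Integration.integral_nonneg) auto
 finally show "(LINT x|PiM I kp. E x) <= exp (SUM B:I. ?A B / 2 + 81 * v ^ 3 * m3)"
  using I by (simp add: exp_sum)
qed

text \<open>Telescoping over hybrid products in which the blocks before \<open>k\<close> already
  follow \<open>\<nu>\<close>. The exchanged block is integrated with the sum of the others held
  fixed, and the tilted moments of that sum factor over blocks. The tilt \<open>th\<close> of a pair
  is left free because its best value depends on the correlation of the pair.\<close>

lemma (in smooth_cutoff) lindeberg_blocks:
 fixes \<mu> \<nu> :: "nat => ('i => real) measure"
 assumes fin: "finite H"
  and Rf: "\<And>h i j. Rf h i j \<subseteq> {h, i, j}"
  and mu: "\<And>B. block_measure H v m3 (q B) (s B) (\<mu> B)"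
  and nu: "\<And>B. block_measure H v m3 (q B) (s B) (\<nu> B)"
  and nu0: "\<And>B h i. h : H ==> i : H ==> h \<noteq> i ==> (LINT y|\<nu> B. y h * y i) = 0"
  and Q: "\<And>h. h : H ==> (\<Sum>B<N. q B h) <= Q h"
  and K: "\<And>h i. h : H ==> i : H ==> h \<noteq> i ==> (\<Sum>B<N. s B h i) <= K h i"
  and th: "\<And>h i. h : H ==> i : H ==> h \<noteq> i ==> 0 <= th h i \<and> th h i <= v"
  and E2: "\<And>h i. h : H ==> i : H ==> h \<noteq> i ==>
   exp ((th h i)^2 * (Q h + Q i + K h i + K i h) / 2 + 81 * real N * v ^ 3 * m3 - 2 * th h i * v) <= E2 h i"
  and E3: "\<And>h i j. h : H ==> i : H ==> j : H ==>
   exp (v^2 * (SUM k:Rf h i j. Q k + (SUM i:Rf h i j-{k}. K k i)) / 2 + 81 * real N * v ^ 3 * m3 - v^2 * card (Rf h i j)) <= E3 h i j"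
 shows "abs ((LINT x|PiM {..<N} \<mu>. (PROD h:H. c (\<Sum>B<N. x B h))) - (LINT x|PiM {..<N} \<nu>. (PROD h:H. c (\<Sum>B<N. x B h))))
  <= b^2 / 2 * (SUM h:H. SUM i:H-{h}. K h i * E2 h i) + 2 * real N * b^3 * m3 * (SUM h:H. SUM i:H. SUM j:H. E3 h i j)"
proof -
 define hyb where "hyb k B = (if B < k then \<nu> B else \<mu> B)" for k B :: nat
 have hyb: "block_measure H v m3 (q B) (s B) (hyb k B)" for k B using mu nu by (simp add: hyb_def)
 define f where "f z = (PROD h:H. c (z h))" for z :: "'i => real"
 define E where "E k = (LINT x|PiM {..<N} (hyb k). f (%h. \<Sum>B<N. x B h))" for k
 have q0: "0 <= q B h" if "h : H" for B h
 proof -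
  have "q B h = (LINT y|\<mu> B. (y h)^2)" using mu[of B] that by (simp add: block_measure_def)
  then show ?thesis by simp
 qed
 have s0: "0 <= s B h i" if "h : H" "i : H" "h \<noteq> i" for B h i
 proof -
  have "abs (LINT y|\<mu> B. y h * y i) <= s B h i" using mu[of B] that by (simp add: block_measure_def)
  then show ?thesis by linarith
 qed
 have m0: "0 <= m3" using mu[of 0] by (simp add: block_measure_def)
 have mgf: "integrable (PiM I (hyb k)) (%x. exp (SUM k:R. l k * (SUM B:I. x B k))) \<and>
  (LINT x|PiM I (hyb k). exp (SUM k:R. l k * (SUM B:I. x B k)))
   <= exp ((SUM k:R. (l k)^2 * Q k + (SUM i:R-{k}. l k * l i * K k i)) / 2 + 81 * real N * v ^ 3 * m3)"
  if I: "I \<subseteq> {..<N}" and R: "R \<subseteq> H" "card R <= 3" and l: "\<And>k. k : R ==> 0 <= l k \<and> l k <= v" for I R l k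
 proof
  have fI: "finite I" and fR: "finite R" using I R fin by (auto intro: finite_subset)
  show "integrable (PiM I (hyb k)) (%x. exp (SUM k:R. l k * (SUM B:I. x B k)))"
   by (rule product_blocks_mgf(1)[OF hyb v0 fI R(1) fR R(2) l])
  have "(LINT x|PiM I (hyb k). exp (SUM k:R. l k * (SUM B:I. x B k)))
   <= exp (SUM B:I. (SUM k:R. (l k)^2 * q B k + (SUM i:R-{k}. l k * l i * s B k i)) / 2 + 81 * v ^ 3 * m3)"
   by (rule product_blocks_mgf(2)[OF hyb v0 fI R(1) fR R(2) l])
  \<comment> \<open>All summands are nonnegative, so leaving out the exchanged block only decreases
    the exponent; the sums over all blocks therefore bound every step uniformly.\<close>
  also have "... <= exp (\<Sum>B<N. (SUM k:R. (l k)^2 * q B k + (SUM i:R-{k}. l k * l i * s B k i)) / 2 + 81 * v ^ 3 * m3)"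
   unfolding exp_le_cancel_iff using I R l v0 m0
   by (intro sum_mono2 add_nonneg_nonneg divide_nonneg_nonneg sum_nonneg mult_nonneg_nonneg q0 s0) auto
  also have "... = exp ((SUM k:R. (l k)^2 * (\<Sum>B<N. q B k) + (SUM i:R-{k}. l k * l i * (\<Sum>B<N. s B k i))) / 2 + 81 * real N * v ^ 3 * m3)"
  proof -
   have "(\<Sum>B<N. SUM k:R. (l k)^2 * q B k + (SUM i:R-{k}. l k * l i * s B k i))
    = (SUM k:R. \<Sum>B<N. (l k)^2 * q B k + (SUM i:R-{k}. l k * l i * s B k i))" by (rule sum.swap)
   also have "... = (SUM k:R. (l k)^2 * (\<Sum>B<N. q B k) + (SUM i:R-{k}. l k * l i * (\<Sum>B<N. s B k i)))"
   proof (rule sum.cong[OF refl])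
    fix k assume "k : R"
    have "(\<Sum>B<N. SUM i:R-{k}. l k * l i * s B k i) = (SUM i:R-{k}. \<Sum>B<N. l k * l i * s B k i)" by (rule sum.swap)
    then show "(\<Sum>B<N. (l k)^2 * q B k + (SUM i:R-{k}. l k * l i * s B k i)) =
      (l k)\<^sup>2 * (\<Sum>B<N. q B k) + (SUM i:R-{k}. l k * l i * (\<Sum>B<N. s B k i))"
     by (simp add: sum.distrib sum_distrib_left)
   qed
   finally show ?thesis by (simp add: sum.distrib sum_divide_distrib[symmetric] mult_ac)
  qed
  also have "... <= exp ((SUM k:R. (l k)^2 * Q k + (SUM i:R-{k}. l k * l i * K k i)) / 2 + 81 * real N * v ^ 3 * m3)"
  proof -
   have "(SUM k:R. (l k)^2 * (\<Sum>B<N. q B k) + (SUM i:R-{k}. l k * l i * (\<Sum>B<N. s B k i)))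
    <= (SUM k:R. (l k)^2 * Q k + (SUM i:R-{k}. l k * l i * K k i))"
    using R l by (intro sum_mono add_mono mult_left_mono Q K) auto
   then show ?thesis by simp
  qed
  finally show "(LINT x|PiM I (hyb k). exp (SUM k:R. l k * (SUM B:I. x B k)))
   <= exp ((SUM k:R. (l k)^2 * Q k + (SUM i:R-{k}. l k * l i * K k i)) / 2 + 81 * real N * v ^ 3 * m3)" .
 qed
 note cm = borel_measurable_cutoff(1)
 have f01: "abs (f y) <= 1" for y unfolding f_def by (rule abs_prod_cutoff_le_1)
 have step: "abs (E k - E (Suc k)) <= b^2 / 2 * (SUM h:H. SUM i:H-{h}. s k h i * E2 h i) + 2 * b^3 * m3 * (SUM h:H. SUM i:H. SUM j:H. E3 h i j)"
  if k: "k < N" for k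
 proof -
  define I where "I = {..<N} - {k}"
  have I: "insert k I = {..<N}" "k \<notin> I" "finite I" "I \<subseteq> {..<N}" using k by (auto simp: I_def)
  interpret P: product_sigma_finite "hyb k'" for k'
   using hyb by (auto simp: product_sigma_finite_def block_measure_def intro: prob_space_imp_sigma_finite)
  have ps: "prob_space (PiM J (hyb k'))" for J k' using hyb by (intro prob_space_PiM) (auto simp: block_measure_def)
  interpret PI: prob_space "PiM I (hyb k)" by (rule ps)
  define G where "G kp x = (LINT y|kp. f (%h. (SUM B:I. x B h) + y h))" for kp and x :: "nat => 'i => real"
  have meas: "(%x. x B h) : borel_measurable (PiM J (hyb k'))" if "B : J" "h : H" for B h J k'
   by (rule measurable_compose[OF measurable_component_singleton[OF that(1)] block_component_measurable[OF hyb v0 that(2)]])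
  have Ek: "E k' = (LINT x|PiM I (hyb k'). G (hyb k' k) x)" for k'
  proof -
   interpret P': prob_space "PiM {..<N} (hyb k')" by (rule ps)
   have "integrable (PiM {..<N} (hyb k')) (%x. f (%h. \<Sum>B<N. x B h))"
   proof (rule P'.integrable_const_bound[of _ 1])
    show "(%x. f (%h. \<Sum>B<N. x B h)) : borel_measurable (PiM {..<N} (hyb k'))"
     unfolding f_def by (intro borel_measurable_prod measurable_compose[OF _ cm] borel_measurable_sum meas) auto
   qed (use f01 in auto)
   then have "E k' = (LINT x|PiM I (hyb k'). (LINT y|hyb k' k. f (%h. \<Sum>B<N. (x(k := y)) B h)))"
    unfolding E_def I(1)[symmetric] by (intro P.product_integral_insert I)
   also have "(%x y. f (%h. \<Sum>B<N. (x(k := y)) B h)) = (%x y. f (%h. (SUM B:I. x B h) + y h))"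
   proof (intro ext arg_cong[of _ _ f])
    fix x :: "nat => 'i => real" and y :: "'i => real" and h
    have "(SUM B:I. (x(k := y)) B h) = (SUM B:I. x B h)" using I by (intro sum.cong) auto
    then show "(\<Sum>B<N. (x(k := y)) B h) = (SUM B:I. x B h) + y h"
     unfolding I(1)[symmetric] using I(2,3) by simp
   qed
   finally show ?thesis by (simp add: G_def)
  qed
  have hk: "hyb k k = \<mu> k" "hyb (Suc k) k = \<nu> k" by (auto simp: hyb_def)
  have same: "PiM I (hyb (Suc k)) = PiM I (hyb k)" by (rule PiM_cong) (auto simp: I_def hyb_def)
  have Gi: "integrable (PiM I (hyb k)) (G kp)" if bk: "block_measure H v m3 (q k) (s k) kp" for kp
  proof -
   interpret KK: prob_space kp using bk by (simp add: block_measure_def)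
   have mm: "(%(x, y). f (%h. (SUM B:I. x B h) + y h)) : borel_measurable (PiM I (hyb k) \<Otimes>\<^sub>M kp)"
    unfolding f_def split_beta
    by (intro borel_measurable_prod measurable_compose[OF _ cm] borel_measurable_add borel_measurable_sum
      measurable_compose[OF measurable_fst meas] measurable_compose[OF measurable_snd block_component_measurable[OF bk v0]]) auto
   show ?thesis
   proof (rule PI.integrable_const_bound[of _ 1])
    show "G kp : borel_measurable (PiM I (hyb k))"
     unfolding G_def[abs_def] by (rule KK.borel_measurable_lebesgue_integral[OF mm])
    show "AE x in PiM I (hyb k). norm (G kp x) <= 1"
    proof (rule AE_I2)
     fix x assume "x : space (PiM I (hyb k))"
     have "norm (G kp x) <= (LINT y|kp. abs (f (%h. (SUM B:I. x B h) + y h)))" unfolding G_def by (simp add: integral_abs_bound)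
     also have "... <= (LINT y|kp. 1)" by (rule integral_mono') (use f01 in auto)
     finally show "norm (G kp x) <= 1" by (simp add: KK.prob_space)
    qed
   qed
  qed
  define e2 where "e2 h i x = exp (th h i * ((SUM B:I. x B h) + (SUM B:I. x B i) - 2 * v))" for h i and x :: "nat => 'i => real"
  define e3 where "e3 h i j x = exp (v * (SUM k:Rf h i j. (SUM B:I. x B k) - v))" for h i j and x :: "nat => 'i => real"
  have e2b: "integrable (PiM I (hyb k)) (e2 h i) \<and> (LINT x|PiM I (hyb k). e2 h i x) <= E2 h i"
   if hi: "h : H" "i : H" "h \<noteq> i" for h i
  proof -
   have eq: "e2 h i x = exp (- 2 * th h i * v) * exp (SUM k:{h,i}. th h i * (SUM B:I. x B k))" for x
    using hi by (simp add: e2_def exp_add[symmetric] algebra_simps)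
   have m: "integrable (PiM I (hyb k)) (%x. exp (SUM k:{h,i}. th h i * (SUM B:I. x B k)))"
    "(LINT x|PiM I (hyb k). exp (SUM k:{h,i}. th h i * (SUM B:I. x B k)))
     <= exp ((SUM k:{h,i}. (th h i)^2 * Q k + (SUM j:{h,i}-{k}. th h i * th h i * K k j)) / 2 + 81 * real N * v ^ 3 * m3)"
    using mgf[of I "{h,i}" "%_. th h i" k] I hi th[OF hi] by auto
   have "(LINT x|PiM I (hyb k). e2 h i x) = exp (- 2 * th h i * v) * (LINT x|PiM I (hyb k). exp (SUM k:{h,i}. th h i * (SUM B:I. x B k)))"
    unfolding eq by simp
   also have "... <= exp (- 2 * th h i * v) * exp ((SUM k:{h,i}. (th h i)^2 * Q k + (SUM j:{h,i}-{k}. th h i * th h i * K k j)) / 2 + 81 * real N * v ^ 3 * m3)"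
    by (intro mult_left_mono m) auto
   also have "... = exp ((th h i)^2 * (Q h + Q i + K h i + K i h) / 2 + 81 * real N * v ^ 3 * m3 - 2 * th h i * v)"
   proof -
    have "{h,i} - {h} = {i}" "{h,i} - {i} = {h}" using hi by auto
    then show ?thesis using hi by (simp add: exp_add[symmetric] algebra_simps power2_eq_square add_divide_distrib)
   qed
   finally show ?thesis using m(1) E2[OF hi] unfolding eq by auto
  qed
  have e3b: "integrable (PiM I (hyb k)) (e3 h i j) \<and> (LINT x|PiM I (hyb k). e3 h i j x) <= E3 h i j"
   if hi: "h : H" "i : H" "j : H" for h i j
  proof -
   define R where "R = Rf h i j"
   have R: "R \<subseteq> {h,i,j}" "R \<subseteq> H" "finite R" using Rf[of h i j] hi by (auto simp: R_def intro: finite_subset)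
   have "card R <= card {h,i,j}" using R by (intro card_mono) auto
   also have "... <= 3" by (simp add: card_insert_if)
   finally have R3: "card R <= 3" .
   have eq: "e3 h i j x = exp (- v\<^sup>2 * card R) * exp (SUM k:R. v * (SUM B:I. x B k))" for x
    by (simp add: e3_def R_def[symmetric] exp_add[symmetric] sum_subtractf sum_distrib_left algebra_simps power2_eq_square)
   have m: "integrable (PiM I (hyb k)) (%x. exp (SUM k:R. v * (SUM B:I. x B k)))"
    "(LINT x|PiM I (hyb k). exp (SUM k:R. v * (SUM B:I. x B k)))
     <= exp ((SUM k:R. v^2 * Q k + (SUM j:R-{k}. v * v * K k j)) / 2 + 81 * real N * v ^ 3 * m3)"
    using mgf[of I R "%_. v" k] I R R3 v0 by auto
   have "(LINT x|PiM I (hyb k). e3 h i j x) = exp (- v\<^sup>2 * card R) * (LINT x|PiM I (hyb k). exp (SUM k:R. v * (SUM B:I. x B k)))"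
    unfolding eq by simp
   also have "... <= exp (- v\<^sup>2 * card R) * exp ((SUM k:R. v^2 * Q k + (SUM j:R-{k}. v * v * K k j)) / 2 + 81 * real N * v ^ 3 * m3)"
    by (intro mult_left_mono m) auto
   also have "... = exp (v^2 * (SUM k:R. Q k + (SUM i:R-{k}. K k i)) / 2 + 81 * real N * v ^ 3 * m3 - v^2 * card R)"
    by (simp add: exp_add[symmetric] sum_distrib_left distrib_left power2_eq_square)
   finally show ?thesis using m(1) E3[OF hi] unfolding eq R_def by auto
  qed
  have bnd: "abs (G (\<mu> k) x - G (\<nu> k) x) <= b^2 / 2 * (SUM h:H. SUM i:H-{h}. s k h i * e2 h i x) + 2 * b^3 * m3 * (SUM h:H. SUM i:H. SUM j:H. e3 h i j x)" for x
  proof -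
   define z where "z h = (SUM B:I. x B h)" for h
   have "abs (G (\<mu> k) x - G (\<nu> k) x) <= (SUM h:H. SUM i:H-{h}. s k h i * abs (c1 (z h) * c1 (z i))) / 2
    + 2 * b^3 * m3 * (SUM h:H. SUM i:H. SUM j:H. exp (v * (SUM k:Rf h i j. z k - v)))"
    unfolding G_def f_def z_def[symmetric]
    by (rule block_swap[OF fin Rf mu nu nu0])
   also have "(SUM h:H. SUM i:H-{h}. s k h i * abs (c1 (z h) * c1 (z i))) <= (SUM h:H. SUM i:H-{h}. s k h i * (b^2 * e2 h i x))"
   proof (intro sum_mono mult_left_mono)
    fix h i assume hi: "h : H" "i : H - {h}"
    show "0 <= s k h i" using hi s0 by auto
    \<comment> \<open>\<open>c1\<close> vanishes left of \<open>v\<close>, so the product is nonzero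
      only if both sums exceed \<open>v\<close>, and then the exponential \<open>e2\<close> is at
      least 1.\<close>
    show "abs (c1 (z h) * c1 (z i)) <= b^2 * e2 h i x"
    proof (cases "z h > v \<and> z i > v")
     case True
     then have "1 <= e2 h i x" using th[of h i] hi by (auto simp: e2_def z_def[symmetric])
     then have "b^2 * 1 <= b^2 * e2 h i x" by (intro mult_left_mono) auto
     moreover have "abs (c1 (z h)) * abs (c1 (z i)) <= b * b" using bd b0 by (intro mult_mono) auto
     ultimately show ?thesis by (simp add: abs_mult power2_eq_square)
    next
     case False
     then have "c1 (z h) = 0 \<or> c1 (z i) = 0" using left by (meson linorder_not_less)
     then show ?thesis by (auto simp: e2_def)
    qed
   qed
   also have "(SUM h:H. SUM i:H-{h}. s k h i * (b^2 * e2 h i x)) = b^2 * (SUM h:H. SUM i:H-{h}. s k h i * e2 h i x)"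
    by (simp add: sum_distrib_left mult_ac)
   finally show ?thesis by (simp add: e3_def z_def)
  qed
  have i2: "integrable (PiM I (hyb k)) (%x. SUM h:H. SUM i:H-{h}. s k h i * e2 h i x)"
   using e2b by (intro Bochner_Integration.integrable_sum integrable_mult_right) auto
  have i3: "integrable (PiM I (hyb k)) (%x. SUM h:H. SUM i:H. SUM j:H. e3 h i j x)"
   using e3b by (intro Bochner_Integration.integrable_sum) auto
  have "abs (E k - E (Suc k)) = abs (LINT x|PiM I (hyb k). G (\<mu> k) x - G (\<nu> k) x)"
   using Gi[OF mu] Gi[OF nu] by (simp add: Ek hk same)
  also have "... <= (LINT x|PiM I (hyb k). abs (G (\<mu> k) x - G (\<nu> k) x))" by (rule integral_abs_bound)
  also have "... <= (LINT x|PiM I (hyb k). b^2 / 2 * (SUM h:H. SUM i:H-{h}. s k h i * e2 h i x) + 2 * b^3 * m3 * (SUM h:H. SUM i:H. SUM j:H. e3 h i j x))"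
   using Gi[OF mu] Gi[OF nu] i2 i3 bnd by (intro integral_mono) auto
  also have "... = b^2 / 2 * (LINT x|PiM I (hyb k). (SUM h:H. SUM i:H-{h}. s k h i * e2 h i x))
    + 2 * b^3 * m3 * (LINT x|PiM I (hyb k). (SUM h:H. SUM i:H. SUM j:H. e3 h i j x))"
   using i2 i3 by simp
  also have "(LINT x|PiM I (hyb k). (SUM h:H. SUM i:H-{h}. s k h i * e2 h i x)) = (SUM h:H. SUM i:H-{h}. s k h i * (LINT x|PiM I (hyb k). e2 h i x))"
  proof -
   have "(LINT x|PiM I (hyb k). (SUM h:H. SUM i:H-{h}. s k h i * e2 h i x)) = (SUM h:H. (LINT x|PiM I (hyb k). (SUM i:H-{h}. s k h i * e2 h i x)))"
    using e2b by (intro Bochner_Integration.integral_sum Bochner_Integration.integrable_sum integrable_mult_right) auto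
   also have "... = (SUM h:H. SUM i:H-{h}. (LINT x|PiM I (hyb k). s k h i * e2 h i x))"
    using e2b by (intro sum.cong refl Bochner_Integration.integral_sum integrable_mult_right) auto
   finally show ?thesis by simp
  qed
  also have "... <= (SUM h:H. SUM i:H-{h}. s k h i * E2 h i)"
   using e2b s0 by (intro sum_mono mult_left_mono) auto
  also have "(LINT x|PiM I (hyb k). (SUM h:H. SUM i:H. SUM j:H. e3 h i j x)) = (SUM h:H. SUM i:H. SUM j:H. (LINT x|PiM I (hyb k). e3 h i j x))"
   using e3b by (subst Bochner_Integration.integral_sum)
    (auto intro!: sum.cong Bochner_Integration.integrable_sum simp: Bochner_Integration.integral_sum)
  also have "... <= (SUM h:H. SUM i:H. SUM j:H. E3 h i j)"
   using e3b by (intro sum_mono) auto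
  finally show ?thesis using b0 m0 by (simp add: mult_left_mono)
 qed
 have "abs (E 0 - E N) <= (\<Sum>k<N. abs (E k - E (Suc k)))"
 proof -
  have "E 0 - E N = (\<Sum>k<N. E k - E (Suc k))" by (rule sum_lessThan_telescope'[symmetric])
  then show ?thesis using sum_abs[of "%k. E k - E (Suc k)" "{..<N}"] by simp
 qed
 also have "... <= (\<Sum>k<N. b^2 / 2 * (SUM h:H. SUM i:H-{h}. s k h i * E2 h i) + 2 * b^3 * m3 * (SUM h:H. SUM i:H. SUM j:H. E3 h i j))"
  by (intro sum_mono step) auto
 also have "... = b^2 / 2 * (SUM h:H. SUM i:H-{h}. (\<Sum>k<N. s k h i) * E2 h i) + 2 * real N * b^3 * m3 * (SUM h:H. SUM i:H. SUM j:H. E3 h i j)"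
 proof -
  have "(\<Sum>k<N. SUM h:H. SUM i:H-{h}. s k h i * E2 h i) = (SUM h:H. SUM i:H-{h}. (\<Sum>k<N. s k h i) * E2 h i)"
   by (subst sum.swap, intro sum.cong refl, subst sum.swap) (simp add: sum_distrib_right)
  then show ?thesis by (simp only: sum.distrib sum_distrib_left[symmetric]) simp
 qed
 also have "... <= b^2 / 2 * (SUM h:H. SUM i:H-{h}. K h i * E2 h i) + 2 * real N * b^3 * m3 * (SUM h:H. SUM i:H. SUM j:H. E3 h i j)"
 proof -
  have "(\<Sum>k<N. s k h i) * E2 h i <= K h i * E2 h i" if "h : H" "i : H - {h}" for h i
   using that K[of h i] E2[of h i] by (intro mult_right_mono) (auto intro: order_trans[OF exp_ge_zero])
  then show ?thesis by (intro add_right_mono mult_left_mono sum_mono) auto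
 qed
 finally have "abs (E 0 - E N) <= b^2 / 2 * (SUM h:H. SUM i:H-{h}. K h i * E2 h i) + 2 * real N * b^3 * m3 * (SUM h:H. SUM i:H. SUM j:H. E3 h i j)" .
 moreover have "PiM {..<N} (hyb 0) = PiM {..<N} \<mu>" "PiM {..<N} (hyb N) = PiM {..<N} \<nu>"
  by (rule PiM_cong; simp add: hyb_def)+
 ultimately show ?thesis by (simp add: E_def f_def)
qed

section \<open>Gaussian blocks\<close>

text \<open>Integrating out one block with independent coordinates replaces every \<open>F h\<close>
  by an average of its translates, again measurable and bounded by 1. This is why the induction over
  the blocks generalises over \<open>F\<close>.\<close>

lemma integral_product_blocks_factor:
 fixes kp :: "'b => 'i => real measure" and F :: "'i => real => real"
 assumes pk: "\<And>B h. prob_space (kp B h)" and sk: "\<And>B h. sets (kp B h) = sets borel"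
  and I: "finite I" and H: "finite H"
  and F: "\<And>h. F h : borel_measurable borel" "\<And>h x. abs (F h x) <= 1"
 shows "(LINT x|PiM I (%B. PiM H (kp B)). (PROD h:H. F h (SUM B:I. x B h)))
  = (PROD h:H. (LINT x|PiM I (%B. kp B h). F h (SUM B:I. x B)))"
 using I F
proof (induction I arbitrary: F rule: finite_induct)
 case empty
 have "prob_space (PiM {} (%B. PiM H (kp B)))" "\<And>h. prob_space (PiM {} (%B. kp B h))"
  by (rule prob_space_PiM, simp)+
 then show ?case by (simp add: prob_space.prob_space)
next
 case (insert k I)
 interpret P: product_sigma_finite "%B. PiM H (kp B)"
  by (auto simp: product_sigma_finite_def intro!: prob_space_imp_sigma_finite prob_space_PiM pk)
 interpret P1: product_sigma_finite "%B. kp B h" for h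
  by (auto simp: product_sigma_finite_def intro!: prob_space_imp_sigma_finite pk)
 interpret PK: product_sigma_finite "kp k"
  by (auto simp: product_sigma_finite_def intro!: prob_space_imp_sigma_finite pk)
 interpret kk: prob_space "kp k h" for h by (rule pk)
 have psJ: "prob_space (PiM J (%B. PiM H (kp B)))" for J by (intro prob_space_PiM pk)
 have psJ1: "prob_space (PiM J (%B. kp B h))" for J h by (intro prob_space_PiM pk)
 note [measurable] = insert.prems(1)
 define G where "G h t = (LINT y|kp k h. F h (t + y))" for h t
 have Gm: "G h : borel_measurable borel" for h unfolding G_def[abs_def]
  by (rule sigma_finite_measure.borel_measurable_lebesgue_integral[OF prob_space_imp_sigma_finite[OF kk.prob_space_axioms]],
   subst measurable_cong_sets[OF sets_pair_measure_cong[OF refl sk] refl]) measurable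
 have Fi: "integrable (kp k h) (%y. F h (t + y))" for h t
 proof (rule kk.integrable_const_bound[of _ 1])
  show "(%y. F h (t + y)) : borel_measurable (kp k h)"
   by (subst measurable_cong_sets[OF sk refl]) measurable
 qed (use insert.prems(2) in auto)
 have G1: "abs (G h x) <= 1" for h x
 proof -
  have "abs (G h x) <= (LINT y|kp k h. abs (F h (x + y)))" unfolding G_def by (rule integral_abs_bound)
  also have "... <= (LINT y|kp k h. 1)" by (rule integral_mono') (use insert.prems(2) in auto)
  finally show ?thesis by (simp add: kk.prob_space)
 qed
 have m1: "(%x. x B h) : borel_measurable (PiM J (%B. PiM H (kp B)))" if "B : J" "h : H" for B h J
 proof -
  have "(%x. x B) : measurable (PiM J (%B. PiM H (kp B))) (PiM H (kp B))" using that by simp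
  moreover have "(%y. y h) : borel_measurable (PiM H (kp B))"
   using measurable_component_singleton[OF that(2), of "kp B"] by (simp add: measurable_cong_sets[OF refl sk])
  ultimately show ?thesis by (rule measurable_compose)
 qed
 have "(LINT x|PiM (insert k I) (%B. PiM H (kp B)). (PROD h:H. F h (SUM B:insert k I. x B h)))
  = (LINT x|PiM I (%B. PiM H (kp B)). (LINT y|PiM H (kp k). (PROD h:H. F h (SUM B:insert k I. (x(k := y)) B h))))"
 proof (intro P.product_integral_insert insert.hyps)
  interpret A: prob_space "PiM (insert k I) (%B. PiM H (kp B))" by (rule psJ)
  show "integrable (PiM (insert k I) (%B. PiM H (kp B))) (%x. PROD h:H. F h (SUM B:insert k I. x B h))"
  proof (rule A.integrable_const_bound[of _ 1])
   show "AE x in PiM (insert k I) (%B. PiM H (kp B)). norm (PROD h:H. F h (SUM B:insert k I. x B h)) <= 1"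
    using insert.prems(2) by (auto simp: abs_prod intro!: prod_le_1)
  qed (intro borel_measurable_prod measurable_compose[OF _ insert.prems(1)] borel_measurable_sum m1; simp)
 qed
 also have "... = (LINT x|PiM I (%B. PiM H (kp B)). (PROD h:H. G h (SUM B:I. x B h)))"
 proof (intro Bochner_Integration.integral_cong refl)
  fix x :: "'b => 'i => real"
  have e: "(SUM B:insert k I. (x(k := y)) B h) = (SUM B:I. x B h) + y h" for y h
  proof -
   have "(SUM B:I. (x(k := y)) B h) = (SUM B:I. x B h)" using insert.hyps by (intro sum.cong) auto
   then show ?thesis using insert.hyps by simp
  qed
  show "(LINT y|PiM H (kp k). (PROD h:H. F h (SUM B:insert k I. (x(k := y)) B h))) = (PROD h:H. G h (SUM B:I. x B h))"
   unfolding e G_def by (intro PK.product_integral_prod H Fi)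
 qed
 also have "... = (PROD h:H. (LINT x|PiM I (%B. kp B h). G h (SUM B:I. x B)))"
  by (rule insert.IH[OF Gm G1])
 also have "... = (PROD h:H. (LINT x|PiM (insert k I) (%B. kp B h). F h (SUM B:insert k I. x B)))"
 proof (intro prod.cong refl)
  fix h
  interpret A: prob_space "PiM (insert k I) (%B. kp B h)" by (rule psJ1)
  have mB: "(%x. x B) : borel_measurable (PiM (insert k I) (%B. kp B h))" if "B : insert k I" for B
   using measurable_component_singleton[OF that, of "%B. kp B h"] by (simp add: measurable_cong_sets[OF refl sk])
  have "integrable (PiM (insert k I) (%B. kp B h)) (%x. F h (SUM B:insert k I. x B))"
  proof (rule A.integrable_const_bound[of _ 1])
   show "(%x. F h (SUM B:insert k I. x B)) : borel_measurable (PiM (insert k I) (%B. kp B h))"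
    by (intro measurable_compose[OF _ insert.prems(1)] borel_measurable_sum mB)
  qed (use insert.prems(2) in simp)
  then have "(LINT x|PiM (insert k I) (%B. kp B h). F h (SUM B:insert k I. x B))
   = (LINT x|PiM I (%B. kp B h). (LINT y|kp k h. F h (SUM B:insert k I. (x(k := y)) B)))"
   by (intro P1.product_integral_insert insert.hyps)
  also have "... = (LINT x|PiM I (%B. kp B h). G h (SUM B:I. x B))"
  proof (intro Bochner_Integration.integral_cong refl)
   fix x :: "'b => real"
   have e: "(SUM B:insert k I. (x(k := y)) B) = (SUM B:I. x B) + y" for y
   proof -
    have "(SUM B:I. (x(k := y)) B) = (SUM B:I. x B)" using insert.hyps by (intro sum.cong) auto
    then show ?thesis using insert.hyps by simp
   qed
   show "(LINT y|kp k h. F h (SUM B:insert k I. (x(k := y)) B)) = G h (SUM B:I. x B)"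
    unfolding e G_def ..
  qed
  finally show "(LINT x|PiM I (%B. kp B h). G h (SUM B:I. x B))
   = (LINT x|PiM (insert k I) (%B. kp B h). F h (SUM B:insert k I. x B))" ..
 qed
 finally show ?case .
qed

text \<open>A scaled standard normal rather than a density: standard deviation 0 is then included
  and gives the point mass at 0, which a block with vanishing variance requires.\<close>

definition centered_normal :: "real => real measure" where
 "centered_normal s = distr std_normal_distribution borel (%x. s * x)"

lemma prob_space_std_normal: "prob_space std_normal_distribution"
 using real_dist_normal_dist by (simp add: real_distribution_def)

lemma prob_space_centered_normal: "prob_space (centered_normal s)"
 unfolding centered_normal_def by (intro prob_space.prob_space_distr prob_space_std_normal) simp

lemma sets_centered_normal [simp]: "sets (centered_normal s) = sets borel"
 by (simp add: centered_normal_def)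

lemma integral_centered_normal:
 fixes f :: "real => real"
 shows "f : borel_measurable borel ==> (LINT x|centered_normal s. f x) = (LINT x|std_normal_distribution. f (s * x))"
 unfolding centered_normal_def by (subst integral_distr) auto

lemma centered_normal_density: "0 < s ==> centered_normal s = density lborel (normal_density 0 s)"
proof -
 assume s: "0 < s"
 interpret N: prob_space std_normal_distribution by (rule prob_space_std_normal)
 have nu: "measure std_normal_distribution UNIV = 1" using N.prob_space by simp
 have "distributed std_normal_distribution lborel (%x. x) std_normal_density"
  by (auto simp: distributed_def distr_id2)
 from N.normal_density_affine[OF this, of s 0] s
 have "distributed std_normal_distribution lborel (%x. s * x) (normal_density 0 s)" by simp
 then have "distr std_normal_distribution lborel (%x. s * x) = density lborel (normal_density 0 s)"
  by (rule distributed_distr_eq_density[symmetric, symmetric])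
 moreover have "distr std_normal_distribution lborel (%x. s * x) = distr std_normal_distribution borel (%x. s * x)"
  by (rule distr_cong) auto
 ultimately show ?thesis by (simp add: centered_normal_def)
qed

lemma centered_normal_convolution:
 fixes F :: "real => real"
 assumes "0 <= r" "0 <= a" and F: "F : borel_measurable borel" "\<And>x. abs (F x) <= 1"
 shows "(LINT x|centered_normal r. (LINT y|centered_normal a. F (x + y))) = (LINT x|centered_normal (sqrt (r^2 + a^2)). F x)"
 (is "?L = ?R")
proof -
 let ?A = "(centered_normal r \<Otimes>\<^sub>M centered_normal a)"
 interpret A: prob_space "centered_normal a" by (rule prob_space_centered_normal)
 interpret R: prob_space "centered_normal r" by (rule prob_space_centered_normal)
 interpret N: prob_space std_normal_distribution by (rule prob_space_std_normal)
 have nu: "measure std_normal_distribution UNIV = 1" using N.prob_space by simp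
 interpret RA: pair_prob_space "centered_normal r" "centered_normal a" ..
 note [measurable] = F(1)
 note [measurable_cong] = sets_centered_normal
 show ?thesis
 proof (cases "r = 0 \<or> a = 0")
  case True
  have [measurable]: "(%x. (LINT y|centered_normal a. F (x + y))) : borel_measurable borel"
   by (rule A.borel_measurable_lebesgue_integral) measurable
  from True show ?thesis using assms(1,2)
   by (auto simp: integral_centered_normal nu real_sqrt_abs)
 next
  case False
  then have pos: "0 < r" "0 < a" using assms by auto
  have "centered_normal (sqrt (r^2 + a^2)) = density lborel (%x. ennreal (normal_density 0 (sqrt (r^2 + a^2)) x))"
   using pos by (intro centered_normal_density) (simp add: sum_power2_gt_zero_iff)
  also have "... = density lborel (%x. \<integral>\<^sup>+y. ennreal (normal_density 0 r (x - y)) * ennreal (normal_density 0 a y) \<partial>lborel)"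
   using conv_normal_density_zero_mean[OF pos] by (simp add: ennreal_mult' fun_eq_iff)
  also have "... = (centered_normal r \<star> centered_normal a)"
   unfolding centered_normal_density[OF pos(1)] centered_normal_density[OF pos(2)]
   by (rule convolution_density[symmetric])
    (simp_all add: centered_normal_density[symmetric] pos R.finite_measure_axioms A.finite_measure_axioms)
  finally have "?R = (LINT z|(centered_normal r \<star> centered_normal a). F z)" by simp
  also have "... = (LINT p|?A. F (fst p + snd p))"
   unfolding convolution_def by (subst integral_distr) (auto simp: split_beta)
  also have "... = ?L"
  proof -
   have "integrable ?A (%p. F (fst p + snd p))"
    by (rule RA.integrable_const_bound[of _ 1]) (use F in auto)
   then show ?thesis
    using RA.integral_fst[of "%x y. F (x + y)"] by (simp add: split_beta')
  qed
  finally show ?thesis ..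
 qed
qed

lemma integral_sum_centered_normal:
 fixes F :: "real => real"
 assumes "finite I" "F : borel_measurable borel" "\<And>x. abs (F x) <= 1" "\<And>B. 0 <= a B"
 shows "(LINT x|PiM I (%B. centered_normal (a B)). F (SUM B:I. x B)) = (LINT x|centered_normal (sqrt (SUM B:I. (a B)^2)). F x)"
 using assms(1-3)
proof (induction I arbitrary: F rule: finite_induct)
 case empty
 interpret N: prob_space std_normal_distribution by (rule prob_space_std_normal)
 have nu: "measure std_normal_distribution UNIV = 1" using N.prob_space by simp
 have "prob_space (PiM {} (%B. centered_normal (a B)))" by (rule prob_space_PiM) simp
 then show ?case using empty by (simp add: prob_space.prob_space integral_centered_normal nu)
next
 case (insert k I)
 interpret P: product_sigma_finite "%B. centered_normal (a B)"
  by (auto simp: product_sigma_finite_def intro!: prob_space_imp_sigma_finite prob_space_centered_normal)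
 interpret A: prob_space "PiM (insert k I) (%B. centered_normal (a B))"
  by (intro prob_space_PiM prob_space_centered_normal)
 interpret kk: prob_space "centered_normal (a k)" by (rule prob_space_centered_normal)
 note [measurable] = insert.prems(1)
 note [measurable_cong] = sets_centered_normal
 define G where "G t = (LINT y|centered_normal (a k). F (t + y))" for t
 have Gm: "G : borel_measurable borel" unfolding G_def[abs_def]
  by (rule sigma_finite_measure.borel_measurable_lebesgue_integral[OF prob_space_imp_sigma_finite[OF kk.prob_space_axioms]],
   subst measurable_cong_sets[OF sets_pair_measure_cong[OF refl sets_centered_normal] refl]) measurable
 have G1: "abs (G x) <= 1" for x
 proof -
  have "abs (G x) <= (LINT y|centered_normal (a k). abs (F (x + y)))" unfolding G_def by (rule integral_abs_bound)
  also have "... <= (LINT y|centered_normal (a k). 1)" by (rule integral_mono') (use insert.prems(2) in auto)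
  finally show ?thesis by (simp add: kk.prob_space)
 qed
 have mB: "(%x. x B) : borel_measurable (PiM (insert k I) (%B. centered_normal (a B)))" if "B : insert k I" for B
  using measurable_component_singleton[OF that, of "%B. centered_normal (a B)"]
  by (simp add: measurable_cong_sets[OF refl sets_centered_normal])
 have "integrable (PiM (insert k I) (%B. centered_normal (a B))) (%x. F (SUM B:insert k I. x B))"
 proof (rule A.integrable_const_bound[of _ 1])
  show "(%x. F (SUM B:insert k I. x B)) : borel_measurable (PiM (insert k I) (%B. centered_normal (a B)))"
   by (intro measurable_compose[OF _ insert.prems(1)] borel_measurable_sum mB)
 qed (use insert.prems(2) in simp)
 then have "(LINT x|PiM (insert k I) (%B. centered_normal (a B)). F (SUM B:insert k I. x B))
  = (LINT x|PiM I (%B. centered_normal (a B)). (LINT y|centered_normal (a k). F (SUM B:insert k I. (x(k := y)) B)))"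
  by (intro P.product_integral_insert insert.hyps)
 also have "... = (LINT x|PiM I (%B. centered_normal (a B)). G (SUM B:I. x B))"
 proof (intro Bochner_Integration.integral_cong refl)
  fix x :: "'a => real"
  have e: "(SUM B:insert k I. (x(k := y)) B) = (SUM B:I. x B) + y" for y
  proof -
   have "(SUM B:I. (x(k := y)) B) = (SUM B:I. x B)" using insert.hyps by (intro sum.cong) auto
   then show ?thesis using insert.hyps by simp
  qed
  show "(LINT y|centered_normal (a k). F (SUM B:insert k I. (x(k := y)) B)) = G (SUM B:I. x B)"
   unfolding e G_def ..
 qed
 also have "... = (LINT x|centered_normal (sqrt (SUM B:I. (a B)^2)). G x)" by (rule insert.IH[OF Gm G1])
 also have "... = (LINT x|centered_normal (sqrt ((sqrt (SUM B:I. (a B)^2))^2 + (a k)^2)). F x)"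
  unfolding G_def by (rule centered_normal_convolution) (use assms(4) insert.prems in \<open>auto intro: sum_nonneg\<close>)
 also have "(sqrt (SUM B:I. (a B)^2))^2 + (a k)^2 = (SUM B:insert k I. (a B)^2)"
  using insert.hyps by (simp add: sum_nonneg)
 finally show ?case .
qed

text \<open>From \<open>|x|^3 <= 6 * exp |x|\<close> the question reduces to
  \<open>exp (2 * x)\<close> and \<open>exp (- 2 * x)\<close>. Multiplying the normal density by
  either only shifts its mean, up to the factor \<open>exp 2\<close>.\<close>

lemma std_normal_cube_exp_integrable: "integrable std_normal_distribution (%x. abs x ^ 3 * exp (abs x))"
proof -
 let ?B = "%x. (6 * (std_normal_density x * exp (2 * x)) + 6 * (std_normal_density x * exp (- 2 * x)))"
 let ?A = "%x. (abs x ^ 3 * exp (abs x))"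
 have eq: "std_normal_density x * exp (2 * x) = exp 2 * normal_density 2 1 x"
  "std_normal_density x * exp (- 2 * x) = exp 2 * normal_density (-2) 1 x" for x :: real
  by (simp_all add: normal_density_def exp_add[symmetric] power2_eq_square field_simps)
 have "integrable lborel (%x. std_normal_density x * exp (2 * x))" "integrable lborel (%x. std_normal_density x * exp (- 2 * x))"
  unfolding eq by (intro integrable_mult_right integrable_normal_density; simp)+
 then have i: "integrable lborel (%x. 6 * (std_normal_density x * exp (2 * x)) + 6 * (std_normal_density x * exp (- 2 * x)))"
  by auto
 have "integrable lborel (%x. std_normal_density x *\<^sub>R (?A x))"
 proof (rule Bochner_Integration.integrable_bound[OF i])
  show "AE x in lborel. norm (std_normal_density x *\<^sub>R (?A x))
   <= norm (?B x)"
  proof (rule AE_I2)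
   fix x :: real
   have "abs x ^ 3 <= 6 * exp (abs x)"
   proof -
    obtain t where "exp (abs x) = (\<Sum>m<4. abs x ^ m / fact m) + exp t / fact 4 * abs x ^ 4"
     using Maclaurin_exp_le[of "abs x" 4] by blast
    then have "exp (abs x) = 1 + abs x + abs x^2 / 2 + abs x ^ 3 / 6 + exp t / 24 * abs x ^ 4"
     by (simp add: eval_nat_numeral)
    moreover have "0 <= exp t / 24 * abs x ^ 4" "0 <= abs x^2 / 2" by auto
    ultimately show ?thesis by linarith
   qed
   then have "abs x ^ 3 * exp (abs x) <= 6 * exp (abs x) * exp (abs x)" by (intro mult_right_mono) auto
   also have "... = 6 * exp (2 * abs x)" by (simp add: exp_add[symmetric])
   also have "... <= 6 * exp (2 * x) + 6 * exp (- 2 * x)" by (cases "x \<ge> 0") auto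
   finally have "std_normal_density x * ?A x <= std_normal_density x * (6 * exp (2 * x) + 6 * exp (- 2 * x))"
    by (intro mult_left_mono) auto
   then show "norm (std_normal_density x *\<^sub>R (?A x))
    <= norm (?B x)"
    by (simp add: abs_mult algebra_simps)
  qed
 qed auto
 then show ?thesis by (subst integrable_density) auto
qed

definition normal_cube_moment :: real where
 "normal_cube_moment = (LINT x|std_normal_distribution. abs x ^ 3 * exp (abs x))"

text \<open>The condition \<open>3 * v * a h <= 1\<close> bounds the weight
  \<open>exp (3 * v * |a h * x|)\<close> by \<open>exp |x|\<close>, so that one fixed moment of the
  standard normal serves for all variances.\<close>

lemma block_measure_normal:
 fixes H :: "'i set"
 assumes H: "finite H" and a: "\<And>h. h : H ==> 0 <= a h" "\<And>h. h : H ==> 3 * v * a h <= 1"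
  "\<And>h. h : H ==> a h ^ 3 * normal_cube_moment <= m3" "0 <= m3"
  and v0: "0 <= v" and s: "\<And>h i. h : H ==> i : H ==> h \<noteq> i ==> 0 <= s h i"
 shows "block_measure H v m3 (%h. (a h)^2) s (PiM H (%h. centered_normal (a h)))"
  and "\<And>h i. h : H ==> i : H ==> h \<noteq> i ==> (LINT y|PiM H (%h. centered_normal (a h)). y h * y i) = 0"
proof -
 let ?B = "%H h i y. (PROD k:H. (if k : {h,i} then y k else 1))"
 let ?P = "PiM H (%h. centered_normal (a h))"
 let ?A = "%h. (LINT y|?P. abs (y h) ^ 3 * exp (3 * v * abs (y h)))"
 interpret P: product_prob_space "%h. centered_normal (a h)" H
  by (intro product_prob_spaceI prob_space_centered_normal)
 interpret N: prob_space std_normal_distribution by (rule prob_space_std_normal)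
 have nu: "measure std_normal_distribution UNIV = 1" using N.prob_space by simp
 have comp: "(LINT y|?P. f (y h)) = (LINT x|std_normal_distribution. f (a h * x))"
  "integrable ?P (%y. f (y h)) \<longleftrightarrow> integrable std_normal_distribution (%x. f (a h * x))"
  if "h : H" "f : borel_measurable borel" for h and f :: "real => real"
 proof -
  have d: "distr ?P borel (%y. y h) = centered_normal (a h)"
  proof -
   have "distr ?P borel (%y. y h) = distr ?P (centered_normal (a h)) (%y. y h)" by (rule distr_cong) auto
   then show ?thesis using distr_PiM_component[OF prob_space_centered_normal that(1), of "%h. a h"] by simp
  qed
  have m: "(%y. y h) : borel_measurable ?P"
   using measurable_component_singleton[OF that(1), of "%h. centered_normal (a h)"]
   by (simp add: measurable_cong_sets[OF refl sets_centered_normal])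
  have "(LINT y|?P. f (y h)) = (LINT x|distr ?P borel (%y. y h). f x)" by (rule integral_distr[OF m that(2), symmetric])
  then show "(LINT y|?P. f (y h)) = (LINT x|std_normal_distribution. f (a h * x))"
   unfolding d by (simp add: integral_centered_normal that)
  have "integrable ?P (%y. f (y h)) \<longleftrightarrow> integrable (distr ?P borel (%y. y h)) f" by (rule integrable_distr_eq[OF m that(2), symmetric])
  also have "... \<longleftrightarrow> integrable std_normal_distribution (%x. f (a h * x))"
   unfolding d unfolding centered_normal_def by (rule integrable_distr_eq) (use that in auto)
  finally show "integrable ?P (%y. f (y h)) \<longleftrightarrow> integrable std_normal_distribution (%x. f (a h * x))" .
 qed
 have mom: "(LINT x|std_normal_distribution. x) = 0" "(LINT x|std_normal_distribution. x^2) = 1"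
  "integrable std_normal_distribution (%x. x)"
  using integral_std_normal_moment_odd[of 0] integral_std_normal_moment_even[of 1] integrable_std_normal_moment[of 1]
  by (subst integral_density, simp_all, subst integral_density, simp_all, subst integrable_density, simp_all)
 have mean: "(LINT y|?P. y h) = 0" if "h : H" for h
 proof -
  have "(LINT y|?P. y h) = (LINT x|std_normal_distribution. a h * x)" by (rule comp(1)[OF that]) simp
  then show ?thesis using mom(1) by simp
 qed
 have sq: "(LINT y|?P. (y h)^2) = (a h)^2" if "h : H" for h
 proof -
  have "(LINT y|?P. (y h)^2) = (LINT x|std_normal_distribution. (a h * x)^2)" by (rule comp(1)[OF that]) simp
  then show ?thesis using mom(2) by (simp add: power_mult_distrib)
 qed
 have dom: "abs (a h * x) ^ 3 * exp (3 * v * abs (a h * x)) <= a h ^ 3 * (abs x ^ 3 * exp (abs x))" if "h : H" for h x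
 proof -
  have "3 * v * a h * abs x <= 1 * abs x" using a(2)[OF that] by (intro mult_right_mono) auto
  then have "a h ^ 3 * abs x ^ 3 * exp (3 * v * (a h * abs x)) <= a h ^ 3 * abs x ^ 3 * exp (abs x)"
   using a(1)[OF that] by (intro mult_left_mono) (auto simp: mult.assoc)
  then show ?thesis using a(1)[OF that] by (simp add: abs_mult power_mult_distrib)
 qed
 have i3: "integrable std_normal_distribution (%x. abs (a h * x) ^ 3 * exp (3 * v * abs (a h * x)))" if "h : H" for h
  by (rule Bochner_Integration.integrable_bound[OF integrable_mult_right[OF std_normal_cube_exp_integrable, of "a h ^ 3"]])
   (use order_trans[OF dom[OF that] abs_ge_self] in simp_all)
 have cube: "?A h <= m3" if "h : H" for h
 proof -
  have "?A h = (LINT x|std_normal_distribution. abs (a h * x) ^ 3 * exp (3 * v * abs (a h * x)))"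
   by (rule comp(1)[OF that, of "%x. abs x ^ 3 * exp (3 * v * abs x)"]) simp
  also have "... <= (LINT x|std_normal_distribution. a h ^ 3 * (abs x ^ 3 * exp (abs x)))"
   by (intro integral_mono i3[OF that] dom[OF that] integrable_mult_right std_normal_cube_exp_integrable)
  also have "... = a h ^ 3 * normal_cube_moment" by (simp add: normal_cube_moment_def)
  finally show ?thesis using a(3)[OF that] by simp
 qed
 have icube: "integrable ?P (%y. abs (y h) ^ 3 * exp (3 * v * abs (y h)))" if "h : H" for h
 proof -
  have "integrable ?P (%y. abs (y h) ^ 3 * exp (3 * v * abs (y h))) \<longleftrightarrow>
   integrable std_normal_distribution (%x. abs (a h * x) ^ 3 * exp (3 * v * abs (a h * x)))"
   by (rule comp(2)[OF that, of "%x. abs x ^ 3 * exp (3 * v * abs x)"]) measurable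
  then show ?thesis using i3[OF that] by (rule iffD2)
 qed
 have cross: "(LINT y|?P. y h * y i) = 0" if "h : H" "i : H" "h \<noteq> i" for h i
 proof -
  have "(LINT y|?P. ?B H h i y) = (PROD k:H. (LINT x|centered_normal (a k). (if k : {h,i} then x else 1)))"
  proof (rule P.product_integral_prod[OF H, where f = "%k x. if k : {h,i} then x else 1"])
   fix k assume "k : H"
   interpret kk: prob_space "centered_normal (a k)" by (rule prob_space_centered_normal)
   have "integrable (centered_normal (a k)) (%x. x)"
    unfolding centered_normal_def by (subst integrable_distr_eq) (simp_all add: mom(3))
   then show "integrable (centered_normal (a k)) (%x. if k : {h,i} then x else 1)"
    by (cases "k : {h,i}") auto
  qed
  also have "... = 0"
   by (intro prod_zero[OF H] bexI[of _ h]) (simp_all add: that integral_centered_normal mom(1))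
  also have "(%y. PROD k:H. (if k : {h,i} then y k else 1)) = (%y. y h * y i :: real)"
  proof
   fix y :: "'i => real"
   have "?B H h i y = (PROD k:{h,i}. y k)"
    by (rule prod.mono_neutral_cong_right[OF H]) (use that in auto)
   then show "?B H h i y = y h * y i" using that by simp
  qed
  finally show ?thesis .
 qed
 show "\<And>h i. h : H ==> i : H ==> h \<noteq> i ==> (LINT y|?P. y h * y i) = 0" by (rule cross)
 show "block_measure H v m3 (%h. (a h)^2) s ?P"
  unfolding block_measure_def
 proof (intro conjI ballI impI)
  show "prob_space ?P" by (rule P.prob_space_axioms)
  show "sets ?P = sets (PiM H (%_. borel))" by (rule sets_PiM_cong) auto
  show "\<And>h i. h : H ==> i : H ==> h \<noteq> i ==> abs (LINT y|?P. y h * y i) <= s h i"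
   using cross s by simp
  show "\<And>h. h : H ==> integrable ?P (%y. abs (y h) ^ 3 * exp (3 * v * abs (y h)))" by (rule icube)
  show "\<And>h. h : H ==> ?A h <= m3" by (rule cube)
  show "\<And>h. h : H ==> (LINT y|?P. y h) = 0" by (rule mean)
  show "\<And>h. h : H ==> (LINT y|?P. (y h)^2) = (a h)^2" by (rule sq)
 qed (rule a(4))
qed

section \<open>Close and far index pairs and triples\<close>

definition index_close :: "nat => nat => nat => bool" where
 "index_close L h i \<longleftrightarrow> h <= i + L \<and> i <= h + L"

lemma index_close_sym: "index_close L h i \<longleftrightarrow> index_close L i h"
 by (auto simp: index_close_def)

lemma index_close_refl [simp]: "index_close L h h"
 by (simp add: index_close_def)

lemma sum_index_close_le: "(\<Sum>i=1..d. of_bool (index_close L h i)) <= (2 * real L + 1)"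
proof -
 have "(\<Sum>i=1..d. of_bool (index_close L h i)) = real (card {i : {1..d}. index_close L h i})"
  by (simp add: of_bool_def sum.inter_filter[symmetric] flip: sum.inter_filter)
 also have "card {i : {1..d}. index_close L h i} <= card {h - L..h + L}"
  by (intro card_mono) (auto simp: index_close_def)
 also have "real (card {h - L..h + L}) <= 2 * real L + 1" by simp
 finally show ?thesis by simp
qed

text \<open>A largest subset of \<open>{h, i, j}\<close> with pairwise far members: as many
  exponential tilts as can be applied without meeting a correlation that is not small.\<close>

definition far_triple :: "nat => nat => nat => nat => nat set" where
 "far_triple L h i j =
  (if \<not> index_close L h i \<and> \<not> index_close L i j \<and> \<not> index_close L h j then {h, i, j}
  else if \<not> index_close L h i then {h, i}
  else if \<not> index_close L i j then {i, j}
  else if \<not> index_close L h j then {h, j} else {h})"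

lemma far_triple_subset: "far_triple L h i j \<subseteq> {h, i, j}"
 by (auto simp: far_triple_def)

lemma far_triple_far: "k : far_triple L h i j ==> l : far_triple L h i j ==> k \<noteq> l ==> \<not> index_close L k l"
 by (auto simp: far_triple_def index_close_sym split: if_splits)

text \<open>Fewer than three members means that some pair is close, and a single member that all
  three are close; the indicators on the right record this. Summed over all triples the terms count
  about \<open>d^3\<close>, \<open>d^2 * L\<close> and \<open>d * L^2\<close> cases.\<close>

lemma far_triple_card:
 fixes x :: real
 assumes "0 <= x"
 shows "x ^ card (far_triple L h i j) <= x ^ 3 + x^2 * (of_bool (index_close L h i) + of_bool (index_close L i j) + of_bool (index_close L h j))
  + x * (of_bool (index_close L h i) * of_bool (index_close L h j))"
proof -
 have ne: "\<not> index_close L a b ==> a \<noteq> b" for a b by auto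
 have x: "0 <= x^3" "0 <= x^2" using assms by auto
 show ?thesis
  using ne[of h i] ne[of i j] ne[of h j] assms x
  by (cases "index_close L h i"; cases "index_close L i j"; cases "index_close L h j")
   (auto simp: far_triple_def card_insert_if eval_nat_numeral algebra_simps)
qed

text \<open>The comparison of the norms of order 2 and 3, from
  \<open>Y^2 * a <= (2 * |Y|^3 + a^3) / 3\<close> with \<open>a\<close> the norm of order 2. It lets
  a Gaussian block inherit the third-moment bound of the block whose variance it copies.\<close>

lemma rpow_abs3_le:
 fixes Y :: "'w => real"
 assumes "prob_space M" "integrable M (%u. abs (Y u) ^ 3)" "integrable M (%u. (Y u)^2)"
 shows "(sqrt (LINT u|M. (Y u)^2)) ^ 3 <= (LINT u|M. abs (Y u) ^ 3)"
proof -
 interpret prob_space M by fact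
 define a where "a = sqrt (LINT u|M. (Y u)^2)"
 have a0: "0 <= a" by (simp add: a_def)
 have a2: "a^2 = (LINT u|M. (Y u)^2)" by (simp add: a_def)
 have "(LINT u|M. (Y u)^2 * a) <= (LINT u|M. (2 * abs (Y u) ^ 3 + a ^ 3) / 3)"
 proof (rule integral_mono)
  fix u
  show "(Y u)^2 * a <= (2 * abs (Y u) ^ 3 + a ^ 3) / 3"
   using amgm3[of "abs (Y u)" "abs (Y u)" a] a0 by (simp add: power2_eq_square)
 qed (use assms in auto)
 also have "... = (2 * (LINT u|M. abs (Y u) ^ 3) + a ^ 3) / 3"
  using assms by (simp add: prob_space)
 finally have "a^2 * a <= (2 * (LINT u|M. abs (Y u) ^ 3) + a ^ 3) / 3" by (simp add: a2)
 then show ?thesis unfolding a_def[symmetric] by (simp add: power2_eq_square power3_eq_cube)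
qed

text \<open>\<open>m\<close> bounds the third absolute moments of the blocks, \<open>kp\<close> the
  total covariance of a far pair and \<open>r\<close> that of a close pair. Powers of
  \<open>exp (- v^2 / 2)\<close> are exponential tail bounds for one, two or three far coordinates;
  \<open>exp (- v^2 / (1 + r))\<close> is the best such bound for a pair with correlation
  \<open>r\<close>. \<open>L\<close> is the range of closeness and \<open>b\<close> the inverse
  width of the cutoff.\<close>

definition swap_error :: "nat => nat => nat => real => real => real => real => real => real" where
 "swap_error d L N m kp r v b =
  b\<^sup>2 / 2 * (real d ^ 2 * kp * exp 3 * exp (- v\<^sup>2 / 2) ^ 2 + real d * (2 * real L + 1) * exp 3 * exp (- v\<^sup>2 / (1 + r)))
  + 2 * real N * b ^ 3 * ((exp 1 + normal_cube_moment) * m) * (exp 7 *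
    (real d ^ 3 * exp (- v\<^sup>2 / 2) ^ 3 + 3 * (2 * real L + 1) * real d ^ 2 * exp (- v\<^sup>2 / 2) ^ 2
    + (2 * real L + 1) ^ 2 * real d * exp (- v\<^sup>2 / 2)))"

lemma normal_cube_moment_nonneg: "0 <= normal_cube_moment"
 unfolding normal_cube_moment_def by (rule Bochner_Integration.integral_nonneg) auto

lemma (in smooth_cutoff) product_cutoff_comparison:
 fixes Y :: "nat => nat => 'w => real"
 assumes pM: "prob_space M"
  and Ym: "\<And>B h. h : {1..d} ==> Y B h : borel_measurable M"
  and indep: "prob_space.indep_vars M (%_. PiM {1..d} (%_. borel)) (%B u. \<lambda>h\<in>{1..d}. Y B h u) {..<N}"
  and cen: "\<And>B h. h : {1..d} ==> (LINT u|M. Y B h u) = 0"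
  and bnd: "\<And>B h u. h : {1..d} ==> abs (Y B h u) <= c0" and vc: "3 * v * c0 <= 1"
  and cub: "\<And>B h. h : {1..d} ==> (LINT u|M. abs (Y B h u) ^ 3) <= m" and m0: "0 <= m"
  and Var: "\<And>h. h : {1..d} ==> (\<Sum>B<N. (LINT u|M. (Y B h u)^2)) <= 1 + e"
  and far: "\<And>h i. h : {1..d} ==> i : {1..d} ==> \<not> index_close L h i ==> (\<Sum>B<N. abs (LINT u|M. Y B h u * Y B i u)) <= kp"
  and close: "\<And>h i. h : {1..d} ==> i : {1..d} ==> h \<noteq> i ==> (\<Sum>B<N. abs (LINT u|M. Y B h u * Y B i u)) <= r"
  and r: "0 <= r" "r <= 1" and k0: "0 <= kp" and e0: "0 <= e"
  and small: "81 * real N * v ^ 3 * ((exp 1 + normal_cube_moment) * m) <= 1" "v^2 * e <= 1" "v^2 * kp <= 1"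
 shows "abs ((LINT u|M. (PROD h:{1..d}. c (\<Sum>B<N. Y B h u)))
   - (PROD h:{1..d}. (LINT x|std_normal_distribution. c (sqrt (\<Sum>B<N. (LINT u|M. (Y B h u)^2)) * x))))
  <= swap_error d L N m kp r v b"
proof -
 let ?F = "%S. (real d * S + real d * S + real d * S)"
 let ?E = "(2 * real L + 1)"
 let ?B = "(- v\<^sup>2 / (1 + r))"
 interpret prob_space M by fact
 let ?H = "{1..d}"
 let ?D = "(PiM {..<N} (%_. PiM ?H (%_. borel)))"
 let ?A = "(PiM ?H (%_. borel))"
 define V where "V B = (%u. \<lambda>h\<in>?H. Y B h u)" for B
 \<comment> \<open>\<open>exp 1\<close> accounts for the bounded block, whose tilt satisfies
   \<open>3 * v * c0 <= 1\<close>; the normal moment accounts for its Gaussian substitute.\<close>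
 define m3 where "m3 = (exp 1 + normal_cube_moment) * m"
 define q where "q B h = (LINT u|M. (Y B h u)^2)" for B h
 define s where "s B h i = abs (LINT u|M. Y B h u * Y B i u)" for B h i
 define \<mu> where "\<mu> B = distr M ?A (V B)" for B
 define \<nu> where "\<nu> B = PiM ?H (%h. centered_normal (sqrt (q B h)))" for B
 have m30: "0 <= m3" using m0 normal_cube_moment_nonneg by (simp add: m3_def)
 have Vm [measurable]: "V B : measurable M ?A" for B
  unfolding V_def by (rule measurable_restrict) (use Ym in auto)
 have c0: "0 <= c0" if "h : ?H" for h using bnd[OF that] by (meson abs_ge_zero order_trans)
 have ibd: "integrable M f" if "f : borel_measurable M" "\<And>u. abs (f u) <= K" for f and K :: real
  by (rule integrable_const_bound[of _ K]) (use that in auto)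
 have iY2: "integrable M (%u. (Y B h u)^2)" if "h : ?H" for B h
  by (rule ibd[of _ "c0^2"]) (use Ym[OF that] bnd[OF that] c0[OF that] in \<open>auto simp: abs_le_square_iff[symmetric] power2_le_iff_abs_le\<close>)
 have Y3: "abs (Y B h u) ^ 3 <= c0 ^ 3" if "h : ?H" for B h u
  using bnd[OF that] by (intro power_mono) auto
 have iY3: "integrable M (%u. abs (Y B h u) ^ 3)" if "h : ?H" for B h
  by (rule ibd[of _ "c0^3"]) (use Ym[OF that] Y3[OF that] in auto)
 have mu: "block_measure ?H v m3 (q B) (s B) (\<mu> B)" for B
 proof -
  have tr: "(LINT y|\<mu> B. f y) = (LINT u|M. f (V B u))" "integrable (\<mu> B) f \<longleftrightarrow> integrable M (%u. f (V B u))"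
   if "f : borel_measurable ?A" for f :: "(nat => real) => real"
   unfolding \<mu>_def by (rule integral_distr[OF Vm that], rule integrable_distr_eq[OF Vm that])
  have Vh: "V B u h = Y B h u" if "h : ?H" for u h using that by (simp add: V_def)
  have dom: "abs (Y B h u) ^ 3 * exp (3 * v * abs (Y B h u)) <= abs (Y B h u) ^ 3 * exp (1::real)" if "h : ?H" for h u
  proof -
   have "3 * v * abs (Y B h u) <= 3 * v * c0" using bnd[OF that] v0 by (intro mult_left_mono) auto
   then show ?thesis using vc by (intro mult_left_mono) auto
  qed
  have icub: "integrable M (%u. abs (Y B h u) ^ 3 * exp (3 * v * abs (Y B h u)))" if "h : ?H" for h
  proof (rule Bochner_Integration.integrable_bound)
   show "integrable M (%u. abs (Y B h u) ^ 3 * exp (1::real))" by (intro integrable_mult_left iY3 that)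
   show "(%u. abs (Y B h u) ^ 3 * exp (3 * v * abs (Y B h u))) : borel_measurable M" using Ym[OF that] by measurable
  qed (use dom[OF that] in \<open>auto simp: abs_mult\<close>)
  have cub': "(LINT u|M. abs (Y B h u) ^ 3 * exp (3 * v * abs (Y B h u))) <= m3" if "h : ?H" for h
  proof -
   have "(LINT u|M. abs (Y B h u) ^ 3 * exp (3 * v * abs (Y B h u))) <= (LINT u|M. abs (Y B h u) ^ 3 * exp (1::real))"
    by (intro integral_mono icub[OF that] integrable_mult_left iY3[OF that] dom[OF that])
   also have "... = exp 1 * (LINT u|M. abs (Y B h u) ^ 3)" by simp
   also have "... <= exp 1 * m" using cub[OF that] by (intro mult_left_mono) auto
   also have "... <= m3" using m0 normal_cube_moment_nonneg by (simp add: m3_def algebra_simps)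
   finally show ?thesis .
  qed
  show ?thesis
   unfolding block_measure_def
  proof (intro conjI ballI impI)
   show "prob_space (\<mu> B)" unfolding \<mu>_def by (rule prob_space_distr[OF Vm])
   show "sets (\<mu> B) = sets ?A" by (simp add: \<mu>_def)
   fix h assume h: "h : ?H"
   have hm[measurable]: "(%y :: nat => real. y h) : borel_measurable ?A" using h by (rule measurable_component_singleton)
   have t3: "(%y. abs (y h) ^ 3 * exp (3 * v * abs (y h))) : borel_measurable ?A" by measurable
   show "integrable (\<mu> B) (%y. abs (y h) ^ 3 * exp (3 * v * abs (y h)))" using icub[OF h] tr(2)[OF t3] by (simp add: Vh[OF h])
   show "(LINT y|\<mu> B. abs (y h) ^ 3 * exp (3 * v * abs (y h))) <= m3" using cub'[OF h] tr(1)[OF t3] by (simp add: Vh[OF h])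
   show "(LINT y|\<mu> B. y h) = 0" using cen[OF h] tr(1)[OF hm] by (simp add: Vh[OF h])
   have t2: "(%y :: nat => real. (y h)^2) : borel_measurable ?A" by (intro borel_measurable_power hm)
   show "(LINT y|\<mu> B. (y h)^2) = q B h" using tr(1)[OF t2] by (simp add: Vh[OF h] q_def)
   fix i assume i: "i : ?H"
   have im[measurable]: "(%y :: nat => real. y i) : borel_measurable ?A" using i by (rule measurable_component_singleton)
   have t11: "(%y :: nat => real. y h * y i) : borel_measurable ?A" by (intro borel_measurable_times hm im)
   show "abs (LINT y|\<mu> B. y h * y i) <= s B h i" using tr(1)[OF t11] by (simp add: Vh[OF h] Vh[OF i] s_def)
  qed (rule m30)
 qed
 have q0: "0 <= q B h" for B h by (simp add: q_def)
 have nu_prems: "0 <= sqrt (q B h)" "3 * v * sqrt (q B h) <= 1" "sqrt (q B h) ^ 3 * normal_cube_moment <= m3" if "h : ?H" for B h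
 proof -
  show "0 <= sqrt (q B h)" by (simp add: q0)
  have "q B h <= (LINT u|M. c0^2)" unfolding q_def
   by (intro integral_mono iY2[OF that]) (use bnd[OF that] c0[OF that] in \<open>auto simp: abs_le_square_iff[symmetric] power2_le_iff_abs_le\<close>)
  then have "sqrt (q B h) <= c0" using c0[OF that] by (simp add: prob_space real_le_lsqrt q0)
  then have "3 * v * sqrt (q B h) <= 3 * v * c0" using v0 by (intro mult_left_mono) auto
  then show "3 * v * sqrt (q B h) <= 1" using vc by simp
  have "sqrt (q B h) ^ 3 <= m"
   using rpow_abs3_le[OF pM iY3[OF that] iY2[OF that]] cub[OF that] unfolding q_def by (rule order_trans)
  then have "sqrt (q B h) ^ 3 * normal_cube_moment <= m * normal_cube_moment"
   using normal_cube_moment_nonneg by (intro mult_right_mono) auto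
  also have "... <= m3" using m0 by (simp add: m3_def algebra_simps)
  finally show "sqrt (q B h) ^ 3 * normal_cube_moment <= m3" .
 qed
 have nu: "block_measure ?H v m3 (q B) (s B) (\<nu> B)" for B
  using block_measure_normal(1)[where H = ?H and a = "%h. sqrt (q B h)" and s = "s B" and v = v and ?m3.0 = m3, OF _ nu_prems m30 v0]
  unfolding \<nu>_def by (simp add: q0 s_def)
 have nu0: "(LINT y|\<nu> B. y h * y i) = 0" if "h : ?H" "i : ?H" "h \<noteq> i" for B h i
  unfolding \<nu>_def
  by (rule block_measure_normal(2)[where s = "%_ _. 0", OF _ nu_prems m30 v0 _ that]) auto
 define K where "K h i = (if index_close L h i then r else kp)" for h i
 define x where "x = exp (- v\<^sup>2 / 2)"
 have x0: "0 <= x" by (simp add: x_def)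
 have xp: "x ^ n = exp (- (v^2 * real n / 2))" for n by (simp add: x_def exp_of_nat_mult[symmetric] mult_ac)
 define E2 where "E2 h i = (if index_close L h i then exp 3 * exp ?B else exp 3 * x ^ 2)" for h i
 \<comment> \<open>The minimiser of \<open>th^2 * (1 + r) - 2 * th * v\<close>. For a far pair the
   covariance is negligible, and the minimiser is \<open>v\<close> itself.\<close>
 define th where "th h i = (if index_close L h i then v / (1 + r) else v)" for h i
 define cl where "cl h i = (of_bool (index_close L h i) :: real)" for h i
 define E3 where "E3 h i j = exp 7 * (x ^ 3 + x^2 * (cl h i + cl i j + cl h j) + x * (cl h i * cl h j))" for h i j
 let ?C = "(SUM h:?H. SUM i:?H. SUM j:?H. E3 h i j)"
 have small1: "81 * real N * v ^ 3 * m3 <= 1" using small(1) by (simp add: m3_def)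
 have "abs ((LINT x|PiM {..<N} \<mu>. (PROD h:?H. c (\<Sum>B<N. x B h))) - (LINT x|PiM {..<N} \<nu>. (PROD h:?H. c (\<Sum>B<N. x B h))))
  <= b^2 / 2 * (SUM h:?H. SUM i:?H-{h}. K h i * E2 h i) + 2 * real N * b^3 * m3 * ?C"
 proof (rule lindeberg_blocks[where Q = "%_. 1 + e" and th = th and Rf = "far_triple L", OF _ far_triple_subset mu nu nu0])
  show "(\<Sum>B<N. q B h) <= 1 + e" if "h : ?H" for h using Var[OF that] by (simp add: q_def)
  show "(\<Sum>B<N. s B h i) <= K h i" if "h : ?H" "i : ?H" "h \<noteq> i" for h i
   using far[OF that(1,2)] close[OF that] by (simp add: s_def K_def)
  show "0 <= th h i \<and> th h i <= v" for h i
  proof -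
   have "v * 1 <= v * (1 + r)" using v0 r by (intro mult_left_mono) auto
   then show ?thesis using v0 r by (auto simp: th_def field_simps)
  qed
  show "exp ((th h i)^2 * (1 + e + (1 + e) + K h i + K i h) / 2 + 81 * real N * v ^ 3 * m3 - 2 * th h i * v) <= E2 h i" for h i
  proof (cases "index_close L h i")
   case True
   have r1: "1 + r > 0" using r by simp
   define p where "p = v / (1 + r)"
   have pv: "v = p * (1 + r)" using r1 by (simp add: p_def)
   have "p^2 * e <= v^2 * e"
   proof (intro mult_right_mono power_mono)
    have "v * 1 <= v * (1 + r)" using v0 r by (intro mult_left_mono) auto
    then show "p <= v" using r1 by (simp add: p_def field_simps)
   qed (use v0 r e0 in \<open>auto simp: p_def\<close>)
   then have "p^2 * e <= 1" using small by linarith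
   moreover have "p^2 * (1 + e + (1 + e) + r + r) / 2 = p^2 * (1 + r) + p^2 * e" by (simp add: algebra_simps)
   moreover have "2 * p * v = 2 * (p^2 * (1 + r))" unfolding pv by (simp add: power2_eq_square)
   moreover have "v^2 / (1 + r) = p^2 * (1 + r)" using r1 unfolding pv by (simp add: power2_eq_square)
   ultimately have "p^2 * (1 + e + (1 + e) + r + r) / 2 + 81 * real N * v ^ 3 * m3 - 2 * p * v <= 3 + - v\<^sup>2 / (1 + r)"
    using small1 by linarith
   then show ?thesis using True by (simp add: th_def E2_def K_def index_close_sym[of L i h] p_def exp_add[symmetric])
  next
   case False
   have "v^2 * (1 + e + (1 + e) + kp + kp) / 2 + 81 * real N * v ^ 3 * m3 - 2 * v * v <= 3 + - (v^2 * real 2 / 2)"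
   proof -
    have "v^2 * (1 + e + (1 + e) + kp + kp) / 2 = v^2 + v^2 * e + v^2 * kp" by (simp add: algebra_simps add_divide_distrib)
    moreover have "2 * v * v = 2 * v^2" by (simp add: power2_eq_square)
    ultimately show ?thesis using small1 small by linarith
   qed
   then show ?thesis unfolding E2_def xp using False by (simp add: th_def K_def index_close_sym[of L i h] exp_add[symmetric])
  qed
  \<comment> \<open>The members are pairwise far, so every off-diagonal entry is at most
    \<open>kp\<close>. The smallness conditions leave at most \<open>12 / 2 + 1 = 7\<close> beyond
    the Gaussian exponent.\<close>
  show "exp (v^2 * (SUM k:far_triple L h i j. 1 + e + (SUM i:far_triple L h i j - {k}. K k i)) / 2 +
    81 * real N * v ^ 3 * m3 - v^2 * real (card (far_triple L h i j))) <= E3 h i j" for h i j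
  proof -
   define R where "R = far_triple L h i j"
   have R: "finite R" using far_triple_subset[of L h i j] by (auto simp: R_def intro: finite_subset)
   have "card R <= card {h,i,j}" unfolding R_def using far_triple_subset by (intro card_mono) auto
   also have "... <= 3" by (simp add: card_insert_if)
   finally have R3: "real (card R) <= 3" by simp
   have "(SUM k:R. 1 + e + (SUM i:R - {k}. K k i)) <= (SUM k:R. 1 + e + 3 * kp)"
   proof (intro sum_mono add_left_mono)
    fix k assume k: "k : R"
    have "(SUM i:R - {k}. K k i) = (SUM i:R - {k}. kp)"
     using k far_triple_far[of k L h i j] by (intro sum.cong) (auto simp: K_def R_def)
    also have "... <= 3 * kp" using R R3 k0 k by (auto simp: card_Diff_singleton intro!: mult_right_mono)
    finally show "(SUM i:R - {k}. K k i) <= 3 * kp" .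
   qed
   also have "... = real (card R) + real (card R) * (e + 3 * kp)" by (simp add: algebra_simps)
   also have "... <= real (card R) + 3 * (e + 3 * kp)" using R3 e0 k0 by (intro add_left_mono mult_right_mono) auto
   finally have "v^2 * (SUM k:R. 1 + e + (SUM i:R - {k}. K k i)) <= v^2 * (real (card R) + 3 * (e + 3 * kp))"
    by (intro mult_left_mono) auto
   also have "... = v^2 * real (card R) + 3 * (v^2 * e) + 9 * (v^2 * kp)" by (simp add: algebra_simps)
   also have "... <= v^2 * real (card R) + 12" using small by linarith
   finally have "v^2 * (SUM k:R. 1 + e + (SUM i:R - {k}. K k i)) / 2 + 81 * real N * v ^ 3 * m3 - v^2 * real (card R) <= 7 + - (v^2 * real (card R) / 2)"
    using small1 by linarith
   then have "exp (v^2 * (SUM k:R. 1 + e + (SUM i:R - {k}. K k i)) / 2 + 81 * real N * v ^ 3 * m3 - v^2 * real (card R)) <= exp 7 * x ^ card R"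
    unfolding xp exp_add[symmetric] by simp
   also have "... <= E3 h i j"
    unfolding E3_def cl_def R_def by (intro mult_left_mono far_triple_card x0) simp
   finally show ?thesis unfolding R_def .
  qed
 qed auto
 moreover have "(SUM h:?H. SUM i:?H-{h}. K h i * E2 h i) <= real d ^ 2 * kp * exp 3 * x ^ 2 + real d * ?E * exp 3 * exp ?B"
 proof -
 have "(SUM h:?H. SUM i:?H-{h}. K h i * E2 h i) <= (SUM h:?H. SUM i:?H. kp * (exp 3 * x ^ 2) + exp 3 * exp ?B * cl h i)"
 proof (rule sum_mono)
  fix h
  have "(SUM i:?H-{h}. K h i * E2 h i) <= (SUM i:?H. K h i * E2 h i)"
   by (rule sum_mono2) (auto simp: K_def E2_def r k0)
  also have "... <= (SUM i:?H. kp * (exp 3 * x ^ 2) + exp 3 * exp ?B * cl h i)"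
  proof (rule sum_mono)
   fix i
   define T where "T = exp 3 * exp ?B"
   have "0 <= T" by (simp add: T_def)
   then have "r * T <= T" using r by (intro mult_left_le_one_le) auto
   moreover have "0 <= kp * (exp 3 * x^2)" using k0 by simp
   ultimately show "K h i * E2 h i <= kp * (exp 3 * x ^ 2) + exp 3 * exp ?B * cl h i"
    unfolding K_def E2_def cl_def T_def[symmetric] by (cases "index_close L h i") auto
  qed
  finally show "(SUM i:?H-{h}. K h i * E2 h i) <= (SUM i:?H. kp * (exp 3 * x ^ 2) + exp 3 * exp ?B * cl h i)" .
 qed
 also have "... = real d ^ 2 * kp * exp 3 * x ^ 2 + exp 3 * exp ?B * (SUM h:?H. SUM i:?H. cl h i)"
  by (simp add: sum.distrib sum_distrib_left power2_eq_square)
 also have "... <= real d ^ 2 * kp * exp 3 * x ^ 2 + exp 3 * exp ?B * (SUM h:?H. 2 * real L + 1)"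
  unfolding cl_def by (intro add_left_mono mult_left_mono sum_mono sum_index_close_le) auto
 finally show ?thesis by (simp add: mult_ac)
 qed
 moreover have "?C <= exp 7 *
  (real d ^ 3 * x ^ 3 + 3 * ?E * real d ^ 2 * x ^ 2 + ?E ^ 2 * real d * x)"
 proof -
  define S where "S = 2 * real L + 1"
  have S0: "0 <= S" by (simp add: S_def)
  have cS: "(SUM i:?H. cl h i) <= S" for h unfolding cl_def S_def by (rule sum_index_close_le)
  have cl0: "0 <= cl h i" for h i by (simp add: cl_def)
  have j: "(SUM j:?H. E3 h i j) <= exp 7 * (real d * x ^ 3 + x^2 * (real d * cl h i + S + S) + x * (cl h i * S))" for h i
  proof -
   have "(SUM j:?H. E3 h i j) = exp 7 * (real d * x ^ 3 + x^2 * (real d * cl h i + (SUM j:?H. cl i j) + (SUM j:?H. cl h j)) + x * (cl h i * (SUM j:?H. cl h j)))"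
    by (simp add: E3_def sum.distrib sum_distrib_left distrib_left)
   also have "... <= exp 7 * (real d * x ^ 3 + x^2 * (real d * cl h i + S + S) + x * (cl h i * S))"
    by (intro mult_left_mono add_mono order_refl cS x0 cl0) auto
   finally show ?thesis .
  qed
  have i: "(SUM i:?H. SUM j:?H. E3 h i j) <= exp 7 * (real d * (real d * x ^ 3) + x^2 * ?F S + x * (S * S))" for h
  proof -
   have "(SUM i:?H. SUM j:?H. E3 h i j) <= (SUM i:?H. exp 7 * (real d * x ^ 3 + x^2 * (real d * cl h i + S + S) + x * (cl h i * S)))"
    by (intro sum_mono j)
   also have "... = exp 7 * (real d * (real d * x ^ 3) + x^2 * (real d * (SUM i:?H. cl h i) + real d * S + real d * S) + x * ((SUM i:?H. cl h i) * S))"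
    by (simp add: sum.distrib sum_distrib_left sum_distrib_right distrib_left mult_ac)
   also have "... <= exp 7 * (real d * (real d * x ^ 3) + x^2 * ?F S + x * (S * S))"
    by (intro mult_left_mono mult_right_mono add_mono order_refl cS x0 S0) auto
   finally show ?thesis .
  qed
  have "?C <= (SUM h:?H. exp 7 * (real d * (real d * x ^ 3) + x^2 * ?F S + x * (S * S)))"
   by (intro sum_mono i)
  also have "... = exp 7 * (real d ^ 3 * x ^ 3 + 3 * S * real d ^ 2 * x ^ 2 + S ^ 2 * real d * x)"
   by (simp add: algebra_simps power2_eq_square power3_eq_cube)
  finally show ?thesis by (simp only: S_def)
 qed
 ultimately have "abs ((LINT x|PiM {..<N} \<mu>. (PROD h:?H. c (\<Sum>B<N. x B h))) - (LINT x|PiM {..<N} \<nu>. (PROD h:?H. c (\<Sum>B<N. x B h))))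
  <= b^2 / 2 * (real d ^ 2 * kp * exp 3 * x ^ 2 + real d * ?E * exp 3 * exp ?B)
   + 2 * real N * b^3 * m3 * (exp 7 * (real d ^ 3 * x ^ 3 + 3 * ?E * real d ^ 2 * x ^ 2 + ?E ^ 2 * real d * x))"
  using b0 m30 by (elim order_trans) (intro add_mono mult_left_mono; simp)
 then have main: "abs ((LINT x|PiM {..<N} \<mu>. (PROD h:?H. c (\<Sum>B<N. x B h))) - (LINT x|PiM {..<N} \<nu>. (PROD h:?H. c (\<Sum>B<N. x B h))))
  <= swap_error d L N m kp r v b"
  by (simp add: swap_error_def m3_def x_def)
 note cm = borel_measurable_cutoff(1)
 have "(LINT x|PiM {..<N} \<nu>. (PROD h:?H. c (\<Sum>B<N. x B h))) = (PROD h:?H. (LINT x|PiM {..<N} (%B. centered_normal (sqrt (q B h))). c (\<Sum>B<N. x B)))"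
  unfolding \<nu>_def
  by (rule integral_product_blocks_factor[where F = "%_. c"]) (use c01 cm prob_space_centered_normal in simp_all)
 also have "... = (PROD h:?H. (LINT x|centered_normal (sqrt (\<Sum>B<N. (sqrt (q B h))^2)). c x))"
  by (intro prod.cong refl integral_sum_centered_normal) (use c01 cm q0 in simp_all)
 also have "... = (PROD h:?H. (LINT x|std_normal_distribution. c (sqrt (\<Sum>B<N. (LINT u|M. (Y B h u)^2)) * x)))"
  by (simp add: integral_centered_normal[OF cm] q0) (simp add: q_def)
 finally have nuE: "(LINT x|PiM {..<N} \<nu>. (PROD h:?H. c (\<Sum>B<N. x B h))) = ..." .
 have muE: "(LINT x|PiM {..<N} \<mu>. (PROD h:?H. c (\<Sum>B<N. x B h))) = (LINT u|M. (PROD h:?H. c (\<Sum>B<N. Y B h u)))"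
 proof (cases "N = 0")
  case True
  have "prob_space (PiM {} \<mu>)" by (rule prob_space_PiM) simp
  then show ?thesis using True by (simp add: prob_space.prob_space prob_space)
 next
  case False
  have d: "distr M ?D (%u. \<lambda>B\<in>{..<N}. V B u) = PiM {..<N} \<mu>"
   unfolding \<mu>_def
   by (subst indep_vars_iff_distr_eq_PiM[symmetric, of "{..<N}" V "%_. PiM ?H (%_. borel)"])
    (use indep False Vm in \<open>simp_all add: V_def[abs_def] lessThan_empty_iff\<close>)
  have m1: "(%x. x B h) : borel_measurable (PiM {..<N} (%_. PiM ?H (%_. borel :: real measure)))" if "B < N" "h : ?H" for B h
   by (rule measurable_compose[where g = "%y. y h" and N = "PiM ?H (%_. borel)"]; rule measurable_component_singleton) (use that in simp_all)
  have "(LINT x|PiM {..<N} \<mu>. (PROD h:?H. c (\<Sum>B<N. x B h))) = (LINT u|M. (PROD h:?H. c (\<Sum>B<N. (\<lambda>B\<in>{..<N}. V B u) B h)))"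
   unfolding d[symmetric]
  proof (rule integral_distr)
   show "(%u. \<lambda>B\<in>{..<N}. V B u) : measurable M ?D"
    by (rule measurable_restrict) (rule Vm)
   show "(%x. PROD h:?H. c (\<Sum>B<N. x B h)) : borel_measurable ?D"
    by (intro borel_measurable_prod measurable_compose[OF _ cm] borel_measurable_sum m1) auto
  qed
  also have "... = (LINT u|M. (PROD h:?H. c (\<Sum>B<N. Y B h u)))"
   by (intro Bochner_Integration.integral_cong refl prod.cong arg_cong[of _ _ c] sum.cong) (auto simp: V_def)
  finally show ?thesis .
 qed
 show ?thesis using main unfolding nuE muE .
qed

section \<open>Moments under resampling of the past\<close>

text \<open>An i.i.d. family read along an injection of index sets is again i.i.d.; the couplings
  below are rereadings of this kind.\<close>

lemma distr_PiM_inj: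
 assumes "prob_space P" "inj f"
 shows "distr (PiM UNIV (%_::'b. P)) (PiM UNIV (%_::'a. P)) (%w n. w (f n)) = PiM UNIV (%_. P)"
 using distr_PiM_reindex[of UNIV "%_. P" f UNIV] assms by (simp add: restrict_UNIV)

lemma measurable_reindex:
 "(%w n. w (f n)) : measurable (PiM UNIV (%_::'b. P)) (PiM UNIV (%_::'a. P))"
 by (rule measurable_PiM_single') (auto simp: space_PiM)

lemma prod_emb_UNIV_iff:
 "x : prod_emb UNIV (%_. P) J (Pi\<^sub>E J E) \<longleftrightarrow> (\<forall>i. x i : space P) \<and> (ALL i:J. x i : E i)"
 by (auto simp: prod_emb_def PiE_iff restrict_def extensional_def)

lemma distr_pair_PiM_case_sum:
 fixes P :: "'s measure"
 assumes "prob_space P"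
 shows "distr (PiM UNIV (%_::'a. P) \<Otimes>\<^sub>M PiM UNIV (%_::'b. P)) (PiM UNIV (%_::'a + 'b. P)) (%(x, y). case_sum x y)
  = PiM UNIV (%_. P)" (is "distr (?A \<Otimes>\<^sub>M ?B) ?R ?f = ?R")
proof (rule measure_eqI_PiM_infinite[symmetric, OF refl])
 let ?C = "(?A \<Otimes>\<^sub>M ?B)"
 interpret A: prob_space ?A by (rule prob_space_PiM) (rule assms)
 interpret B: prob_space ?B by (rule prob_space_PiM) (rule assms)
 interpret R: prob_space ?R by (rule prob_space_PiM) (rule assms)
 interpret P: prob_space P by fact
 show "finite_measure ?R" by unfold_locales
 have fm: "?f : measurable ?C ?R"
 proof (rule measurable_PiM_single')
  show "(%w. (case w of (x, y) => case_sum x y) i) : measurable ?C P" for i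
  proof (cases i)
   case (Inl a)
   have eq: "(%w. (case w of (x, y) => case_sum x y) i) = (%w. fst w a)" by (auto simp: Inl)
   show ?thesis unfolding eq by (rule measurable_compose[OF measurable_fst measurable_component_singleton]) simp
  next
   case (Inr b)
   have eq: "(%w. (case w of (x, y) => case_sum x y) i) = (%w. snd w b)" by (auto simp: Inr)
   show ?thesis unfolding eq by (rule measurable_compose[OF measurable_snd measurable_component_singleton]) simp
  qed
  show "?f : space ?C \<rightarrow> (\<Pi>\<^sub>E i\<in>UNIV. space P)"
   by (auto simp: space_pair_measure space_PiM PiE_iff split: sum.split)
 qed
 fix J :: "('a + 'b) set" and E assume J: "finite J" "J \<subseteq> UNIV" and E: "\<And>i. i : J ==> E i : sets P"
 let ?X = "prod_emb UNIV (%_. P) J (Pi\<^sub>E J E)"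
 define J1 where "J1 = Inl -` J" define J2 where "J2 = Inr -` J"
 have fin: "finite J1" "finite J2" using J by (auto simp: J1_def J2_def intro: finite_vimageI)
 have JJ: "J = Inl ` J1 \<union> Inr ` J2"
 proof (rule set_eqI)
  show "x : J \<longleftrightarrow> x : Inl ` J1 \<union> Inr ` J2" for x by (cases x) (auto simp: J1_def J2_def)
 qed
 have pre: "?f -` ?X \<inter> space ?C =
  prod_emb UNIV (%_. P) J1 (\<Pi>\<^sub>E i\<in>J1. E (Inl i)) \<times> prod_emb UNIV (%_. P) J2 (\<Pi>\<^sub>E i\<in>J2. E (Inr i))"
  unfolding JJ by (auto simp: prod_emb_UNIV_iff space_pair_measure space_PiM PiE_iff ball_Un split: sum.split)
 have "emeasure (distr ?C ?R ?f) ?X = emeasure ?C (?f -` ?X \<inter> space ?C)"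
  using J E by (intro emeasure_distr fm sets_PiM_I) auto
 also have "... = emeasure ?A (prod_emb UNIV (%_. P) J1 (\<Pi>\<^sub>E i\<in>J1. E (Inl i))) * emeasure ?B (prod_emb UNIV (%_. P) J2 (\<Pi>\<^sub>E i\<in>J2. E (Inr i)))"
  unfolding pre using fin E by (intro B.emeasure_pair_measure_Times sets_PiM_I) (auto simp: J1_def J2_def)
 also have "... = (PROD i:J1. emeasure P (E (Inl i))) * (PROD i:J2. emeasure P (E (Inr i)))"
  using fin E by (intro arg_cong2[where f = "(*)"] emeasure_PiM_emb) (auto simp: J1_def J2_def P.prob_space_axioms)
 also have "... = (PROD i:J. emeasure P (E i))"
  unfolding JJ using fin by (subst prod.union_disjoint) (auto simp: prod.reindex)
 also have "... = emeasure ?R ?X"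
  using J E by (intro emeasure_PiM_emb[symmetric]) (auto simp: P.prob_space_axioms)
 finally show "emeasure ?R ?X = emeasure (distr ?C ?R ?f) ?X" ..
qed simp

text \<open>\<open>Inl\<close> carries the given sequence and \<open>Inr\<close> an independent
  copy. Coordinate 0 is the most recent innovation, so it is the remote past that is
  exchanged.\<close>

definition resample :: "nat => (nat + nat => 's) => nat => 's" where
 "resample l w = (%k. if k < l then w (Inl k) else w (Inr k))"

text \<open>Only finitely many coordinates are exchanged, so this sequence is reached by single
  replacements; letting \<open>K\<close> tend to infinity leads to \<open>resample\<close>.\<close>

definition resample_until :: "nat => nat => (nat + nat => 's) => nat => 's" where
 "resample_until l K w = (%k. if k < l \<or> K <= k then w (Inl k) else w (Inr k))"

lemma resample_reindex: "resample l = (%w n. w (if n < l then Inl n else Inr n))"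
 by (auto simp: resample_def fun_eq_iff)

lemma resample_until_reindex: "resample_until l K = (%w n. w (if n < l \<or> K <= n then Inl n else Inr n))"
 by (auto simp: resample_until_def fun_eq_iff)

lemma measurable_resample [measurable]:
 "resample l : measurable (PiM UNIV (%_. P)) (PiM UNIV (%_. P))"
 "resample_until l K : measurable (PiM UNIV (%_. P)) (PiM UNIV (%_. P))"
 unfolding resample_reindex resample_until_reindex by (rule measurable_reindex)+

context
 fixes P :: "'s measure"
 assumes P: "prob_space P"
begin

abbreviation "path_law \<equiv> PiM (UNIV :: nat set) (%_. P)"
abbreviation "pair_law \<equiv> PiM (UNIV :: (nat + nat) set) (%_. P)"

interpretation R: prob_space pair_law by (rule prob_space_PiM) (rule P)
interpretation Q: prob_space path_law by (rule prob_space_PiM) (rule P)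

lemma distr_resample:
 "distr pair_law path_law (resample l) = path_law" "distr pair_law path_law (resample_until l K) = path_law"
proof -
 have "inj (%n::nat. if n < l then Inl n else Inr n :: nat + nat)" by (auto simp: inj_def)
 then show "distr pair_law path_law (resample l) = path_law"
  unfolding resample_reindex by (rule distr_PiM_inj[OF P])
 have "inj (%n::nat. if n < l \<or> K <= n then Inl n else Inr n :: nat + nat)" by (auto simp: inj_def)
 then show "distr pair_law path_law (resample_until l K) = path_law"
  unfolding resample_until_reindex by (rule distr_PiM_inj[OF P])
qed

text \<open>The sets with this property form a sigma-algebra that contains the sets determined by
  one coordinate. For a countable union one stops after \<open>m\<close> sets: the leftover set has
  the same small probability for both sequences, because either of them has the law
  \<open>path_law\<close>.\<close>

lemma resample_until_set_tendsto:
 assumes "A : sets path_law"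
 shows "(%K. measure pair_law {w : space pair_law. (resample_until l K w : A) \<noteq> (resample l w : A)}) ----> 0"
proof -
 define N where "N A K = {w : space pair_law. (resample_until l K w : A) \<noteq> (resample l w : A)}" for A K
 have Nm [measurable]: "N A K : sets pair_law" if [measurable]: "A : sets path_law" for A K
  unfolding N_def by measurable
 have "A : sigma_sets (\<Pi>\<^sub>E i\<in>UNIV. space P) {{f:\<Pi>\<^sub>E i\<in>UNIV. space P. f i : E} | i E. i : (UNIV::nat set) \<and> E : sets P}"
  using assms unfolding sets_PiM_single .
 then have "(%K. measure pair_law (N A K)) ----> 0"
 proof (induction rule: sigma_sets.induct)
  case (Basic a)
  then obtain i E where a: "a = {f:\<Pi>\<^sub>E i\<in>UNIV. space P. f i : E}" by auto
  have "N a K = {}" if "K > i" for K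
   using that by (auto simp: N_def a resample_def resample_until_def space_PiM PiE_iff)
  then have "eventually (%K. measure pair_law (N a K) = 0) sequentially"
   by (auto simp: eventually_sequentially intro!: exI[of _ "Suc i"])
  then show ?case by (rule tendsto_eventually)
 next
  case Empty
  then show ?case by (simp add: N_def)
 next
  case (Compl a)
  have "N ((\<Pi>\<^sub>E i\<in>UNIV. space P) - a) K = N a K" for K
   using measurable_space[OF measurable_resample(1)[of l P]] measurable_space[OF measurable_resample(2)[of l K P]]
   by (auto simp: N_def space_PiM)
  then show ?case using Compl by simp
 next
  case (Union a)
  have am [measurable]: "a i : sets path_law" for i
   using Union(1)[of i] unfolding sets_PiM_single .
  define U where "U m = (\<Union>i<m. a i)" for m
  define U' where "U' = (\<Union>i. a i)"
  have [measurable]: "U m : sets path_law" "U' : sets path_law" for m by (auto simp: U_def U'_def)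
  have "(%m. measure path_law (U m)) ----> measure path_law (\<Union>m. U m)"
   by (rule Q.finite_Lim_measure_incseq) (auto simp: incseq_def U_def intro: less_le_trans)
  moreover have "(\<Union>m. U m) = U'" by (auto simp: U_def U'_def)
  ultimately have lim: "(%m. measure path_law (U' - U m)) ----> 0"
  proof -
   assume l: "(%m. measure path_law (U m)) ----> measure path_law (\<Union>m. U m)" and eq: "(\<Union>m. U m) = U'"
   have "measure path_law (U' - U m) = measure path_law U' - measure path_law (U m)" for m
    by (rule Q.finite_measure_Diff) (auto simp: U_def U'_def)
   then show ?thesis using tendsto_diff[OF tendsto_const[of "measure path_law U'"] l] by (simp add: eq)
  qed
  have law: "measure pair_law (f -` X \<inter> space pair_law) = measure path_law X"
   if "X : sets path_law" "f : measurable pair_law path_law" "distr pair_law path_law f = path_law" for X f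
   using measure_distr[OF that(2,1)] that(3) by simp
  have bound: "measure pair_law (N U' K) <= (\<Sum>i<m. measure pair_law (N (a i) K)) + 2 * measure path_law (U' - U m)" for K m
  proof -
   let ?A = "resample_until l K -` (U' - U m) \<inter> space pair_law" and ?B = "resample l -` (U' - U m) \<inter> space pair_law"
   have "measure pair_law (N U' K) <= measure pair_law ((\<Union>i<m. N (a i) K) \<union> (?A \<union> ?B))"
    by (rule R.finite_measure_mono) (auto simp: N_def U'_def U_def)
   also have "... <= measure pair_law (\<Union>i<m. N (a i) K) + (measure pair_law ?A + measure pair_law ?B)"
    by (intro order_trans[OF measure_Un_le] add_mono measure_Un_le order_refl) auto
   also have "measure pair_law (\<Union>i<m. N (a i) K) <= (\<Sum>i<m. measure pair_law (N (a i) K))"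
    by (rule R.finite_measure_subadditive_finite) auto
   also have "measure pair_law ?A = measure path_law (U' - U m)"
    by (rule law) (auto simp: distr_resample)
   also have "measure pair_law ?B = measure path_law (U' - U m)"
    by (rule law) (auto simp: distr_resample)
   finally show ?thesis by simp
  qed
  show ?case unfolding U'_def[symmetric]
  proof (rule LIMSEQ_I)
   fix \<epsilon> :: real assume e: "0 < \<epsilon>"
   obtain m where m: "measure path_law (U' - U m) < \<epsilon> / 4"
    using LIMSEQ_D[OF lim, of "\<epsilon> / 4"] e by auto
   have "(%K. \<Sum>i<m. measure pair_law (N (a i) K)) ----> (\<Sum>i<m. 0)"
    by (intro tendsto_sum Union.IH)
   then have "eventually (%K. (\<Sum>i<m. measure pair_law (N (a i) K)) < \<epsilon> / 2) sequentially"
    by (rule order_tendstoD(2)) (use e in simp)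
   then obtain K0 where K0: "\<And>K. K \<ge> K0 ==> (\<Sum>i<m. measure pair_law (N (a i) K)) < \<epsilon> / 2"
    unfolding eventually_sequentially by blast
   show "\<exists>no. \<forall>K\<ge>no. norm (measure pair_law (N U' K) - 0) < \<epsilon>"
   proof (intro exI[of _ K0] allI impI)
    fix K assume "K \<ge> K0"
    then show "norm (measure pair_law (N U' K) - 0) < \<epsilon>"
     using bound[of K m] K0[of K] m by simp
   qed
  qed
 qed
 then show ?thesis by (simp add: N_def)
qed

text \<open>The range of \<open>G\<close> is cut into finitely many levels of width
  \<open>1 / m\<close>. If no level set separates the two sequences, their values are within one
  level width of each other; the probability of separation tends to 0 by the statement for
  sets.\<close>

lemma resample_until_bounded_tendsto:
 fixes G :: "(nat => 's) => real"
 assumes [measurable]: "G : borel_measurable path_law" and T: "\<And>x. abs (G x) <= T"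
 shows "(%K. (LINT u|pair_law. abs (G (resample_until l K u) - G (resample l u)))) ----> 0"
proof (rule LIMSEQ_I)
 fix \<epsilon> :: real assume e: "0 < \<epsilon>"
 let ?A = "%K u. abs (G (resample_until l K u) - G (resample l u))"
 have T0: "0 <= T" using T[of undefined] by simp
 \<comment> \<open>With this choice the discretisation error \<open>2 / m\<close> is a quarter of
   \<open>\<epsilon>\<close>.\<close>
 define m where "m = 8 / \<epsilon>"
 have m0: "m > 0" using e by (simp add: m_def)
 define F where "F x = \<lfloor>m * G x\<rfloor>" for x
 have [measurable]: "F : measurable path_law (count_space UNIV)" unfolding F_def[abs_def] by measurable
 define I where "I = {\<lfloor>- m * T\<rfloor>..\<lfloor>m * T\<rfloor>}"
 have FI: "F x : I" for x
 proof -
  have "- T <= G x" "G x <= T" using T[of x] by auto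
  then have "m * (- T) <= m * G x \<and> m * G x <= m * T" using m0 by (intro conjI mult_left_mono) auto
  then show ?thesis unfolding F_def I_def by (auto intro!: floor_mono)
 qed
 have fin: "finite I" by (simp add: I_def)
 define N where "N i K = {u : space pair_law. (resample_until l K u : F -` {i} \<inter> space path_law) \<noteq> (resample l u : F -` {i} \<inter> space path_law)}" for i K
 let ?C = "%K. (SUM i:I. measure pair_law (N i K))"
 let ?B = "%K u. (SUM i:I. 2 * T * indicator (N i K) u)"
 have Fi[measurable]: "F -` {i} \<inter> space path_law : sets path_law" for i by measurable
 have Nm [measurable]: "N i K : sets pair_law" for i K
  unfolding N_def by measurable
 have Nlim: "(%K. measure pair_law (N i K)) ----> 0" for i
  unfolding N_def by (rule resample_until_set_tendsto[OF Fi])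
 have pt: "?A K u <= 2 / m + ?B K u"
  if w: "u : space pair_law" for K u
 proof (cases "F (resample_until l K u) = F (resample l u)")
  case True
  then have "abs (m * G (resample_until l K u) - m * G (resample l u)) <= 1" unfolding F_def by linarith
  then have "m * ?A K u <= 2"
   using m0 by (simp add: abs_mult right_diff_distrib[symmetric])
  then have "?A K u <= 2 / m" using m0 by (simp add: field_simps)
  moreover have "0 <= ?B K u" using T0 by (intro sum_nonneg) auto
  ultimately show ?thesis by linarith
 next
  case False
  define i where "i = F (resample l u)"
  have "i : I" by (simp add: i_def FI)
  have "u : N i K"
   using False w measurable_space[OF measurable_resample(1)[of l P]] by (auto simp: N_def i_def)
  have "?A K u <= 2 * T"
   using T[of "resample_until l K u"] T[of "resample l u"] by linarith
  also have "... = 2 * T * indicator (N i K) u" using \<open>u \<in> N i K\<close> by simp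
  also have "... <= ?B K u"
   using \<open>i \<in> I\<close> fin T0 by (intro member_le_sum) auto
  finally show ?thesis using m0 by (simp add: add_increasing)
 qed
 have bound: "(LINT u|pair_law. ?A K u) <= 2 / m + 2 * T * ?C K" for K
 proof -
  have i1: "integrable pair_law (%u. 2 * T * indicator (N i K) u)" for i
   by (intro integrable_mult_right integrable_real_indicator Nm) (simp add: R.emeasure_eq_measure)
  have iS: "integrable pair_law (%u. SUM i:I. 2 * T * indicator (N i K) u)"
   by (rule Bochner_Integration.integrable_sum) (rule i1)
  have "(LINT u|pair_law. ?A K u) <= (LINT u|pair_law. 2 / m + ?B K u)"
  proof (rule integral_mono)
   show "integrable pair_law (%u. ?A K u)"
   proof (rule R.integrable_const_bound[of _ "2 * T"])
    show "AE u in pair_law. norm (?A K u) <= 2 * T"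
    proof (rule AE_I2)
     fix u :: "nat + nat => 's"
     show "norm (?A K u) <= 2 * T"
      using T[of "resample_until l K u"] T[of "resample l u"] by simp
    qed
   qed measurable
   show "integrable pair_law (%u. 2 / m + ?B K u)"
    by (rule Bochner_Integration.integrable_add[OF _ iS]) simp
  qed (rule pt)
  also have "... = (LINT u|pair_law. 2 / m) + (LINT u|pair_law. ?B K u)"
   by (rule Bochner_Integration.integral_add[OF _ iS]) simp
  also have "(LINT u|pair_law. ?B K u) = (SUM i:I. (LINT u|pair_law. 2 * T * indicator (N i K) u))"
   by (rule Bochner_Integration.integral_sum) (rule i1)
  also have "... = 2 * T * ?C K"
   by (simp add: sum_distrib_left)
  also have "(LINT u|pair_law. 2 / m) = 2 / m" by (simp only: lebesgue_integral_const R.prob_space) simp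
  finally show ?thesis .
 qed
 have "(%K. 2 / m + 2 * T * ?C K) ----> 2 / m + 2 * T * (SUM i:I. 0)"
  by (intro tendsto_intros Nlim)
 moreover have "2 / m + 2 * T * (SUM i:I. 0) < \<epsilon>" using e by (simp add: m_def)
 ultimately have "eventually (%K. 2 / m + 2 * T * ?C K < \<epsilon>) sequentially"
  by (rule order_tendstoD(2))
 then obtain K0 where "\<And>K. K \<ge> K0 ==> 2 / m + 2 * T * ?C K < \<epsilon>"
  by (auto simp: eventually_sequentially)
 then show "\<exists>no. \<forall>K\<ge>no. norm ((LINT u|pair_law. ?A K u) - 0) < \<epsilon>"
  using bound by (intro exI[of _ K0]) (auto intro: le_less_trans)
qed

end

section \<open>Truncation and summation of single replacements\<close>

definition clip :: "real => real => real" where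
 "clip T x = max (- T) (min T x)"

lemma clip_bound: "0 <= T ==> abs (clip T x) <= T"
 by (auto simp: clip_def)

lemma clip_diff: "abs (clip T x - clip T y) <= abs (x - y)"
 by (auto simp: clip_def max_def min_def)

lemma clip_eq: "abs x <= T ==> clip T x = x"
 by (auto simp: clip_def)

lemma measurable_clip [measurable]: "clip T : borel_measurable borel"
 unfolding clip_def[abs_def] by measurable

text \<open>Jensen's inequality with geometric weights replaces Minkowski's inequality.\<close>

lemma power_sum_geometric_weights:
 fixes D :: "nat => real" and s :: real
 assumes s: "0 < s" "s < 1" and D: "\<And>i. 0 <= D i" and r: "1 <= r"
 shows "(\<Sum>i<n. D i) ^ r <= (\<Sum>i<n. D i ^ r / ((1 - s) * s ^ i) ^ (r - 1))"
proof (cases "n = 0")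
 case True
 then show ?thesis using r by (simp add: zero_power)
next
 case False
 define w where "w i = (1 - s) * s ^ i" for i
 define W where "W = (\<Sum>i<n. w i)"
 have w0: "0 < w i" for i using s by (simp add: w_def)
 have W0: "0 < W" unfolding W_def using False w0 by (intro sum_pos) auto
 have W1: "W <= 1"
  using s by (simp add: W_def w_def sum_distrib_left[symmetric] sum_gp_strict power_le_one)
 have cvx: "convex_on {0..} (%x::real. x ^ r)"
 proof (rule f''_ge0_imp_convex)
  show "convex {0::real..}" by simp
  show "DERIV (%x. x ^ r) x :> real r * x ^ (r - 1)" for x :: real
   by (rule DERIV_pow[THEN DERIV_cong]) simp
  show "((%x. real r * x ^ (r - 1)) has_real_derivative real r * (real (r - 1) * x ^ (r - 1 - 1))) (at x)" for x :: real
   by (intro DERIV_cmult DERIV_pow[THEN DERIV_cong]) simp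
  show "0 <= real r * (real (r - 1) * x ^ (r - 1 - 1))" if "x : {0..}" for x :: real using that by auto
 qed
 have "(\<Sum>i<n. D i) ^ r = W ^ r * (\<Sum>i<n. w i / W * (D i / w i)) ^ r"
 proof -
  have "(\<Sum>i<n. D i) = W * (\<Sum>i<n. w i / W * (D i / w i))"
   unfolding sum_distrib_left using w0 W0 by (intro sum.cong) (auto simp: less_imp_neq[THEN not_sym])
  then show ?thesis by (simp add: power_mult_distrib)
 qed
 also have "(\<Sum>i<n. w i / W * (D i / w i)) ^ r <= (\<Sum>i<n. w i / W * (D i / w i) ^ r)"
 proof -
  have "(%x. x ^ r) (\<Sum>i<n. (w i / W) *\<^sub>R (D i / w i)) <= (\<Sum>i<n. w i / W * (%x. x ^ r) (D i / w i))"
  proof (rule convex_on_sum[OF _ _ cvx])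
   show "(\<Sum>i<n. w i / W) = 1" using W0 by (simp add: sum_divide_distrib[symmetric] W_def[symmetric])
   show "0 <= w i / W" for i using w0[of i] W0 by auto
   show "D i / w i : {0..}" for i using D[of i] w0[of i] by auto
  qed (use False in auto)
  then show ?thesis by simp
 qed
 then have "W ^ r * (\<Sum>i<n. w i / W * (D i / w i)) ^ r <= W ^ r * (\<Sum>i<n. w i / W * (D i / w i) ^ r)"
  using W0 by (intro mult_left_mono) auto
 also have "... = W ^ (r - 1) * (\<Sum>i<n. D i ^ r / w i ^ (r - 1))"
 proof -
  obtain k where k: "r = Suc k" using r by (cases r) auto
  show ?thesis unfolding sum_distrib_left
  proof (rule sum.cong[OF refl])
   fix i
   show "W ^ r * (w i / W * (D i / w i) ^ r) = W ^ (r - 1) * (D i ^ r / w i ^ (r - 1))"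
    using w0[of i] W0 by (simp add: k power_divide field_simps)
  qed
 qed
 also have "... <= 1 * (\<Sum>i<n. D i ^ r / w i ^ (r - 1))"
  using W0 W1 D w0 by (intro mult_right_mono power_le_one sum_nonneg divide_nonneg_nonneg zero_le_power) (auto intro: less_imp_le)
 finally show ?thesis by (simp add: w_def)
qed

lemma resample_until_self: "l <= k ==> resample_until l l w = (%n. w (Inl n))"
 by (auto simp: resample_until_def fun_eq_iff)

text \<open>The perturbation \<open>c\<close> enters linearly because, where this is applied, only
  its mean is known to vanish. The price is a power of the bound \<open>T\<close>, which is harmless
  for a fixed truncation level.\<close>

lemma abs_power_diff_le:
 fixes a b c T :: real
 assumes "0 <= a" "a <= b + c" "0 <= b" "0 <= c" "a <= T"
 shows "a ^ r <= b ^ r + real r * T ^ (r - 1) * c"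
proof (cases "a <= b")
 case True
 then have "a ^ r <= b ^ r" using assms by (intro power_mono) auto
 moreover have "0 <= real r * T ^ (r - 1) * c" using assms by (intro mult_nonneg_nonneg zero_le_power) auto
 ultimately show ?thesis by linarith
next
 case False
 have "a ^ r - b ^ r = (a - b) * (\<Sum>i<r. b ^ (r - Suc i) * a ^ i)"
  using power_diff_sumr2[of a r b] by simp
 also have "... <= c * (\<Sum>i<r. T ^ (r - 1))"
 proof (intro mult_mono sum_mono)
  fix i assume "i : {..<r}"
  then have "r - 1 = (r - Suc i) + i" by auto
  then have "T ^ (r - 1) = T ^ (r - Suc i) * T ^ i" by (metis power_add)
  then show "b ^ (r - Suc i) * a ^ i <= T ^ (r - 1)"
   using assms False by (auto intro!: mult_mono power_mono)
 qed (use assms False in \<open>auto intro!: sum_nonneg mult_nonneg_nonneg\<close>)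
 finally show ?thesis by (simp add: mult_ac)
qed

text \<open>The coordinates \<open>l\<close>, \<open>l + 1\<close>, ... are replaced one at a time.
  Each replacement is a single-innovation coupling at its own lag, and the geometric decay sums the
  errors. The passage to infinitely many replacements is made for truncated \<open>g\<close>, where
  convergence in mean has been established; Fatou's lemma then removes the truncation.\<close>

lemma resample_moment_bound:
 fixes P :: "'s measure" and g :: "(nat => 's) => real"
 assumes P: "prob_space P" and g [measurable]: "g : borel_measurable (PiM UNIV (%_. P))"
  and \<delta>: "0 < \<delta>" "\<delta> < 1" and A: "0 <= A" and r: "1 <= r"
  and dep: "\<And>k. (\<integral>\<^sup>+w. ennreal (abs (g (%n. w (Some n)) - g ((%n. w (Some n))(k := w None))) ^ r) \<partial>PiM UNIV (%_. P))
   <= ennreal (A * (\<delta> ^ k) ^ r)"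
 shows "(\<integral>\<^sup>+w. ennreal (abs (g (%n. w (Inl n)) - g (resample l w)) ^ r) \<partial>PiM UNIV (%_. P))
  <= ennreal (A * (\<delta> ^ l) ^ r / (1 - sqrt \<delta>) ^ r)"
proof -
 let ?J = "(PiM UNIV (%_. P))"
 let ?H = "%T. (real r * (2 * T) ^ (r - 1))"
 let ?B = "%w. (abs (g (%n. w (Inl n)) - g (resample l w)) ^ r)"
 let ?R = "PiM (UNIV :: (nat + nat) set) (%_. P)" and ?Q = "PiM (UNIV :: nat set) (%_. P)"
 interpret R: prob_space ?R by (rule prob_space_PiM) (rule P)
 \<comment> \<open>The geometric weights have ratio \<open>s = sqrt \<delta>\<close>. Dividing
   \<open>(\<delta> ^ i) ^ r = s ^ (2 * i * r)\<close> by the weight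
   \<open>(s ^ i) ^ (r - 1)\<close> leaves at most \<open>s ^ i\<close>, which is still
   summable.\<close>
 define s where "s = sqrt \<delta>"
 let ?F = "%i. ((1 - s) * s ^ i)"
 have s: "0 < s" "s < 1" using \<delta> by (auto simp: s_def)
 have s2: "\<delta> = s^2" using \<delta> by (simp add: s_def)
 define u where "u i w = resample_until l (l + i) w" for i and w :: "nat + nat => 's"
 let ?A = "%w n. abs (g (u 0 w) - g (u n w))"
 let ?D = "%i. (A * (\<delta> ^ (l + i)) ^ r)"
 let ?I = "%n. (\<Sum>i<n. 1 / ?F i ^ (r - 1) * ?D i)"
 let ?C = "%n. (\<integral>\<^sup>+w. ennreal (?A w n ^ r) \<partial>?R)"
 have um [measurable]: "u i : measurable ?R ?Q" for i unfolding u_def by measurable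
 define D where "D i w = abs (g (u i w) - g (u (Suc i) w))" for i w
 let ?E = "%i. (\<integral>\<^sup>+w. ennreal (D i w ^ r) \<partial>?R)"
 have Dm [measurable]: "D i : borel_measurable ?R" for i unfolding D_def by measurable
 have D0: "0 <= D i w" for i w by (simp add: D_def)
 have D1: "?E i <= ennreal (?D i)" for i
 proof -
  \<comment> \<open>An injection in which \<open>None\<close> points to the copy that replaces
    coordinate \<open>l + i\<close>. Read along it, \<open>u i\<close> and \<open>u (Suc i)\<close>
    are a sequence and its one-coordinate coupling, so the hypothesis on \<open>g\<close> applies at
    lag \<open>l + i\<close>.\<close>
  define f :: "nat option => nat + nat" where "f n = (case n of None => Inr (l + i) | Some k => (if k < l \<or> l + i <= k then Inl k else Inr k))" for n
  have inj: "inj f"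
   unfolding f_def by (rule injI) (auto split: option.splits if_splits)
  let ?T = "%w n. w (f n) :: 's"
  have law: "distr ?R ?J ?T = PiM UNIV (%_. P)" by (rule distr_PiM_inj[OF P inj])
  have Tm: "?T : measurable ?R ?J" by (rule measurable_reindex)
  have m1: "(%w. (%n. w (Some n))) : measurable (PiM UNIV (%_::nat option. P)) ?Q" by (rule measurable_reindex)
  have m2: "(%w. (%n. w (Some n))(k := w None)) : measurable (PiM UNIV (%_::nat option. P)) ?Q" for k
  proof -
   have "(%w. (%n. w (Some n))(k := w None)) = (%w n. w (if n = k then None else Some n) :: 's)"
    by (auto simp: fun_eq_iff)
   then show ?thesis using measurable_reindex[of "%n. if n = k then None else Some n" P] by simp
  qed
  have e1: "u i w = (%n. ?T w (Some n))" for w by (auto simp: u_def resample_until_def f_def fun_eq_iff)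
  have e2: "u (Suc i) w = (%n. ?T w (Some n))(l + i := ?T w None)" for w
   by (auto simp: u_def resample_until_def f_def fun_eq_iff)
  have "(?E i)
   = (\<integral>\<^sup>+w. ennreal (abs (g (%n. ?T w (Some n)) - g ((%n. ?T w (Some n))(l + i := ?T w None))) ^ r) \<partial>?R)"
   unfolding D_def e1 e2 ..
  also have "... = (\<integral>\<^sup>+w. ennreal (abs (g (%n. w (Some n)) - g ((%n. w (Some n))(l + i := w None))) ^ r) \<partial>distr ?R ?J ?T)"
   by (rule nn_integral_distr[symmetric, OF Tm])
    (unfold measurable_distr_eq1, intro measurable_compose[OF _ measurable_ennreal] borel_measurable_power borel_measurable_abs borel_measurable_diff
     measurable_compose[OF m1 g] measurable_compose[OF m2 g])
  also have "... <= ennreal (?D i)" unfolding law by (rule dep)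
  finally show ?thesis .
 qed
 define C where "C = A * (\<delta> ^ l) ^ r / (1 - s) ^ r"
 have C0: "0 <= C" using A \<delta> s by (simp add: C_def)
 have part: "?C n <= ennreal C" for n
 proof -
  have "?C n <= (\<integral>\<^sup>+w. (\<Sum>i<n. ennreal (1 / ?F i ^ (r - 1)) * ennreal (D i w ^ r)) \<partial>?R)"
  proof (rule nn_integral_mono)
   fix w
   have "g (u 0 w) - g (u n w) = (\<Sum>i<n. g (u i w) - g (u (Suc i) w))"
    by (rule sum_lessThan_telescope'[symmetric])
   then have "?A w n <= (\<Sum>i<n. D i w)" unfolding D_def by (simp only: sum_abs)
   then have "?A w n ^ r <= (\<Sum>i<n. D i w) ^ r" by (intro power_mono) auto
   also have "... <= (\<Sum>i<n. D i w ^ r / ?F i ^ (r - 1))"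
    by (rule power_sum_geometric_weights[OF s D0 r])
   also have "... = (\<Sum>i<n. 1 / ?F i ^ (r - 1) * D i w ^ r)" by simp
   finally show "ennreal (?A w n ^ r) <= (\<Sum>i<n. ennreal (1 / ?F i ^ (r - 1)) * ennreal (D i w ^ r))"
    using s D0 by (subst sum.cong[OF refl ennreal_mult[symmetric]]) (auto intro!: ennreal_leI simp: sum_ennreal)
  qed
  also have "... = (\<Sum>i<n. ennreal (1 / ?F i ^ (r - 1)) * ?E i)"
   by (subst nn_integral_sum) (auto simp: nn_integral_cmult)
  also have "... <= (\<Sum>i<n. ennreal (1 / ?F i ^ (r - 1)) * ennreal (?D i))"
   by (intro sum_mono mult_left_mono D1) auto
  also have "... = ennreal (?I n)"
   using s A \<delta> by (subst sum.cong[OF refl ennreal_mult[symmetric]]) (auto simp: sum_ennreal)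
  also have "... <= ennreal C"
  proof (rule ennreal_leI)
   have "?I n <= (\<Sum>i<n. A * (\<delta> ^ l) ^ r / (1 - s) ^ (r - 1) * s ^ i)"
   proof (rule sum_mono)
    fix i
    have "(\<delta> ^ i) ^ r / (s ^ i) ^ (r - 1) <= s ^ i"
    proof -
     have "(\<delta> ^ i) ^ r = (s ^ i) ^ (r + r)"
      by (simp add: s2 power_mult[symmetric] mult_2[symmetric] mult_ac)
     also have "... = (s ^ i) ^ (r - 1) * (s ^ i) ^ (r + 1)" using r by (simp only: power_add[symmetric]) simp
     finally have "(\<delta> ^ i) ^ r / (s ^ i) ^ (r - 1) = (s ^ i) ^ (r + 1)" using s by simp
     also have "... <= (s ^ i) ^ 1" using s by (intro power_decreasing) (auto simp: power_le_one)
     finally show ?thesis by simp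
    qed
    then have "A * (\<delta> ^ l) ^ r / (1 - s) ^ (r - 1) * ((\<delta> ^ i) ^ r / (s ^ i) ^ (r - 1)) <= A * (\<delta> ^ l) ^ r / (1 - s) ^ (r - 1) * s ^ i"
     using A \<delta> s by (intro mult_left_mono) auto
    then show "1 / ?F i ^ (r - 1) * ?D i <= A * (\<delta> ^ l) ^ r / (1 - s) ^ (r - 1) * s ^ i"
     by (simp add: power_mult_distrib power_add mult_ac)
   qed
   also have "... = A * (\<delta> ^ l) ^ r / (1 - s) ^ (r - 1) * (\<Sum>i<n. s ^ i)" by (simp add: sum_distrib_left)
   also have "... <= A * (\<delta> ^ l) ^ r / (1 - s) ^ (r - 1) * (1 / (1 - s))"
    using A \<delta> s by (intro mult_left_mono) (auto simp: sum_gp_strict divide_right_mono)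
   also have "... = C" using r s by (cases r) (auto simp: C_def)
   finally show "?I n <= C" .
  qed
  finally show ?thesis .
 qed
 have clipped: "(\<integral>\<^sup>+w. ennreal (abs (clip T (g (%n. w (Inl n))) - clip T (g (resample l w))) ^ r) \<partial>?R) <= ennreal C" if T: "0 <= T" for T
 proof -
  let ?G = "%x. clip T (g x)"
  have Gm: "?G : borel_measurable ?Q" by measurable
  have m0: "(%w. (%n. w (Inl n))) : measurable ?R ?Q" by (rule measurable_reindex)
  note [measurable] = measurable_compose[OF m0 g]
  define e where "e K = (LINT w|?R. abs (?G (resample_until l K w) - ?G (resample l w)))" for K
  have lim: "e ----> 0" unfolding e_def
   by (rule resample_until_bounded_tendsto[OF P Gm clip_bound[OF T]])
  have bound: "(\<integral>\<^sup>+w. ennreal (abs (?G (%n. w (Inl n)) - ?G (resample l w)) ^ r) \<partial>?R) <= ennreal (C + real r * (2 * T) ^ (r - 1) * e (l + n))" for n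
  proof -
   have i: "integrable ?R (%w. abs (?G (u n w) - ?G (resample l w)))"
   proof (rule R.integrable_const_bound[of _ "2 * T"])
    show "AE w in ?R. norm (abs (?G (u n w) - ?G (resample l w))) <= 2 * T"
    proof (rule AE_I2)
     fix w :: "nat + nat => 's"
     show "norm (abs (?G (u n w) - ?G (resample l w))) <= 2 * T"
      using clip_bound[OF T, of "g (u n w)"] clip_bound[OF T, of "g (resample l w)"] by simp
    qed
   qed measurable
   have "(\<integral>\<^sup>+w. ennreal (abs (?G (%n. w (Inl n)) - ?G (resample l w)) ^ r) \<partial>?R)
    <= (\<integral>\<^sup>+w. ennreal (?A w n ^ r) + ennreal (?H T) * ennreal (abs (?G (u n w) - ?G (resample l w))) \<partial>?R)"
   proof (rule nn_integral_mono)
    fix w :: "nat + nat => 's"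
    have u0: "u 0 w = (%n. w (Inl n))" by (simp add: u_def resample_until_self[of l l])
    have "abs (?G (u 0 w) - ?G (resample l w)) ^ r <= ?A w n ^ r + real r * (2 * T) ^ (r - 1) * abs (?G (u n w) - ?G (resample l w))"
    proof (rule abs_power_diff_le)
     show "abs (?G (u 0 w) - ?G (resample l w)) <= ?A w n + abs (?G (u n w) - ?G (resample l w))"
      using clip_diff[of T "g (u 0 w)" "g (u n w)"] by linarith
     show "abs (?G (u 0 w) - ?G (resample l w)) <= 2 * T"
      using clip_bound[OF T, of "g (u 0 w)"] clip_bound[OF T, of "g (resample l w)"] by linarith
    qed auto
    then show "ennreal (abs (?G (%n. w (Inl n)) - ?G (resample l w)) ^ r) <= ennreal (?A w n ^ r) + ennreal (?H T) * ennreal (abs (?G (u n w) - ?G (resample l w)))"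
     using T by (simp add: u0 ennreal_mult[symmetric] ennreal_plus[symmetric] ennreal_leI del: ennreal_plus)
   qed
   also have "... = ?C n + ennreal (?H T) * (\<integral>\<^sup>+w. ennreal (abs (?G (u n w) - ?G (resample l w))) \<partial>?R)"
    by (subst nn_integral_add) (auto simp: nn_integral_cmult)
   also have "(\<integral>\<^sup>+w. ennreal (abs (?G (u n w) - ?G (resample l w))) \<partial>?R) = ennreal (e (l + n))"
    unfolding e_def u_def by (rule nn_integral_eq_integral) (use i in \<open>auto simp: u_def\<close>)
   also have "?C n + ennreal (?H T) * ennreal (e (l + n))
    <= ennreal C + ennreal (?H T) * ennreal (e (l + n))" by (intro add_right_mono part)
   also have "... = ennreal (C + real r * (2 * T) ^ (r - 1) * e (l + n))"
    using C0 T by (simp add: ennreal_mult[symmetric] ennreal_plus[symmetric] e_def del: ennreal_plus)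
   finally show ?thesis .
  qed
  have "(%n. ennreal (C + real r * (2 * T) ^ (r - 1) * e (l + n))) ----> ennreal (C + real r * (2 * T) ^ (r - 1) * 0)"
   by (intro tendsto_ennrealI tendsto_intros LIMSEQ_ignore_initial_segment[OF lim, of l, unfolded add.commute[of _ l]])
  then show ?thesis using bound by (intro LIMSEQ_le_const[of _ "ennreal C"]) auto
 qed
 have m0: "(%w. (%n. w (Inl n))) : measurable ?R ?Q" by (rule measurable_reindex)
 note [measurable] = measurable_compose[OF m0 g]
 define h where "h T w = ennreal (abs (clip (real T) (g (%n. w (Inl n))) - clip (real T) (g (resample l w))) ^ r)" for T :: nat and w
 have "(\<integral>\<^sup>+w. ennreal (?B w) \<partial>?R) = (\<integral>\<^sup>+w. liminf (%T. h T w) \<partial>?R)"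
 proof (rule nn_integral_cong)
  fix w :: "nat + nat => 's"
  obtain N :: nat where N: "real N \<ge> max (abs (g (%n. w (Inl n)))) (abs (g (resample l w)))" using real_arch_simple by blast
  have "h T w = ennreal (?B w)" if "T \<ge> N" for T
   using N that by (simp add: h_def clip_eq)
  then have "(%T. h T w) ----> ennreal (?B w)"
   by (intro tendsto_eventually) (auto simp: eventually_sequentially)
  then show "ennreal (?B w) = liminf (%T. h T w)"
   by (rule lim_imp_Liminf[OF sequentially_bot, symmetric])
 qed
 also have "... <= liminf (%T. \<integral>\<^sup>+w. h T w \<partial>?R)"
  by (rule nn_integral_liminf) (simp add: h_def[abs_def])
 also have "... <= ennreal C"
  by (rule Liminf_le) (auto intro!: always_eventually clipped simp: h_def)
 finally show ?thesis by (simp add: C_def s_def)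
qed

section \<open>Averaging over the remote past\<close>

lemma (in prob_space) abs_expectation_power_le:
 fixes f :: "'a => real"
 assumes [measurable]: "f : borel_measurable M" and T: "\<And>x. x : space M ==> abs (f x) <= T" and r: "1 <= r"
 shows "abs (expectation f) ^ r <= expectation (%x. abs (f x) ^ r)"
proof -
 have T0: "0 <= T" using T not_empty by (meson abs_ge_zero all_not_in_conv order_trans)
 have i1: "integrable M (%x. abs (f x))" by (rule integrable_const_bound[of _ T]) (use T in auto)
 have i2: "integrable M (%x. abs (f x) ^ r)"
  by (rule integrable_const_bound[of _ "T ^ r"]) (use T in \<open>auto intro!: power_mono AE_I2 simp: power_abs\<close>)
 have cvx: "convex_on {0..} (%x::real. x ^ r)"
 proof (rule f''_ge0_imp_convex)
  show "convex {0::real..}" by simp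
  show "DERIV (%x. x ^ r) x :> real r * x ^ (r - 1)" for x :: real
   by (rule DERIV_pow[THEN DERIV_cong]) simp
  show "((%x. real r * x ^ (r - 1)) has_real_derivative real r * (real (r - 1) * x ^ (r - 1 - 1))) (at x)" for x :: real
   by (intro DERIV_cmult DERIV_pow[THEN DERIV_cong]) simp
  show "0 <= real r * (real (r - 1) * x ^ (r - 1 - 1))" if "x : {0..}" for x :: real using that by auto
 qed
 define a where "a = expectation (%x. abs (f x))"
 have a0: "0 <= a" by (simp add: a_def)
 \<comment> \<open>The power function lies above its tangent at the mean of \<open>|f|\<close>;
   integrating this gives Jensen's inequality. The case \<open>a = 0\<close> is separate because 0
   is not an interior point of \<open>{0..}\<close>.\<close>
 have tangent: "a ^ r + real r * a ^ (r - 1) * (y - a) <= y ^ r" if "0 <= y" for y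
 proof -
  have "y ^ r - a ^ r \<ge> real r * a ^ (r - 1) * (y - a)"
  proof (cases "a = 0")
   case True
   then show ?thesis using r that by (cases "r = 1") (auto simp: zero_power)
  next
   case False
   then show ?thesis using a0
   by (intro convex_on_imp_above_tangent[where A = "{0..}", OF cvx])
    (use that in \<open>auto intro!: derivative_eq_intros\<close>)
  qed
  then show ?thesis by simp
 qed
 have "a ^ r = expectation (%x. a ^ r + real r * a ^ (r - 1) * (abs (f x) - a))"
  using i1 by (simp add: prob_space a_def)
 also have "... <= expectation (%x. abs (f x) ^ r)"
  using i1 i2 tangent by (intro integral_mono) auto
 finally have "a ^ r <= expectation (%x. abs (f x) ^ r)" .
 moreover have "abs (expectation f) ^ r <= a ^ r" unfolding a_def by (intro power_mono integral_abs_bound) auto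
 ultimately show ?thesis by linarith
qed

text \<open>The conditional expectation of \<open>G\<close> given the first \<open>l\<close>
  coordinates, written as an integral over an independent tail. This version is defined pointwise
  and depends on those coordinates in a visible way.\<close>

definition prefix_mean :: "'s measure => nat => ((nat => 's) => real) => (nat => 's) => real" where
 "prefix_mean P l G x = (LINT y|PiM UNIV (%_. P). G (%n. if n < l then x n else y n))"

context
 fixes P :: "'s measure" and G :: "(nat => 's) => real" and T :: real
 assumes P: "prob_space P" and G [measurable]: "G : borel_measurable (PiM UNIV (%_. P))" and T: "\<And>x. abs (G x) <= T"
begin

abbreviation (input) "Qm \<equiv> PiM (UNIV :: nat set) (%_. P)"
abbreviation (input) "Rm \<equiv> PiM (UNIV :: (nat + nat) set) (%_. P)"

interpretation Q: prob_space Qm by (rule prob_space_PiM) (rule P)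
interpretation QQ: pair_prob_space Qm Qm ..

lemma prefix_mean_bound: "abs (prefix_mean P l G x) <= T"
proof -
 have "abs (prefix_mean P l G x) <= (LINT y|Qm. abs (G (%n. if n < l then x n else y n)))"
  unfolding prefix_mean_def by (rule integral_abs_bound)
 also have "... <= (LINT y|Qm. T)"
  by (rule integral_mono') (use T in \<open>auto intro: order_trans[OF abs_ge_zero]\<close>)
 finally show ?thesis by (simp add: Q.prob_space)
qed

lemma measurable_splice:
 "(%(x, y) n. if n < l then x n else y n) : measurable (Qm \<Otimes>\<^sub>M Qm) Qm"
proof (rule measurable_PiM_single')
 show "(%w. (case w of (x, y) => %n. if n < l then x n else y n) i) : measurable (Qm \<Otimes>\<^sub>M Qm) P" for i
 proof -
  have eq: "(%w. (case w of (x, y) => %n. if n < l then x n else y n) i) = (%w. if i < l then fst w i else snd w i)" by auto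
  show ?thesis unfolding eq
   by (cases "i < l") (simp_all add: measurable_compose[OF measurable_fst measurable_component_singleton] measurable_compose[OF measurable_snd measurable_component_singleton])
 qed
qed (auto simp: space_pair_measure space_PiM PiE_iff)

lemma splice_law: "distr (Qm \<Otimes>\<^sub>M Qm) Qm (%(x, y) n. if n < l then x n else y n) = Qm"
proof -
 let ?A = "(Qm \<Otimes>\<^sub>M Qm)"
 have cs: "(%(x, y). case_sum x y) : measurable ?A Rm"
 proof (rule measurable_PiM_single')
  show "(%w. (case w of (x, y) => case_sum x y) i) : measurable ?A P" for i
  proof -
   have eq: "(%w. (case w of (x, y) => case_sum x y) i) = (%w. case i of Inl a => fst w a | Inr b => snd w b)"
    by (auto split: sum.split)
   show ?thesis unfolding eq
    by (cases i) (simp_all add: measurable_compose[OF measurable_fst measurable_component_singleton] measurable_compose[OF measurable_snd measurable_component_singleton])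
  qed
 qed (auto simp: space_pair_measure space_PiM PiE_iff split: sum.split)
 have "distr ?A Qm (resample l \<circ> (%(x, y). case_sum x y)) = distr (distr ?A Rm (%(x, y). case_sum x y)) Qm (resample l)"
  by (rule distr_distr[symmetric, OF measurable_resample(1) cs])
 also have "... = Qm" by (simp add: distr_pair_PiM_case_sum[OF P] distr_resample[OF P])
 also have "resample l \<circ> (%(x, y). case_sum x y) = (%(x, y) n. if n < l then x n else y n)"
  by (auto simp: resample_def fun_eq_iff)
 finally show ?thesis .
qed

lemma nn_integral_pair_law:
 assumes [measurable]: "F : borel_measurable Rm"
 shows "(\<integral>\<^sup>+w. F w \<partial>Rm) = (\<integral>\<^sup>+p. F (case_sum (fst p) (snd p)) \<partial>(Qm \<Otimes>\<^sub>M Qm))"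
proof -
 let ?A = "(Qm \<Otimes>\<^sub>M Qm)"
 have cs: "(%(x, y). case_sum x y) : measurable ?A Rm"
 proof (rule measurable_PiM_single')
  show "(%w. (case w of (x, y) => case_sum x y) i) : measurable ?A P" for i
  proof -
   have eq: "(%w. (case w of (x, y) => case_sum x y) i) = (%w. case i of Inl a => fst w a | Inr b => snd w b)"
    by (auto split: sum.split)
   show ?thesis unfolding eq
    by (cases i) (simp_all add: measurable_compose[OF measurable_fst measurable_component_singleton] measurable_compose[OF measurable_snd measurable_component_singleton])
  qed
 qed (auto simp: space_pair_measure space_PiM PiE_iff split: sum.split)
 have "(\<integral>\<^sup>+w. F w \<partial>Rm) = (\<integral>\<^sup>+w. F w \<partial>distr ?A Rm (%(x, y). case_sum x y))"
  by (simp only: distr_pair_PiM_case_sum[OF P])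
 also have "... = (\<integral>\<^sup>+p. F (case_sum (fst p) (snd p)) \<partial>?A)"
  by (subst nn_integral_distr[OF cs]) (auto simp: split_beta')
 finally show ?thesis .
qed

lemma measurable_splice_G: "(%(x, y). G (%n. if n < l then x n else y n)) : borel_measurable (Qm \<Otimes>\<^sub>M Qm)"
 using measurable_compose[OF measurable_splice G] by (simp add: split_beta')

lemma measurable_prefix_mean: "prefix_mean P l G : borel_measurable Qm"
 unfolding prefix_mean_def[abs_def]
 by (rule sigma_finite_measure.borel_measurable_lebesgue_integral[OF prob_space_imp_sigma_finite[OF Q.prob_space_axioms] measurable_splice_G])

text \<open>By Jensen's inequality in the tail, the difference is dominated by the mean difference
  between \<open>G\<close> and \<open>G\<close> with a resampled tail; integrating over the prefix
  as well gives the moment of \<open>resample\<close>.\<close>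

lemma prefix_mean_diff_moment:
 assumes r: "1 <= r"
  and C: "(\<integral>\<^sup>+w. ennreal (abs (G (%n. w (Inl n)) - G (resample l w)) ^ r) \<partial>Rm) <= ennreal C" "0 <= C"
 shows "(LINT x|Qm. abs (G x - prefix_mean P l G x) ^ r) <= C"
proof -
 let ?C = "(Qm \<Otimes>\<^sub>M Qm)"
 let ?A = "%x. abs (G x - prefix_mean P l G x)"
 let ?s = "%x y n. if n < l then x n else y n :: 's"
 let ?B = "%x y. abs (G x - G (?s x y))"
 have pm: "(%x. G (?s z x)) : borel_measurable Qm" if "z : space Qm" for z
  using measurable_compose[OF measurable_Pair1'[OF that] measurable_splice_G] by simp
 have pt: "ennreal (?A x ^ r) <= (\<integral>\<^sup>+y. ennreal (?B x y ^ r) \<partial>Qm)" if x: "x : space Qm" for x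
 proof -
  note [measurable] = pm[OF x]
  have i: "integrable Qm (%y. G (?s x y))" by (rule Q.integrable_const_bound[of _ T]) (use T in auto)
  have bd: "?B x y <= 2 * T" for y using T[of x] T[of "?s x y"] by linarith
  have "G x - prefix_mean P l G x = (LINT y|Qm. G x - G (?s x y))"
   unfolding prefix_mean_def using i by (simp add: Q.prob_space)
  then have "?A x ^ r <= (LINT y|Qm. ?B x y ^ r)"
   using Q.abs_expectation_power_le[of "%y. G x - G (?s x y)" "2 * T" r] bd r by simp
  also have "ennreal ... = (\<integral>\<^sup>+y. ennreal (?B x y ^ r) \<partial>Qm)"
  proof (rule nn_integral_eq_integral[symmetric])
   show "integrable Qm (%y. ?B x y ^ r)"
    by (rule Q.integrable_const_bound[of _ "(2 * T) ^ r"]) (use power_mono[OF bd, where n = r] in auto)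
  qed auto
  finally show ?thesis by (simp add: ennreal_leI)
 qed
 have m0: "(%w. (%n. w (Inl n))) : measurable Rm Qm" by (rule measurable_reindex)
 note [measurable] = measurable_compose[OF m0 G] measurable_prefix_mean
 have i: "integrable Qm (%x. ?A x ^ r)"
 proof (rule Q.integrable_const_bound[of _ "(2 * T) ^ r"])
  have "?A x <= 2 * T" for x using T[of x] prefix_mean_bound[of l x] by linarith
  then have "?A x ^ r <= (2 * T) ^ r" for x by (intro power_mono) auto
  then show "AE x in Qm. norm (?A x ^ r) <= (2 * T) ^ r" by auto
 qed measurable
 have "ennreal (LINT x|Qm. ?A x ^ r) = (\<integral>\<^sup>+x. ennreal (?A x ^ r) \<partial>Qm)"
  by (rule nn_integral_eq_integral[symmetric, OF i]) auto
 also have "... <= (\<integral>\<^sup>+x. \<integral>\<^sup>+y. ennreal (?B x y ^ r) \<partial>Qm \<partial>Qm)"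
  by (intro nn_integral_mono pt)
 also have "... = (\<integral>\<^sup>+p. ennreal (abs (G (fst p) - G (?s (fst p) (snd p))) ^ r) \<partial>?C)"
 proof -
  have m: "(%p. G (?s (fst p) (snd p))) : borel_measurable ?C" using measurable_splice_G by (simp add: split_beta')
  have "(%p. ennreal (abs (G (fst p) - G (?s (fst p) (snd p))) ^ r)) : borel_measurable ?C"
   by (intro measurable_compose[OF _ measurable_ennreal] borel_measurable_power borel_measurable_abs borel_measurable_diff m measurable_compose[OF measurable_fst G])
  from Q.nn_integral_fst[OF this] show ?thesis by (simp only: fst_conv snd_conv)
 qed
 also have "... = (\<integral>\<^sup>+w. ennreal (abs (G (%n. w (Inl n)) - G (resample l w)) ^ r) \<partial>Rm)"
  by (subst nn_integral_pair_law, measurable) (simp only: resample_def sum.case)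
 also have "... <= ennreal C" by (rule C)
 finally show ?thesis using C(2) by (simp add: ennreal_le_iff)
qed

lemma integral_splice:
 fixes F :: "real => real"
 assumes F [measurable]: "F : borel_measurable borel" and B: "\<And>t. abs t <= T ==> abs (F t) <= B"
 shows "(LINT x|Qm. (LINT y|Qm. F (G (%n. if n < l then x n else y n)))) = (LINT x|Qm. F (G x))"
proof -
 let ?B = "(Qm \<Otimes>\<^sub>M Qm)"
 let ?A = "%x y. (G (%n. if n < l then x n else y n))"
 have m: "(%(x, y). F (?A x y)) : borel_measurable ?B"
  using measurable_compose[OF measurable_splice_G F] by (simp add: split_beta')
 have i: "integrable ?B (%(x, y). F (?A x y))"
  by (rule QQ.integrable_const_bound[of _ B]) (use m B T in \<open>auto simp: split_beta'\<close>)
 have "(LINT x|Qm. (LINT y|Qm. F (?A x y))) = (LINT p|?B. (%(x, y). F (?A x y)) p)"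
  by (rule QQ.integral_fst'[OF i, simplified])
 also have "... = (LINT x|distr ?B Qm (%(x, y) n. if n < l then x n else y n). F (G x))"
  by (subst integral_distr[OF measurable_splice]) (auto simp: split_beta')
 finally show ?thesis by (simp only: splice_law)
qed

lemma integral_prefix_mean: "(LINT x|Qm. prefix_mean P l G x) = (LINT x|Qm. G x)"
 unfolding prefix_mean_def by (rule integral_splice[of "%t. t" T]) auto

lemma prefix_mean_centered_moment:
 assumes r: "1 <= r"
 shows "(LINT x|Qm. abs (prefix_mean P l G x - a) ^ r) <= (LINT x|Qm. abs (G x - a) ^ r)"
proof -
 let ?B = "%x. abs (prefix_mean P l G x - a)"
 let ?s = "%x y n. if n < l then x n else y n :: 's"
 let ?A = "%x y. abs (G (?s x y) - a)"
 note [measurable] = measurable_prefix_mean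
 have pm: "(%x. G (?s z x)) : borel_measurable Qm" if "z : space Qm" for z
  using measurable_compose[OF measurable_Pair1'[OF that] measurable_splice_G] by simp
 have pt: "?B x ^ r <= (LINT y|Qm. ?A x y ^ r)" if x: "x : space Qm" for x
 proof -
  note [measurable] = pm[OF x]
  have i: "integrable Qm (%y. G (?s x y))" by (rule Q.integrable_const_bound[of _ T]) (use T in auto)
  have bd: "?A x y <= T + abs a" for y using T[of "?s x y"] by linarith
  have "prefix_mean P l G x - a = (LINT y|Qm. G (?s x y) - a)"
   unfolding prefix_mean_def using i by (simp add: Q.prob_space)
  then show ?thesis
   using Q.abs_expectation_power_le[of "%y. G (?s x y) - a" "T + abs a" r] bd r by simp
 qed
 have bd1: "?B x <= T + abs a" for x using prefix_mean_bound[of l x] by linarith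
 have m: "(%(x, y). ?A x y ^ r) : borel_measurable (Qm \<Otimes>\<^sub>M Qm)"
  using measurable_splice_G by (simp add: split_beta')
 have "(LINT x|Qm. ?B x ^ r) <= (LINT x|Qm. (LINT y|Qm. ?A x y ^ r))"
 proof (rule integral_mono[OF _ _ pt])
  show "integrable Qm (%x. ?B x ^ r)"
   by (rule Q.integrable_const_bound[of _ "(T + abs a) ^ r"]) (use power_mono[OF bd1, where n = r] in auto)
  show "integrable Qm (%x. (LINT y|Qm. ?A x y ^ r))"
  proof (rule QQ.integrable_fst'[of "%(x, y). ?A x y ^ r", simplified])
   have "?A x y <= T + abs a" for x y using T[of "?s x y"] by linarith
   then show "integrable (Qm \<Otimes>\<^sub>M Qm) (%(x, y). ?A x y ^ r)"
    by (intro QQ.integrable_const_bound[of _ "(T + abs a) ^ r"] m) (auto intro!: power_mono AE_I2 simp: split_beta')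
  qed
 qed
 also have "... = (LINT x|Qm. abs (G x - a) ^ r)"
 proof (rule integral_splice[of "%t. abs (t - a) ^ r" "(T + abs a) ^ r"])
  show "abs (abs (t - a) ^ r) <= (T + abs a) ^ r" if "abs t <= T" for t
   using that by (auto simp: power_abs intro!: power_mono)
 qed measurable
 finally show ?thesis .
qed

end

section \<open>Causal arrays\<close>

locale iid_innovations = prob_space M for M :: "'w measure" +
 fixes S :: "'s measure" and eps :: "int => 'w => 's" and eps' :: "'w => 's"
 assumes eps_indep: "indep_vars (%_. S) (case_option eps' eps) (UNIV :: int option set)"
  and eps_ident: "distr M S (eps j) = distr M S (eps 0)"
  and copy_ident: "distr M S eps' = distr M S (eps 0)"
begin

definition law :: "'s measure" where "law = distr M S (eps 0)"

definition past :: "int => 'w => nat => 's" where "past j u = (%k. eps (j - int k) u)"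

lemma measurable_case_eps: "case_option eps' eps i : measurable M S"
 using eps_indep by (auto simp: indep_vars_def)

lemma measurable_eps [measurable]: "eps j : measurable M S" "eps' : measurable M S"
 using measurable_case_eps[of "Some j"] measurable_case_eps[of None] by auto

lemma prob_space_law: "prob_space law"
 unfolding law_def by (rule prob_space_distr) measurable

lemma sets_law [measurable_cong]: "sets law = sets S"
 by (simp add: law_def)

lemma space_law: "space law = space S"
 by (simp add: law_def)

lemma distr_innovations:
 assumes "inj f"
 shows "distr M (PiM UNIV (%_. law)) (%w n. case_option eps' eps (f n) w) = PiM UNIV (%_. law)"
proof -
 let ?A = "(PiM UNIV (%_. law))"
 have each: "distr M S (case_option eps' eps i) = law" for i
  using eps_ident copy_ident by (cases i) (auto simp: law_def)
 have "distr M (PiM UNIV (%_. S)) (%w. \<lambda>i\<in>UNIV. case_option eps' eps i w) = PiM UNIV (%_. law)"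
  using indep_vars_iff_distr_eq_PiM[of UNIV "case_option eps' eps" "%_. S"] eps_indep measurable_case_eps each by simp
 moreover have "distr M (PiM UNIV (%_. S)) (%w. \<lambda>i\<in>UNIV. case_option eps' eps i w)
   = distr M ?A (%w i. case_option eps' eps i w)"
  by (rule distr_cong) (auto intro!: sets_PiM_cong simp: sets_law restrict_UNIV)
 ultimately have full: "distr M ?A (%w i. case_option eps' eps i w) = PiM UNIV (%_. law)" by simp
 have m: "(%w i. case_option eps' eps i w) : measurable M ?A"
  by (rule measurable_PiM_single')
   (use measurable_case_eps measurable_space[OF measurable_case_eps] in \<open>auto simp: space_law measurable_cong_sets[OF refl sets_law]\<close>)
 have "distr M ?A ((%w n. w (f n)) \<circ> (%w i. case_option eps' eps i w)) = PiM UNIV (%_. law)"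
  by (subst distr_distr[symmetric, OF measurable_reindex m]) (simp add: full distr_PiM_inj[OF prob_space_law assms])
 then show ?thesis by (simp add: comp_def)
qed

lemma measurable_innovations: "(%w n. case_option eps' eps (f n) w) : measurable M (PiM UNIV (%_. law))"
 by (rule measurable_PiM_single')
  (use measurable_case_eps measurable_space[OF measurable_case_eps] in \<open>auto simp: space_law measurable_cong_sets[OF refl sets_law]\<close>)

lemma past_innovations: "past j = (%w n. case_option eps' eps (Some (j - int n)) w)"
 by (simp add: past_def fun_eq_iff)

lemma measurable_past [measurable]: "past j : measurable M (PiM UNIV (%_. law))"
 unfolding past_innovations by (rule measurable_innovations)

lemma distr_past: "distr M (PiM UNIV (%_. law)) (past j) = PiM UNIV (%_. law)"
 unfolding past_innovations by (rule distr_innovations) (auto simp: inj_def)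

lemma expectation_past:
 fixes F :: "(nat => 's) => real"
 assumes "F : borel_measurable (PiM UNIV (%_. law))"
 shows "(LINT w|M. F (past j w)) = (LINT x|PiM UNIV (%_. law). F x)"
  and "integrable M (%w. F (past j w)) \<longleftrightarrow> integrable (PiM UNIV (%_. law)) F"
 using integral_distr[OF measurable_past assms, of j] integrable_distr_eq[OF measurable_past assms, of j] distr_past[of j] by auto

text \<open>Stationarity for pairs of times: both pasts are read off one doubly infinite sequence of
  innovations, whose law does not change under shifts.\<close>

lemma expectation_past_shift:
 fixes F :: "(nat => 's) => (nat => 's) => real"
 assumes F: "(%(x, y). F x y) : borel_measurable (PiM UNIV (%_. law) \<Otimes>\<^sub>M PiM UNIV (%_. law))"
 shows "(LINT w|M. F (past j w) (past (j + k) w)) = (LINT w|M. F (past 0 w) (past k w))"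
proof -
 let ?B = "(PiM UNIV (%_. law))"
 let ?A = "(LINT z|PiM UNIV (%_. law). F (%n. z (- int n)) (%n. z (k - int n)))"
 define E where "E j w = (%n::int. case_option eps' eps (Some (n + j)) w)" for j w
 have Em: "E j : measurable M ?B" for j unfolding E_def[abs_def] by (rule measurable_innovations)
 have El: "distr M ?B (E j) = PiM UNIV (%_. law)" for j
  unfolding E_def[abs_def] by (rule distr_innovations) (auto simp: inj_def)
 have m: "(%z. F (%n. z (- int n)) (%n. z (k - int n))) : borel_measurable ?B"
  using measurable_compose[OF measurable_Pair[OF measurable_reindex[of "%n::nat. - int n" law] measurable_reindex[of "%n::nat. k - int n" law]] F]
  by simp
 have "(LINT w|M. F (past j w) (past (j + k) w)) = (LINT w|M. F (%n. E j w (- int n)) (%n. E j w (k - int n)))" for j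
  by (simp add: E_def past_def algebra_simps)
 also have "... j = ?A" for j
  using integral_distr[OF Em m, of j] El[of j] by simp
 finally have "(LINT w|M. F (past j w) (past (j + k) w)) = ?A" for j .
 from this[of j] this[of 0] show ?thesis by simp
qed

lemma indep_eps: "indep_vars (%_. S) eps (UNIV :: int set)"
proof -
 have "distr M (PiM UNIV (%_. S)) (%w. \<lambda>i\<in>UNIV. eps i w) = distr M (PiM UNIV (%_. law)) (%w n. case_option eps' eps (Some n) w)"
  by (rule distr_cong) (auto intro!: sets_PiM_cong simp: sets_law restrict_UNIV)
 also have "... = PiM UNIV (%i::int. law)" by (rule distr_innovations) (auto simp: inj_def)
 also have "... = PiM UNIV (%i. distr M S (eps i))" by (intro PiM_cong refl) (unfold law_def, rule eps_ident[symmetric])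
 finally show ?thesis
  by (subst indep_vars_iff_distr_eq_PiM) auto
qed

lemma measurable_prefix_mean_restrict:
 assumes G: "G : borel_measurable (PiM UNIV (%_. law))" and K: "{j - int l<..j} \<subseteq> K"
 shows "(%r. prefix_mean law l G (%n. r (j - int n))) : borel_measurable (PiM K (%_. S))"
proof -
 let ?Q = "PiM (UNIV :: nat set) (%_. law)"
 have s: "(%(r, y) n. if n < l then r (j - int n) else y n) : measurable (PiM K (%_. S) \<Otimes>\<^sub>M ?Q) ?Q"
 proof (rule measurable_PiM_single')
  have c: "i < l ==> j - int i : K" for i using K by auto
  show "(%w. (case w of (r, y) => %n. if n < l then r (j - int n) else y n) i) : measurable (PiM K (%_. S) \<Otimes>\<^sub>M ?Q) law" for i
  proof -
   have eq: "(%w. (case w of (r, y) => %n. if n < l then r (j - int n) else y n) i) = (%w. if i < l then fst w (j - int i) else snd w i)" by auto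
   show ?thesis unfolding eq measurable_cong_sets[OF refl sets_law]
   proof (cases "i < l")
    case True
    have "(%w. fst w (j - int i)) : measurable (PiM K (%_. S) \<Otimes>\<^sub>M ?Q) S"
     by (rule measurable_compose[OF measurable_fst measurable_component_singleton[OF c[OF True]]])
    then show "(%w. if i < l then fst w (j - int i) else snd w i) : measurable (PiM K (%_. S) \<Otimes>\<^sub>M ?Q) S" using True by simp
   next
    case False
    have "(%w. snd w i) : measurable (PiM K (%_. S) \<Otimes>\<^sub>M ?Q) law"
     by (rule measurable_compose[OF measurable_snd measurable_component_singleton]) simp
    then show "(%w. if i < l then fst w (j - int i) else snd w i) : measurable (PiM K (%_. S) \<Otimes>\<^sub>M ?Q) S"
     using False by (simp add: measurable_cong_sets[OF refl sets_law])
   qed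
  qed
  show "(%(r, y) n. if n < l then r (j - int n) else y n) : space (PiM K (%_. S) \<Otimes>\<^sub>M ?Q) \<rightarrow> (\<Pi>\<^sub>E i\<in>UNIV. space law)"
   using c by (auto simp: space_pair_measure space_PiM PiE_iff space_law)
 qed
 have "(%(r, y). G (%n. if n < l then r (j - int n) else y n)) : borel_measurable (PiM K (%_. S) \<Otimes>\<^sub>M ?Q)"
  using measurable_compose[OF s G] by (simp add: split_beta')
 then show ?thesis
  unfolding prefix_mean_def
  by (rule sigma_finite_measure.borel_measurable_lebesgue_integral[OF prob_space_imp_sigma_finite[OF prob_space_PiM[OF prob_space_law]]])
qed

lemma prefix_mean_past_restrict:
 assumes "{j - int l<..j} \<subseteq> K"
 shows "prefix_mean law l G (past j w) = prefix_mean law l G (%n. (\<lambda>i\<in>K. eps i w) (j - int n))"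
proof -
 have "j - int n : K" if "n < l" for n using assms that by auto
 then have "(%n. if n < l then past j w n else y n) = (%n. if n < l then (\<lambda>i\<in>K. eps i w) (j - int n) else y n)" for y
  by (auto simp: past_def fun_eq_iff)
 then show ?thesis unfolding prefix_mean_def by simp
qed

text \<open>At time \<open>k\<close>, averaging over all but the \<open>k\<close> most recent
  innovations leaves a function of the innovations 1 to \<open>k\<close>, which is independent of
  everything up to time 0.\<close>

lemma indep_past_future:
 fixes F G :: "(nat => 's) => real"
 assumes F: "F : borel_measurable (PiM UNIV (%_. law))"
  and G: "G : borel_measurable (PiM UNIV (%_. law))" and T: "\<And>x. abs (G x) <= T"
  and i: "integrable M (%w. F (past 0 w))"
 shows "(LINT w|M. F (past 0 w) * prefix_mean law k G (past (int k) w))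
  = (LINT w|M. F (past 0 w)) * (LINT x|PiM UNIV (%_. law). G x)"
proof -
 let ?A = "{..0::int}" and ?B = "{0<..int k}"
 let ?C = "(PiM ?A (%_. S))"
 have m1: "(%r. F (%n. r (0 - int n))) : borel_measurable ?C"
 proof (rule measurable_compose[OF _ F])
  show "(%r n. r (0 - int n)) : measurable ?C (PiM UNIV (%_. law))"
  proof (rule measurable_PiM_single')
   show "(%r. r (0 - int n)) : measurable ?C law" for n
    unfolding measurable_cong_sets[OF refl sets_law] by (rule measurable_component_singleton) simp
  qed (auto simp: space_PiM PiE_iff space_law)
 qed
 have m2: "(%r. prefix_mean law k G (%n. r (int k - int n))) : borel_measurable (PiM ?B (%_. S))"
  by (rule measurable_prefix_mean_restrict[OF G]) auto
 have "indep_var ?C (%w. \<lambda>i\<in>?A. eps i w) (PiM ?B (%_. S)) (%w. \<lambda>i\<in>?B. eps i w)"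
  by (rule indep_var_restrict[OF indep_eps]) auto
 from indep_var_compose[OF this m1 m2]
 have "indep_var borel (%w. F (%n. (\<lambda>i\<in>?A. eps i w) (0 - int n))) borel (%w. prefix_mean law k G (%n. (\<lambda>i\<in>?B. eps i w) (int k - int n)))"
  by (simp add: comp_def)
 moreover have "(%n. (\<lambda>i\<in>?A. eps i w) (0 - int n)) = past 0 w" for w by (auto simp: past_def fun_eq_iff)
 moreover have "prefix_mean law k G (%n. (\<lambda>i\<in>?B. eps i w) (int k - int n)) = prefix_mean law k G (past (int k) w)" for w
  by (rule prefix_mean_past_restrict[symmetric]) auto
 ultimately have ind: "indep_var borel (%w. F (past 0 w)) borel (%w. prefix_mean law k G (past (int k) w))"
  by simp
 have pm: "prefix_mean law k G : borel_measurable (PiM UNIV (%_. law))"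
  by (rule measurable_prefix_mean[OF prob_space_law G T])
 have i2: "integrable M (%w. prefix_mean law k G (past (int k) w))"
  by (rule integrable_const_bound[of _ T])
   (use prefix_mean_bound[OF prob_space_law G T] measurable_compose[OF measurable_past pm] in auto)
 have "(LINT w|M. prefix_mean law k G (past (int k) w)) = (LINT x|PiM UNIV (%_. law). G x)"
  by (simp add: expectation_past(1)[OF pm] integral_prefix_mean[OF prob_space_law G T])
 then show ?thesis using indep_var_lebesgue_integral[OF ind i i2] by simp
qed

text \<open>A term at time \<open>j\<close> uses the \<open>l\<close> innovations at the times
  \<open>j - l + 1\<close> to \<open>j\<close>. Blocks at distance at least \<open>l\<close>
  therefore use disjoint sets of innovations.\<close>

lemma indep_separated_blocks:
 fixes G :: "'h => (nat => 's) => real"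
 assumes G: "\<And>h. h : H ==> G h : borel_measurable (PiM UNIV (%_. law))"
  and sep: "\<And>B B' j j'. B : L ==> B' : L ==> B \<noteq> B' ==> j : J B ==> j' : J B' ==> int l <= abs (j - j')"
 shows "indep_vars (%_. PiM H (%_. borel)) (%B u. \<lambda>h\<in>H. SUM j:J B. w B j h * (prefix_mean law l (G h) (past j u) - a h)) L"
proof -
 define K where "K B = (UN j:J B. {j - int l<..j})" for B
 define F where "F B r = (\<lambda>h\<in>H. SUM j:J B. w B j h * (prefix_mean law l (G h) (%n. r (j - int n)) - a h))" for B and r :: "int => 's"
 have sub: "{j - int l<..j} \<subseteq> K B" if "j : J B" for j B using that by (auto simp: K_def)
 have "indep_vars (%B. PiM (K B) (%_. S)) (%B u. \<lambda>i\<in>K B. eps i u) L"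
 proof (rule indep_vars_restrict[OF indep_eps])
  show "disjoint_family_on K L"
   unfolding disjoint_family_on_def
  proof (intro ballI impI)
   fix B B' assume B: "B : L" "B' : L" "B \<noteq> B'"
   show "K B \<inter> K B' = {}"
   proof (rule ccontr)
    assume "K B \<inter> K B' \<noteq> {}"
    then obtain x j j' where x: "j : J B" "j' : J B'" "j - int l < x" "x <= j" "j' - int l < x" "x <= j'"
     unfolding K_def by auto
    then show False using sep[OF B x(1,2)] by linarith
   qed
  qed
 qed auto
 then have "indep_vars (%_. PiM H (%_. borel)) (%B u. F B (\<lambda>i\<in>K B. eps i u)) L"
 proof (rule indep_vars_compose2)
  fix B assume "B : L"
  show "F B : measurable (PiM (K B) (%_. S)) (PiM H (%_. borel))"
   unfolding F_def
   by (intro measurable_restrict borel_measurable_sum borel_measurable_times borel_measurable_diff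
     borel_measurable_const measurable_prefix_mean_restrict G sub)
 qed
 also have "(%B u. F B (\<lambda>i\<in>K B. eps i u)) = (%B u. \<lambda>h\<in>H. SUM j:J B. w B j h * (prefix_mean law l (G h) (past j u) - a h))"
  unfolding F_def by (intro ext restrict_ext sum.cong refl) (simp add: prefix_mean_past_restrict[OF sub])
 finally show ?thesis .
qed

lemma indep_separated_sums:
 fixes G :: "(nat => 's) => real"
 assumes G: "G : borel_measurable (PiM UNIV (%_. law))"
  and sep: "\<And>B B' j j'. B : L ==> B' : L ==> B \<noteq> B' ==> j : J B ==> j' : J B' ==> int l <= abs (j - j')"
 shows "indep_vars (%_. borel) (%B u. SUM j:J B. w B j * (prefix_mean law l G (past j u) - a)) L"
proof -
 have "indep_vars (%_. PiM {()} (%_. borel)) (%B u. \<lambda>h\<in>{()}. SUM j:J B. w B j * (prefix_mean law l G (past j u) - a)) L"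
  by (rule indep_separated_blocks[where G = "%_. G" and w = "%B j _. w B j" and a = "%_. a", OF G sep])
 then have "indep_vars (%_. borel) (%B u. (%f. f ()) (\<lambda>h\<in>{()}. SUM j:J B. w B j * (prefix_mean law l G (past j u) - a))) L"
  by (rule indep_vars_compose2) (rule measurable_component_singleton, simp)
 then show ?thesis by simp
qed

end

section \<open>Moments of the causal array\<close>

locale causal_array = iid_innovations M S eps eps' for M :: "'w measure" and S :: "'s measure" and eps eps' +
 fixes g :: "nat => (nat => 's) => real" and p K \<delta> :: real
 assumes g_meas: "h \<ge> 1 ==> g h : borel_measurable (PiM UNIV (%_. S))"
  and centered: "h \<ge> 1 ==> integrable M (causal g eps j h) \<and> (LINT u|M. causal g eps j h u) = 0"
  and \<delta>: "0 < \<delta>" "\<delta> < 1" and p: "3 <= p"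
  and dep: "h \<ge> 1 ==>
    integrable M (%u. abs (causal g eps (int k) h u - causal g (eps(0 := eps')) (int k) h u) powr p) \<and>
    phys_dep M g eps eps' k h p <= K * \<delta> ^ k"
begin

abbreviation "X \<equiv> causal g eps"
abbreviation "Q \<equiv> PiM (UNIV :: nat set) (%_. law)"

sublocale Q: prob_space Q
 by (rule prob_space_PiM) (rule prob_space_law)

lemma X_past: "X j h w = g h (past j w)"
 by (simp add: causal_def past_def)

lemma measurable_g: "h \<ge> 1 ==> g h : borel_measurable Q"
 using g_meas by (subst measurable_cong_sets[OF sets_PiM_cong refl]) (auto simp: sets_law)

lemma measurable_X: "h \<ge> 1 ==> X j h : borel_measurable M"
 unfolding X_past[abs_def] by (rule measurable_compose[OF measurable_past measurable_g])

definition moment_const :: "nat => real" where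
 "moment_const r = 2 * (max K 1) ^ r / (1 - sqrt \<delta>) ^ r"

lemma sqrt_delta: "0 < sqrt \<delta>" "sqrt \<delta> < 1"
 using \<delta> by auto

lemma moment_const_nonneg: "0 <= moment_const r"
 using sqrt_delta by (simp add: moment_const_def)

text \<open>An integer order \<open>r <= p\<close> is reached by comparing with the scale
  \<open>a = max K 1 * \<delta> ^ k\<close>: below it \<open>D ^ r <= a ^ r\<close>, above it
  \<open>(D / a) ^ r <= (D / a) powr p\<close>. The two regimes give the factor 2, and the maximum
  with 1 keeps \<open>a\<close> positive.\<close>

lemma dep_moment:
 assumes h: "h \<ge> 1" and r: "1 <= r" "real r <= p"
 shows "(\<integral>\<^sup>+w. ennreal (abs (g h (%n. w (Some n)) - g h ((%n. w (Some n))(k := w None))) ^ r) \<partial>PiM UNIV (%_. law))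
   <= ennreal (2 * (max K 1) ^ r * (\<delta> ^ k) ^ r)"
proof -
 let ?D = "(PiM UNIV (%_. law))"
 define a where "a = max K 1 * \<delta> ^ k"
 have a0: "0 < a" using \<delta> by (simp add: a_def)
 define D where "D w = abs (X (int k) h w - causal g (eps(0 := eps')) (int k) h w)" for w
 let ?B = "LINT w|M. D w powr p"
 let ?A = "%w. (1 + D w powr p / a powr p)"
 let ?E = "LINT w|M. a ^ r * ?A w"
 have i: "integrable M (%w. D w powr p)" and b: "?B powr (1 / p) <= K * \<delta> ^ k"
  using dep[OF h, of k] by (auto simp: D_def phys_dep_def Lp_norm_def)
 have I0: "0 <= ?B" by simp
 have "K * \<delta> ^ k <= a" unfolding a_def using \<delta> by (intro mult_right_mono) auto
 then have "?B powr (1 / p) <= a" using b by linarith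
 then have "(?B powr (1 / p)) powr p <= a powr p" using p by (intro powr_mono2) auto
 then have Ip: "?B <= a powr p" using p I0 by (simp add: powr_powr)
 have pt: "D w ^ r <= a ^ r * ?A w" for w
 proof (cases "D w <= a")
  case True
  then have "D w ^ r <= a ^ r" by (intro power_mono) (auto simp: D_def)
  also have "... <= a ^ r * ?A w" using a0 by (simp add: mult_le_cancel_left1)
  finally show ?thesis .
 next
  case False
  then have D1: "1 <= D w / a" "0 < D w" using a0 by auto
  have "(D w / a) ^ r = (D w / a) powr real r" using D1 a0 by (simp add: powr_realpow)
  also have "... <= (D w / a) powr p" using D1 r by (intro powr_mono) auto
  also have "... = D w powr p / a powr p" using D1 a0 by (simp add: powr_divide)
  finally have "(D w / a) ^ r <= 1 + D w powr p / a powr p" by simp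
  then have "a ^ r * (D w / a) ^ r <= a ^ r * ?A w" using a0 by (intro mult_left_mono) auto
  then show ?thesis using a0 by (simp add: power_divide)
 qed
 \<comment> \<open>Coordinate \<open>m\<close> is the innovation at time \<open>k - m\<close>;
   replacing coordinate \<open>k\<close> therefore replaces the innovation at time 0.\<close>
 define f where "f n = (case n of None => None | Some m => Some (int k - int m))" for n :: "nat option"
 have inj: "inj f" unfolding f_def by (rule injI) (auto split: option.splits)
 let ?T = "%w n. case_option eps' eps (f n) w"
 let ?C = "%w. abs (g h (%n. ?T w (Some n)) - g h ((%n. ?T w (Some n))(k := ?T w None)))"
 have law: "distr M ?D ?T = PiM UNIV (%_. law)" by (rule distr_innovations[OF inj])
 have Tm: "?T : measurable M ?D" by (rule measurable_innovations)
 have m1: "(%w. (%n. w (Some n))) : measurable (PiM UNIV (%_::nat option. law)) Q" by (rule measurable_reindex)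
 have m2: "(%w. (%n. w (Some n))(k := w None)) : measurable (PiM UNIV (%_::nat option. law)) Q"
 proof -
  have "(%w. (%n. w (Some n))(k := w None)) = (%w n. w (if n = k then None else Some n) :: 's)"
   by (auto simp: fun_eq_iff)
  then show ?thesis using measurable_reindex[of "%n. if n = k then None else Some n" law] by simp
 qed
 have De: "D w = ?C w" for w
 proof -
  have "(%n. ?T w (Some n))(k := ?T w None) = (%n. (eps(0 := eps')) (int k - int n) w)"
   by (auto simp: f_def fun_eq_iff)
  moreover have "(%n. ?T w (Some n)) = (%n. eps (int k - int n) w)" by (simp add: f_def)
  ultimately show ?thesis by (simp add: D_def causal_def)
 qed
 have "(\<integral>\<^sup>+w. ennreal (abs (g h (%n. w (Some n)) - g h ((%n. w (Some n))(k := w None))) ^ r) \<partial>distr M ?D ?T)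
  = (\<integral>\<^sup>+w. ennreal (?C w ^ r) \<partial>M)"
  by (rule nn_integral_distr[OF Tm])
   (unfold measurable_distr_eq1, intro measurable_compose[OF _ measurable_ennreal] borel_measurable_power borel_measurable_abs borel_measurable_diff
    measurable_compose[OF m1 measurable_g[OF h]] measurable_compose[OF m2 measurable_g[OF h]])
 also have "... = (\<integral>\<^sup>+w. ennreal (D w ^ r) \<partial>M)" by (simp only: De)
 also have "... <= (\<integral>\<^sup>+w. ennreal (a ^ r * ?A w) \<partial>M)"
  by (intro nn_integral_mono ennreal_leI pt)
 also have "... = ennreal ?E"
  by (rule nn_integral_eq_integral) (use i a0 in auto)
 also have "... <= ennreal (2 * (max K 1) ^ r * (\<delta> ^ k) ^ r)"
 proof (rule ennreal_leI)
  have "?E = a ^ r * (1 + ?B / a powr p)"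
   using i by (simp add: prob_space)
  also have "... <= a ^ r * (1 + 1)"
   using a0 Ip by (intro mult_left_mono add_left_mono) auto
  also have "... = 2 * (max K 1) ^ r * (\<delta> ^ k) ^ r" by (simp add: a_def power_mult_distrib)
  finally show "?E <= 2 * (max K 1) ^ r * (\<delta> ^ k) ^ r" .
 qed
 finally show ?thesis unfolding law .
qed

lemma resample_moment:
 assumes h: "h \<ge> 1" and r: "1 <= r" "r <= 3"
 shows "(\<integral>\<^sup>+w. ennreal (abs (g h (%n. w (Inl n)) - g h (resample l w)) ^ r) \<partial>PiM UNIV (%_. law))
  <= ennreal (moment_const r * (\<delta> ^ l) ^ r)"
 using resample_moment_bound[OF prob_space_law measurable_g[OF h] \<delta> _ r(1), of "2 * (max K 1) ^ r" l] dep_moment[OF h r(1)] r p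
 by (simp add: moment_const_def mult_ac)

definition gclip :: "real => nat => (nat => 's) => real" where
 "gclip T h x = clip T (g h x)"

definition gmean :: "real => nat => real" where
 "gmean T h = (LINT x|Q. gclip T h x)"

lemma measurable_gclip: "h \<ge> 1 ==> gclip T h : borel_measurable Q"
 unfolding gclip_def[abs_def] by (rule measurable_compose[OF measurable_g measurable_clip])

lemma gclip_bound: "0 <= T ==> abs (gclip T h x) <= T"
 unfolding gclip_def by (rule clip_bound)

lemma gclip_resample_moment:
 assumes h: "h \<ge> 1" and r: "1 <= r" "r <= 3"
 shows "(\<integral>\<^sup>+w. ennreal (abs (gclip T h (%n. w (Inl n)) - gclip T h (resample l w)) ^ r) \<partial>PiM UNIV (%_. law))
  <= ennreal (moment_const r * (\<delta> ^ l) ^ r)"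
 by (rule order_trans[OF nn_integral_mono resample_moment[OF h r, of l]])
  (auto intro!: ennreal_leI power_mono simp: gclip_def clip_diff)

lemma gclip_prefix_moment:
 assumes h: "h \<ge> 1" and r: "1 <= r" "r <= 3" and T: "0 <= T"
 shows "(LINT x|Q. abs (gclip T h x - prefix_mean law l (gclip T h) x) ^ r) <= moment_const r * (\<delta> ^ l) ^ r"
 by (rule prefix_mean_diff_moment[OF prob_space_law measurable_gclip[OF h] gclip_bound[OF T] r(1) gclip_resample_moment[OF h r]])
  (use moment_const_nonneg \<delta> in auto)

text \<open>For \<open>l = 0\<close> the prefix mean averages over all coordinates and becomes the
  constant \<open>gmean\<close>.\<close>

lemma gclip_centered_moment:
 assumes h: "h \<ge> 1" and r: "1 <= r" "r <= 3" and T: "0 <= T"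
 shows "(LINT x|Q. abs (gclip T h x - gmean T h) ^ r) <= moment_const r"
 using gclip_prefix_moment[OF assms, of 0] by (simp add: prefix_mean_def gmean_def)

lemma X_integrable: "h \<ge> 1 ==> integrable M (X j h)"
 using centered by auto

lemma g_integrable: "h \<ge> 1 ==> integrable Q (g h)"
 using X_integrable[of h 0] expectation_past(2)[OF measurable_g, of h 0] by (simp add: X_past[abs_def])

lemma g_mean: "h \<ge> 1 ==> (LINT x|Q. g h x) = 0"
 using centered[of h 0] expectation_past(1)[OF measurable_g, of h 0] by (simp add: X_past[abs_def])

lemma clip_tendsto: "(%n. clip (real n) x) ----> x"
proof -
 obtain N :: nat where "abs x <= real N" using real_arch_simple by blast
 then have "clip (real n) x = x" if "n \<ge> N" for n using that by (intro clip_eq) simp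
 then show ?thesis by (intro tendsto_eventually) (auto simp: eventually_sequentially)
qed

lemma abs_clip_le: "0 <= T ==> abs (clip T x) <= abs x"
 by (auto simp: clip_def)

lemma gmean_tendsto: "h \<ge> 1 ==> (%n. gmean (real n) h) ----> 0"
 unfolding gmean_def g_mean[symmetric, of h]
 by (rule integral_dominated_convergence[where w = "%x. abs (g h x)"])
  (use measurable_g measurable_gclip g_integrable clip_tendsto in \<open>auto simp: gclip_def abs_clip_le\<close>)

text \<open>Square integrability is derived from the dependence bound: clipped and centred versions
  have uniformly bounded second moments, the centring constants tend to the mean 0, and Fatou's
  lemma passes to the limit.\<close>

lemma g_square:
 assumes h: "h \<ge> 1"
 shows "integrable Q (%x. (g h x)^2)" and "(LINT x|Q. (g h x)^2) <= moment_const 2"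
proof -
 let ?B = "(\<integral>\<^sup>+x. ennreal ((g h x)^2) \<partial>Q)"
 let ?A = "%n x. abs (gclip (real n) h x - gmean (real n) h)"
 let ?C = "%n x. ((?A n x)\<^sup>2)"
 note [measurable] = measurable_g[OF h] measurable_gclip[OF h]
 have "?B = (\<integral>\<^sup>+x. liminf (%n. ennreal (?C n x)) \<partial>Q)"
 proof (rule nn_integral_cong)
  fix x
  have "(%n. ennreal (?C n x)) ----> ennreal (abs (g h x - 0)^2)"
   unfolding gclip_def by (intro tendsto_ennrealI tendsto_intros clip_tendsto gmean_tendsto h)
  then have "liminf (%n. ennreal (?C n x)) = ennreal (abs (g h x - 0)^2)"
   by (rule lim_imp_Liminf[OF sequentially_bot])
  then show "ennreal ((g h x)^2) = liminf (%n. ennreal (?C n x))"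
   by simp
 qed
 also have "... <= liminf (%n. \<integral>\<^sup>+x. ennreal (?C n x) \<partial>Q)"
  by (rule nn_integral_liminf) measurable
 also have "... <= ennreal (moment_const 2)"
 proof (rule Liminf_le[OF _ always_eventually])
  show "\<forall>n. (\<integral>\<^sup>+x. ennreal (?C n x) \<partial>Q) <= ennreal (moment_const 2)"
  proof
   fix n :: nat
   have "integrable Q (%x. (?A n x)\<^sup>2)"
   proof (rule Q.integrable_const_bound[of _ "(real n + abs (gmean (real n) h))^2"])
    have "?A n x <= real n + abs (gmean (real n) h)" for x
     using gclip_bound[of "real n" h x] by linarith
    from power_mono[OF this, where n = 2]
    show "AE x in Q. norm (?C n x) <= (real n + abs (gmean (real n) h))^2" by auto
   qed measurable
   then show "(\<integral>\<^sup>+x. ennreal (?C n x) \<partial>Q) <= ennreal (moment_const 2)"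
    using gclip_centered_moment[OF h, of 2 "real n"] by (subst nn_integral_eq_integral) (auto intro!: ennreal_leI)
  qed
 qed auto
 finally have le: "?B <= ennreal (moment_const 2)" .
 show i: "integrable Q (%x. (g h x)^2)"
  by (rule integrableI_bounded) (use le in \<open>auto intro: le_less_trans[OF _ ennreal_less_top]\<close>)
 show "(LINT x|Q. (g h x)^2) <= moment_const 2"
  using le nn_integral_eq_integral[OF i] moment_const_nonneg by (simp add: ennreal_le_iff)
qed

lemma X_square: "h \<ge> 1 ==> integrable M (%w. (X j h w)^2)" "h \<ge> 1 ==> (LINT w|M. (X j h w)^2) <= moment_const 2"
 using g_square[of h] expectation_past[of "%x. (g h x)^2" j] measurable_g[of h]
 by (auto simp: X_past)

end

section \<open>Decay of the cross-covariances\<close>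

lemma integrable_mult_L2:
 fixes U V :: "'w => real"
 assumes [measurable]: "U : borel_measurable M" "V : borel_measurable M"
  and "integrable M (%u. (U u)^2)" "integrable M (%u. (V u)^2)"
 shows "integrable M (%u. U u * V u)"
proof (rule Bochner_Integration.integrable_bound[of _ "%u. (U u)^2 + (V u)^2"])
 show "AE u in M. norm (U u * V u) <= norm ((U u)^2 + (V u)^2)"
 proof (rule AE_I2)
  fix u
  have "0 <= (abs (U u) - abs (V u))^2" by simp
  then have "2 * (abs (U u) * abs (V u)) <= (U u)^2 + (V u)^2" by (simp add: power2_diff mult.assoc)
  moreover have "0 <= abs (U u) * abs (V u)" by simp
  ultimately have "abs (U u) * abs (V u) <= (U u)^2 + (V u)^2" by linarith
  then show "norm (U u * V u) <= norm ((U u)^2 + (V u)^2)" by (simp add: abs_mult)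
 qed
qed (use assms in auto)

text \<open>The weighted inequality \<open>2 * a * b <= c * a^2 + b^2 / c\<close> takes the place of
  Cauchy-Schwarz; the weight is balanced for a second factor of norm about \<open>c\<close>.\<close>

lemma integral_mult_L2_le:
 fixes U V :: "'w => real"
 assumes m: "U : borel_measurable M" "V : borel_measurable M"
  and i: "integrable M (%u. (U u)^2)" "integrable M (%u. (V u)^2)"
  and b: "(LINT u|M. (U u)^2) <= C" "(LINT u|M. (V u)^2) <= D * c^2" and c: "0 < c"
 shows "abs (LINT u|M. U u * V u) <= (C + D) / 2 * c"
proof -
 have "abs (LINT u|M. U u * V u) <= (LINT u|M. abs (U u * V u))" by (rule integral_abs_bound)
 also have "... <= (LINT u|M. c / 2 * (U u)^2 + 1 / (2 * c) * (V u)^2)"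
 proof (rule integral_mono)
  show "integrable M (%u. abs (U u * V u))" using integrable_mult_L2[OF m i] by auto
  show "integrable M (%u. c / 2 * (U u)^2 + 1 / (2 * c) * (V u)^2)" using i by auto
  fix u
  have "0 <= (c * abs (U u) - abs (V u))^2" by simp
  then have "2 * c * (abs (U u) * abs (V u)) <= c^2 * (U u)^2 + (V u)^2" by (simp add: power2_diff power_mult_distrib)
  then show "abs (U u * V u) <= c / 2 * (U u)^2 + 1 / (2 * c) * (V u)^2"
   using c by (simp add: abs_mult field_simps power2_eq_square)
 qed
 also have "... = c / 2 * (LINT u|M. (U u)^2) + 1 / (2 * c) * (LINT u|M. (V u)^2)"
  using i by simp
 also have "... <= c / 2 * C + 1 / (2 * c) * (D * c^2)"
  using b c by (intro add_mono mult_left_mono) auto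
 also have "... = (C + D) / 2 * c" using c by (simp add: field_simps power2_eq_square)
 finally show ?thesis .
qed

context causal_array
begin

lemma expectation_X: "h \<ge> 1 ==> (LINT w|M. X j h w) = 0"
 using centered by blast

lemma cross_cov_X:
 assumes "h \<ge> 1" "i \<ge> 1"
 shows "cross_cov M X h i k = (LINT w|M. X 0 h w * X k i w)"
 using assms by (simp add: cross_cov_def covar_def expectation_X)

lemma expectation_X_product:
 assumes "h \<ge> 1" "i \<ge> 1"
 shows "(LINT w|M. X j h w * X k i w) = cross_cov M X h i (k - j)"
proof -
 have "(%p. g h (fst p) * g i (snd p)) : borel_measurable (Q \<Otimes>\<^sub>M Q)"
  by (intro borel_measurable_times measurable_compose[OF measurable_fst measurable_g] measurable_compose[OF measurable_snd measurable_g] assms)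
 then have "(LINT w|M. g h (past j w) * g i (past (j + (k - j)) w)) = (LINT w|M. g h (past 0 w) * g i (past (k - j) w))"
  by (intro expectation_past_shift[where F = "%x y. g h x * g i y"]) (simp add: split_beta')
 then show ?thesis using assms by (simp add: cross_cov_X X_past)
qed

text \<open>The later variable is replaced by its average over all but its last \<open>k\<close>
  innovations. That average is independent of \<open>X 0 h\<close>, which has mean 0, and the
  replacement error has norm of order \<open>\<delta> ^ k\<close>. This is done for clipped
  variables and extended by dominated convergence.\<close>

lemma cov_decay_nonneg:
 assumes h: "h \<ge> 1" and i: "i \<ge> 1"
 shows "abs (LINT u|M. X 0 h u * X (int k) i u) <= moment_const 2 * \<delta> ^ k"
proof -
 let ?U = "X 0 h"
 have Um: "?U : borel_measurable M" by (rule measurable_X[OF h])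
 define V where "V n u = gclip (real n) i (past (int k) u)" for n u
 have Vm: "V n : borel_measurable M" for n
  unfolding V_def by (rule measurable_compose[OF measurable_past measurable_gclip[OF i]])
 have bound: "abs (LINT u|M. ?U u * V n u) <= moment_const 2 * \<delta> ^ k" for n
 proof -
  let ?G = "gclip (real n) i"
  define W where "W u = prefix_mean law k ?G (past (int k) u)" for u
  have pmm: "prefix_mean law k ?G : borel_measurable Q"
   by (rule measurable_prefix_mean[OF prob_space_law measurable_gclip[OF i] gclip_bound]) simp
  have Wm: "W : borel_measurable M" unfolding W_def by (rule measurable_compose[OF measurable_past pmm])
  have Vb: "abs (V n u) <= real n" for u unfolding V_def by (rule gclip_bound) simp
  have Wb: "abs (W u) <= real n" for u unfolding W_def
   by (rule prefix_mean_bound[OF prob_space_law measurable_gclip[OF i] gclip_bound]) simp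
  have d2: "(%x. (?G x - prefix_mean law k ?G x)^2) : borel_measurable Q"
   using measurable_gclip[OF i] pmm by measurable
  have VW: "(LINT u|M. (V n u - W u)^2) <= moment_const 2 * (\<delta> ^ k)^2"
   using gclip_prefix_moment[OF i, of 2 "real n" k] expectation_past(1)[OF d2, of "int k"] by (simp add: V_def W_def)
  have iVW: "integrable M (%u. (V n u - W u)^2)"
  proof (rule integrable_const_bound[of _ "(2 * real n)^2"])
   have "abs (V n u - W u) <= 2 * real n" for u using Vb[of u] Wb[of u] by linarith
   from power_mono[OF this, where n = 2] show "AE u in M. norm ((V n u - W u)^2) <= (2 * real n)^2" by auto
  qed (use Vm Wm in measurable)
  have iV: "integrable M (%u. ?U u * V n u)"
   by (rule integrable_mult_L2[OF Um Vm X_square(1)[OF h]], rule integrable_const_bound[of _ "(real n)^2"])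
    (use Vm power_mono[OF Vb, where n = 2] in auto)
  have iW: "integrable M (%u. ?U u * W u)"
   by (rule integrable_mult_L2[OF Um Wm X_square(1)[OF h]], rule integrable_const_bound[of _ "(real n)^2"])
    (use Wm power_mono[OF Wb, where n = 2] in auto)
  have "(LINT u|M. ?U u * W u) = (LINT u|M. g h (past 0 u)) * (LINT x|Q. ?G x)"
   unfolding W_def X_past
   by (rule indep_past_future[OF measurable_g[OF h] measurable_gclip[OF i] gclip_bound])
    (use X_integrable[OF h, of 0] in \<open>simp_all add: X_past[abs_def]\<close>)
  also have "... = 0" using expectation_X[OF h, of 0] by (simp add: X_past)
  finally have "(LINT u|M. ?U u * V n u) = (LINT u|M. ?U u * (V n u - W u))"
   using iV iW by (simp add: right_diff_distrib)
  also have "abs (...) <= (moment_const 2 + moment_const 2) / 2 * \<delta> ^ k"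
   by (rule integral_mult_L2_le[OF Um _ X_square(1)[OF h] iVW X_square(2)[OF h] VW]) (use Vm Wm \<delta> in auto)
  finally show ?thesis by simp
 qed
 have "(%n. (LINT u|M. ?U u * V n u)) ----> (LINT u|M. ?U u * X (int k) i u)"
 proof (rule integral_dominated_convergence[where w = "%u. abs (?U u * X (int k) i u)"])
  show "integrable M (%u. abs (?U u * X (int k) i u))"
   by (intro integrable_abs integrable_mult_L2 measurable_X X_square h i)
  show "AE u in M. (%n. ?U u * V n u) ----> ?U u * X (int k) i u"
   unfolding V_def gclip_def X_past by (intro AE_I2 tendsto_intros clip_tendsto)
  show "AE u in M. norm (?U u * V n u) <= abs (?U u * X (int k) i u)" for n
   unfolding V_def gclip_def X_past by (intro AE_I2) (auto simp: abs_mult intro!: mult_left_mono abs_clip_le)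
 qed (use Um Vm measurable_X[OF i] in measurable)
 then have "(%n. abs (LINT u|M. ?U u * V n u)) ----> abs (LINT u|M. ?U u * X (int k) i u)" by (rule tendsto_rabs)
 then show ?thesis using bound by (intro LIMSEQ_le_const2) auto
qed

lemma cross_cov_decay:
 assumes h: "h \<ge> 1" and i: "i \<ge> 1"
 shows "abs (cross_cov M X h i k) <= moment_const 2 * \<delta> ^ nat (abs k)"
proof (cases "k \<ge> 0")
 case True
 then show ?thesis using cov_decay_nonneg[OF h i, of "nat k"] by (simp add: cross_cov_X[OF h i])
next
 case False
 have "cross_cov M X h i k = (LINT w|M. X (- k) h w * X 0 i w)"
  by (subst expectation_X_product[OF h i]) simp
 also have "... = (LINT w|M. X 0 i w * X (int (nat (- k))) h w)" using False by (simp add: mult.commute)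
 finally show ?thesis using cov_decay_nonneg[OF i h, of "nat (- k)"] False by simp
qed

section \<open>Bounded variables depending on finitely many innovations\<close>

definition Xt :: "nat => real => int => nat => 'w => real" where
 "Xt l T j h u = prefix_mean law l (gclip T h) (past j u) - gmean T h"

lemma measurable_prefix_gclip: "h \<ge> 1 ==> 0 <= T ==> prefix_mean law l (gclip T h) : borel_measurable Q"
 by (rule measurable_prefix_mean[OF prob_space_law measurable_gclip gclip_bound])

lemma measurable_Xt: "h \<ge> 1 ==> 0 <= T ==> Xt l T j h : borel_measurable M"
 unfolding Xt_def[abs_def]
 by (intro borel_measurable_diff borel_measurable_const measurable_compose[OF measurable_past measurable_prefix_gclip])

lemma gmean_bound:
 assumes h: "h \<ge> 1" and T: "0 <= T"
 shows "abs (gmean T h) <= T"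
proof -
 have "abs (gmean T h) <= (LINT x|Q. abs (gclip T h x))" unfolding gmean_def by (rule integral_abs_bound)
 also have "... <= (LINT x|Q. T)" by (rule integral_mono') (use gclip_bound[OF T] T in auto)
 finally show ?thesis by (simp add: Q.prob_space)
qed

lemma Xt_bound: "h \<ge> 1 ==> 0 <= T ==> abs (Xt l T j h w) <= 2 * T"
 using prefix_mean_bound[OF prob_space_law measurable_gclip gclip_bound, of h T l "past j w"] gmean_bound[of h T]
 unfolding Xt_def by force

lemma Xt_mean: "h \<ge> 1 ==> 0 <= T ==> (LINT w|M. Xt l T j h w) = 0"
proof -
 assume h: "h \<ge> 1" and T: "0 <= T"
 have "integrable M (%w. prefix_mean law l (gclip T h) (past j w))"
  by (rule integrable_const_bound[of _ T])
   (use prefix_mean_bound[OF prob_space_law measurable_gclip[OF h] gclip_bound[OF T]] measurable_compose[OF measurable_past measurable_prefix_gclip[OF h T]] in auto)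
 then show ?thesis
  unfolding Xt_def
  by (simp add: prob_space expectation_past(1)[OF measurable_prefix_gclip[OF h T]]
    integral_prefix_mean[OF prob_space_law measurable_gclip[OF h] gclip_bound[OF T]] gmean_def)
qed

lemma Xt_moment:
 assumes h: "h \<ge> 1" and T: "0 <= T" and r: "1 <= r" "r <= 3"
 shows "(LINT w|M. abs (Xt l T j h w) ^ r) <= moment_const r"
proof -
 have m: "(%x. abs (prefix_mean law l (gclip T h) x - gmean T h) ^ r) : borel_measurable Q"
  using measurable_prefix_gclip[OF h T] by measurable
 have "(LINT w|M. abs (Xt l T j h w) ^ r) = (LINT x|Q. abs (prefix_mean law l (gclip T h) x - gmean T h) ^ r)"
  unfolding Xt_def by (rule expectation_past(1)[OF m])
 also have "... <= (LINT x|Q. abs (gclip T h x - gmean T h) ^ r)"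
  by (rule prefix_mean_centered_moment[OF prob_space_law measurable_gclip[OF h] gclip_bound[OF T] r(1)])
 also have "... <= moment_const r" by (rule gclip_centered_moment[OF h r T])
 finally show ?thesis .
qed

lemma Xt_power_integrable: "h \<ge> 1 ==> 0 <= T ==> integrable M (%w. abs (Xt l T j h w) ^ r)"
 by (rule integrable_const_bound[of _ "(2 * T) ^ r"])
  (use measurable_Xt power_mono[OF Xt_bound, where n = r] in auto)

lemma Xt_square:
 assumes h: "h \<ge> 1" and T: "0 <= T"
 shows "integrable M (%w. (Xt l T j h w)^2)" "(LINT w|M. (Xt l T j h w)^2) <= moment_const 2"
 using Xt_power_integrable[OF h T, of l j 2] Xt_moment[OF h T, of 2 l j] by simp_all

text \<open>With \<open>t = |g| / m\<close> one has \<open>t^2 <= 8 * exp (t / 2)\<close>. Beyond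
  the clipping level, the other half of the exponential moment yields the factor
  \<open>exp (- T / (2 * m))\<close>.\<close>

lemma clip_tail:
 assumes h: "h \<ge> 1" and T: "0 <= T" and m: "0 < m"
  and i: "integrable M (%w. exp (abs (X 1 h w) / m))" and b: "(LINT w|M. exp (abs (X 1 h w) / m)) <= C"
 shows "(LINT x|Q. (g h x - gclip T h x)^2) <= 8 * m^2 * C * exp (- T / (2 * m))"
  and "integrable Q (%x. (g h x - gclip T h x)^2)"
proof -
 let ?A = "%x. (abs (g h x) / m)"
 note [measurable] = measurable_g[OF h] measurable_gclip[OF h]
 have em: "(%x. exp (?A x)) : borel_measurable Q" by measurable
 have iQ: "integrable Q (%x. exp (?A x))" "(LINT x|Q. exp (?A x)) <= C"
  using i b expectation_past[OF em, of 1] by (auto simp: X_past)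
 have pt: "(g h x - gclip T h x)^2 <= 8 * m^2 * exp (- T / (2 * m)) * exp (?A x)" for x
 proof (cases "abs (g h x) <= T")
  case True
  then show ?thesis by (simp add: gclip_def clip_eq)
 next
  case False
  define t where "t = abs (g h x) / m"
  have t0: "0 <= t" using m by (simp add: t_def)
  have "(t / 2)^2 / 2 <= exp (t / 2)" using exp_lower_Taylor_quadratic[of "t / 2"] t0 by simp
  then have e: "t^2 <= 8 * exp (t / 2)" by (simp add: power_divide)
  have "abs (g h x - gclip T h x) <= abs (g h x)" using T by (auto simp: gclip_def clip_def)
  then have "(g h x - gclip T h x)^2 <= abs (g h x)^2" by (metis abs_ge_zero power2_abs power_mono)
  also have "abs (g h x) = m * t" using m by (simp add: t_def)
  also have "(m * t)^2 <= m^2 * (8 * exp (t / 2))" unfolding power_mult_distrib using e by (intro mult_left_mono) auto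
  also have "... <= m^2 * (8 * (exp (- T / (2 * m)) * exp t))"
  proof -
   have "T / m <= t" using False m by (simp add: t_def divide_right_mono)
   then have "t / 2 <= - T / (2 * m) + t" by (simp add: field_simps)
   then show ?thesis unfolding exp_add[symmetric] by (intro mult_left_mono) auto
  qed
  finally show ?thesis by (simp add: t_def mult_ac)
 qed
 show i2: "integrable Q (%x. (g h x - gclip T h x)^2)"
  by (rule Bochner_Integration.integrable_bound[OF integrable_mult_right[OF iQ(1), of "8 * m^2 * exp (- T / (2 * m))"]])
   (use pt in \<open>auto intro!: AE_I2 order_trans[OF pt abs_ge_self]\<close>)
 have "(LINT x|Q. (g h x - gclip T h x)^2) <= (LINT x|Q. 8 * m^2 * exp (- T / (2 * m)) * exp (?A x))"
  by (intro integral_mono i2 pt integrable_mult_right iQ)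
 also have "... = 8 * m^2 * exp (- T / (2 * m)) * (LINT x|Q. exp (?A x))" by simp
 also have "... <= 8 * m^2 * exp (- T / (2 * m)) * C" by (intro mult_left_mono iQ) auto
 finally show "(LINT x|Q. (g h x - gclip T h x)^2) <= 8 * m^2 * C * exp (- T / (2 * m))" by (simp add: mult_ac)
qed

lemma Xt_approx:
 assumes h: "h \<ge> 1" and T: "0 <= T"
  and D: "(LINT x|Q. (g h x - gclip T h x)^2) <= D" "integrable Q (%x. (g h x - gclip T h x)^2)"
 shows "(LINT w|M. (Xt l T j h w - X j h w)^2) <= 6 * D + 3 * moment_const 2 * (\<delta> ^ l)^2"
  and "integrable M (%w. (Xt l T j h w - X j h w)^2)"
proof -
 note [measurable] = measurable_g[OF h] measurable_gclip[OF h] measurable_prefix_gclip[OF h T]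
 let ?pm = "prefix_mean law l (gclip T h)"
 let ?A = "%x. (gclip T h x - ?pm x)"
 define F where "F x = (?pm x - gmean T h - g h x)^2" for x
 have Fm: "F : borel_measurable Q" unfolding F_def by measurable
 \<comment> \<open>\<open>g\<close> has mean 0, so the clipped mean is minus the mean of the part
   cut off, and its square is at most \<open>D\<close> because a variance is nonnegative. It
   accounts for one half of \<open>6 * D\<close>.\<close>
 have m2: "(gmean T h)^2 <= D"
 proof -
  have ig: "integrable Q (gclip T h)" by (rule Q.integrable_const_bound[of _ T]) (use gclip_bound[OF T] in auto)
  define U where "U x = g h x - gclip T h x" for x
  have iU: "integrable Q U" unfolding U_def using ig g_integrable[OF h] by auto
  have Ue: "(LINT x|Q. U x) = - gmean T h" unfolding U_def gmean_def using ig g_integrable[OF h] g_mean[OF h] by simp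
  have iU2: "integrable Q (%x. (U x)^2)" using D(2) by (simp add: U_def)
  define c where "c = (LINT x|Q. U x)"
  have "0 <= (LINT x|Q. (U x - c)^2)" by simp
  also have "... = (LINT x|Q. (U x)^2 - 2 * c * U x + c^2)" by (simp add: power2_diff algebra_simps)
  also have "... = (LINT x|Q. (U x)^2) - 2 * c * c + c^2" using iU iU2 by (simp add: Q.prob_space c_def)
  finally have "c^2 <= (LINT x|Q. (U x)^2)" by (simp add: power2_eq_square)
  then show ?thesis using D(1) Ue by (simp add: c_def U_def)
 qed
 have ipm: "integrable Q (%x. (?A x)^2)"
 proof (rule Q.integrable_const_bound[of _ "(2 * T)^2"])
  have "abs (gclip T h x - ?pm x) <= 2 * T" for x
   using gclip_bound[OF T, of h x] prefix_mean_bound[OF prob_space_law measurable_gclip[OF h] gclip_bound[OF T], of l x] by linarith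
  from power_mono[OF this, where n = 2] show "AE x in Q. norm ((?A x)^2) <= (2 * T)^2" by auto
 qed measurable
 have pt: "F x <= 3 * (g h x - gclip T h x)^2 + 3 * (?A x)^2 + 3 * (gmean T h)^2" for x
 proof -
  have sq: "(a + b + c)^2 <= 3 * a^2 + 3 * b^2 + 3 * c^2" for a b c :: real
  proof -
   have "3 * a^2 + 3 * b^2 + 3 * c^2 - (a + b + c)^2 = (a - b)^2 + (b - c)^2 + (a - c)^2" by (simp add: power2_eq_square algebra_simps)
   moreover have "0 <= (a - b)^2 + (b - c)^2 + (a - c)^2" by simp
   ultimately show ?thesis by linarith
  qed
  have "F x = ((g h x - gclip T h x) + ?A x + gmean T h)^2" unfolding F_def by (simp add: power2_eq_square algebra_simps)
  then show ?thesis using sq[of "g h x - gclip T h x" "gclip T h x - ?pm x" "gmean T h"] by linarith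
 qed
 have idom: "integrable Q (%x. 3 * (g h x - gclip T h x)^2 + 3 * (?A x)^2 + 3 * (gmean T h)^2)"
  using D(2) ipm by auto
 have iF: "integrable Q F"
  by (rule Bochner_Integration.integrable_bound[OF idom Fm]) (use pt in \<open>auto intro!: AE_I2 order_trans[OF pt abs_ge_self] simp: F_def\<close>)
 have "(LINT x|Q. F x) <= (LINT x|Q. 3 * (g h x - gclip T h x)^2 + 3 * (?A x)^2 + 3 * (gmean T h)^2)"
  by (intro integral_mono iF idom pt)
 also have "... = 3 * (LINT x|Q. (g h x - gclip T h x)^2) + 3 * (LINT x|Q. (?A x)^2) + 3 * (gmean T h)^2"
  using D(2) ipm by (simp add: Q.prob_space)
 also have "... <= 6 * D + 3 * moment_const 2 * (\<delta> ^ l)^2"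
  using D(1) m2 gclip_prefix_moment[OF h, of 2 T l] T by simp
 finally have "(LINT x|Q. F x) <= 6 * D + 3 * moment_const 2 * (\<delta> ^ l)^2" .
 then show "(LINT w|M. (Xt l T j h w - X j h w)^2) <= 6 * D + 3 * moment_const 2 * (\<delta> ^ l)^2"
  and "integrable M (%w. (Xt l T j h w - X j h w)^2)"
  using expectation_past[OF Fm, of j] iF by (simp_all add: F_def Xt_def X_past)
qed

lemma Xt_product_approx:
 assumes h: "h \<ge> 1" and i: "i \<ge> 1" and T: "0 <= T" and c: "0 < c"
  and ap: "\<And>j h. h : {a, b} ==> (LINT w|M. (Xt l T j h w - X j h w)^2) <= c^2 \<and> integrable M (%w. (Xt l T j h w - X j h w)^2)"
  and ab: "a = h" "b = i"
 shows "abs ((LINT w|M. Xt l T j h w * Xt l T k i w) - cross_cov M X h i (k - j)) <= (moment_const 2 + 1) * c"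
proof -
 note m = measurable_Xt[OF h T, of l] measurable_Xt[OF i T, of l] measurable_X[OF h] measurable_X[OF i]
 define U where "U w = Xt l T k i w - X k i w" for w
 define V where "V w = Xt l T j h w - X j h w" for w
 have Um: "U : borel_measurable M" and Vm: "V : borel_measurable M" unfolding U_def V_def using m by auto
 have U2: "integrable M (%w. (U w)^2)" "(LINT w|M. (U w)^2) <= 1 * c^2" using ap[of i k] ab by (auto simp: U_def)
 have V2: "integrable M (%w. (V w)^2)" "(LINT w|M. (V w)^2) <= 1 * c^2" using ap[of h j] ab by (auto simp: V_def)
 have b1: "abs (LINT w|M. Xt l T j h w * U w) <= (moment_const 2 + 1) / 2 * c"
  by (rule integral_mult_L2_le[OF m(1) Um Xt_square(1)[OF h T] U2(1) Xt_square(2)[OF h T] U2(2) c])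
 have b2: "abs (LINT w|M. X k i w * V w) <= (moment_const 2 + 1) / 2 * c"
  by (rule integral_mult_L2_le[OF m(4) Vm X_square(1)[OF i] V2(1) X_square(2)[OF i] V2(2) c])
 have int: "integrable M (%w. Xt l T j h w * U w)" "integrable M (%w. X k i w * V w)" "integrable M (%w. X j h w * X k i w)"
  using integrable_mult_L2[OF m(1) Um Xt_square(1)[OF h T] U2(1)] integrable_mult_L2[OF m(4) Vm X_square(1)[OF i] V2(1)]
   integrable_mult_L2[OF m(3) m(4) X_square(1)[OF h] X_square(1)[OF i]] by auto
 have "(LINT w|M. Xt l T j h w * Xt l T k i w) = (LINT w|M. Xt l T j h w * U w + X k i w * V w + X j h w * X k i w)"
  unfolding U_def V_def by (simp add: algebra_simps)
 also have "... = (LINT w|M. Xt l T j h w * U w) + (LINT w|M. X k i w * V w) + cross_cov M X h i (k - j)"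
  using int by (simp add: expectation_X_product[OF h i])
 finally show ?thesis using b1 b2 by linarith
qed

end

section \<open>Long-run covariances\<close>

lemma geometric_tail_le:
 fixes \<delta> :: real
 assumes \<delta>: "0 < \<delta>" "\<delta> < 1" and F: "finite F" "\<And>m. m : F ==> int p <= m"
 shows "(SUM m:F. \<delta> ^ nat (abs m)) <= \<delta> ^ p / (1 - \<delta>)"
proof -
 obtain N where N: "\<And>m. m : F ==> m < int p + int N"
 proof -
  have "\<exists>N::nat. ALL m:F. m < int p + int N"
  proof (cases "F = {}")
   case False
   have "m < int p + int (nat (Max F) + 1)" if "m : F" for m
    using Max_ge[OF F(1) that] F(2)[OF that] by linarith
   then show ?thesis by blast
  qed auto
  then show ?thesis using that by blast
 qed
 have "(SUM m:F. \<delta> ^ nat (abs m)) <= (SUM m:(%k. int p + int k) ` {..<N}. \<delta> ^ nat (abs m))"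
 proof (rule sum_mono2)
  show "F \<subseteq> (%k. int p + int k) ` {..<N}"
  proof
   fix m assume m: "m : F"
   have "m = int p + int (nat (m - int p))" "nat (m - int p) < N" using F(2)[OF m] N[OF m] by auto
   then show "m : (%k. int p + int k) ` {..<N}" by blast
  qed
 qed (use \<delta> in auto)
 also have "... = (\<Sum>k<N. \<delta> ^ (p + k))"
  by (subst sum.reindex) (auto simp: inj_on_def nat_add_distrib intro!: sum.cong)
 also have "... = \<delta> ^ p * (\<Sum>k<N. \<delta> ^ k)" by (simp add: power_add sum_distrib_left)
 also have "... <= \<delta> ^ p * (1 / (1 - \<delta>))"
  using \<delta> by (intro mult_left_mono) (auto simp: sum_gp_strict divide_right_mono)
 finally show ?thesis by simp
qed

lemma geometric_neg_tail_le:
 fixes \<delta> :: real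
 assumes \<delta>: "0 < \<delta>" "\<delta> < 1" and F: "finite F" "\<And>m. m : F ==> m <= - int p"
 shows "(SUM m:F. \<delta> ^ nat (abs m)) <= \<delta> ^ p / (1 - \<delta>)"
proof -
 have "(SUM m:F. \<delta> ^ nat (abs m)) = (SUM m:uminus ` F. \<delta> ^ nat (abs m))"
  by (subst sum.reindex) auto
 also have "... <= \<delta> ^ p / (1 - \<delta>)"
 proof (rule geometric_tail_le[OF \<delta>])
  show "int p <= m" if "m : uminus ` F" for m using that F(2) by force
 qed (use F in auto)
 finally show ?thesis .
qed

lemma geometric_two_sided_le:
 fixes \<delta> :: real
 assumes \<delta>: "0 < \<delta>" "\<delta> < 1" and F: "finite F" "\<And>m. m : F ==> int p <= m \<or> m <= - int p'"
 shows "(SUM m:F. \<delta> ^ nat (abs m)) <= (\<delta> ^ p + \<delta> ^ p') / (1 - \<delta>)"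
proof -
 have "(SUM m:F. \<delta> ^ nat (abs m)) = (SUM m:F \<inter> {m. int p <= m}. \<delta> ^ nat (abs m)) + (SUM m:F - {m. int p <= m}. \<delta> ^ nat (abs m))"
  using F(1) by (rule sum.Int_Diff)
 also have "... <= \<delta> ^ p / (1 - \<delta>) + \<delta> ^ p' / (1 - \<delta>)"
  by (intro add_mono geometric_tail_le geometric_neg_tail_le \<delta>) (use F in auto)
 finally show ?thesis by (simp add: add_divide_distrib)
qed

context
 fixes \<phi> :: "int => real" and C \<delta> :: real
 assumes \<delta>: "0 < \<delta>" "\<delta> < 1" and C: "0 <= C" and decay: "\<And>m. abs (\<phi> m) <= C * \<delta> ^ nat (abs m)"
begin

lemma geometric_decay_has_sum: "(\<phi> has_sum (infsum \<phi> UNIV)) UNIV"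
proof -
 let ?A = "(\<delta> ^ 0 + \<delta> ^ 0)"
 have "(%m. C * \<delta> ^ nat (abs m)) summable_on (UNIV :: int set)"
 proof (rule nonneg_bdd_above_summable_on)
  show "bdd_above (sum (%m. C * \<delta> ^ nat (abs m)) ` {F. F \<subseteq> (UNIV :: int set) \<and> finite F})"
  proof (rule bdd_aboveI2)
   fix F :: "int set" assume "F : {F. F \<subseteq> UNIV \<and> finite F}"
   then have "(SUM m:F. \<delta> ^ nat (abs m)) <= ?A / (1 - \<delta>)"
    by (intro geometric_two_sided_le \<delta>) auto
   then have "C * (SUM m:F. \<delta> ^ nat (abs m)) <= C * (?A / (1 - \<delta>))" using C by (rule mult_left_mono)
   then show "(SUM m:F. C * \<delta> ^ nat (abs m)) <= C * (?A / (1 - \<delta>))" by (simp add: sum_distrib_left)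
  qed
 qed (use C \<delta> in auto)
 then have "(%m. norm (\<phi> m)) summable_on UNIV"
  by (rule Infinite_Sum.abs_summable_on_comparison_test') (simp add: decay)
 then have "\<phi> summable_on UNIV"
  by (rule Infinite_Sum.abs_summable_summable)
 then show ?thesis by (rule has_sum_infsum)
qed

text \<open>The missing lags lie beyond the two ends of the window, which gives the two geometric
  tails. The unordered infinite sum is evaluated along symmetric intervals.\<close>

lemma geometric_decay_window:
 assumes j: "a <= j" "j <= c"
 shows "abs (infsum \<phi> UNIV - (\<Sum>k=a..c. \<phi> (k - j))) <= C / (1 - \<delta>) * (\<delta> ^ nat (c - j + 1) + \<delta> ^ nat (j - a + 1))"
proof -
 let ?C = "(\<Sum>k=a..c. \<phi> (k - j))"
 let ?B = "(\<delta> ^ nat (c - j + 1) + \<delta> ^ nat (j - a + 1))"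
 let ?A = "%N. abs ((\<Sum>m=- int N..int N. \<phi> m) - ?C)"
 have "filterlim (%N::nat. {- int N..int N}) (finite_subsets_at_top UNIV) sequentially"
  unfolding filterlim_finite_subsets_at_top
 proof (intro allI impI)
  fix X :: "int set" assume X: "finite X \<and> X \<subseteq> UNIV"
  show "EV N. finite {- int N..int N} \<and> X \<subseteq> {- int N..int N} \<and> {- int N..int N} \<subseteq> UNIV"
  proof -
   have "X \<subseteq> {- int N..int N}" if "N \<ge> nat (Max (abs ` X \<union> {0}))" for N
   proof
    fix x assume "x : X"
    then have "abs x <= Max (abs ` X \<union> {0})" using X by (intro Max_ge) auto
    then show "x : {- int N..int N}" using that by auto
   qed
   then show ?thesis by (auto simp: eventually_sequentially)
  qed
 qed
 then have lim: "(%N. \<Sum>m=- int N..int N. \<phi> m) ----> infsum \<phi> UNIV"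
  using geometric_decay_has_sum unfolding has_sum_def by (rule filterlim_compose[rotated])
 have win: "?C = (\<Sum>m=a-j..c-j. \<phi> m)"
  by (rule sum.reindex_bij_witness[of _ "%m. m + j" "%k. k - j"]) auto
 have bound: "?A N <= C / (1 - \<delta>) * ?B"
  if N: "int N \<ge> j - a" "int N \<ge> c - j" for N
 proof -
  have "(\<Sum>m=- int N..int N. \<phi> m) - (\<Sum>m=a-j..c-j. \<phi> m) = (SUM m:{- int N..int N} - {a-j..c-j}. \<phi> m)"
   using N by (intro sum_diff[symmetric]) auto
  also have "abs (...) <= (SUM m:{- int N..int N} - {a-j..c-j}. C * \<delta> ^ nat (abs m))"
   by (intro order_trans[OF sum_abs] sum_mono decay)
  also have "... = C * (SUM m:{- int N..int N} - {a-j..c-j}. \<delta> ^ nat (abs m))" by (simp add: sum_distrib_left)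
  also have "... <= C * (?B / (1 - \<delta>))"
   by (intro mult_left_mono C geometric_two_sided_le \<delta>) (use j in auto)
  finally show ?thesis by (simp add: win)
 qed
 have "(%N. ?A N) ----> abs (infsum \<phi> UNIV - ?C)"
  by (intro tendsto_intros lim)
 then show ?thesis
 proof (rule LIMSEQ_le_const2)
  show "\<exists>N0. \<forall>N\<ge>N0. ?A N <= C / (1 - \<delta>) * ?B"
   by (intro exI[of _ "nat (j - a) + nat (c - j)"] allI impI bound) auto
 qed
qed

text \<open>Only times near the ends feel the truncation, so the total error is bounded
  independently of the length of the window.\<close>

lemma geometric_decay_window_sum:
 "(\<Sum>j=a..c. abs (infsum \<phi> UNIV - (\<Sum>k=a..c. \<phi> (k - j)))) <= 2 * C / (1 - \<delta>)^2"
proof -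
 let ?C = "(\<Sum>m=1..c-a+1. \<delta> ^ nat (abs m))"
 let ?B = "(\<Sum>j=a..c. \<delta> ^ nat (j - a + 1))"
 let ?A = "(\<Sum>j=a..c. \<delta> ^ nat (c - j + 1))"
 have g1: "?A <= 1 / (1 - \<delta>)"
 proof -
  have "?A = ?C"
   by (rule sum.reindex_bij_witness[of _ "%m. c - m + 1" "%j. c - j + 1"]) auto
  also have "... <= \<delta> ^ 0 / (1 - \<delta>)" by (rule geometric_tail_le[OF \<delta>]) auto
  finally show ?thesis by simp
 qed
 have g2: "?B <= 1 / (1 - \<delta>)"
 proof -
  have "?B = ?C"
   by (rule sum.reindex_bij_witness[of _ "%m. m + a - 1" "%j. j - a + 1"]) auto
  also have "... <= \<delta> ^ 0 / (1 - \<delta>)" by (rule geometric_tail_le[OF \<delta>]) auto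
  finally show ?thesis by simp
 qed
 have "(\<Sum>j=a..c. abs (infsum \<phi> UNIV - (\<Sum>k=a..c. \<phi> (k - j)))) <= (\<Sum>j=a..c. C / (1 - \<delta>) * (\<delta> ^ nat (c - j + 1) + \<delta> ^ nat (j - a + 1)))"
  by (intro sum_mono geometric_decay_window) auto
 also have "... = C / (1 - \<delta>) * (?A + ?B)"
  by (simp only: sum_distrib_left[symmetric] sum.distrib)
 also have "... <= C / (1 - \<delta>) * (1 / (1 - \<delta>) + 1 / (1 - \<delta>))"
  using C \<delta> g1 g2 by (intro mult_left_mono add_mono) auto
 also have "... = 2 * C / (1 - \<delta>)^2" by (simp add: power2_eq_square)
 finally show ?thesis .
qed

text \<open>\<open>m * s ^ m <= 1 / (1 - s)\<close> with \<open>s = sqrt \<delta>\<close> absorbs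
  the factor \<open>|k - j|\<close> at the price of half of the decay rate.\<close>

lemma geometric_decay_lag_sum:
 assumes J: "finite J"
 shows "(SUM k:J. of_int (abs (k - j)) * abs (\<phi> (k - j))) <= 2 * C / (1 - sqrt \<delta>)^2"
proof -
 define s where "s = sqrt \<delta>"
 have s: "0 < s" "s < 1" "\<delta> = s^2" using \<delta> by (auto simp: s_def)
 have ms: "real m * s ^ m <= 1 / (1 - s)" for m
 proof -
  have "real m * s ^ m = (\<Sum>i<m. s ^ m)" by simp
  also have "... <= (\<Sum>i<m. s ^ i)" using s by (intro sum_mono power_decreasing) auto
  also have "... <= 1 / (1 - s)" using s by (simp add: sum_gp_strict divide_right_mono)
  finally show ?thesis .
 qed
 have "(SUM k:J. of_int (abs (k - j)) * abs (\<phi> (k - j))) <= (SUM k:J. C / (1 - s) * s ^ nat (abs (k - j)))"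
 proof (rule sum_mono)
  fix k
  define m where "m = nat (abs (k - j))"
  have mi: "real_of_int (abs (k - j)) = real m" by (simp add: m_def)
  have "real m * abs (\<phi> (k - j)) <= real m * (C * \<delta> ^ m)" unfolding m_def by (intro mult_left_mono decay) auto
  also have "... = C * (real m * s ^ m) * s ^ m" by (simp add: s power_mult[symmetric] power_add[symmetric] mult_2)
  also have "... <= C * (1 / (1 - s)) * s ^ m" using ms C s by (intro mult_right_mono mult_left_mono) auto
  finally show "of_int (abs (k - j)) * abs (\<phi> (k - j)) <= C / (1 - s) * s ^ nat (abs (k - j))" by (simp add: mi m_def)
 qed
 also have "... = C / (1 - s) * (SUM m:(%k. k - j) ` J. s ^ nat (abs m))"
  by (subst sum.reindex) (auto simp: inj_on_def sum_distrib_left)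
 also have "... <= C / (1 - s) * ((s ^ 0 + s ^ 0) / (1 - s))"
  using J s C by (intro mult_left_mono geometric_two_sided_le) auto
 also have "... = 2 * C / (1 - s)^2" by (simp add: power2_eq_square)
 finally show ?thesis by (simp add: s_def)
qed

text \<open>Freezing the second weight at \<open>j\<close> produces the full covariance series times
  the sum of \<open>\<alpha> j * \<beta> j\<close>, up to the end effects of the window. The
  Lipschitz bound pays for the freezing through the lag-weighted series.\<close>

lemma weighted_window_covariance:
 fixes \<alpha> \<beta> :: "int => real"
 assumes al: "\<And>j. j : {a..c} ==> abs (\<alpha> j) <= V" and be: "\<And>j. j : {a..c} ==> abs (\<beta> j) <= V"
  and lip: "\<And>j k. j : {a..c} ==> k : {a..c} ==> abs (\<beta> k - \<beta> j) <= W * of_int (abs (k - j))" and V: "0 <= V" and W: "0 <= W"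
 shows "abs ((\<Sum>j=a..c. \<Sum>k=a..c. \<alpha> j * \<beta> k * \<phi> (k - j)) - infsum \<phi> UNIV * (\<Sum>j=a..c. \<alpha> j * \<beta> j))
  <= V * W * real (card {a..c}) * (2 * C / (1 - sqrt \<delta>)^2) + V^2 * (2 * C / (1 - \<delta>)^2)"
proof -
 let ?A = "(2 * C / (1 - sqrt \<delta>)^2)"
 let ?g = "infsum \<phi> UNIV"
 let ?B = "%a c j. abs (?g - (\<Sum>k=a..c. \<phi> (k - j)))"
 have eq: "(\<Sum>j=a..c. \<Sum>k=a..c. \<alpha> j * \<beta> k * \<phi> (k - j)) - ?g * (\<Sum>j=a..c. \<alpha> j * \<beta> j)
  = (\<Sum>j=a..c. \<alpha> j * (\<Sum>k=a..c. (\<beta> k - \<beta> j) * \<phi> (k - j)) - \<alpha> j * \<beta> j * (?g - (\<Sum>k=a..c. \<phi> (k - j))))"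
  unfolding sum_distrib_left sum_subtractf[symmetric]
  by (intro sum.cong refl) (simp add: sum_distrib_left sum_subtractf algebra_simps)
 have "abs (\<alpha> j * (\<Sum>k=a..c. (\<beta> k - \<beta> j) * \<phi> (k - j)) - \<alpha> j * \<beta> j * (?g - (\<Sum>k=a..c. \<phi> (k - j))))
  <= V * (W * ?A) + V^2 * ?B a c j" if j: "j : {a..c}" for j
 proof -
  have "abs (\<Sum>k=a..c. (\<beta> k - \<beta> j) * \<phi> (k - j)) <= (\<Sum>k=a..c. W * (of_int (abs (k - j)) * abs (\<phi> (k - j))))"
  proof (intro order_trans[OF sum_abs] sum_mono)
   fix k assume "k : {a..c}"
   from mult_right_mono[OF lip[OF j this], of "abs (\<phi> (k - j))"]
   show "abs ((\<beta> k - \<beta> j) * \<phi> (k - j)) <= W * (of_int (abs (k - j)) * abs (\<phi> (k - j)))" by (simp add: abs_mult mult.assoc)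
  qed
  also have "... <= W * ?A"
   unfolding sum_distrib_left[symmetric] using W by (intro mult_left_mono geometric_decay_lag_sum) auto
  finally have "abs (\<alpha> j) * abs (\<Sum>k=a..c. (\<beta> k - \<beta> j) * \<phi> (k - j)) <= V * (W * ?A)"
   using al[OF j] V by (intro mult_mono) auto
  moreover have "abs (\<alpha> j) * abs (\<beta> j) * ?B a c j <= V^2 * ?B a c j"
   unfolding power2_eq_square using al[OF j] be[OF j] V by (intro mult_right_mono mult_mono) auto
  ultimately show ?thesis
   by (intro order_trans[OF abs_triangle_ineq4]) (simp add: abs_mult)
 qed
 then have "abs ((\<Sum>j=a..c. \<Sum>k=a..c. \<alpha> j * \<beta> k * \<phi> (k - j)) - ?g * (\<Sum>j=a..c. \<alpha> j * \<beta> j))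
  <= (\<Sum>j=a..c. V * (W * ?A) + V^2 * ?B a c j)"
  unfolding eq by (intro order_trans[OF sum_abs] sum_mono) auto
 also have "... = V * W * real (card {a..c}) * ?A + V^2 * (\<Sum>j=a..c. ?B a c j)"
  by (simp add: sum.distrib sum_distrib_left mult_ac)
 also have "... <= V * W * real (card {a..c}) * ?A + V^2 * (2 * C / (1 - \<delta>)^2)"
  by (intro add_left_mono mult_left_mono geometric_decay_window_sum) auto
 finally show ?thesis .
qed

end

section \<open>Weights of the linearised statistic\<close>

definition pw :: "real => (real => real) => (real => real) => real => real" where
 "pw t f1 f2 x = (if x <= t then f1 x else f2 x)"

text \<open>A mean value theorem across the gluing point: if \<open>t\<close> lies inside the
  interval, the mean values on the two sides are averaged with weights proportional to the lengths
  of the two pieces.\<close>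

lemma pw_increment:
 assumes d1: "\<And>x. DERIV F1 x :> f1 x" and d2: "\<And>x. DERIV F2 x :> f2 x"
  and eq: "F1 t = F2 t" and xy: "x < y"
 obtains \<xi> \<zeta> tt where "x <= \<xi>" "\<xi> <= y" "x <= \<zeta>" "\<zeta> <= y" "0 <= tt" "tt <= 1"
  "pw t F1 F2 y - pw t F1 F2 x = (y - x) * (tt * pw t f1 f2 \<xi> + (1 - tt) * pw t f1 f2 \<zeta>)"
proof -
 consider "y <= t" | "t <= x" | "x < t" "t < y" by linarith
 then show ?thesis
 proof cases
  case 1
  obtain z where "x < z" "z < y" "F1 y - F1 x = (y - x) * f1 z" using MVT2[OF xy d1] by blast
  then show ?thesis using 1 by (intro that[of z z 1]) (auto simp: pw_def)
 next
  case 2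
  obtain z where z: "x < z" "z < y" "F2 y - F2 x = (y - x) * f2 z" using MVT2[OF xy d2] by blast
  have "pw t F1 F2 x = F2 x" using 2 eq by (cases "x = t") (auto simp: pw_def)
  then show ?thesis using 2 z xy by (intro that[of z z 1]) (auto simp: pw_def)
 next
  case 3
  obtain z1 where z1: "x < z1" "z1 < t" "F1 t - F1 x = (t - x) * f1 z1" using MVT2[OF 3(1) d1] by blast
  obtain z2 where z2: "t < z2" "z2 < y" "F2 y - F2 t = (y - t) * f2 z2" using MVT2[OF 3(2) d2] by blast
  define tt where "tt = (t - x) / (y - x)"
  have th: "0 <= tt" "tt <= 1" "(y - x) * tt = t - x" using 3 by (auto simp: tt_def field_simps)
  have "(y - x) * (tt * f1 z1 + (1 - tt) * f2 z2) = ((y - x) * tt) * f1 z1 + ((y - x) - (y - x) * tt) * f2 z2"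
   by (simp add: algebra_simps)
  also have "... = (t - x) * f1 z1 + (y - t) * f2 z2" unfolding th(3) by simp
  finally have "(y - x) * (tt * f1 z1 + (1 - tt) * f2 z2) = F2 y - F1 x" using z1 z2 eq by simp
  then show ?thesis using 3 z1 z2 th(1,2) by (intro that[of z1 z2 tt]) (auto simp: pw_def)
 qed
qed

lemma pw_riemann_step:
 assumes d: "\<And>x. DERIV F1 x :> f1 x" "\<And>x. DERIV F2 x :> f2 x"
  and eq: "F1 t = F2 t" and xy: "0 <= x" "x < y" "y <= 1"
  and lip: "\<And>x y. 0 <= x ==> x <= 1 ==> 0 <= y ==> y <= 1 ==> abs (pw t f1 f2 x - pw t f1 f2 y) <= L * abs (x - y)" and L: "0 <= L"
 shows "abs (pw t F1 F2 y - pw t F1 F2 x - (y - x) * pw t f1 f2 x) <= L * (y - x)^2"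
proof -
 obtain \<xi> \<zeta> tt where z: "x <= \<xi>" "\<xi> <= y" "x <= \<zeta>" "\<zeta> <= y" "0 <= tt" "tt <= 1"
  "pw t F1 F2 y - pw t F1 F2 x = (y - x) * (tt * pw t f1 f2 \<xi> + (1 - tt) * pw t f1 f2 \<zeta>)"
  using pw_increment[OF d eq xy(2)] by blast
 let ?A = "%x. abs (tt * (pw t f1 f2 \<xi> - pw t f1 f2 x) + (1 - tt) * (pw t f1 f2 \<zeta> - pw t f1 f2 x))"
 have b: "abs (pw t f1 f2 w - pw t f1 f2 x) <= L * (y - x)" if "x <= w" "w <= y" for w
 proof -
  have "abs (pw t f1 f2 w - pw t f1 f2 x) <= L * abs (w - x)" using lip[of w x] that xy by auto
  also have "... <= L * (y - x)" using that L by (intro mult_left_mono) auto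
  finally show ?thesis .
 qed
 have "?A x <= tt * (L * (y - x)) + (1 - tt) * (L * (y - x))"
  using z b[of \<xi>] b[of \<zeta>] by (intro order_trans[OF abs_triangle_ineq] add_mono) (auto simp: abs_mult intro!: mult_left_mono)
 also have "... = L * (y - x)" by (simp add: algebra_simps)
 finally have e: "?A x <= L * (y - x)" .
 have "pw t F1 F2 y - pw t F1 F2 x - (y - x) * pw t f1 f2 x = (y - x) * (tt * (pw t f1 f2 \<xi> - pw t f1 f2 x) + (1 - tt) * (pw t f1 f2 \<zeta> - pw t f1 f2 x))"
  unfolding z(7) by (simp add: algebra_simps)
 also have "abs (...) <= (y - x) * (L * (y - x))" unfolding abs_mult using xy e by (intro mult_mono) auto
 finally show ?thesis by (simp add: power2_eq_square mult_ac)
qed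

text \<open>Left-endpoint sums of a Lipschitz integrand with glued antiderivative; each of the at
  most \<open>n\<close> steps errs by \<open>L / n^2\<close>.\<close>

lemma pw_riemann_sum:
 assumes d: "\<And>x. DERIV F1 x :> f1 x" "\<And>x. DERIV F2 x :> f2 x"
  and eq: "F1 t = F2 t"
  and lip: "\<And>x y. 0 <= x ==> x <= 1 ==> 0 <= y ==> y <= 1 ==> abs (pw t f1 f2 x - pw t f1 f2 y) <= L * abs (x - y)" and L: "0 <= L"
  and n: "0 < n" and im: "i <= m" "m <= n"
 shows "abs (pw t F1 F2 (real m / real n) - pw t F1 F2 (real i / real n) - (\<Sum>k=i..<m. pw t f1 f2 (real k / real n)) / real n) <= L / real n"
proof -
 define P where "P k = pw t F1 F2 (real k / real n)" for k
 define p where "p k = pw t f1 f2 (real k / real n)" for k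
 have step: "abs (P (Suc k) - P k - p k / real n) <= L / (real n)^2" if "k < n" for k
 proof -
  have eqn: "real (Suc k) / real n - real k / real n = 1 / real n" by (simp add: diff_divide_distrib[symmetric])
  have "abs (P (Suc k) - P k - (real (Suc k) / real n - real k / real n) * p k) <= L * (real (Suc k) / real n - real k / real n)^2"
   unfolding P_def p_def
   by (rule pw_riemann_step[OF d eq _ _ _ lip L]) (use that n assms(3) in \<open>auto simp: divide_strict_right_mono divide_le_eq\<close>)
  then show ?thesis unfolding eqn by (simp add: power_divide)
 qed
 have "P m - P i - (\<Sum>k=i..<m. p k) / real n = (\<Sum>k=i..<m. P (Suc k) - P k - p k / real n)"
  using sum_Suc_diff'[OF im(1), of P] by (simp add: sum_subtractf sum_divide_distrib)
 also have "abs (...) <= (\<Sum>k=i..<m. L / (real n)^2)"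
  using im by (intro order_trans[OF sum_abs] sum_mono step) auto
 also have "... = real (m - i) * (L / (real n)^2)" by simp
 also have "... <= real n * (L / (real n)^2)" using im L by (intro mult_right_mono) auto
 also have "... = L / real n" using n by (simp add: power2_eq_square)
 finally show ?thesis by (simp add: P_def p_def)
qed

text \<open>\<open>min s t - s * t\<close>, the CUSUM transform of a unit drop at time
  \<open>t\<close> in the limit of continuous time. \<open>tent_int\<close> is its antiderivative
  that vanishes at 0.\<close>

definition tent :: "real => real => real" where
 "tent t = pw t (%s. (1 - t) * s) (%s. t * (1 - s))"

definition tent_int :: "real => real => real" where
 "tent_int t = pw t (%s. (1 - t) * s^2 / 2) (%s. t * (1 - t) / 2 - t * (1 - s)^2 / 2)"

text \<open>\<open>limit_weight t x\<close> is \<open>\<integral>\<^sub>x\<^sup>1 tent t - \<integral>\<^sub>0\<^sup>1 s * tent t s ds\<close>.\<close>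

definition limit_weight :: "real => real => real" where
 "limit_weight t x = t * (1 - t) / 2 - tent_int t x - t * (1 - t^2) / 6"

context
 fixes t :: real
 assumes t: "0 < t" "t < 1"
begin

lemma tent_min: "tent t s = min s t - s * t"
 by (auto simp: tent_def pw_def min_def algebra_simps)

lemma tent_range: "0 <= s ==> s <= 1 ==> 0 <= tent t s \<and> tent t s <= 1"
proof -
 assume s: "0 <= s" "s <= 1"
 have "(1 - t) * s <= 1 * 1" "t * (1 - s) <= 1 * 1" by (intro mult_mono; use s t in auto)+
 then show ?thesis using s t by (auto simp: tent_def pw_def)
qed

lemma tent_lip: "abs (tent t x - tent t y) <= 1 * abs (x - y)"
proof -
 have *: "abs (tent t x - tent t y) <= abs (x - y)" if "x <= y" for x y
 proof -
  have "min x t <= min y t" "min y t - min x t <= y - x" using that by auto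
  moreover have "t * (y - x) <= 1 * (y - x)" "0 <= t * (y - x)" using t that by (intro mult_right_mono mult_nonneg_nonneg; auto)+
  ultimately show ?thesis unfolding tent_min using that by (auto simp: algebra_simps abs_if)
 qed
 show ?thesis using *[of x y] *[of y x] by (cases "x <= y") (auto simp: abs_minus_commute)
qed

lemma lip_mult:
 fixes f g :: "real => real"
 assumes "abs (f x) <= 1" "abs (g y) <= 1" "abs (f x - f y) <= abs (x - y)" "abs (g x - g y) <= abs (x - y)"
 shows "abs (f x * g x - f y * g y) <= 2 * abs (x - y)"
proof -
 have "f x * g x - f y * g y = f x * (g x - g y) + (f x - f y) * g y" by (simp add: algebra_simps)
 also have "abs (...) <= abs (f x) * abs (g x - g y) + abs (f x - f y) * abs (g y)" unfolding abs_mult[symmetric] by (rule abs_triangle_ineq)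
 also have "... <= 1 * abs (x - y) + abs (x - y) * 1" by (intro add_mono mult_mono assms) auto
 finally show ?thesis by simp
qed

lemma tent_int_lip: "0 <= x ==> x <= 1 ==> 0 <= y ==> y <= 1 ==> abs (tent_int t x - tent_int t y) <= abs (x - y)"
proof -
 have *: "abs (tent_int t y - tent_int t x) <= y - x" if "0 <= x" "x < y" "y <= 1" for x y
 proof -
  obtain \<xi> \<zeta> tt where z: "x <= \<xi>" "\<xi> <= y" "x <= \<zeta>" "\<zeta> <= y" "0 <= tt" "tt <= 1"
   "tent_int t y - tent_int t x = (y - x) * (tt * tent t \<xi> + (1 - tt) * tent t \<zeta>)"
   unfolding tent_int_def tent_def
  proof (rule pw_increment[OF _ _ _ \<open>x < y\<close>, where ?F1.0 = "%s. (1 - t) * s^2 / 2" and ?f1.0 = "%s. (1 - t) * s"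
     and ?F2.0 = "%s. t * (1 - t) / 2 - t * (1 - s)^2 / 2" and ?f2.0 = "%s. t * (1 - s)" and t = t])
   show "((%s. (1 - t) * s^2 / 2) has_real_derivative (1 - t) * x) (at x)" for x by (auto intro!: derivative_eq_intros)
   show "((%s. t * (1 - t) / 2 - t * (1 - s)^2 / 2) has_real_derivative t * (1 - x)) (at x)" for x by (auto intro!: derivative_eq_intros simp: field_simps)
   show "(1 - t) * t^2 / 2 = t * (1 - t) / 2 - t * (1 - t)^2 / 2" by (simp add: power2_eq_square field_simps)
  qed blast
  have "0 <= tent t \<xi>" "tent t \<xi> <= 1" "0 <= tent t \<zeta>" "tent t \<zeta> <= 1" using tent_range z that by auto
  then have "abs (tt * tent t \<xi> + (1 - tt) * tent t \<zeta>) <= tt * 1 + (1 - tt) * 1"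
   using z by (intro order_trans[OF abs_triangle_ineq] add_mono) (auto simp: abs_mult intro!: mult_left_le)
  then have "(y - x) * abs (tt * tent t \<xi> + (1 - tt) * tent t \<zeta>) <= (y - x) * 1" using that by (intro mult_left_mono) auto
  then show ?thesis using z that by (simp add: abs_mult)
 qed
 assume "0 <= x" "x <= 1" "0 <= y" "y <= 1"
 then show ?thesis using *[of x y] *[of y x] by (cases x y rule: linorder_cases) (auto simp: abs_minus_commute)
qed

lemma tent_riemann:
 assumes n: "0 < n" and im: "i <= n"
 shows "abs (tent_int t 1 - tent_int t (real i / real n) - (\<Sum>k=i..<n. tent t (real k / real n)) / real n) <= 1 / real n"
proof -
 have "abs (pw t (%s. (1 - t) * s^2 / 2) (%s. t * (1 - t) / 2 - t * (1 - s)^2 / 2) (real n / real n) -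
  pw t (%s. (1 - t) * s^2 / 2) (%s. t * (1 - t) / 2 - t * (1 - s)^2 / 2) (real i / real n)
  - (\<Sum>k=i..<n. pw t (%s. (1 - t) * s) (%s. t * (1 - s)) (real k / real n)) / real n) <= 1 / real n"
 proof (rule pw_riemann_sum[OF _ _ _ _ _ n im order_refl])
  show "((%s. (1 - t) * s^2 / 2) has_real_derivative (1 - t) * x) (at x)" for x by (auto intro!: derivative_eq_intros)
  show "((%s. t * (1 - t) / 2 - t * (1 - s)^2 / 2) has_real_derivative t * (1 - x)) (at x)" for x by (auto intro!: derivative_eq_intros simp: field_simps)
  show "(1 - t) * t^2 / 2 = t * (1 - t) / 2 - t * (1 - t)^2 / 2" by (simp add: power2_eq_square field_simps)
 qed (use tent_lip in \<open>auto simp: tent_def\<close>)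
 then show ?thesis using n by (simp add: tent_def tent_int_def)
qed

text \<open>The limit \<open>(t * (1 - t))^2 / 3\<close> is the integral of the squared tent; it is
  the origin of the factor \<open>3 / (t * (1 - t))^2\<close> in the statistic.\<close>

lemma tent_square_riemann:
 assumes n: "0 < n"
 shows "abs ((t * (1 - t))\<^sup>2 / 3 - (\<Sum>k<n. (tent t (real k / real n))^2) / real n) <= 2 / real n"
proof -
 let ?F1 = "%s. (1 - t)^2 * s ^ 3 / 3" and ?F2 = "%s. (1 - t)^2 * t ^ 3 / 3 + t^2 * ((1 - t) ^ 3 - (1 - s) ^ 3) / 3"
 let ?f1 = "%s. ((1 - t) * s)^2" and ?f2 = "%s. (t * (1 - s))^2"
 have sq: "pw t ?f1 ?f2 x = (tent t x)^2" for x by (simp add: tent_def pw_def)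
 have "abs (pw t ?F1 ?F2 (real n / real n) - pw t ?F1 ?F2 (real 0 / real n) - (\<Sum>k=0..<n. pw t ?f1 ?f2 (real k / real n)) / real n) <= 2 / real n"
 proof (rule pw_riemann_sum[OF _ _ _ _ _ n le0 order_refl])
  show "DERIV ?F1 x :> ?f1 x" for x by (auto intro!: derivative_eq_intros simp: power2_eq_square)
  show "DERIV ?F2 x :> ?f2 x" for x by (auto intro!: derivative_eq_intros simp: power2_eq_square)
  show "abs (pw t ?f1 ?f2 x - pw t ?f1 ?f2 y) <= 2 * abs (x - y)" if "0 <= x" "x <= 1" "0 <= y" "y <= 1" for x y
   unfolding sq unfolding power2_eq_square using tent_range that tent_lip[of x y] by (intro lip_mult) auto
 qed auto
 moreover have "pw t ?F1 ?F2 (real n / real n) - pw t ?F1 ?F2 (real 0 / real n) = (t * (1 - t))^2 / 3"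
  using n t by (simp add: pw_def power2_eq_square power3_eq_cube field_simps)
 ultimately show ?thesis by (simp only: sq atLeast0LessThan)
qed

lemma tent_moment_riemann:
 assumes n: "0 < n"
 shows "abs (t * (1 - t^2) / 6 - (\<Sum>k<n. real k / real n * tent t (real k / real n)) / real n) <= 2 / real n"
proof -
 let ?F1 = "%s. (1 - t) * s ^ 3 / 3" and ?F2 = "%s. (1 - t) * t ^ 3 / 3 + t * (s^2 / 2 - s ^ 3 / 3 - t^2 / 2 + t ^ 3 / 3)"
 let ?f1 = "%s. s * ((1 - t) * s)" and ?f2 = "%s. s * (t * (1 - s))"
 have sq: "pw t ?f1 ?f2 x = x * tent t x" for x by (simp add: tent_def pw_def)
 have "abs (pw t ?F1 ?F2 (real n / real n) - pw t ?F1 ?F2 (real 0 / real n) - (\<Sum>k=0..<n. pw t ?f1 ?f2 (real k / real n)) / real n) <= 2 / real n"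
 proof (rule pw_riemann_sum[OF _ _ _ _ _ n le0 order_refl])
  show "DERIV ?F1 x :> ?f1 x" for x by (auto intro!: derivative_eq_intros simp: power2_eq_square)
  show "DERIV ?F2 x :> ?f2 x" for x by (auto intro!: derivative_eq_intros simp: power2_eq_square algebra_simps)
  show "abs (pw t ?f1 ?f2 x - pw t ?f1 ?f2 y) <= 2 * abs (x - y)" if "0 <= x" "x <= 1" "0 <= y" "y <= 1" for x y
   unfolding sq using tent_range that tent_lip[of x y] by (intro lip_mult) auto
 qed auto
 moreover have "pw t ?F1 ?F2 (real n / real n) - pw t ?F1 ?F2 (real 0 / real n) = t * (1 - t^2) / 6"
  using n t by (simp add: pw_def power2_eq_square power3_eq_cube field_simps)
 ultimately show ?thesis by (simp only: sq atLeast0LessThan)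
qed

lemma limit_weight_pw:
 "limit_weight t = pw t (%x. t * (1 - t) * (2 - t) / 6 - (1 - t) * x^2 / 2) (%x. t * (1 - x)^2 / 2 - t * (1 - t^2) / 6)"
 by (auto simp: limit_weight_def tent_int_def pw_def fun_eq_iff field_simps power2_eq_square)

lemma limit_weight_lip:
 "0 <= x ==> x <= 1 ==> 0 <= y ==> y <= 1 ==> abs (limit_weight t x - limit_weight t y) <= abs (x - y)"
 using tent_int_lip[of x y] by (simp add: limit_weight_def abs_minus_commute)

lemma limit_weight_bound:
 assumes "0 <= x" "x <= 1"
 shows "abs (limit_weight t x) <= 1"
proof -
 have a: "0 <= t * (1 - t)" "t * (1 - t) <= 1 * 1" using t by (simp, intro mult_mono, auto)
 have t2: "0 <= 1 - t^2" "1 - t^2 <= 1" using t by (auto simp: power_le_one)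
 have b: "0 <= t * (1 - t^2)" using t t2 by (intro mult_nonneg_nonneg) auto
 have b': "t * (1 - t^2) <= 1 * 1" using t t2 by (intro mult_mono) auto
 have "tent_int t 0 = 0" using t by (simp add: tent_int_def pw_def)
 have "abs (tent_int t x) <= t * (1 - t) / 2 \<and> 0 <= tent_int t x"
 proof (cases "x <= t")
  case True
  have "x^2 <= t * 1" unfolding power2_eq_square using True assms t by (intro mult_mono) auto
  then have "(1 - t) * x^2 <= (1 - t) * t" using t by (intro mult_left_mono) auto
  then show ?thesis using True t by (auto simp: tent_int_def pw_def abs_mult mult.commute)
 next
  case False
  have "(1 - x)^2 <= (1 - t) * 1" unfolding power2_eq_square using False assms t by (intro mult_mono) auto
  then have "t * (1 - x)^2 <= t * (1 - t)" "0 <= t * (1 - x)^2" using t by (auto intro!: mult_left_mono)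
  then show ?thesis using False by (auto simp: tent_int_def pw_def)
 qed
 then show ?thesis using a b b' unfolding limit_weight_def by (auto simp: abs_le_iff)
qed

text \<open>The constant of the asymptotic variance: multiplied by the square of
  \<open>6 / (tau t * (t * (1 - t))^2)\<close> it becomes 1, which explains the form of
  \<open>tau\<close>. The square is a polynomial of degree 4 on either side of \<open>t\<close>, so
  its antiderivatives are explicit.\<close>

lemma limit_weight_square_riemann:
 assumes n: "0 < n"
 shows "abs ((t * (1 - t))\<^sup>2 * (1 + 2 * t * (1 - t)) / 45 - (\<Sum>k<n. (limit_weight t (real k / real n))^2) / real n) <= 2 / real n"
proof -
 define e where "e = t * (1 - t) * (2 - t) / 6"
 define q where "q = t * (1 - t^2) / 6"
 let ?f1 = "%x. (e - (1 - t) * x^2 / 2)^2" and ?f2 = "%x. (t * (1 - x)^2 / 2 - q)^2"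
 let ?F1 = "%x. e^2 * x - e * (1 - t) * x ^ 3 / 3 + (1 - t)^2 * x ^ 5 / 20"
 let ?G2 = "%x. - t\<^sup>2 * (1 - x) ^ 5 / 20 + t * q * (1 - x) ^ 3 / 3 + q^2 * x"
 \<comment> \<open>\<open>?G2\<close> is an antiderivative for the right branch, shifted here so
   that the two branches meet at \<open>t\<close>.\<close>
 let ?F2 = "%x. ?G2 x + (?F1 t - ?G2 t)"
 have sq: "pw t ?f1 ?f2 x = (limit_weight t x)^2" for x by (simp add: limit_weight_pw pw_def e_def q_def)
 have "abs (pw t ?F1 ?F2 (real n / real n) - pw t ?F1 ?F2 (real 0 / real n) - (\<Sum>k=0..<n. pw t ?f1 ?f2 (real k / real n)) / real n) <= 2 / real n"
 proof (rule pw_riemann_sum[OF _ _ _ _ _ n le0 order_refl])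
  show "DERIV ?F1 x :> ?f1 x" for x
   by (rule derivative_eq_intros refl | simp)+ (simp add: power2_eq_square eval_nat_numeral algebra_simps)
  show "DERIV ?F2 x :> ?f2 x" for x
   by (rule derivative_eq_intros refl | simp)+ (simp add: power2_eq_square eval_nat_numeral algebra_simps)
  show "abs (pw t ?f1 ?f2 x - pw t ?f1 ?f2 y) <= 2 * abs (x - y)" if "0 <= x" "x <= 1" "0 <= y" "y <= 1" for x y
   unfolding sq unfolding power2_eq_square using limit_weight_bound that limit_weight_lip[of x y] by (intro lip_mult) auto
 qed auto
 moreover have "pw t ?F1 ?F2 (real n / real n) - pw t ?F1 ?F2 (real 0 / real n) = (t * (1 - t))^2 * (1 + 2 * t * (1 - t)) / 45"
 proof -
  have "pw t ?F1 ?F2 (real n / real n) - pw t ?F1 ?F2 (real 0 / real n) = ?F2 1" using n t by (simp add: pw_def)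
  also have "... = (t * (1 - t))^2 * (1 + 2 * t * (1 - t)) / 45"
   unfolding e_def q_def by (simp add: field_simps power2_eq_square eval_nat_numeral)
  finally show ?thesis .
 qed
 ultimately show ?thesis by (simp only: sq atLeast0LessThan)
qed

end

definition cpart :: "nat => (nat => real) => nat => real" where
 "cpart n z k = (\<Sum>j=1..k. z j) / real n - real k / (real n)^2 * (\<Sum>j=1..n. z j)"

text \<open>The CUSUM process is constant between consecutive multiples of \<open>1 / n\<close>, so
  the integral is a finite sum. At the right endpoint \<open>s = 1\<close> the process is 0, which
  makes the closed interval agree with the sum over \<open>k < n\<close>.\<close>

lemma integral_cusum_square:
 assumes n: "0 < n"
 shows "(LBINT s:{0..1}. (cusum n z s)^2) = (\<Sum>k<n. (cpart n z k)^2) / real n"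
proof -
 let ?A = "%s. (\<Sum>k<n. (cpart n z k)^2 * indicator {real k / real n..<(real k + 1) / real n} s)"
 have cn: "cpart n z n = 0" using n by (simp add: cpart_def power2_eq_square)
 have cu: "cusum n z s = cpart n z (nat \<lfloor>real n * s\<rfloor>)" if "0 <= s" for s
 proof -
  have "0 <= \<lfloor>real n * s\<rfloor>" using that by simp
  then have "real_of_int \<lfloor>real n * s\<rfloor> = real (nat \<lfloor>real n * s\<rfloor>)" by simp
  then show ?thesis by (simp only: cusum_def cpart_def)
 qed
 have eq: "indicator {0..1} s *\<^sub>R (cusum n z s)\<^sup>2 = ?A s" for s
 proof (cases "0 <= s")
  case True
  define K where "K = nat \<lfloor>real n * s\<rfloor>"
  have ns: "0 <= real n * s" using True by simp
  have ind: "indicator {real k / real n..<(real k + 1) / real n} s = (if k = K then 1 else 0 :: real)" for k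
  proof -
   have "s : {real k / real n..<(real k + 1) / real n} \<longleftrightarrow> real k <= real n * s \<and> real n * s < real k + 1"
    using n by (auto simp: field_simps)
   also have "... \<longleftrightarrow> \<lfloor>real n * s\<rfloor> = int k" by (auto simp: floor_eq_iff)
   also have "... \<longleftrightarrow> k = K" using ns by (auto simp: K_def)
   finally show ?thesis by (simp add: indicator_def)
  qed
  have "?A s = (if K < n then (cpart n z K)^2 else 0)"
   unfolding ind by (simp add: if_distrib[of "%x. _ * x"] sum.delta' cong: if_cong)
  also have "... = indicator {0..1} s *\<^sub>R (cusum n z s)\<^sup>2"
  proof (cases "s < 1")
   case True
   then have "real n * s < real n" using n by simp
   then have "\<lfloor>real n * s\<rfloor> < int n" by linarith
   then have "K < n" using ns by (simp add: K_def nat_less_iff)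
   then show ?thesis using True \<open>0 <= s\<close> by (simp add: cu K_def)
  next
   case False
   then have "real n * 1 <= real n * s" using n by (intro mult_left_mono) auto
   then have "int n <= \<lfloor>real n * s\<rfloor>" by linarith
   then have "n <= K" by (simp add: K_def le_nat_iff)
   moreover have "cusum n z s = 0" if "s = 1" using that cu[of s] cn by simp
   ultimately show ?thesis using False by (auto simp: indicator_def)
  qed
  finally show ?thesis ..
 next
  case False
  then have "s < real k / real n" for k by (meson divide_nonneg_nonneg not_less of_nat_0_le_iff order_trans)
  then have "(cpart n z k)^2 * indicator {real k / real n..<(real k + 1) / real n} s = 0" for k by (simp add: not_le)
  then show ?thesis using False by (subst sum.neutral) auto
 qed
 have "(LBINT s:{0..1}. (cusum n z s)^2) = (LINT s|lborel. ?A s)"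
  unfolding set_lebesgue_integral_def eq ..
 also have "... = (\<Sum>k<n. (LINT s|lborel. (cpart n z k)^2 * indicator {real k / real n..<(real k + 1) / real n} s))"
  by (intro Bochner_Integration.integral_sum integrable_mult_right integrable_real_indicator) (auto simp: divide_right_mono)
 also have "... = (\<Sum>k<n. (cpart n z k)^2 * (1 / real n))"
 proof (intro sum.cong refl)
  fix k
  have "real k / real n <= (real k + 1) / real n" by (simp add: divide_right_mono)
  then show "(LINT s|lborel. (cpart n z k)^2 * indicator {real k / real n..<(real k + 1) / real n} s) = (cpart n z k)^2 * (1 / real n)"
   by (simp add: diff_divide_distrib[symmetric])
 qed
 finally show ?thesis by (simp add: sum_divide_distrib)
qed

text \<open>The CUSUM values of a step from 1 to 0 after time \<open>floor (n * t)\<close>, the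
  discrete counterpart of \<open>tent\<close>.\<close>

definition acoef :: "nat => real => nat => real" where
 "acoef n t k = real (min k (nat \<lfloor>real n * t\<rfloor>)) / real n - real k * real (nat \<lfloor>real n * t\<rfloor>) / (real n)^2"

text \<open>The coefficient of observation \<open>j\<close> in the sum of
  \<open>acoef n t k * cpart n x k\<close> over \<open>k\<close>, found by reversing the order of
  summation.\<close>

definition bweight :: "nat => real => nat => real" where
 "bweight n t j = ((\<Sum>k=j..<n. acoef n t k) - (\<Sum>k<n. acoef n t k * (real k / real n))) / real n"

text \<open>The factor \<open>3 / (t * (1 - t))^2\<close> of the statistic, doubled by the cross
  term of the square and divided by \<open>tau t\<close>.\<close>

definition kfac :: "real => real" where
 "kfac t = 6 / (tau t * (t * (1 - t))^2)"

text \<open>Dividing the cross term by \<open>|\<Delta>|\<close> leaves only the sign of the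
  jump.\<close>

definition tweight :: "nat => real => real => nat => real" where
 "tweight n t \<Delta> j = sgn \<Delta> * kfac t * bweight n t j"

lemma cpart_add: "cpart n (%j. y j + z j) k = cpart n y k + cpart n z k"
 by (simp add: cpart_def sum.distrib add_divide_distrib distrib_left)

lemma sum_step: "(\<Sum>j=1..k. if j <= r then \<mu>1 else \<mu>2) = real (min k r) * \<mu>1 + (real k - real (min k r)) * (\<mu>2 :: real)"
proof (induction k)
 case (Suc k)
 have "real (min (Suc k) r) = real (min k r) + (if Suc k <= r then 1 else 0)" by (simp add: min_def)
 then show ?case using Suc by (cases "Suc k <= r") (auto simp: algebra_simps min_def)
qed simp

context
 fixes n :: nat and t :: real
 assumes n: "0 < n" and t: "0 < t" "t < 1"
begin

abbreviation (input) "rr \<equiv> nat \<lfloor>real n * t\<rfloor>"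

lemma rr_props: "rr <= n" "abs (real rr / real n - t) <= 1 / real n"
proof -
 have nt: "0 <= real n * t" "real n * t <= real n * 1" using n t by (auto intro!: mult_left_mono)
 then have r: "real rr = of_int \<lfloor>real n * t\<rfloor>" by simp
 have "\<lfloor>real n * t\<rfloor> <= int n" using nt by (simp add: floor_le_iff)
 then show "rr <= n" by simp
 have "abs (real rr - real n * t) <= 1" unfolding r by linarith
 then have "abs (real rr - real n * t) / real n <= 1 / real n" using n by (intro divide_right_mono) auto
 moreover have "real rr / real n - t = (real rr - real n * t) / real n" using n by (simp add: field_simps)
 ultimately show "abs (real rr / real n - t) <= 1 / real n" by (simp add: abs_divide)
qed

lemma cpart_step:
 assumes k: "k <= n"
 shows "cpart n (%j. if int j <= \<lfloor>real n * t\<rfloor> then \<mu>1 else \<mu>2) k = acoef n t k * (\<mu>1 - \<mu>2)"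
proof -
 have "0 <= \<lfloor>real n * t\<rfloor>" using n t by simp
 then have e: "int j <= \<lfloor>real n * t\<rfloor> \<longleftrightarrow> j <= rr" for j by (simp add: le_nat_iff)
 have m: "min n rr = rr" using rr_props(1) by simp
 show ?thesis
  unfolding cpart_def e sum_step acoef_def m using n by (simp add: field_simps power2_eq_square)
qed

lemma acoef_range: "k <= n ==> 0 <= acoef n t k \<and> acoef n t k <= 1"
proof -
 assume k: "k <= n"
 define x y where "x = real k / real n" and "y = real rr / real n"
 have xy: "0 <= x" "x <= 1" "0 <= y" "y <= 1" using k rr_props(1) n by (auto simp: x_def y_def)
 have "acoef n t k = min x y - x * y"
  using n by (simp add: acoef_def x_def y_def min_def divide_le_cancel power2_eq_square)
 moreover have "x * y <= x" "x * y <= y" "0 <= x * y" using xy by (auto intro: mult_left_le mult_left_le_one_le)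
 ultimately show ?thesis using xy by linarith
qed

lemma acoef_tent:
 assumes k: "k <= n"
 shows "abs (acoef n t k - tent t (real k / real n)) <= 2 / real n"
proof -
 define x y where "x = real k / real n" and "y = real rr / real n"
 have xy: "0 <= x" "x <= 1" using k n by (auto simp: x_def)
 have e: "acoef n t k = min x y - x * y"
  using n by (simp add: acoef_def x_def y_def min_def divide_le_cancel power2_eq_square)
 have d: "abs (y - t) <= 1 / real n" using rr_props(2) by (simp add: y_def)
 have "abs (min x y - min x t) <= abs (y - t)" by (auto simp: min_def abs_if)
 moreover have "abs (x * (y - t)) <= 1 * abs (y - t)" unfolding abs_mult using xy by (intro mult_right_mono) auto
 moreover have "acoef n t k - tent t x = (min x y - min x t) - x * (y - t)"
  unfolding e tent_min[OF t] by (simp add: algebra_simps)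
 moreover have "2 / real n = 1 / real n + 1 / real n" by simp
 moreover have "abs ((min x y - min x t) - x * (y - t)) <= abs (min x y - min x t) + abs (x * (y - t))" by (rule abs_triangle_ineq4)
 ultimately show ?thesis using d unfolding x_def[symmetric] by simp
qed

lemma acoef_square_sum: "abs ((\<Sum>k<n. (acoef n t k)^2) / real n - (t * (1 - t))^2 / 3) <= 6 / real n"
proof -
 let ?A = "%k. (tent t (real k / real n))"
 let ?B = "abs ((\<Sum>k<n. (acoef n t k)^2) - (\<Sum>k<n. (?A k)^2))"
 have "abs ((acoef n t k)\<^sup>2 - (?A k)^2) <= 4 / real n" if "k < n" for k
 proof -
  have r: "0 <= acoef n t k" "acoef n t k <= 1" "0 <= tent t (real k / real n)" "tent t (real k / real n) <= 1"
   using acoef_range[of k] tent_range[OF t, of "real k / real n"] that n by auto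
  have "(acoef n t k)^2 - (?A k)^2 = (acoef n t k + tent t (real k / real n)) * (acoef n t k - tent t (real k / real n))"
   by (simp add: power2_eq_square algebra_simps)
  also have "abs (...) <= 2 * (2 / real n)" unfolding abs_mult using r acoef_tent[of k] that by (intro mult_mono) auto
  finally show ?thesis by simp
 qed
 then have "abs (\<Sum>k<n. (acoef n t k)^2 - (?A k)^2) <= (\<Sum>k<n. 4 / real n)"
  by (intro order_trans[OF sum_abs] sum_mono) auto
 then have "?B <= 4" using n by (simp add: sum_subtractf)
 then have "?B / real n <= 4 / real n"
  by (rule divide_right_mono) simp
 then have "abs ((\<Sum>k<n. (acoef n t k)^2) / real n - (\<Sum>k<n. (?A k)^2) / real n) <= 4 / real n"
  using n by (simp add: diff_divide_distrib[symmetric] abs_divide)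
 then show ?thesis using tent_square_riemann[OF t n] by (simp add: add_divide_distrib[symmetric])
qed

lemma bweight_bound: "abs (bweight n t j) <= 1"
proof -
 let ?A = "%A w. (SUM k:A. acoef n t k * w k)"
 have ub: "?A A w / real n <= 1 \<and> 0 <= ?A A w / real n"
  if "A \<subseteq> {..<n}" "\<And>k. k < n ==> 0 <= w k \<and> w k <= 1" for A w
 proof -
  have "?A A w <= (SUM k:A. 1 * 1)" using that acoef_range by (intro sum_mono mult_mono) (auto simp: subset_iff)
  also have "... = real (card A)" by simp
  also have "... <= real n" using card_mono[OF _ that(1)] by simp
  finally have "?A A w <= real n" .
  moreover have "0 <= ?A A w" using that acoef_range by (intro sum_nonneg mult_nonneg_nonneg) (auto simp: subset_iff)
  ultimately show ?thesis using n by auto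
 qed
 have "(\<Sum>k=j..<n. acoef n t k) / real n <= 1 \<and> 0 <= (\<Sum>k=j..<n. acoef n t k) / real n" using ub[of "{j..<n}" "%_. 1"] by (simp add: subset_iff)
 moreover have "(\<Sum>k<n. acoef n t k * (real k / real n)) / real n <= 1 \<and> 0 <= (\<Sum>k<n. acoef n t k * (real k / real n)) / real n"
  using ub[of "{..<n}" "%k. real k / real n"] by auto
 ultimately show ?thesis unfolding bweight_def diff_divide_distrib by linarith
qed

lemma bweight_lip: "j <= n ==> i <= n ==> abs (bweight n t j - bweight n t i) <= abs (real j - real i) / real n"
proof -
 have *: "abs (bweight n t j - bweight n t i) <= abs (real j - real i) / real n" if "j <= i" "i <= n" for i j
 proof -
  have "(\<Sum>k=j..<n. acoef n t k) = (\<Sum>k=j..<i. acoef n t k) + (\<Sum>k=i..<n. acoef n t k)"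
   using that by (simp add: sum.atLeastLessThan_concat)
  then have "bweight n t j - bweight n t i = (\<Sum>k=j..<i. acoef n t k) / real n"
   unfolding bweight_def by (simp add: diff_divide_distrib[symmetric])
  moreover have "0 <= (\<Sum>k=j..<i. acoef n t k)" using acoef_range that by (intro sum_nonneg) auto
  moreover have "(\<Sum>k=j..<i. acoef n t k) <= (\<Sum>k=j..<i. 1)" using acoef_range that by (intro sum_mono) auto
  ultimately show ?thesis using that n by (simp add: divide_right_mono of_nat_diff abs_divide)
 qed
 assume "j <= n" "i <= n"
 then show ?thesis using *[of j i] *[of i j] by (cases "j <= i") (auto simp: abs_minus_commute)
qed

text \<open>Replacing \<open>acoef\<close> by \<open>tent\<close> costs \<open>2 / n\<close> in each
  of the two sums, and the two Riemann sums cost \<open>1 / n\<close> and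
  \<open>2 / n\<close>.\<close>

lemma bweight_limit:
 assumes j: "j <= n"
 shows "abs (bweight n t j - limit_weight t (real j / real n)) <= 7 / real n"
proof -
 let ?A = "%k. (real k / real n)"
 have app: "abs ((SUM k:A. acoef n t k * w k) / real n - (SUM k:A. tent t (?A k) * w k) / real n) <= 2 / real n"
  if A: "A \<subseteq> {..<n}" "\<And>k. k < n ==> 0 <= w k \<and> w k <= 1" for A w
 proof -
  have "abs ((SUM k:A. acoef n t k * w k) - (SUM k:A. tent t (?A k) * w k)) = abs (SUM k:A. (acoef n t k - tent t (?A k)) * w k)"
   by (simp add: sum_subtractf left_diff_distrib)
  also have "... <= (SUM k:A. 2 / real n * 1)"
  proof (intro order_trans[OF sum_abs] sum_mono)
   fix k assume "k : A"
   then have k: "k < n" using A by auto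
   show "abs ((acoef n t k - tent t (?A k)) * w k) <= 2 / real n * 1"
    unfolding abs_mult using A(2)[OF k] acoef_tent[of k] k by (intro mult_mono) auto
  qed
  also have "... = real (card A) * (2 / real n)" by simp
  also have "... <= real n * (2 / real n)" using card_mono[OF _ A(1)] by (intro mult_right_mono) auto
  also have "... = 2" using n by simp
  finally have "abs ((SUM k:A. acoef n t k * w k) - (SUM k:A. tent t (?A k) * w k)) / real n <= 2 / real n"
   by (rule divide_right_mono) simp
  then show ?thesis using n by (simp add: diff_divide_distrib[symmetric] abs_divide)
 qed
 have a1: "abs ((\<Sum>k=j..<n. acoef n t k) / real n - (\<Sum>k=j..<n. tent t (?A k)) / real n) <= 2 / real n"
  using app[of "{j..<n}" "%_. 1"] by (simp add: subset_iff)
 have a2: "abs ((\<Sum>k<n. acoef n t k * ?A k) / real n - (\<Sum>k<n. tent t (?A k) * ?A k) / real n) <= 2 / real n"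
  using app[of "{..<n}" "%k. real k / real n"] by auto
 have a3: "abs (tent_int t 1 - tent_int t (real j / real n) - (\<Sum>k=j..<n. tent t (?A k)) / real n) <= 1 / real n"
  by (rule tent_riemann[OF t n j])
 have a4: "abs (t * (1 - t^2) / 6 - (\<Sum>k<n. tent t (?A k) * ?A k) / real n) <= 2 / real n"
  using tent_moment_riemann[OF t n] by (simp add: mult.commute)
 have a5: "tent_int t 1 = t * (1 - t) / 2" using t by (simp add: tent_int_def pw_def)
 have "7 / real n = 2 / real n + 2 / real n + 1 / real n + 2 / real n" by (simp add: add_divide_distrib[symmetric])
 then show ?thesis unfolding bweight_def limit_weight_def diff_divide_distrib using a1 a2 a3 a4 a5 by linarith
qed

lemma bweight_square_sum:
 "abs ((\<Sum>j=1..n. (bweight n t j)^2) / real n - (t * (1 - t))^2 * (1 + 2 * t * (1 - t)) / 45) <= 17 / real n"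
proof -
 let ?A = "(\<Sum>j=1..n. (bweight n t j)^2)"
 let ?L = "%j. limit_weight t (real j / real n)"
 let ?B = "(\<Sum>k<n. (?L k)^2)"
 have "abs ((bweight n t j)\<^sup>2 - (?L j)^2) <= 14 / real n" if "j : {1..n}" for j
 proof -
  have "abs (?L j) <= 1" using that n by (intro limit_weight_bound[OF t]) auto
  have "(bweight n t j)^2 - (?L j)^2 = (bweight n t j + ?L j) * (bweight n t j - ?L j)"
   by (simp add: power2_eq_square algebra_simps)
  also have "abs (...) <= 2 * (7 / real n)"
   unfolding abs_mult using bweight_limit[of j] bweight_bound[of j] \<open>\<bar>?L j\<bar> <= 1\<close> that by (intro mult_mono) auto
  finally show ?thesis by simp
 qed
 then have "abs (\<Sum>j=1..n. (bweight n t j)^2 - (?L j)^2) <= (\<Sum>j=1..n. 14 / real n)"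
  by (intro order_trans[OF sum_abs] sum_mono) auto
 then have 1: "abs (?A - (\<Sum>j=1..n. (?L j)^2)) <= 14" using n by (simp add: sum_subtractf)
 \<comment> \<open>The weights are summed over \<open>1..n\<close>, the Riemann sum over
   \<open>0..n-1\<close>. The shift costs at most 1, which gives \<open>14 + 1 = 15\<close>, and the
   Riemann error makes it 17.\<close>
 have "(\<Sum>j=1..n. (?L j)^2) = (\<Sum>k<n. (?L (Suc k))^2)"
  by (rule sum.reindex_bij_witness[of _ Suc "%j. j - 1"]) auto
 then have "(\<Sum>j=1..n. (?L j)^2) - ?B = (?L n)^2 - (?L 0)^2"
  using sum_lessThan_telescope[of "%k. (?L k)^2" n] by (simp add: sum_subtractf)
 moreover have "(?L n)^2 <= 1" "(?L 0)^2 <= 1"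
  using limit_weight_bound[OF t, of 1] limit_weight_bound[OF t, of 0] n by (auto simp: abs_square_le_1)
 moreover have "0 <= (?L n)^2" "0 <= (?L 0)^2" by auto
 ultimately have "abs (?A - ?B) <= 15" using 1 by linarith
 then have "abs (?A - ?B) / real n <= 15 / real n" by (rule divide_right_mono) simp
 then have "abs (?A / real n - ?B / real n) <= 15 / real n"
  using n by (simp add: diff_divide_distrib[symmetric] abs_divide)
 moreover have "17 / real n = 15 / real n + 2 / real n" by (simp add: add_divide_distrib[symmetric])
 ultimately show ?thesis using limit_weight_square_riemann[OF t n] by linarith
qed

lemma acoef_cpart_sum: "(\<Sum>k<n. acoef n t k * cpart n x k) = (\<Sum>j=1..n. bweight n t j * x j)"
proof -
 let ?A = "%n. (\<Sum>k<n. acoef n t k * (\<Sum>j=1..k. x j))"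
 let ?S = "\<Sum>j=1..n. x j"
 have "?A n = (\<Sum>k<n. \<Sum>j=1..n. if j <= k then acoef n t k * x j else 0)"
 proof (intro sum.cong refl)
  fix k assume k: "k : {..<n}"
  have "(\<Sum>j=1..n. if j <= k then acoef n t k * x j else 0) = (SUM j:{j:{1..n}. j <= k}. acoef n t k * x j)"
   by (rule sum.inter_filter[symmetric]) simp
  also have "{j:{1..n}. j <= k} = {1..k}" using k by auto
  finally show "acoef n t k * (\<Sum>j=1..k. x j) = (\<Sum>j=1..n. if j <= k then acoef n t k * x j else 0)" by (simp add: sum_distrib_left)
 qed
 also have "... = (\<Sum>j=1..n. \<Sum>k<n. if j <= k then acoef n t k * x j else 0)" by (rule sum.swap)
 also have "... = (\<Sum>j=1..n. (\<Sum>k=j..<n. acoef n t k) * x j)"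
 proof (intro sum.cong refl)
  fix j
  have "(\<Sum>k<n. if j <= k then acoef n t k * x j else 0) = (SUM k:{k:{..<n}. j <= k}. acoef n t k * x j)"
   by (rule sum.inter_filter[symmetric]) simp
  also have "{k:{..<n}. j <= k} = {j..<n}" by auto
  finally show "(\<Sum>k<n. if j <= k then acoef n t k * x j else 0) = (\<Sum>k=j..<n. acoef n t k) * x j" by (simp add: sum_distrib_right)
 qed
 finally have A: "?A n = (\<Sum>j=1..n. (\<Sum>k=j..<n. acoef n t k) * x j)" .
 have "(\<Sum>k<n. acoef n t k * cpart n x k) = ?A n / real n - (\<Sum>k<n. acoef n t k * (real k / real n)) / real n * ?S"
 proof -
  have "acoef n t k * cpart n x k = acoef n t k * (\<Sum>j=1..k. x j) / real n - acoef n t k * (real k / real n) / real n * ?S" for k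
   by (simp add: cpart_def right_diff_distrib power2_eq_square)
  then show ?thesis by (simp only: sum_subtractf sum_divide_distrib sum_distrib_right)
 qed
 also have "... = (\<Sum>j=1..n. bweight n t j * x j)"
 proof -
  define c where "c = (\<Sum>k<n. acoef n t k * (real k / real n))"
  have "bweight n t j * x j = (\<Sum>k=j..<n. acoef n t k) * x j / real n - c / real n * x j" for j
   unfolding bweight_def c_def by (simp add: diff_divide_distrib left_diff_distrib)
  then show ?thesis unfolding A c_def[symmetric] by (simp only: sum_subtractf sum_divide_distrib sum_distrib_left)
 qed
 finally show ?thesis .
qed

lemma tau_pos: "0 < tau t"
 using t by (simp add: tau_def add_pos_nonneg)

lemma kfac_pos: "0 < kfac t"
 using tau_pos t by (simp add: kfac_def)

lemma kfac_square: "(kfac t)^2 * ((t * (1 - t))^2 * (1 + 2 * t * (1 - t)) / 45) = 1"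
proof -
 define a where "a = t * (1 - t)"
 have a0: "0 < a" using t by (simp add: a_def)
 have a1: "1 + 2 * a > 0" using a0 by simp
 have ta: "tau t = 2 * sqrt (1 + 2 * a) / (sqrt 5 * a)" by (simp add: tau_def a_def mult.assoc)
 have t2: "(tau t)^2 = 4 * (1 + 2 * a) / (5 * a^2)" unfolding ta using a1 by (simp add: power_divide power_mult_distrib)
 have "(kfac t)^2 = 36 / ((tau t)^2 * a ^ 4)" unfolding kfac_def a_def[symmetric] by (simp add: power_divide power_mult_distrib flip: power_mult)
 then have "(kfac t)^2 * (a^2 * (1 + 2 * a) / 45) = 1" unfolding t2 using a0 a1 by (simp add: divide_simps power2_eq_square eval_nat_numeral) (simp add: algebra_simps)
 then show ?thesis by (simp add: a_def mult.assoc)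
qed

text \<open>With \<open>a = t * (1 - t)\<close>, one has \<open>tau t * a >= 2 / 3\<close> because
  \<open>sqrt 5 <= 3\<close>, and \<open>a >= tb / 2\<close> because the larger of \<open>t\<close>
  and \<open>1 - t\<close> is at least one half.\<close>

lemma kfac_bound:
 assumes tb: "0 < tb" "tb < 1/2" "tb <= t" "t <= 1 - tb"
 shows "kfac t <= 18 / tb"
proof -
 define a where "a = t * (1 - t)"
 have a0: "0 < a" using t by (simp add: a_def)
 have ta: "tau t * a = 2 * sqrt (1 + 2 * a) / sqrt 5" using a0 unfolding tau_def mult.assoc a_def[symmetric] by simp
 have "2 / 3 <= 2 * sqrt (1 + 2 * a) / sqrt 5"
 proof -
  have "sqrt 5 <= 3" by (rule real_le_lsqrt) auto
  then have "2 / 3 <= 2 / sqrt 5" by (intro divide_left_mono) auto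
  also have "... <= 2 * sqrt (1 + 2 * a) / sqrt 5" using a0 by (intro divide_right_mono) auto
  finally show ?thesis .
 qed
 then have 1: "2 / 3 <= tau t * a" by (simp add: ta)
 have "tb / 2 <= a"
 proof (cases "t <= 1/2")
  case True
  then have "tb * (1 / 2) <= t * (1 - t)" using tb by (intro mult_mono) auto
  then show ?thesis by (simp add: a_def)
 next
  case False
  then have "(1 / 2) * tb <= t * (1 - t)" using tb by (intro mult_mono) auto
  then show ?thesis by (simp add: a_def)
 qed
 then have "2 / 3 * (tb / 2) <= (tau t * a) * a" using 1 a0 tb by (intro mult_mono) auto
 then have "6 / ((tau t * a) * a) <= 6 / (2 / 3 * (tb / 2))"
  using tb a0 tau_pos by (intro divide_left_mono mult_pos_pos) auto
 then show ?thesis by (simp add: kfac_def a_def power2_eq_square mult.assoc)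
qed

text \<open>The squared CUSUM of drift plus noise has three parts. The squared drift cancels
  \<open>\<Delta>^2\<close> up to a Riemann error of order \<open>1 / n\<close>; the cross term is
  the linear statistic; the squared noise is at most \<open>4 * A^2 / n^2\<close> on average.
  Multiplication by \<open>sqrt n\<close> turns the first and the last part into the two error
  terms.\<close>

lemma tstat_linear:
 fixes x :: "nat => real"
 assumes tb: "0 < tb" "tb < 1/2" "tb <= t" "t <= 1 - tb" and s: "0 < sl" "sl <= \<sigma>"
  and D: "\<Delta> = \<mu>1 - \<mu>2" "0 < Cl" "Cl <= abs \<Delta>" "abs \<Delta> <= Cu"
  and A: "\<And>k. k <= n ==> abs (\<Sum>j=1..k. x j) <= A"
 shows "abs (tstat n t \<sigma> \<Delta> (%j. (if int j <= \<lfloor>real n * t\<rfloor> then \<mu>1 else \<mu>2) + x j)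
   - (\<Sum>j=1..n. tweight n t \<Delta> j * x j) / (\<sigma> * sqrt (real n)))
  <= 54 * Cu / (tb * sl) / sqrt (real n) + 36 / (tb * sl * Cl) * A^2 / (real n * sqrt (real n))"
proof -
 define a where "a = t * (1 - t)"
 define T where "T = tau t"
 define k where "k = kfac t"
 define c where "c = cpart n x"
 define F where "F = sqrt (real n) / (T * \<sigma> * abs \<Delta>)"
 have a0: "0 < a" using t by (simp add: a_def)
 have T0: "0 < T" using tau_pos by (simp add: T_def)
 have k0: "0 < k" "k <= 18 / tb" using kfac_pos kfac_bound[OF tb] by (auto simp: k_def)
 have kT: "3 / a^2 / T = k / 2" by (simp add: k_def kfac_def a_def T_def)
 have \<sigma>0: "0 < \<sigma>" using s by linarith
 have D0: "0 < abs \<Delta>" using D by linarith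
 have n0: "0 < real n" using n by simp
 let ?m = "%j. if int j <= \<lfloor>real n * t\<rfloor> then \<mu>1 else \<mu>2"
 have "(\<Sum>j<n. (cpart n (%j. ?m j + x j) j)^2) = (\<Sum>j<n. (acoef n t j * \<Delta> + c j)^2)"
  by (intro sum.cong refl) (simp add: cpart_add cpart_step D(1) c_def)
 also have "... = \<Delta>^2 * (\<Sum>j<n. (acoef n t j)^2) + 2 * \<Delta> * (\<Sum>j<n. acoef n t j * c j) + (\<Sum>j<n. (c j)^2)"
  by (simp add: power2_sum sum.distrib sum_distrib_left power_mult_distrib mult_ac)
 finally have sq: "(LBINT s:{0..1}. (cusum n (%j. ?m j + x j) s)^2)
  = (\<Delta>^2 * (\<Sum>j<n. (acoef n t j)^2) + 2 * \<Delta> * (\<Sum>j=1..n. bweight n t j * x j) + (\<Sum>j<n. (c j)^2)) / real n"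
  unfolding integral_cusum_square[OF n] by (simp add: acoef_cpart_sum c_def)
 have "tstat n t \<sigma> \<Delta> (%j. ?m j + x j) = F * (3 / a^2 * ((\<Delta>^2 * (\<Sum>j<n. (acoef n t j)^2) + 2 * \<Delta> * (\<Sum>j=1..n. bweight n t j * x j) + (\<Sum>j<n. (c j)^2)) / real n) - \<Delta>^2)"
  unfolding tstat_def msq_def sq by (simp add: F_def T_def a_def)
 also have "... = F * (3 / a^2) * \<Delta>^2 * ((\<Sum>j<n. (acoef n t j)^2) / real n - a^2 / 3)
   + F * (3 / a^2) * (2 * \<Delta>) * (\<Sum>j=1..n. bweight n t j * x j) / real n + F * (3 / a^2) * ((\<Sum>j<n. (c j)^2) / real n)"
  using a0 n0 by (simp add: field_simps)
 also have "F * (3 / a^2) * (2 * \<Delta>) * (\<Sum>j=1..n. bweight n t j * x j) / real n = (\<Sum>j=1..n. tweight n t \<Delta> j * x j) / (\<sigma> * sqrt (real n))"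
 proof -
  have "F * (3 / a^2) = 3 / a^2 / T * (sqrt (real n) / (\<sigma> * abs \<Delta>))" by (simp add: F_def mult_ac)
  also have "... = k / 2 * (sqrt (real n) / (\<sigma> * abs \<Delta>))" unfolding kT ..
  finally have "F * (3 / a^2) * (2 * \<Delta>) = k / 2 * (sqrt (real n) / (\<sigma> * abs \<Delta>)) * (2 * \<Delta>)" by simp
  also have "... = sgn \<Delta> * k * sqrt (real n) / \<sigma>" using D0 \<sigma>0 by (cases "\<Delta> > 0") (auto simp: abs_if field_simps)
  finally have "F * (3 / a^2) * (2 * \<Delta>) = sgn \<Delta> * k * sqrt (real n) / \<sigma>" .
  moreover have "(\<Sum>j=1..n. tweight n t \<Delta> j * x j) = sgn \<Delta> * k * (\<Sum>j=1..n. bweight n t j * x j)"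
   by (simp add: tweight_def k_def sum_distrib_left mult_ac)
  moreover have "y * sqrt (real n) / \<sigma> * z / real n = y * z / (\<sigma> * sqrt (real n))" for y z
   using \<sigma>0 n0 by (simp add: divide_simps)
  ultimately show ?thesis by simp
 qed
 finally have eq: "tstat n t \<sigma> \<Delta> (%j. ?m j + x j) - (\<Sum>j=1..n. tweight n t \<Delta> j * x j) / (\<sigma> * sqrt (real n))
  = F * (3 / a^2) * \<Delta>^2 * ((\<Sum>j<n. (acoef n t j)^2) / real n - a^2 / 3) + F * (3 / a^2) * ((\<Sum>j<n. (c j)^2) / real n)" by simp
 have F3: "F * (3 / a^2) = k / 2 * (sqrt (real n) / (\<sigma> * abs \<Delta>))" unfolding kT[symmetric] by (simp add: F_def mult_ac)
 have F0: "0 <= F * (3 / a^2)" unfolding F3 using k0 \<sigma>0 by simp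
 have b1: "abs (F * (3 / a^2) * \<Delta>^2 * ((\<Sum>j<n. (acoef n t j)^2) / real n - a^2 / 3)) <= 54 * Cu / (tb * sl) / sqrt (real n)"
 proof -
  have "abs (F * (3 / a^2) * \<Delta>^2 * ((\<Sum>j<n. (acoef n t j)^2) / real n - a^2 / 3)) <= F * (3 / a^2) * \<Delta>^2 * (6 / real n)"
   unfolding abs_mult[of "F * (3 / a^2) * \<Delta>^2"] using acoef_square_sum mult_nonneg_nonneg[OF F0 zero_le_power2[of \<Delta>]] by (intro mult_mono) (auto simp: a_def simp del: times_divide_eq_right)
  also have "... = 3 * k * abs \<Delta> / \<sigma> * (sqrt (real n) / real n)"
   unfolding F3 using D0 \<sigma>0 n0 by (simp add: field_simps power2_eq_square abs_mult_self_eq)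
  also have "... <= 3 * (18 / tb) * Cu / sl * (sqrt (real n) / real n)"
   using k0 D s tb D0 by (intro mult_right_mono frac_le mult_mono) auto
  also have "sqrt (real n) / real n = 1 / sqrt (real n)" using n0 by (simp add: divide_simps)
  also have "3 * (18 / tb) * Cu / sl * (1 / sqrt (real n)) = 54 * Cu / (tb * sl) / sqrt (real n)" by (simp add: mult_ac)
  finally show ?thesis .
 qed
 have A0: "0 <= A" using A[of 0] by simp
 have cb: "(c j)^2 <= 4 * A^2 / (real n)^2" if "j < n" for j
 proof -
  have "abs (real j / (real n)^2 * (\<Sum>j=1..n. x j)) <= real n / (real n)^2 * A"
   unfolding abs_mult using that A[of n] by (intro mult_mono) (auto simp: divide_right_mono)
  also have "... = A / real n" using n0 by (simp add: power2_eq_square)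
  finally have "abs (real j / (real n)^2 * (\<Sum>j=1..n. x j)) <= A / real n" .
  moreover have "abs ((\<Sum>j=1..j. x j) / real n) <= A / real n" using A[of j] that by (simp add: abs_divide divide_right_mono)
  ultimately have "abs (c j) <= 2 * (A / real n)" unfolding c_def cpart_def mult_2 by (intro order_trans[OF abs_triangle_ineq4] add_mono)
  then have "abs (c j)^2 <= (2 * (A / real n))^2" by (intro power_mono) auto
  then show ?thesis by (simp add: power_mult_distrib power_divide)
 qed
 have b2: "abs (F * (3 / a^2) * ((\<Sum>j<n. (c j)^2) / real n)) <= 36 / (tb * sl * Cl) * A^2 / (real n * sqrt (real n))"
 proof -
  have "(\<Sum>j<n. (c j)^2) <= (\<Sum>j<n. 4 * A^2 / (real n)^2)" by (intro sum_mono cb) auto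
  then have "(\<Sum>j<n. (c j)^2) / real n <= 4 * A^2 / (real n)^2" using n0 by (simp add: field_simps)
  then have "F * (3 / a^2) * ((\<Sum>j<n. (c j)^2) / real n) <= F * (3 / a^2) * (4 * A^2 / (real n)^2)"
   by (rule mult_left_mono[OF _ F0])
  also have "... = 2 * k / (\<sigma> * abs \<Delta>) * (A^2 * (sqrt (real n) / (real n)^2))" unfolding F3 by (simp add: field_simps)
  also have "... <= 2 * (18 / tb) / (sl * Cl) * (A^2 * (sqrt (real n) / (real n)^2))"
   using k0 D s tb D0 by (intro mult_right_mono frac_le mult_mono mult_left_mono mult_pos_pos) auto
  also have "sqrt (real n) / (real n)^2 = 1 / (real n * sqrt (real n))" using n0 by (simp add: field_simps power2_eq_square)
  finally have "F * (3 / a^2) * ((\<Sum>j<n. (c j)^2) / real n) <= 36 / (tb * sl * Cl) * A^2 / (real n * sqrt (real n))" by (simp add: mult.assoc)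
  moreover have "0 <= F * (3 / a^2) * ((\<Sum>j<n. (c j)^2) / real n)" by (intro mult_nonneg_nonneg[OF F0] divide_nonneg_nonneg sum_nonneg) auto
  ultimately show ?thesis by simp
 qed
 show ?thesis unfolding eq using b1 b2 by (intro order_trans[OF abs_triangle_ineq] add_mono)
qed

lemma tweight_bound:
 assumes tb: "0 < tb" "tb < 1/2" "tb <= t" "t <= 1 - tb"
 shows "abs (tweight n t \<Delta> j) <= 18 / tb"
proof -
 have "abs (tweight n t \<Delta> j) <= 1 * (18 / tb) * 1"
  unfolding tweight_def abs_mult using kfac_bound[OF tb] kfac_pos bweight_bound[of j] tb
  by (intro mult_mono) (auto simp: abs_sgn_eq)
 then show ?thesis by simp
qed

lemma tweight_lip:
 assumes tb: "0 < tb" "tb < 1/2" "tb <= t" "t <= 1 - tb" and ij: "j <= n" "i <= n"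
 shows "abs (tweight n t \<Delta> j - tweight n t \<Delta> i) <= 18 / tb / real n * abs (real j - real i)"
proof -
 have "tweight n t \<Delta> j - tweight n t \<Delta> i = sgn \<Delta> * kfac t * (bweight n t j - bweight n t i)" by (simp add: tweight_def algebra_simps)
 also have "abs (...) <= 1 * (18 / tb) * (abs (real j - real i) / real n)"
  unfolding abs_mult using kfac_bound[OF tb] kfac_pos bweight_lip[OF ij] tb
  by (intro mult_mono) (auto simp: abs_sgn_eq)
 finally show ?thesis by simp
qed

lemma tweight_square_sum:
 assumes tb: "0 < tb" "tb < 1/2" "tb <= t" "t <= 1 - tb" and D: "\<Delta> \<noteq> 0"
 shows "abs ((\<Sum>j=1..n. (tweight n t \<Delta> j)^2) / real n - 1) <= 17 * (18 / tb)^2 / real n"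
proof -
 have "(sgn \<Delta>)^2 = 1" using D by (simp add: sgn_if)
 then have "(\<Sum>j=1..n. (tweight n t \<Delta> j)^2) / real n = (kfac t)^2 * ((\<Sum>j=1..n. (bweight n t j)^2) / real n)"
  by (simp add: tweight_def power_mult_distrib sum_distrib_left)
 then have "(\<Sum>j=1..n. (tweight n t \<Delta> j)^2) / real n - 1 =
  (kfac t)\<^sup>2 * ((\<Sum>j=1..n. (bweight n t j)^2) / real n - (t * (1 - t))^2 * (1 + 2 * t * (1 - t)) / 45)"
  using kfac_square by (simp add: right_diff_distrib)
 also have "abs (...) <= (18 / tb)^2 * (17 / real n)"
  unfolding abs_mult using bweight_square_sum power_mono[OF kfac_bound[OF tb], of 2] kfac_pos by (intro mult_mono) auto
 finally show ?thesis by (simp add: mult_ac)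
qed

end

section \<open>Tail bounds for partial sums\<close>

lemma exp_le_quadratic:
 fixes x :: real
 assumes "abs x <= 1"
 shows "exp x <= 1 + x + x^2"
proof (cases "0 <= x")
 case True
 then show ?thesis using assms by (intro exp_bound) auto
next
 case False
 have "1 <= (1 + x + x^2) * (1 - x)" using False by (simp add: algebra_simps power2_eq_square mult_nonpos_nonneg)
 also have "... <= (1 + x + x^2) * exp (- x)" using assms exp_ge_add_one_self[of "- x"] by (intro mult_left_mono) auto
 finally show ?thesis by (simp add: exp_minus field_simps)
qed

text \<open>Every factor is at most \<open>exp (tt^2 * q)\<close> by
  \<open>exp x <= 1 + x + x^2\<close> on \<open>[-1, 1]\<close>; this is why the tilt is limited by
  \<open>|tt| * K <= 1\<close>.\<close>

lemma (in prob_space) indep_sum_mgf: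
 fixes U :: "'i => 'a => real"
 assumes ind: "indep_vars (%_. borel) U I" and fin: "finite I"
  and K: "\<And>i w. i : I ==> abs (U i w) <= K" and mean: "\<And>i. i : I ==> expectation (U i) = 0"
  and q: "\<And>i. i : I ==> expectation (%w. (U i w)^2) <= q" and l: "abs tt * K <= 1"
 shows "expectation (%w. exp (tt * (SUM i:I. U i w))) <= exp (tt^2 * (real (card I) * q))"
  and "integrable M (%w. exp (tt * (SUM i:I. U i w)))"
proof -
 let ?A = "%w. (tt * (SUM i:I. U i w))"
 have Um: "U i : borel_measurable M" if "i : I" for i using ind that by (auto simp: indep_vars_def)
 have lu: "abs (tt * U i w) <= 1" if "i : I" for i w
  using mult_left_mono[OF K[OF that], of "abs tt"] l by (auto simp: abs_mult intro: order_trans)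
 have ie: "integrable M (%w. exp (tt * U i w))" if "i : I" for i
  by (rule integrable_const_bound[where B = "exp 1"]) (use Um[OF that] lu[OF that] in \<open>auto simp: abs_le_iff\<close>)
 have iU: "integrable M (U i)" if "i : I" for i
  by (rule integrable_const_bound[where B = K]) (use Um[OF that] K[OF that] in auto)
 have iU2: "integrable M (%w. (U i w)^2)" if "i : I" for i
  by (rule integrable_const_bound[where B = "K^2"])
   (use Um[OF that] K[OF that] in \<open>auto simp: abs_le_square_iff[symmetric] intro: order_trans[OF _ abs_ge_self]\<close>)
 have one: "expectation (%w. exp (tt * U i w)) <= exp (tt^2 * q)" if i: "i : I" for i
 proof -
  have "expectation (%w. exp (tt * U i w)) <= expectation (%w. 1 + tt * U i w + tt^2 * (U i w)^2)"
   using exp_le_quadratic[OF lu[OF i]] ie[OF i] iU[OF i] iU2[OF i]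
   by (intro Bochner_Integration.integral_mono) (auto simp: power_mult_distrib)
  also have "... = 1 + tt^2 * expectation (%w. (U i w)^2)" using iU[OF i] iU2[OF i] mean[OF i] by (simp add: prob_space)
  also have "... <= 1 + tt^2 * q" using q[OF i] by (intro add_left_mono mult_left_mono) auto
  also have "... <= exp (tt^2 * q)" by (rule exp_ge_add_one_self)
  finally show ?thesis .
 qed
 have ind': "indep_vars (%_. borel) (%i w. exp (tt * U i w)) I"
  by (rule indep_vars_compose2[OF ind, where Y = "%_ x. exp (tt * x)"]) auto
 have e: "exp (?A w) = (PROD i:I. exp (tt * U i w))" for w
  by (simp add: sum_distrib_left exp_sum[OF fin])
 show "integrable M (%w. exp (?A w))"
  unfolding e by (rule indep_vars_integrable[OF fin ind' ie])
 have "expectation (%w. exp (?A w)) = (PROD i:I. expectation (%w. exp (tt * U i w)))"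
  unfolding e by (rule indep_vars_lebesgue_integral[OF fin ind' ie])
 also have "... <= (PROD i:I. exp (tt^2 * q))"
  by (intro prod_mono) (auto simp: one intro!: Bochner_Integration.integral_nonneg)
 also have "... = exp (tt^2 * (real (card I) * q))" by (simp add: exp_of_nat_mult[symmetric] mult_ac)
 finally show "expectation (%w. exp (?A w)) <= exp (tt^2 * (real (card I) * q))" .
qed

lemma (in prob_space) indep_sum_tail:
 fixes U :: "'i => 'a => real"
 assumes ind: "indep_vars (%_. borel) U I" and fin: "finite I"
  and K: "\<And>i w. i : I ==> abs (U i w) <= K" and mean: "\<And>i. i : I ==> expectation (U i) = 0"
  and q: "\<And>i. i : I ==> expectation (%w. (U i w)^2) <= q" and l: "0 <= tt" "tt * K <= 1"
 shows "prob {w:space M. x < abs (SUM i:I. U i w)} <= 2 * exp (tt^2 * (real (card I) * q) - tt * x)"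
proof -
 let ?S = "%w. SUM i:I. U i w" and ?E = "exp (tt^2 * (real (card I) * q))"
 have Um [measurable]: "U i : borel_measurable M" if "i : I" for i using ind that by (auto simp: indep_vars_def)
 have mgf: "expectation (%w. exp (\<mu> * ?S w)) <= ?E" "integrable M (%w. exp (\<mu> * ?S w))" if "\<mu> = tt \<or> \<mu> = - tt" for \<mu>
  using indep_sum_mgf[OF ind fin K mean q, of \<mu>] that l by auto
 have one: "prob {w:space M. tt * x <= \<mu> * ?S w} <= ?E / exp (tt * x)" if \<mu>: "\<mu> = tt \<or> \<mu> = - tt" for \<mu>
 proof -
  have "prob {w:space M. tt * x <= \<mu> * ?S w} = prob {w:space M. exp (tt * x) <= exp (\<mu> * ?S w)}" by simp
  also have "... <= expectation (%w. exp (\<mu> * ?S w)) / exp (tt * x)"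
   by (rule integral_Markov_inequality_measure[where A = "space M"]) (use mgf(2)[OF \<mu>] in auto)
  also have "... <= ?E / exp (tt * x)" by (intro divide_right_mono mgf(1)[OF \<mu>]) auto
  finally show ?thesis .
 qed
 have "prob {w:space M. x < abs (?S w)} <= prob ({w:space M. tt * x <= tt * ?S w} \<union> {w:space M. tt * x <= (- tt) * ?S w})"
 proof (rule finite_measure_mono)
  have "tt * x <= tt * s \<or> tt * x <= (- tt) * s" if "x < abs s" for s
   using that l mult_left_mono[of x s tt] mult_left_mono[of x "- s" tt] by (cases "0 <= s") auto
  then show "{w:space M. x < abs (?S w)} \<subseteq> {w:space M. tt * x <= tt * ?S w} \<union> {w:space M. tt * x <= (- tt) * ?S w}" by blast
 qed measurable
 also have "... <= prob {w:space M. tt * x <= tt * ?S w} + prob {w:space M. tt * x <= (- tt) * ?S w}"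
  by (rule measure_Un_le) measurable
 also have "... <= ?E / exp (tt * x) + ?E / exp (tt * x)" by (intro add_mono one) auto
 finally show ?thesis by (simp add: exp_diff)
qed

lemma power2_sum_weighted_le:
 fixes w x :: "'i => real"
 assumes J: "card J <= s" and w: "\<And>j. j : J ==> abs (w j) <= c" and c: "0 <= c"
 shows "(SUM j:J. w j * x j)^2 <= real s * c^2 * (SUM j:J. (x j)^2)"
proof (cases "finite J")
 case True
 have "(SUM j:J. w j * x j)^2 <= real (card J) * (SUM j:J. (w j * x j)^2)"
  using sum_squared_le_sum_of_squares[of "%j. w j * x j" J] by (simp add: mult.commute)
 also have "... <= real s * (SUM j:J. c^2 * (x j)^2)"
  using J w c by (intro mult_mono sum_mono sum_nonneg) (auto simp: power_mult_distrib abs_le_square_iff[symmetric] intro!: mult_right_mono)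
 finally show ?thesis by (simp add: sum_distrib_left mult_ac)
qed simp

context causal_array
begin

lemma block_sum_bound:
 assumes h: "h \<ge> 1" and T: "0 <= T" and s: "card J <= s" and w: "\<And>j. j : J ==> abs (w j) <= c" and c: "0 <= c"
 shows "abs (SUM j:J. w j * Xt l T j h u) <= real s * (c * (2 * T))"
proof -
 have "abs (SUM j:J. w j * Xt l T j h u) <= (SUM j:J. c * (2 * T))"
  using w c Xt_bound[OF h T] by (intro order_trans[OF sum_abs] sum_mono) (auto simp: abs_mult intro!: mult_mono)
 also have "... = real (card J) * (c * (2 * T))" by simp
 also have "... <= real s * (c * (2 * T))" using s c T by (intro mult_right_mono) auto
 finally show ?thesis .
qed

lemma Xt_integrable: "h \<ge> 1 ==> 0 <= T ==> integrable M (Xt l T j h)"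
 by (rule integrable_const_bound[where B = "2 * T"]) (auto simp: Xt_bound measurable_Xt)

lemma block_sum_mean:
 assumes h: "h \<ge> 1" and T: "0 <= T"
 shows "(LINT u|M. (SUM j:J. w j * Xt l T j h u)) = 0"
 by (subst Bochner_Integration.integral_sum) (auto simp: Xt_integrable[OF h T] Xt_mean[OF h T])

lemma block_sum_square:
 assumes h: "h \<ge> 1" and T: "0 <= T" and s: "card J <= s" and w: "\<And>j. j : J ==> abs (w j) <= c" and c: "0 <= c"
 shows "(LINT u|M. (SUM j:J. w j * Xt l T j h u)^2) <= (real s * c)^2 * moment_const 2"
proof -
 note [measurable] = measurable_Xt[OF h T]
 have "(LINT u|M. (SUM j:J. w j * Xt l T j h u)^2) <= (LINT u|M. real s * c^2 * (SUM j:J. (Xt l T j h u)^2))"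
  by (intro integral_mono_AE' AE_I2 power2_sum_weighted_le[OF s w c] integrable_mult_right Bochner_Integration.integrable_sum Xt_square(1)[OF h T] mult_nonneg_nonneg sum_nonneg zero_le_power2) auto
 also have "... = real s * c^2 * (SUM j:J. (LINT u|M. (Xt l T j h u)^2))"
  by (subst Bochner_Integration.integral_mult_right_zero, subst Bochner_Integration.integral_sum) (auto simp: Xt_square(1)[OF h T])
 also have "... <= real s * c^2 * (SUM j:J. moment_const 2)"
  by (intro mult_left_mono sum_mono Xt_square(2)[OF h T]) auto
 also have "... <= real s * c^2 * (real s * moment_const 2)"
  using s moment_const_nonneg[of 2] by (intro mult_left_mono) (auto intro!: mult_right_mono)
 finally show ?thesis by (simp add: power2_eq_square mult_ac)
qed

lemma separated_tail:
 assumes h: "h \<ge> 1" and T: "0 <= T" and s: "\<And>B. B : I ==> card (J B) <= s"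
  and w: "\<And>B j. B : I ==> j : J B ==> abs (w B j) <= c" and c: "0 <= c" and fin: "finite I" and N: "card I <= N"
  and sep: "\<And>B B' j j'. B : I ==> B' : I ==> B \<noteq> B' ==> j : J B ==> j' : J B' ==> int l <= abs (j - j')"
  and l: "0 <= tt" "tt * (real s * (c * (2 * T))) <= 1"
 shows "prob {u:space M. x < abs (SUM B:I. SUM j:J B. w B j * Xt l T j h u)}
  <= 2 * exp (tt^2 * (real N * ((real s * c)^2 * moment_const 2)) - tt * x)"
proof -
 have "prob {u:space M. x < abs (SUM B:I. SUM j:J B. w B j * Xt l T j h u)}
  <= 2 * exp (tt^2 * (real (card I) * ((real s * c)^2 * moment_const 2)) - tt * x)"
 proof (rule indep_sum_tail[OF _ fin _ _ _ l])
  show "indep_vars (%_. borel) (%B u. SUM j:J B. w B j * Xt l T j h u) I"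
   unfolding Xt_def using sep by (intro indep_separated_sums measurable_gclip[OF h]) auto
 qed (use block_sum_bound[OF h T s w c] block_sum_mean[OF h T] block_sum_square[OF h T s w c] in auto)
 also have "... <= 2 * exp (tt^2 * (real N * ((real s * c)^2 * moment_const 2)) - tt * x)"
  using N moment_const_nonneg[of 2] by (auto intro!: mult_left_mono mult_right_mono)
 finally show ?thesis .
qed

text \<open>Splitting the times into residue classes modulo \<open>l + 1\<close> makes the terms of
  one class independent, and a total above \<open>(l + 1) * x\<close> forces some class above
  \<open>x\<close>. A union bound over \<open>k <= n\<close> takes the place of a maximal
  inequality. The tilt \<open>1 / (2 * T)\<close> is the largest admissible one for terms bounded by
  \<open>2 * T\<close>.\<close>

lemma partial_sum_tail:
 assumes h: "h \<ge> 1" and T: "0 < T"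
 shows "prob {w:space M. \<exists>k\<le>n. real (l + 1) * x < abs (\<Sum>j=1..k. Xt l T (int j) h w)}
  <= real (n + 1) * (real (l + 1) * (2 * exp (real n * moment_const 2 / (2 * T)^2 - x / (2 * T))))"
proof -
 note [measurable] = measurable_Xt[OF h less_imp_le[OF T]]
 define R where "R k r = {j : {1..k}. j mod (l + 1) = r}" for k r :: nat
 let ?U = "%k r w. SUM j:R k r. SUM i:{int j}. 1 * Xt l T i h w"
 let ?A = "%l. (UN k:{..n}. UN r:{..<l+1}. {w:space M. x < abs (?U k r w)})"
 let ?e = "2 * exp (real n * moment_const 2 / (2 * T)^2 - x / (2 * T))"
 have tail: "prob {w:space M. x < abs (?U k r w)} <= ?e" if "k <= n" for k r
 proof -
  have "prob {w:space M. x < abs (?U k r w)}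
    <= 2 * exp ((1 / (2 * T))^2 * (real n * ((real 1 * 1)^2 * moment_const 2)) - (1 / (2 * T)) * x)"
  proof (rule separated_tail[OF h less_imp_le[OF T]])
   show "card (R k r) <= n"
    using card_mono[of "{1..k}" "R k r"] that unfolding R_def by fastforce
   fix B B' j j' assume *: "B : R k r" "B' : R k r" "B \<noteq> B'" "j : {int B}" "j' : {int B'}"
   have "abs (int B - int B') \<noteq> 0" using *(3) by simp
   moreover have "int B mod int (l + 1) = int B' mod int (l + 1)" using *(1,2) unfolding zmod_int[symmetric] by (simp add: R_def)
   then have "int (l + 1) dvd int B - int B'" by (rule mod_eq_dvd_iff[THEN iffD1])
   ultimately have "int (l + 1) <= abs (int B - int B')" by (intro zdvd_imp_le) (auto simp: dvd_abs_iff)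
   then show "int l <= abs (j - j')" using *(4,5) by auto
  qed (use T in \<open>auto simp: R_def\<close>)
  then show ?thesis by (simp add: power_divide mult_ac)
 qed
 have split: "(\<Sum>j=1..k. Xt l T (int j) h w) = (\<Sum>r<l+1. ?U k r w)" for k w
 proof -
  have "(\<Sum>j=1..k. Xt l T (int j) h w) = (\<Sum>r<l+1. SUM j:{j:{1..k}. j mod (l + 1) = r}. Xt l T (int j) h w)"
   by (rule sum.group[symmetric]) auto
  then show ?thesis by (simp add: R_def)
 qed
 have "prob {w:space M. \<exists>k\<le>n. real (l + 1) * x < abs (\<Sum>j=1..k. Xt l T (int j) h w)}
   <= prob (?A l)"
 proof (rule finite_measure_mono)
  have "\<exists>r<l+1. x < abs (?U k r w)" if "real (l + 1) * x < abs (\<Sum>j=1..k. Xt l T (int j) h w)" for k w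
  proof (rule ccontr)
   assume "\<not> ?thesis"
   then have "(\<Sum>r<l+1. abs (?U k r w)) <= (\<Sum>r<l+1. x)" by (intro sum_mono) (meson lessThan_iff not_le)
   then have "abs (\<Sum>r<l+1. ?U k r w) <= real (l + 1) * x" using sum_abs[of "%r. ?U k r w" "{..<l+1}"] by simp
   then show False using that unfolding split by linarith
  qed
  then show "{w:space M. \<exists>k\<le>n. real (l + 1) * x < abs (\<Sum>j=1..k. Xt l T (int j) h w)} \<subseteq>
    (?A l)" by fastforce
 qed measurable
 also have "... <= (SUM k:{..n}. prob (UN r:{..<l+1}. {w:space M. x < abs (?U k r w)}))"
  by (intro finite_measure_subadditive_finite) auto
 also have "... <= (SUM k:{..n}. SUM r:{..<l+1}. prob {w:space M. x < abs (?U k r w)})"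
  by (intro sum_mono finite_measure_subadditive_finite) auto
 also have "... <= (SUM k:{..n}. SUM r:{..<l+1}. ?e)" by (intro sum_mono tail) auto
 also have "... = real (n + 1) * (real (l + 1) * ?e)" by (simp add: algebra_simps)
 finally show ?thesis .
qed

lemma sum_abs_Xt_diff_tail:
 assumes h: "h \<ge> 1" and T: "0 <= T"
  and ap: "\<And>j. (LINT w|M. (Xt l T j h w - X j h w)^2) <= c^2 \<and> integrable M (%w. (Xt l T j h w - X j h w)^2)"
 shows "prob {w:space M. 1 < (\<Sum>j=1..n. abs (Xt l T (int j) h w - X (int j) h w))} <= (real n * c)^2"
proof -
 note [measurable] = measurable_Xt[OF h T] measurable_X[OF h]
 let ?D = "%j w. Xt l T (int j) h w - X (int j) h w"
 let ?B = "%w. (\<Sum>j=1..n. (?D j w)^2)"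
 let ?A = "%w. (\<Sum>j=1..n. abs (?D j w))"
 have sq: "(?A w)^2 <= real n * ?B w" for w
  using power2_sum_weighted_le[of "{1..n}" n "%_. 1" 1 "%j. abs (?D j w)"] by simp
 have i: "integrable M (%w. real n * ?B w)" using ap by (intro integrable_mult_right Bochner_Integration.integrable_sum) auto
 have "prob {w:space M. 1 < (?A w)} <= prob {w:space M. 1 <= real n * (?B w)}"
 proof (rule finite_measure_mono)
  show "{w:space M. 1 < (?A w)} \<subseteq> {w:space M. 1 <= real n * (?B w)}"
  proof safe
   fix w assume "1 < ?A w"
   then have "1 <= (?A w)^2" by (simp add: one_le_power)
   then show "1 <= real n * ?B w" using sq[of w] by linarith
  qed
 qed measurable
 also have "... <= (LINT w|M. real n * ?B w) / 1"
  by (rule integral_Markov_inequality_measure[where A = "space M"]) (use i in \<open>auto intro!: AE_I2 mult_nonneg_nonneg sum_nonneg\<close>)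
 also have "... = real n * (\<Sum>j=1..n. (LINT w|M. (?D j w)^2))"
  using ap by (simp add: Bochner_Integration.integral_sum)
 also have "... <= real n * (\<Sum>j=1..n. c^2)" using ap by (intro mult_left_mono sum_mono) auto
 finally show ?thesis by (simp add: power2_eq_square mult_ac)
qed

end

section \<open>Gumbel limit for Gaussian tails\<close>

abbreviation "normal_tail u \<equiv> measure std_normal_distribution {u<..}"

text \<open>\<open>- std_normal_density x / x\<close> is an antiderivative of the density times
  \<open>1 + 1 / x^2\<close>, and on the tail beyond \<open>u\<close> that extra factor lies between
  1 and \<open>1 + 1 / u^2\<close>.\<close>

lemma mills_ratio:
 assumes u: "0 < u"
 shows "normal_tail u <= std_normal_density u / u" and "std_normal_density u / u <= (1 + 1 / u^2) * normal_tail u"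
proof -
 let ?p = std_normal_density
 let ?B = "(\<integral>\<^sup>+x. ennreal (?p x) * indicator {u..} x \<partial>lborel)"
 let ?A = "(\<integral>\<^sup>+x. ennreal (?p x * (1 + 1 / x^2)) * indicator {u..} x \<partial>lborel)"
 interpret prob_space std_normal_distribution by (rule prob_space_std_normal)
 have "DERIV ?p x :> - x * ?p x" for x
 proof -
  define c where "c = 1 / sqrt (2 * pi)"
  show ?thesis unfolding std_normal_density_def c_def[symmetric] by (auto intro!: derivative_eq_intros)
 qed
 then have "((%x. - (?p x / x)) has_real_derivative ?p x * (1 + 1 / x^2)) (at x)" if "u <= x" for x
  using that u by (auto intro!: derivative_eq_intros simp: field_simps power2_eq_square)
 moreover have "((%x. - (?p x / x)) \<longlongrightarrow> 0) at_top" unfolding std_normal_density_def by real_asymp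
 ultimately have "?A = ennreal (0 - - (?p u / u))"
  by (intro nn_integral_FTC_atLeast) auto
 also have "0 - - (?p u / u) = ?p u / u" by simp
 finally have 1: "?A = ennreal (?p u / u)" .
 have "emeasure std_normal_distribution {u<..} = (\<integral>\<^sup>+x. ennreal (?p x) * indicator {u<..} x \<partial>lborel)"
  by (subst emeasure_density) auto
 also have "... = ?B"
 proof (rule nn_integral_cong_AE)
  show "AE x in lborel. ennreal (?p x) * indicator {u<..} x = ennreal (?p x) * indicator {u..} x"
   using AE_lborel_singleton[of u] by eventually_elim (auto simp: indicator_def)
 qed
 finally have 2: "ennreal (normal_tail u) = ?B"
  by (simp add: emeasure_eq_measure)
 have "ennreal (normal_tail u) <= ennreal (?p u / u)"
  unfolding 1[symmetric] 2 by (intro nn_integral_mono mult_right_mono ennreal_leI) (auto simp: field_simps)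
 then show "normal_tail u <= ?p u / u" using u by simp
 have "ennreal (?p u / u) <= (\<integral>\<^sup>+x. ennreal (1 + 1 / u^2) * (ennreal (?p x) * indicator {u..} x) \<partial>lborel)"
  unfolding 1[symmetric]
 proof (rule nn_integral_mono)
  fix x :: real
  show "ennreal (?p x * (1 + 1 / x^2)) * indicator {u..} x <= ennreal (1 + 1 / u^2) * (ennreal (?p x) * indicator {u..} x)"
  proof (cases "u <= x")
   case True
   then have "1 / x^2 <= 1 / u^2" using u by (intro divide_left_mono power_mono) auto
   then have "?p x * (1 + 1 / x^2) <= ?p x * (1 + 1 / u^2)" by (intro mult_left_mono) auto
   then show ?thesis using True by (simp add: ennreal_mult''[symmetric] mult.commute del: ennreal_plus)
  qed simp
 qed
 also have "... = ennreal (1 + 1 / u^2) * ennreal (normal_tail u)" unfolding 2 by (rule nn_integral_cmult) measurable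
 also have "... = ennreal ((1 + 1 / u^2) * normal_tail u)" by (rule ennreal_mult''[symmetric]) simp
 finally show "?p u / u <= (1 + 1 / u^2) * normal_tail u"
  by (subst (asm) ennreal_le_iff) auto
qed

text \<open>\<open>ln (1 - q)\<close> lies between \<open>- q - 2 * q^2\<close> and
  \<open>- q\<close>, and \<open>d * q^2\<close> tends to 0 together with \<open>q\<close>.\<close>

lemma one_minus_power_tendsto:
 fixes q :: "nat => real" and d :: "nat => nat"
 assumes q: "\<And>n. 0 <= q n" and lim: "(%n. real (d n) * q n) ----> c" and d: "filterlim d at_top sequentially"
 shows "(%n. (1 - q n) ^ d n) ----> exp (- c)"
proof (rule tendsto_sandwich)
 let ?A = "%n. (- (real (d n) * q n) - 2 * (real (d n) * q n * q n))"
 have rd: "filterlim (%n. real (d n)) at_top sequentially"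
  by (rule filterlim_compose[OF filterlim_real_sequentially d])
 have q0: "q ----> 0"
 proof (rule Lim_transform_eventually)
  show "(%n. real (d n) * q n / real (d n)) ----> 0"
   by (rule tendsto_divide_0[OF lim]) (rule filterlim_mono[OF rd at_top_le_at_infinity order_refl])
  show "EV n. real (d n) * q n / real (d n) = q n"
   using filterlim_at_top_dense[THEN iffD1, OF rd, rule_format, of 0] by eventually_elim auto
 qed
 have small: "EV n. q n < 1/2" by (rule order_tendstoD[OF q0]) simp
 show "EV n. exp (?A n) <= (1 - q n) ^ d n"
  using small
 proof eventually_elim
  case (elim n)
  have "exp (- q n - 2 * (q n)^2) <= exp (ln (1 - q n))" using ln_one_minus_pos_lower_bound[of "q n"] q[of n] elim by (subst exp_le_cancel_iff) simp
  also have "... = 1 - q n" using elim by simp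
  finally have "exp (- q n - 2 * (q n)^2) ^ d n <= (1 - q n) ^ d n" by (intro power_mono) auto
  then show ?case by (simp add: exp_of_nat_mult[symmetric] algebra_simps power2_eq_square)
 qed
 show "EV n. (1 - q n) ^ d n <= exp (- (real (d n) * q n))"
  using small
 proof eventually_elim
  case (elim n)
  have "(1 - q n) ^ d n <= exp (- q n) ^ d n" using exp_ge_add_one_self[of "- q n"] elim by (intro power_mono) auto
  then show ?case by (simp add: exp_of_nat_mult[symmetric])
 qed
 have "(%n. exp (?A n)) ----> exp (- c - 2 * (c * 0))"
  by (intro tendsto_intros lim q0)
 then show "(%n. exp (?A n)) ----> exp (- c)" by simp
 show "(%n. exp (- (real (d n) * q n))) ----> exp (- c)" by (intro tendsto_intros lim)
qed

context
 fixes d :: "nat => nat" and v :: "nat => real" and x :: real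
 assumes d: "filterlim d at_top sequentially"
  and lim: "(%n. gumbel_a (d n) * (v n - gumbel_b (d n))) ----> x"
begin

abbreviation (input) "lam n \<equiv> ln (real (d n))"

lemma filterlim_lam: "filterlim (%n. lam n) at_top sequentially"
 by (intro filterlim_compose[OF ln_at_top] filterlim_compose[OF filterlim_real_sequentially d])

text \<open>Only the normalised position of the level has to converge, so that levels shifted by a
  smaller order than \<open>1 / sqrt (log d)\<close> are covered without further work.\<close>

lemma gumbel_level_asymp:
 shows "(%n. v n / sqrt (lam n)) ----> sqrt 2"
  and "(%n. real (d n) * exp (- (v n)\<^sup>2 / 2) / sqrt (lam n)) ----> sqrt (4 * pi) * exp (- x)"
proof -
 define y where "y n = gumbel_a (d n) * (v n - gumbel_b (d n))" for n
 \<comment> \<open>By the form of \<open>gumbel_b\<close>, \<open>v = a + D / a\<close> with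
   \<open>a = gumbel_a\<close>. Hence \<open>v^2 / 2 = log d + D + D^2 / (4 * log d)\<close>, and
   \<open>D\<close> grows only like \<open>log (log d)\<close>, so that the last term
   vanishes.\<close>
 define D where "D n = y n - ln (4 * pi * lam n) / 2" for n
 let ?A = "%n. (- y n - (D n / sqrt (lam n))^2 / 4)"
 have y: "y ----> x" using lim by (simp add: y_def[abs_def])
 have pos: "EV n. 0 < lam n" using filterlim_lam by (simp add: filterlim_at_top_dense)
 have veq: "v n = sqrt (2 * lam n) + D n / sqrt (2 * lam n)" if "0 < lam n" for n
  using that by (simp add: D_def y_def gumbel_b_def gumbel_a_def field_simps)
 have lims: "((%z::real. 1 / sqrt z) \<longlongrightarrow> 0) at_top" "((%z::real. ln (4 * pi * z) / sqrt z) \<longlongrightarrow> 0) at_top"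
  by real_asymp+
 have Ds: "(%n. D n / sqrt (lam n)) ----> 0"
 proof -
  have "(%n. y n * (1 / sqrt (lam n)) - (ln (4 * pi * lam n) / sqrt (lam n)) / 2) ----> x * 0 - 0 / 2"
   by (intro tendsto_intros y filterlim_compose[OF lims(1) filterlim_lam] filterlim_compose[OF lims(2) filterlim_lam]) auto
  then show ?thesis by (simp add: D_def diff_divide_distrib mult_ac)
 qed
 have i0: "(%n. 1 / sqrt (lam n)) ----> 0" by (rule filterlim_compose[OF lims(1) filterlim_lam])
 have "(%n. sqrt 2 + D n / sqrt (lam n) * (1 / sqrt (lam n)) / sqrt 2) ----> sqrt 2 + 0 * 0 / sqrt 2"
  by (intro tendsto_intros Ds i0) auto
 then have "(%n. sqrt 2 + D n / sqrt (lam n) * (1 / sqrt (lam n)) / sqrt 2) ----> sqrt 2" by simp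
 then show "(%n. v n / sqrt (lam n)) ----> sqrt 2"
 proof (rule Lim_transform_eventually)
  show "EV n. sqrt 2 + D n / sqrt (lam n) * (1 / sqrt (lam n)) / sqrt 2 = v n / sqrt (lam n)"
   using pos by eventually_elim (simp add: veq real_sqrt_mult add_divide_distrib mult_ac)
 qed
 have "(%n. sqrt (4 * pi) * exp (?A n)) ----> sqrt (4 * pi) * exp (- x - 0^2 / 4)"
  by (intro tendsto_intros y Ds) auto
 then have "(%n. sqrt (4 * pi) * exp (?A n)) ----> sqrt (4 * pi) * exp (- x)" by simp
 then show "(%n. real (d n) * exp (- (v n)\<^sup>2 / 2) / sqrt (lam n)) ----> sqrt (4 * pi) * exp (- x)"
 proof (rule Lim_transform_eventually)
  show "EV n. sqrt (4 * pi) * exp (?A n) = real (d n) * exp (- (v n)\<^sup>2 / 2) / sqrt (lam n)"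
   using pos
  proof eventually_elim
   case (elim n)
   define a where "a = sqrt (2 * lam n)"
   have a: "0 < a" "a^2 = 2 * lam n" using elim by (auto simp: a_def)
   have "(v n)^2 = a^2 + 2 * D n + (D n)^2 / a^2"
    unfolding veq[OF elim] a_def[symmetric] using a(1) by (simp add: power2_sum power_divide)
   then have "lam n - (v n)^2 / 2 = - D n - (D n)^2 / (4 * lam n)" unfolding a(2) by (simp add: add_divide_distrib)
   also have "... = ln (4 * pi * lam n) / 2 + ?A n" using elim by (simp add: D_def power_divide)
   finally have "exp (lam n - (v n)^2 / 2) = exp (ln (4 * pi * lam n) / 2) * exp (?A n)" by (simp add: exp_add)
   moreover have "exp (ln (4 * pi * lam n) / 2) = sqrt (4 * pi * lam n)"
    using elim by (intro real_sqrt_unique[symmetric]) (auto simp: power2_eq_square mult_exp_exp)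
   moreover have "exp (lam n - (v n)^2 / 2) = real (d n) * exp (- (v n)\<^sup>2 / 2)"
   proof -
    have "0 < real (d n)" using elim by (cases "d n = 0") auto
    then show ?thesis by (simp only: exp_diff exp_minus exp_ln divide_inverse minus_mult_left[symmetric])
   qed
   ultimately show ?case using elim by (simp add: real_sqrt_mult)
  qed
 qed
qed

lemma level_at_top: "filterlim v at_top sequentially"
proof -
 have "filterlim (%n. v n / sqrt (lam n) * sqrt (lam n)) at_top sequentially"
  by (rule filterlim_tendsto_pos_mult_at_top[OF gumbel_level_asymp(1)])
   (auto intro: filterlim_compose[OF sqrt_at_top filterlim_lam])
 moreover have "EV n. v n / sqrt (lam n) * sqrt (lam n) = v n"
  using filterlim_at_top_dense[THEN iffD1, OF filterlim_lam, rule_format, of 0] by eventually_elim simp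
 ultimately show ?thesis by (simp cong: filterlim_cong)
qed

lemma normal_tail_limit: "(%n. real (d n) * normal_tail (v n)) ----> exp (- x)"
proof -
 let ?r = "%n. real (d n) * (std_normal_density (v n) / v n)"
 have pos: "EV n. 0 < lam n" using filterlim_lam by (simp add: filterlim_at_top_dense)
 have vpos: "EV n. 0 < v n" using level_at_top by (simp add: filterlim_at_top_dense)
 have "(%n. real (d n) * exp (- (v n)\<^sup>2 / 2) / sqrt (lam n) / (sqrt (2 * pi) * (v n / sqrt (lam n))))
   ----> sqrt (4 * pi) * exp (- x) / (sqrt (2 * pi) * sqrt 2)"
  by (intro tendsto_intros gumbel_level_asymp) auto
 also have "sqrt (4 * pi) * exp (- x) / (sqrt (2 * pi) * sqrt 2) = exp (- x)"
  by (simp add: real_sqrt_mult)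
 finally have r: "?r ----> exp (- x)"
 proof (rule Lim_transform_eventually)
  show "EV n. real (d n) * exp (- (v n)\<^sup>2 / 2) / sqrt (lam n) / (sqrt (2 * pi) * (v n / sqrt (lam n))) = ?r n"
   using pos by eventually_elim (simp add: std_normal_density_def)
 qed
 show ?thesis
 proof (rule tendsto_sandwich[OF _ _ _ r])
  have "((%u::real. 1 / (1 + 1 / u^2)) \<longlongrightarrow> 1) at_top" by real_asymp
  then have "(%n. ?r n * (1 / (1 + 1 / (v n)^2))) ----> exp (- x) * 1"
   by (intro tendsto_mult r filterlim_compose[OF _ level_at_top])
  then show "(%n. ?r n * (1 / (1 + 1 / (v n)^2))) ----> exp (- x)" by simp
  show "EV n. ?r n * (1 / (1 + 1 / (v n)^2)) <= real (d n) * normal_tail (v n)"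
   using vpos
  proof eventually_elim
   case (elim n)
   have "0 < 1 + 1 / (v n)^2" using elim by (simp add: add_pos_nonneg)
   then have "std_normal_density (v n) / v n * (1 / (1 + 1 / (v n)^2)) <= normal_tail (v n)"
    using mills_ratio(2)[OF elim] by (simp add: pos_divide_le_eq mult.commute del: divide_divide_eq_left)
   then show ?case unfolding mult.assoc by (rule mult_left_mono) simp
  qed
  show "EV n. real (d n) * normal_tail (v n) <= ?r n"
   using vpos by eventually_elim (rule mult_left_mono[OF mills_ratio(1)], auto)
 qed
qed

lemma normal_cdf_power_limit: "(%n. (1 - normal_tail (v n)) ^ d n) ----> exp (- exp (- x))"
 by (rule one_minus_power_tendsto[OF _ normal_tail_limit d]) simp

end

text \<open>A variance close to 1 is traded for a small change of level, by
  \<open>sqrt s2 * (1 - e) <= 1 <= sqrt s2 * (1 + 2 * e)\<close>. The cutoff itself is enclosed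
  between indicators at the levels \<open>v\<close> and \<open>u\<close>.\<close>

lemma cutoff_integral_bounds:
 fixes c :: "real => real"
 assumes [measurable]: "c : borel_measurable borel" and c01: "\<And>z. 0 <= c z \<and> c z <= 1"
  and v: "\<And>z. z <= v ==> c z = 1" and u: "\<And>z. u <= z ==> c z = 0" and uv: "0 <= v" "0 <= u"
  and s: "0 <= s2" "1 - e <= s2" "s2 <= 1 + e" and e: "0 <= e" "e <= 1/2"
 shows "1 - normal_tail (v * (1 - e)) <= (LINT x|std_normal_distribution. c (sqrt s2 * x))"
  and "(LINT x|std_normal_distribution. c (sqrt s2 * x)) <= 1 - normal_tail (u * (1 + 2 * e))"
proof -
 let ?A = "LINT x|std_normal_distribution. c (sqrt s2 * x)"
 interpret prob_space std_normal_distribution by (rule prob_space_std_normal)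
 have ind: "1 - normal_tail w = (LINT x|std_normal_distribution. indicator {..w} x)" for w
 proof -
  have "1 - normal_tail w = prob (space std_normal_distribution - {w<..})" by (subst prob_compl) auto
  also have "space std_normal_distribution - {w<..} = {..w}" by auto
  finally show ?thesis by simp
 qed
 have i1: "integrable std_normal_distribution (indicator {..w} :: real => real)" for w by (auto simp: emeasure_eq_measure)
 have i2: "integrable std_normal_distribution (%x. c (sqrt s2 * x))"
  by (rule integrable_const_bound[where B = 1]) (use c01 in auto)
 have s0: "0 < sqrt s2" using s e by auto
 have "(1 - e)^2 * (1 + e) <= 1"
 proof -
  have "(1 - e)^2 * (1 + e) = (1 - e) * (1 - e^2)" by (simp add: power2_eq_square algebra_simps)
  also have "... <= 1 * 1" using e by (intro mult_mono) (auto simp: abs_square_le_1)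
  finally show ?thesis by simp
 qed
 then have "(1 - e)^2 * s2 <= 1" using mult_left_mono[OF s(3), of "(1 - e)^2"] by simp
 then have "sqrt ((1 - e)^2 * s2) <= 1" by simp
 then have lo: "sqrt s2 * (1 - e) <= 1" using e by (simp add: real_sqrt_mult mult.commute)
 have "1 <= (1 + 2 * e)^2 * (1 - e)"
 proof -
  have "4 * e^2 <= 1" using power_mono[of e "1/2" 2] e by (simp add: power_divide)
  then have "0 <= e * (3 - 4 * e^2)" using e by simp
  then show ?thesis by (simp add: power2_eq_square algebra_simps)
 qed
 then have "1 <= (1 + 2 * e)^2 * s2" using mult_left_mono[OF s(2), of "(1 + 2 * e)^2"] by simp
 then have "1 <= sqrt ((1 + 2 * e)^2 * s2)" by simp
 then have hi: "1 <= sqrt s2 * (1 + 2 * e)" using e by (simp add: real_sqrt_mult mult.commute)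
 show "1 - normal_tail (v * (1 - e)) <= ?A"
  unfolding ind
 proof (rule Bochner_Integration.integral_mono[OF i1 i2])
  fix x
  show "indicator {..v * (1 - e)} x <= c (sqrt s2 * x)"
  proof (cases "x <= v * (1 - e)")
   case True
   then have "sqrt s2 * x <= sqrt s2 * (v * (1 - e))" using s0 by (intro mult_left_mono) auto
   also have "... = v * (sqrt s2 * (1 - e))" by simp
   also have "... <= v * 1" using lo uv by (intro mult_left_mono) auto
   finally show ?thesis using v c01 by simp
  qed (use c01 in simp)
 qed
 show "?A <= 1 - normal_tail (u * (1 + 2 * e))"
  unfolding ind
 proof (rule Bochner_Integration.integral_mono[OF i2 i1])
  fix x
  show "c (sqrt s2 * x) <= indicator {..u * (1 + 2 * e)} x"
  proof (cases "x <= u * (1 + 2 * e)")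
   case False
   have "u * 1 <= u * (sqrt s2 * (1 + 2 * e))" using hi uv by (intro mult_left_mono) auto
   also have "... = sqrt s2 * (u * (1 + 2 * e))" by simp
   also have "... <= sqrt s2 * x" using s0 False by (intro mult_left_mono) auto
   finally show ?thesis using u by simp
  qed (use c01 in simp)
 qed
qed

section \<open>Big blocks and gaps\<close>

definition blk :: "nat => nat => nat => int set" where
 "blk b l B = {int (B * (b + l)) + 1..int (B * (b + l)) + int b}"

definition gap :: "nat => nat => nat => int set" where
 "gap b l B = {int (B * (b + l)) + int b + 1..int (B * (b + l)) + int (b + l)}"

lemma card_blk [simp]: "card (blk b l B) = b" and card_gap [simp]: "card (gap b l B) = l"
 by (simp_all add: blk_def gap_def)

lemma finite_blk [simp]: "finite (blk b l B)" and finite_gap [simp]: "finite (gap b l B)"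
 by (simp_all add: blk_def gap_def)

lemma index_block_less:
 fixes B B' :: nat
 assumes "B < B'"
 shows "int (B * (b + l)) + int (b + l) <= int (B' * (b + l))"
proof -
 have "Suc B * (b + l) <= B' * (b + l)" using assms by (intro mult_right_mono) auto
 then have "int (Suc B * (b + l)) <= int (B' * (b + l))" by (simp only: of_nat_le_iff)
 then show ?thesis by (simp add: algebra_simps)
qed

lemma blk_separated:
 assumes "B \<noteq> B'" "j : blk b l B" "j' : blk b l B'"
 shows "int l <= abs (j - j')"
 using assms index_block_less[of B B' b l] index_block_less[of B' B b l]
 by (cases "B < B'") (auto simp: blk_def)

lemma gap_separated:
 assumes "B \<noteq> B'" "j : gap b l B" "j' : gap b l B'" "l <= b"
 shows "int l <= abs (j - j')"
 using assms index_block_less[of B B' b l] index_block_less[of B' B b l]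
 by (cases "B < B'") (auto simp: gap_def)

lemma sum_int_concat:
 fixes f :: "int => real"
 assumes "a <= c" "c <= e"
 shows "sum f {a+1..e} = sum f {a+1..c} + sum f {c+1..e}"
proof -
 have "{a+1..e} = {a+1..c} \<union> {c+1..e}" using assms by auto
 then show ?thesis by (simp add: sum.union_disjoint)
qed

lemma sum_blocks:
 fixes f :: "int => real"
 shows "sum f {1..int (N * (b + l))} = (\<Sum>B<N. sum f (blk b l B)) + (\<Sum>B<N. sum f (gap b l B))"
proof (induction N)
 case (Suc N)
 let ?a = "int (N * (b + l))"
 have "int (Suc N * (b + l)) = ?a + int (b + l)" by simp
 then have "sum f {1..int (Suc N * (b + l))} = sum f {0 + 1..?a + int (b + l)}" by (simp only: add_0)
 also have "... = sum f {0 + 1..?a} + (sum f {?a + 1..?a + int b} + sum f {?a + int b + 1..?a + int (b + l)})"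
  by (subst sum_int_concat[of 0 ?a], simp, simp, subst sum_int_concat[of ?a "?a + int b"]) auto
 finally show ?case using Suc by (simp add: blk_def gap_def)
qed simp

lemma sum_blocks_rest:
 fixes f :: "int => real"
 assumes "N * (b + l) <= n"
 shows "sum f {1..int n} = (\<Sum>B<N. sum f (blk b l B)) + (\<Sum>B<N. sum f (gap b l B)) + sum f {int (N * (b + l)) + 1..int n}"
proof -
 have "sum f {0 + 1..int n} = sum f {0 + 1..int (N * (b + l))} + sum f {int (N * (b + l)) + 1..int n}"
  using assms by (intro sum_int_concat) (simp_all only: of_nat_0_le_iff of_nat_le_iff)
 then show ?thesis by (simp only: add_0 sum_blocks)
qed

lemma sum_int_nat: "(\<Sum>j=1..n. f (int j)) = (\<Sum>j=1..int n. f j)" for f :: "int => real"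
 by (rule sum.reindex_bij_witness[of _ nat int]) auto

lemma cube_sum_le:
 fixes x :: "'i => real"
 assumes x: "\<And>j. j : J ==> 0 <= x j"
 shows "(SUM j:J. x j) ^ 3 <= (real (card J))^2 * (SUM j:J. x j ^ 3)"
proof -
 have "(SUM j:J. x j) ^ 3 = (SUM i:J. SUM j:J. SUM k:J. x i * (x j * x k))"
  by (simp add: power3_eq_cube sum_distrib_left[symmetric] sum_distrib_right[symmetric] mult.assoc)
 also have "... <= (SUM i:J. SUM j:J. SUM k:J. (x i ^ 3 + x j ^ 3 + x k ^ 3) / 3)"
  using amgm3 x by (intro sum_mono) (simp add: mult.assoc)
 also have "... = (real (card J))^2 * (SUM j:J. x j ^ 3)"
  by (simp add: sum.distrib sum_divide_distrib[symmetric] sum_distrib_left[symmetric] power2_eq_square)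
 finally show ?thesis .
qed

context causal_array
begin

lemma block_sum_cube:
 assumes h: "h \<ge> 1" and T: "0 <= T" and s: "finite J" "card J <= s" and w: "\<And>j. j : J ==> abs (w j) <= c" and c: "0 <= c"
 shows "(LINT u|M. abs (SUM j:J. w j * Xt l T j h u) ^ 3) <= (real s * c) ^ 3 * moment_const 3"
proof -
 let ?B = "%u. abs (SUM j:J. w j * Xt l T j h u)"
 let ?A = "%u. (SUM j:J. abs (Xt l T j h u) ^ 3)"
 have p: "?B u ^ 3 <= c ^ 3 * ((real s)^2 * ?A u)" for u
 proof -
  have "?B u <= c * (SUM j:J. abs (Xt l T j h u))"
   unfolding sum_distrib_left using w by (intro order_trans[OF sum_abs] sum_mono) (auto simp: abs_mult intro!: mult_right_mono)
  then have "?B u ^ 3 <= c ^ 3 * (SUM j:J. abs (Xt l T j h u)) ^ 3"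
   unfolding power_mult_distrib[symmetric] by (intro power_mono) auto
  also have "... <= c ^ 3 * ((real (card J))^2 * ?A u)"
   using c by (intro mult_left_mono cube_sum_le) auto
  also have "... <= c ^ 3 * ((real s)^2 * ?A u)"
   using c s by (intro mult_left_mono mult_right_mono power_mono sum_nonneg) auto
  finally show ?thesis .
 qed
 have "(LINT u|M. ?B u ^ 3) <= (LINT u|M. c ^ 3 * ((real s)^2 * ?A u))"
  by (intro integral_mono_AE' AE_I2 p integrable_mult_right Bochner_Integration.integrable_sum Xt_power_integrable[OF h T] mult_nonneg_nonneg sum_nonneg) (use c in auto)
 also have "... = c ^ 3 * ((real s)^2 * (SUM j:J. (LINT u|M. abs (Xt l T j h u) ^ 3)))"
  by (subst Bochner_Integration.integral_mult_right_zero, subst Bochner_Integration.integral_mult_right_zero, subst Bochner_Integration.integral_sum)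
   (auto simp: Xt_power_integrable[OF h T])
 also have "... <= c ^ 3 * ((real s)^2 * (SUM j:J. moment_const 3))"
  using c by (intro mult_left_mono sum_mono Xt_moment[OF h T]) auto
 also have "... <= c ^ 3 * ((real s)^2 * (real s * moment_const 3))"
  using c s moment_const_nonneg[of 3] by (intro mult_left_mono) (auto intro!: mult_right_mono)
 finally show ?thesis by (simp add: power2_eq_square power3_eq_cube mult_ac)
qed

text \<open>Replacing truncated products by true cross-covariances costs a multiple of
  \<open>c\<close> for each of the \<open>b^2\<close> pairs of times. What remains is a double sum
  with slowly varying weights and geometrically decaying covariances, governed by the long-run
  covariance.\<close>

lemma block_covariance:
 fixes \<alpha> \<beta> :: "int => real"
 assumes h: "h \<ge> 1" and i: "i \<ge> 1" and T: "0 <= T" and c: "0 < c"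
  and ap: "\<And>j k. k : {h, i} ==> (LINT w|M. (Xt l T j k w - X j k w)^2) <= c^2 \<and> integrable M (%w. (Xt l T j k w - X j k w)^2)"
  and al: "\<And>j. j : {a..e} ==> abs (\<alpha> j) <= A" and be: "\<And>j. j : {a..e} ==> abs (\<beta> j) <= A"
  and lip: "\<And>j k. j : {a..e} ==> k : {a..e} ==> abs (\<beta> k - \<beta> j) <= W * of_int (abs (k - j))" and A: "0 <= A" and W: "0 <= W"
  and b: "card {a..e} = b"
 shows "abs ((LINT w|M. (\<Sum>j=a..e. \<alpha> j * Xt l T j h w) * (\<Sum>k=a..e. \<beta> k * Xt l T k i w)) - lr_cov M X h i * (\<Sum>j=a..e. \<alpha> j * \<beta> j))
  <= A * W * real b * (2 * moment_const 2 / (1 - sqrt \<delta>)^2) + A^2 * (2 * moment_const 2 / (1 - \<delta>)^2)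
   + (real b * A)^2 * ((moment_const 2 + 1) * c)"
proof -
 let ?D = "%a e. (LINT w|M. (\<Sum>j=a..e. \<alpha> j * Xt l T j h w) * (\<Sum>k=a..e. \<beta> k * Xt l T k i w))"
 let ?C = "(moment_const 2 + 1)"
 let ?E = "%j k. (LINT w|M. Xt l T j h w * Xt l T k i w)"
 let ?A = "%a e. (\<Sum>j=a..e. \<Sum>k=a..e. \<alpha> j * \<beta> k * ?E j k)"
 let ?\<phi> = "cross_cov M X h i"
 let ?B = "%a e. (\<Sum>j=a..e. \<Sum>k=a..e. \<alpha> j * \<beta> k * ?\<phi> (k - j))"
 have int: "integrable M (%w. Xt l T j h w * Xt l T k i w)" for j k
  by (rule integrable_mult_L2) (intro measurable_Xt Xt_square h i T)+
 have "(?D a e)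
   = (LINT w|M. (\<Sum>j=a..e. \<Sum>k=a..e. \<alpha> j * \<beta> k * (Xt l T j h w * Xt l T k i w)))"
  by (simp add: sum_product mult_ac)
 also have "... = ?A a e"
  using int by (simp add: Bochner_Integration.integral_sum)
 finally have eq: "(?D a e)
   = ?A a e" .
 have "abs (?A a e - ?B a e)
   = abs (\<Sum>j=a..e. \<Sum>k=a..e. \<alpha> j * \<beta> k * (?E j k - ?\<phi> (k - j)))"
  by (simp add: sum_subtractf right_diff_distrib)
 also have "... <= (\<Sum>j=a..e. \<Sum>k=a..e. A * A * (?C * c))"
 proof (intro order_trans[OF sum_abs] sum_mono)
  fix j k assume jk: "j : {a..e}" "k : {a..e}"
  have "abs (?E j k - ?\<phi> (k - j)) <= ?C * c"
   by (rule Xt_product_approx[OF h i T c ap refl refl])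
  then show "abs (\<alpha> j * \<beta> k * (?E j k - ?\<phi> (k - j))) <= A * A * (?C * c)"
   unfolding abs_mult using al[OF jk(1)] be[OF jk(2)] A by (intro mult_mono) auto
 qed
 also have "... = (real b * A)^2 * (?C * c)" by (simp only: sum_constant b) (simp add: power2_eq_square)
 finally have 1: "abs (?A a e - ?B a e)
   <= (real b * A)^2 * (?C * c)" .
 have 2: "abs (?B a e - lr_cov M X h i * (\<Sum>j=a..e. \<alpha> j * \<beta> j))
   <= A * W * real b * (2 * moment_const 2 / (1 - sqrt \<delta>)^2) + A^2 * (2 * moment_const 2 / (1 - \<delta>)^2)"
  unfolding lr_cov_def b[symmetric]
  by (rule weighted_window_covariance[OF \<delta> moment_const_nonneg cross_cov_decay[OF h i] al be lip A W])
 show ?thesis unfolding eq using 1 2 by linarith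
qed

end

section \<open>The normalised CUSUM statistics\<close>

locale cusum_array = causal_array M S eps eps' g p K \<delta> for M :: "'w measure" and S :: "'s measure" and eps eps' g p K \<delta> +
 fixes \<mu>1 \<mu>2 t :: "nat => real" and \<sigma>_lo tb Cl Cu :: real
 assumes sd_lower: "0 < \<sigma>_lo" "h \<ge> 1 ==> \<sigma>_lo <= lr_sd M (causal g eps) h"
  and change_point: "0 < tb" "tb < 1/2" "h \<ge> 1 ==> tb <= t h \<and> t h <= 1 - tb"
  and jump: "0 < Cl" "Cl <= Cu" "h \<ge> 1 ==> Cl <= abs (\<mu>1 h - \<mu>2 h) \<and> abs (\<mu>1 h - \<mu>2 h) <= Cu"
begin

abbreviation "\<sigma> h \<equiv> lr_sd M X h"

definition V :: real where "V = 18 / tb"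

definition wt :: "nat => nat => int => real" where
 "wt n h j = tweight n (t h) (\<mu>1 h - \<mu>2 h) (nat j)"

definition cw :: "nat => nat => int => real" where
 "cw n h j = wt n h j / (\<sigma> h * sqrt (real n))"

text \<open>A bound of order \<open>1 / sqrt n\<close> for the weights \<open>cw\<close> that is
  uniform in the coordinate and in time.\<close>

definition A :: "nat => real" where "A n = V / (\<sigma>_lo * sqrt (real n))"

definition Y :: "nat => nat => real => nat => nat => nat => 'w => real" where
 "Y n l T b B h u = (SUM j:blk b l B. cw n h j * Xt l T j h u)"

definition tst :: "nat => nat => 'w => real" where
 "tst n h u = tstat n (t h) (\<sigma> h) (\<mu>1 h - \<mu>2 h) (%j. obs n \<mu>1 \<mu>2 t X j h u)"

lemma V_pos: "0 < V" using change_point by (simp add: V_def)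

lemma sd_pos: "h \<ge> 1 ==> 0 < \<sigma> h" using sd_lower by (meson less_le_trans)

lemma lr_cov_self: "h \<ge> 1 ==> lr_cov M X h h = (\<sigma> h)^2"
 using sd_pos[of h] by (simp add: lr_sd_def)

lemma A_nonneg: "0 <= A n" using V_pos sd_lower by (simp add: A_def)

lemma A_square: "0 < n ==> (A n)\<^sup>2 = V^2 / \<sigma>_lo^2 / real n"
 by (simp add: A_def power_divide power_mult_distrib)

context
 fixes h :: nat
 assumes h: "h \<ge> 1"
begin

lemma t_range: "0 < t h" "t h < 1" "tb <= t h" "t h <= 1 - tb" using change_point(1) change_point(3)[OF h] by auto

lemma wt_bound: "0 < n ==> abs (wt n h j) <= V"
 unfolding wt_def V_def by (intro tweight_bound t_range change_point)

lemma cw_bound: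
 assumes n: "0 < n"
 shows "abs (cw n h j) <= A n"
 unfolding cw_def A_def abs_divide using wt_bound[OF n, of j] sd_lower(1) sd_lower(2)[OF h] n sd_pos[OF h]
 by (intro frac_le) (auto simp: abs_mult intro!: mult_right_mono)

lemma cw_lip:
 assumes n: "0 < n" and jk: "j : {1..int n}" "k : {1..int n}"
 shows "abs (cw n h k - cw n h j) <= A n / real n * of_int (abs (k - j))"
proof -
 let ?A = "abs (wt n h k - wt n h j)"
 have "?A <= V / real n * abs (real (nat k) - real (nat j))"
  unfolding wt_def V_def using jk by (intro tweight_lip t_range change_point n) auto
 then have w: "?A <= V / real n * of_int (abs (k - j))" using jk by simp
 have "abs (cw n h k - cw n h j) = ?A / (\<sigma> h * sqrt (real n))"
  using sd_pos[OF h] n by (simp add: cw_def diff_divide_distrib[symmetric] abs_mult)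
 also have "... <= V / real n * of_int (abs (k - j)) / (\<sigma>_lo * sqrt (real n))"
  using w sd_lower(1) sd_lower(2)[OF h] n V_pos by (intro frac_le mult_right_mono) auto
 finally show ?thesis by (simp add: A_def mult_ac)
qed

lemma wt_square_sum:
 assumes n: "0 < n"
 shows "abs ((\<Sum>j=1..int n. (wt n h j)^2) / real n - 1) <= 17 * V^2 / real n"
proof -
 have "\<mu>1 h - \<mu>2 h \<noteq> 0" using jump(1) jump(3)[OF h] by auto
 then have "abs ((\<Sum>j=1..n. (tweight n (t h) (\<mu>1 h - \<mu>2 h) j)^2) / real n - 1) <= 17 * V^2 / real n"
  unfolding V_def by (intro tweight_square_sum t_range change_point n)
 then show ?thesis unfolding sum_int_nat[symmetric] wt_def by simp
qed

lemma tst_linear: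
 assumes n: "0 < n" and R: "\<And>k. k <= n ==> abs (\<Sum>j=1..k. X (int j) h w) <= R"
 shows "abs (tst n h w - (\<Sum>j=1..int n. cw n h j * X j h w))
  <= 54 * Cu / (tb * \<sigma>_lo) / sqrt (real n) + 36 / (tb * \<sigma>_lo * Cl) * R^2 / (real n * sqrt (real n))"
proof -
 have "(\<Sum>j=1..int n. cw n h j * X j h w) = (\<Sum>j=1..n. tweight n (t h) (\<mu>1 h - \<mu>2 h) j * X (int j) h w) / (\<sigma> h * sqrt (real n))"
  unfolding sum_int_nat[symmetric] by (simp add: cw_def wt_def sum_divide_distrib)
 then show ?thesis unfolding tst_def obs_def
  using jump(1) jump(3)[OF h] by (simp only:) (intro tstat_linear n t_range change_point sd_lower(1) sd_lower(2)[OF h] refl R; simp)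
qed

lemma measurable_tst: "0 < n ==> tst n h : borel_measurable M"
 unfolding tst_def[abs_def] tstat_def msq_def obs_def using measurable_X[OF h]
 by (simp add: integral_cusum_square cpart_def)

lemma measurable_Y: "0 <= T ==> Y n l T b B h : borel_measurable M"
 unfolding Y_def using measurable_Xt[OF h] by auto

lemma Y_mean: "0 <= T ==> (LINT w|M. Y n l T b B h w) = 0"
 unfolding Y_def by (rule block_sum_mean[OF h])

lemma Y_bound: "0 < n ==> 0 <= T ==> abs (Y n l T b B h w) <= real b * (A n * (2 * T))"
 unfolding Y_def by (rule block_sum_bound[OF h]) (auto simp: cw_bound A_nonneg)

lemma Y_cube: "0 < n ==> 0 <= T ==> (LINT w|M. abs (Y n l T b B h w) ^ 3) <= (real b * A n) ^ 3 * moment_const 3"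
 unfolding Y_def by (rule block_sum_cube[OF h]) (auto simp: cw_bound A_nonneg)

end

lemma Y_indep:
 "indep_vars (%_. PiM {1..d} (%_. borel)) (%B w. \<lambda>h\<in>{1..d}. Y n l T b B h w) {..<N}"
 unfolding Y_def Xt_def by (intro indep_separated_blocks measurable_gclip blk_separated) auto

text \<open>The three terms are, summed over all blocks, the variation of the weights inside a
  block, the end effects of the blocks, and the replacement of \<open>X\<close> by bounded variables
  at accuracy \<open>c\<close>.\<close>

definition cov_err :: "nat => nat => real => real" where
 "cov_err n b c = V^2 / \<sigma>_lo^2 * (2 * moment_const 2 / (1 - sqrt \<delta>)^2 / real n + 2 * moment_const 2 / (1 - \<delta>)^2 / real b
   + real b * ((moment_const 2 + 1) * c))"

lemma cov_err_nonneg: "0 <= c ==> 0 <= cov_err n b c"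
 unfolding cov_err_def using moment_const_nonneg[of 2] by simp

lemma Y_covariance_sum:
 assumes h: "h \<ge> 1" and i: "i \<ge> 1" and T: "0 <= T" and c: "0 < c" and n: "0 < n" and b: "0 < b" and N: "N * (b + l) <= n"
  and ap: "\<And>j k. k : {h, i} ==> (LINT w|M. (Xt l T j k w - X j k w)^2) <= c^2 \<and> integrable M (%w. (Xt l T j k w - X j k w)^2)"
 shows "(\<Sum>B<N. abs ((LINT w|M. Y n l T b B h w * Y n l T b B i w) - lr_corr M X h i * ((SUM j:blk b l B. wt n h j * wt n i j) / real n)))
   <= cov_err n b c"
proof -
 let ?A = "%B. abs ((LINT w|M. Y n l T b B h w * Y n l T b B i w) - lr_corr M X h i * ((SUM j:blk b l B. wt n h j * wt n i j) / real n))"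
 define K1 K2 K3 where "K1 = 2 * moment_const 2 / (1 - sqrt \<delta>)^2" and "K2 = 2 * moment_const 2 / (1 - \<delta>)^2" and "K3 = (moment_const 2 + 1) * c"
 have K: "0 <= K1" "0 <= K2" "0 <= K3" using moment_const_nonneg[of 2] c by (auto simp: K1_def K2_def K3_def)
 have Nb: "real N * real b <= real n"
 proof -
  have "N * b <= N * (b + l)" by simp
  then have "N * b <= n" using N by linarith
  then show ?thesis by (metis of_nat_le_iff of_nat_mult)
 qed
 have one: "(?A B)
   <= A n * (A n / real n) * real b * K1 + (A n)^2 * K2 + (real b * A n)^2 * K3" if B: "B < N" for B
 proof -
  have "Suc B * (b + l) <= n" using B N mult_right_mono[of "Suc B" N "b + l"] by linarith
  then have "int (Suc B * (b + l)) <= int n" by (simp only: of_nat_le_iff)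
  moreover have "int (Suc B * (b + l)) = int (B * (b + l)) + int b + int l" by simp
  ultimately have "int (B * (b + l)) + int b <= int n" by linarith
  then have sub: "blk b l B \<subseteq> {1..int n}" unfolding blk_def atLeastatMost_subset_iff by simp
  have "lr_cov M X h i * (SUM j:blk b l B. cw n h j * cw n i j) = lr_corr M X h i * ((SUM j:blk b l B. wt n h j * wt n i j) / real n)"
  proof -
   have "lr_cov M X h i * (cw n h j * cw n i j) = lr_corr M X h i * (wt n h j * wt n i j / real n)" for j
    using n by (simp add: cw_def lr_corr_def)
   then show ?thesis by (simp only: sum_distrib_left sum_divide_distrib)
  qed
  then show ?thesis
   using block_covariance[OF h i T c ap, where a = "int (B * (b + l)) + 1" and e = "int (B * (b + l)) + int b"
     and \<alpha> = "cw n h" and \<beta> = "cw n i" and A = "A n" and W = "A n / real n" and b = b]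
    cw_bound[OF h n] cw_bound[OF i n] cw_lip[OF i n] A_nonneg[of n] sub
   unfolding Y_def K1_def K2_def K3_def by (simp add: blk_def subset_iff)
 qed
 have "(\<Sum>B<N. ?A B)
  <= (\<Sum>B<N. A n * (A n / real n) * real b * K1 + (A n)^2 * K2 + (real b * A n)^2 * K3)"
  by (intro sum_mono one) auto
 also have "... = (A n)^2 / real n * K1 * (real N * real b) + (A n)^2 * K2 / real b * (real N * real b) + real b * (A n)^2 * K3 * (real N * real b)"
  using b by (simp add: power2_eq_square algebra_simps)
 also have "... <= (A n)^2 / real n * K1 * real n + (A n)^2 * K2 / real b * real n + real b * (A n)^2 * K3 * real n"
  using K by (intro add_mono mult_left_mono[OF Nb] mult_nonneg_nonneg divide_nonneg_nonneg) auto
 also have "... = (A n)^2 * real n * (K1 / real n + K2 / real b + real b * K3)" by (simp add: algebra_simps)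
 also have "(A n)^2 * real n = V^2 / \<sigma>_lo^2" unfolding A_square[OF n] using n by simp
 finally show ?thesis unfolding cov_err_def K1_def K2_def K3_def .
qed

text \<open>\<open>|w * w'| <= (w^2 + w'^2) / 2\<close> reduces the product to squares, whose
  averages over time are close to 1. A correlation \<open>\<rho>\<close> thus contributes hardly
  more than \<open>|\<rho>|\<close> in total.\<close>

lemma wt_product_sum:
 assumes h: "h \<ge> 1" and i: "i \<ge> 1" and n: "0 < n" and N: "N * (b + l) <= n"
 shows "(\<Sum>B<N. abs ((SUM j:blk b l B. wt n h j * wt n i j) / real n)) <= 1 + 17 * V^2 / real n"
proof -
 let ?q = "%k j. (wt n k j)^2"
 let ?A = "%B. (SUM j:blk b l B. (?q h j + ?q i j) / 2)"
 have blk_le: "(\<Sum>B<N. sum f (blk b l B)) <= sum f {1..int n}" if "\<And>j. 0 <= f j" for f :: "int => real"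
  unfolding sum_blocks_rest[OF N] using that by (simp add: sum_nonneg add_nonneg_nonneg)
 have "(\<Sum>B<N. abs ((SUM j:blk b l B. wt n h j * wt n i j) / real n)) <= (\<Sum>B<N. ?A B / real n)"
 proof (intro sum_mono)
  fix B
  have "abs (wt n h j * wt n i j) <= (?q h j + ?q i j) / 2" for j
   using sum_squares_bound[of "abs (wt n h j)" "abs (wt n i j)"] by (simp add: abs_mult)
  then have "abs (SUM j:blk b l B. wt n h j * wt n i j) <= ?A B"
   by (intro order_trans[OF sum_abs] sum_mono)
  then show "abs ((SUM j:blk b l B. wt n h j * wt n i j) / real n) <= ?A B / real n"
   by (simp add: abs_divide divide_right_mono)
 qed
 also have "... = (\<Sum>B<N. SUM j:blk b l B. (?q h j + ?q i j) / 2) / real n" by (rule sum_divide_distrib[symmetric])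
 also have "... <= (\<Sum>j=1..int n. (?q h j + ?q i j) / 2) / real n"
  by (intro divide_right_mono blk_le) auto
 also have "... = ((\<Sum>j=1..int n. ?q h j) / real n + (\<Sum>j=1..int n. ?q i j) / real n) / 2"
  by (simp add: sum.distrib sum_divide_distrib[symmetric] add_divide_distrib)
 also have "... <= 1 + 17 * V^2 / real n"
 proof -
  have "(x + y) / 2 <= 1 + s" if "abs (x - 1) <= s" "abs (y - 1) <= s" for x y s :: real
   using that unfolding add_divide_distrib by linarith
  then show ?thesis using wt_square_sum[OF h n] wt_square_sum[OF i n] .
 qed
 finally show ?thesis .
qed

text \<open>Over all times the squared weights average to almost 1. The times outside the blocks
  make up the fraction \<open>1 - N * b / n\<close>, and each of them carries at most
  \<open>V^2\<close>.\<close>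

lemma wt_square_blocks:
 assumes h: "h \<ge> 1" and n: "0 < n" and N: "N * (b + l) <= n"
 shows "abs ((\<Sum>B<N. (SUM j:blk b l B. wt n h j * wt n h j) / real n) - 1) <= 17 * V^2 / real n + V^2 * (1 - real N * real b / real n)"
proof -
 let ?q = "%j. wt n h j * wt n h j"
 let ?B = "(sum ?q {1..int n} - (real n - real N * real b) * V^2)"
 let ?A = "(\<Sum>B<N. sum ?q (blk b l B))"
 have q: "0 <= ?q j" "?q j <= V^2" for j
  using wt_bound[OF h n, of j] V_pos power_mono[of "abs (wt n h j)" V 2] by (auto simp: power2_eq_square)
 have Nn: "real N * real b + real N * real l <= real n"
 proof -
  have "real (N * (b + l)) <= real n" using N by (simp only: of_nat_le_iff)
  then show ?thesis by (simp add: algebra_simps)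
 qed
 have "(\<Sum>B<N. sum ?q (gap b l B)) <= (\<Sum>B<N. real l * V^2)"
  by (intro sum_mono order_trans[OF sum_bounded_above]) (auto simp: q)
 moreover have "sum ?q {int (N * (b + l)) + 1..int n} <= (real n - real N * real b - real N * real l) * V^2"
 proof -
  have "sum ?q {int (N * (b + l)) + 1..int n} <= real (card {int (N * (b + l)) + 1..int n}) * V^2"
   by (rule sum_bounded_above) (rule q)
  also have "real (card {int (N * (b + l)) + 1..int n}) = real n - real N * real b - real N * real l"
  proof -
   have "card {int (N * (b + l)) + 1..int n} = n - N * (b + l)" by (simp only: card_atLeastAtMost_int)
   then show ?thesis using N by (simp add: of_nat_diff algebra_simps)
  qed
  finally show ?thesis .
 qed
 moreover have "0 <= (\<Sum>B<N. sum ?q (gap b l B))" "0 <= sum ?q {int (N * (b + l)) + 1..int n}" by (auto intro!: sum_nonneg)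
 ultimately have "?A <= sum ?q {1..int n}" "sum ?q {1..int n} - (real n - real N * real b) * V^2 <= ?A"
  unfolding sum_blocks_rest[OF N] by (auto simp: algebra_simps)
 then have "?A / real n <= sum ?q {1..int n} / real n"
  "?B / real n <= ?A / real n"
  by (auto intro!: divide_right_mono)
 moreover have "?B / real n = sum ?q {1..int n} / real n - V^2 * (1 - real N * real b / real n)"
  using n by (simp add: field_simps)
 moreover have "abs (sum ?q {1..int n} / real n - 1) <= 17 * V^2 / real n"
  using wt_square_sum[OF h n] by (simp add: power2_eq_square)
 moreover have "0 <= V^2 * (1 - real N * real b / real n)"
 proof -
  have "real N * real b <= real n" using Nn by (meson add_le_same_cancel1 le_add_same_cancel1 of_nat_0_le_iff mult_nonneg_nonneg order_trans)
  then show ?thesis using n by (simp add: divide_le_eq)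
 qed
 moreover have "abs (x - 1) <= s + r" if "x <= y" "z <= x" "z = y - r" "abs (y - 1) <= s" "0 <= r" for x y z r s :: real
  using that by linarith
 ultimately show ?thesis unfolding sum_divide_distrib[symmetric] by blast
qed

definition var_err :: "nat => nat => nat => real => real" where
 "var_err n N b c = 17 * V^2 / real n + V^2 * (1 - real N * real b / real n) + cov_err n b c"

text \<open>Three failure probabilities: a bad approximation of \<open>X\<close>, a large partial
  sum, and a large weighted sum over the gaps.\<close>

definition tail_bound :: "nat => nat => nat => real => real => real => real => real => real" where
 "tail_bound n N l T c x tt z = (real n * c)^2 + real (n + 1) * (real (l + 1) * (2 * exp (real n * moment_const 2 / (2 * T)^2 - x / (2 * T))))
  + 2 * exp (tt^2 * (real N * ((real l * A n)^2 * moment_const 2)) - tt * z)"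

text \<open>The error outside the three exceptional events: two terms from the linearisation, with
  partial sums of at most \<open>(l + 1) * x + 1\<close>; then the approximation of
  \<open>X\<close>, the gaps, and the incomplete stretch after the last gap.\<close>

definition linear_err :: "nat => nat => nat => real => real => real => real" where
 "linear_err n b l T x z = 54 * Cu / (tb * \<sigma>_lo) / sqrt (real n) + 36 / (tb * \<sigma>_lo * Cl) * (real (l + 1) * x + 1)^2 / (real n * sqrt (real n))
  + A n + z + real (b + l) * (A n * (2 * T))"

context
 fixes n N b l d :: nat and T c :: real
 assumes T: "0 < T" and c: "0 < c" and n: "0 < n" and b: "0 < b" and N: "N * (b + l) <= n"
  and ap: "\<And>j h. h : {1..d} ==> (LINT w|M. (Xt l T j h w - X j h w)^2) <= c^2 \<and> integrable M (%w. (Xt l T j h w - X j h w)^2)"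
begin

abbreviation (input) "YY \<equiv> Y n l T b"

lemma block_fraction: "real N * real b / real n <= 1"
proof -
 have "N * b <= N * (b + l)" by simp
 then have "N * b <= n" using N by linarith
 then have "real N * real b <= real n" by (metis of_nat_le_iff of_nat_mult)
 then show ?thesis using n by (simp add: divide_le_eq)
qed

lemma var_err_ge: "17 * V^2 / real n + cov_err n b c <= var_err n N b c" "0 <= var_err n N b c"
 using block_fraction cov_err_nonneg[of c n b] c unfolding var_err_def by auto

lemma Y_variance:
 assumes h: "h : {1..d}"
 shows "abs ((\<Sum>B<N. (LINT w|M. (YY B h w)^2)) - 1) <= var_err n N b c"
proof -
 let ?A = "(\<Sum>B<N. abs ((LINT w|M. (YY B h w)^2) - (SUM j:blk b l B. wt n h j * wt n h j) / real n))"
 have h1: "h \<ge> 1" using h by simp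
 have "lr_corr M X h h = 1" using sd_pos[OF h1] by (simp add: lr_corr_def lr_cov_self[OF h1] power2_eq_square)
 then have "?A <= cov_err n b c"
  using Y_covariance_sum[OF h1 h1 less_imp_le[OF T] c n b N] ap h by (simp add: power2_eq_square)
 moreover have "abs ((\<Sum>B<N. (LINT w|M. (YY B h w)^2)) - (\<Sum>B<N. (SUM j:blk b l B. wt n h j * wt n h j) / real n))
   <= ?A"
  unfolding sum_subtractf[symmetric] by (rule sum_abs)
 ultimately show ?thesis using wt_square_blocks[OF h1 n N] unfolding var_err_def by linarith
qed

lemma Y_covariance:
 assumes h: "h : {1..d}" and i: "i : {1..d}" and \<rho>: "abs (lr_corr M X h i) <= 1"
 shows "(\<Sum>B<N. abs (LINT u|M. YY B h u * YY B i u)) <= abs (lr_corr M X h i) + var_err n N b c"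
proof -
 let ?\<rho> = "lr_corr M X h i" and ?w = "%B. (SUM j:blk b l B. wt n h j * wt n i j) / real n"
 let ?E = "%B. (LINT u|M. YY B h u * YY B i u)"
 have hi: "h \<ge> 1" "i \<ge> 1" using h i by auto
 have "abs (?E B) <= abs (?E B - ?\<rho> * ?w B) + abs (?\<rho>) * abs (?w B)" for B by (simp only: abs_mult[symmetric])
 then have "(\<Sum>B<N. abs (?E B)) <= (\<Sum>B<N. abs (?E B - ?\<rho> * ?w B)) + abs (?\<rho>) * (\<Sum>B<N. abs (?w B))"
  unfolding sum_distrib_left sum.distrib[symmetric] by (intro sum_mono)
 also have "... <= cov_err n b c + abs (?\<rho>) * (1 + 17 * V^2 / real n)"
  using h i ap by (intro add_mono mult_left_mono Y_covariance_sum[OF hi less_imp_le[OF T] c n b N] wt_product_sum[OF hi n N]) auto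
 also have "... <= cov_err n b c + (abs (?\<rho>) + 1 * (17 * V^2 / real n))"
  unfolding distrib_left mult_1_right using \<rho> by (intro add_left_mono mult_right_mono) auto
 also have "... <= abs (?\<rho>) + var_err n N b c" using var_err_ge(1) by simp
 finally show ?thesis .
qed

lemma Y_comparison:
 assumes cut: "smooth_cutoff q q1 q2 q3 v \<beta>"
  and vc: "3 * v * (real b * (A n * (2 * T))) <= 1" and e: "var_err n N b c <= e"
  and r: "\<And>h i. h : {1..d} ==> i : {1..d} ==> h \<noteq> i ==> abs (lr_corr M X h i) + e <= r" "r <= 1" "0 <= r"
  and far: "\<And>h i. h : {1..d} ==> i : {1..d} ==> \<not> index_close L h i ==> abs (lr_corr M X h i) + e <= kp" and kp: "0 <= kp"
  and small: "81 * real N * v ^ 3 * ((exp 1 + normal_cube_moment) * ((real b * A n) ^ 3 * moment_const 3)) <= 1" "v^2 * e <= 1" "v^2 * kp <= 1"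
 shows "abs ((LINT w|M. (PROD h:{1..d}. q (\<Sum>B<N. YY B h w)))
   - (PROD h:{1..d}. (LINT x|std_normal_distribution. q (sqrt (\<Sum>B<N. (LINT w|M. (YY B h w)^2)) * x))))
  <= swap_error d L N ((real b * A n) ^ 3 * moment_const 3) kp r v \<beta>"
proof (rule smooth_cutoff.product_cutoff_comparison[OF cut prob_space_axioms])
 let ?A = "%h i. (\<Sum>B<N. abs (LINT w|M. YY B h w * YY B i w))"
 have T0: "0 <= T" using T by simp
 have e0: "0 <= e" using var_err_ge(2) e by linarith
 have cov: "?A h i <= abs (lr_corr M X h i) + e"
  if "h : {1..d}" "i : {1..d}" "h \<noteq> i" for h i
 proof -
  have "abs (lr_corr M X h i) <= 1" using r(1)[OF that] r(2) e0 by linarith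
  then show ?thesis using Y_covariance[OF that(1,2)] e by linarith
 qed
 show "YY B h : borel_measurable M" if "h : {1..d}" for B h using that T0 by (intro measurable_Y) auto
 show "indep_vars (%_. PiM {1..d} (%_. borel)) (%B w. \<lambda>h\<in>{1..d}. YY B h w) {..<N}" by (rule Y_indep)
 show "(LINT w|M. YY B h w) = 0" if "h : {1..d}" for B h using that T0 by (intro Y_mean) auto
 show "abs (YY B h w) <= real b * (A n * (2 * T))" if "h : {1..d}" for B h w using that T0 n by (intro Y_bound) auto
 show "(LINT w|M. abs (YY B h w) ^ 3) <= (real b * A n) ^ 3 * moment_const 3" if "h : {1..d}" for B h
  using that T0 n by (intro Y_cube) auto
 show "0 <= (real b * A n) ^ 3 * moment_const 3" using A_nonneg moment_const_nonneg by simp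
 show "(\<Sum>B<N. (LINT w|M. (YY B h w)^2)) <= 1 + e" if "h : {1..d}" for h using Y_variance[OF that] e by linarith
 show "?A h i <= kp" if "h : {1..d}" "i : {1..d}" "\<not> index_close L h i" for h i
  using cov[OF that(1,2)] far[OF that] that(3) by force
 show "?A h i <= r" if "h : {1..d}" "i : {1..d}" "h \<noteq> i" for h i
  using cov[OF that] r(1)[OF that] by linarith
 show "0 <= e" by (rule e0)
qed (use vc r kp small in auto)

lemma linear_decomposition:
 assumes h: "h \<ge> 1" and N': "n < (N + 1) * (b + l)"
  and g1: "(\<Sum>j=1..n. abs (Xt l T (int j) h u - X (int j) h u)) <= 1"
  and g2: "\<And>k. k <= n ==> abs (\<Sum>j=1..k. Xt l T (int j) h u) <= real (l + 1) * x"
  and g3: "abs (\<Sum>B<N. SUM j:gap b l B. cw n h j * Xt l T j h u) <= z"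
 shows "abs (tst n h u - (\<Sum>B<N. YY B h u)) <= linear_err n b l T x z"
proof -
 let ?X = "%j. X j h u" and ?Z = "%j. Xt l T j h u" and ?w = "cw n h"
 let ?B = "(\<Sum>j=1..n. abs (?Z (int j) - ?X (int j)))"
 let ?A = "abs ((\<Sum>j=1..int n. ?w j * ?Z j) - (\<Sum>j=1..int n. ?w j * ?X j))"
 have T0: "0 <= T" using T by simp
 have R: "abs (\<Sum>j=1..k. ?X (int j)) <= real (l + 1) * x + 1" if k: "k <= n" for k
 proof -
  have "abs (\<Sum>j=1..k. ?Z (int j) - ?X (int j)) <= ?B"
   using k by (intro order_trans[OF sum_abs] sum_mono2) auto
  then have "abs ((\<Sum>j=1..k. ?Z (int j)) - (\<Sum>j=1..k. ?X (int j))) <= 1" using g1 unfolding sum_subtractf by linarith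
  then show ?thesis using g2[OF k] by linarith
 qed
 have "?A <= (\<Sum>j=1..int n. A n * abs (?Z j - ?X j))"
  unfolding sum_subtractf[symmetric] right_diff_distrib[symmetric]
  using cw_bound[OF h n] by (intro order_trans[OF sum_abs] sum_mono) (auto simp: abs_mult intro!: mult_right_mono)
 also have "... = A n * ?B"
  unfolding sum_distrib_left[symmetric] by (subst sum_int_nat[symmetric]) simp
 also have "... <= A n * 1" by (rule mult_left_mono[OF g1 A_nonneg])
 finally have 2: "?A <= A n" by simp
 have "card {int (N * (b + l)) + 1..int n} = n - N * (b + l)" by (simp only: card_atLeastAtMost_int)
 then have "card {int (N * (b + l)) + 1..int n} <= b + l" using N' by simp
 then have 3: "abs (SUM j:{int (N * (b + l)) + 1..int n}. ?w j * ?Z j) <= real (b + l) * (A n * (2 * T))"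
  by (rule block_sum_bound[OF h T0]) (auto simp: cw_bound[OF h n] A_nonneg)
 have "(\<Sum>j=1..int n. ?w j * ?Z j) = (\<Sum>B<N. YY B h u) + (\<Sum>B<N. SUM j:gap b l B. ?w j * ?Z j) + (SUM j:{int (N * (b + l)) + 1..int n}. ?w j * ?Z j)"
  unfolding Y_def by (rule sum_blocks_rest[OF N])
 then show ?thesis using tst_linear[OF h n R] 2 3 g3 unfolding linear_err_def by linarith
qed

lemma tst_block_tail:
 assumes h: "h : {1..d}" and N': "n < (N + 1) * (b + l)" and lb: "l <= b"
  and th: "0 <= tt" "tt * (real l * (A n * (2 * T))) <= 1"
 shows "prob {u:space M. linear_err n b l T x z < abs (tst n h u - (\<Sum>B<N. YY B h u))} <= tail_bound n N l T c x tt z"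
proof -
 let ?A = "%n h u N YY. abs (tst n h u - (\<Sum>B<N. YY B h u))"
 have h1: "h \<ge> 1" using h by simp
 have T0: "0 <= T" using T by simp
 note [measurable] = measurable_Xt[OF h1 T0] measurable_X[OF h1] measurable_tst[OF h1 n] measurable_Y[OF h1 T0]
 let ?P1 = "{u:space M. 1 < (\<Sum>j=1..n. abs (Xt l T (int j) h u - X (int j) h u))}"
 let ?P2 = "{u:space M. \<exists>k\<le>n. real (l + 1) * x < abs (\<Sum>j=1..k. Xt l T (int j) h u)}"
 let ?P3 = "{u:space M. z < abs (\<Sum>B<N. SUM j:gap b l B. cw n h j * Xt l T j h u)}"
 have "prob {u:space M. linear_err n b l T x z < (?A n h u N YY)} <= prob (?P1 \<union> ?P2 \<union> ?P3)"
 proof (rule finite_measure_mono)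
  show "{u:space M. linear_err n b l T x z < (?A n h u N YY)} \<subseteq> ?P1 \<union> ?P2 \<union> ?P3"
  proof (rule subsetI, rule ccontr)
   fix u assume a: "u : {u:space M. linear_err n b l T x z < (?A n h u N YY)}" "u \<notin> ?P1 \<union> ?P2 \<union> ?P3"
   have "?A n h u N YY <= linear_err n b l T x z"
    by (rule linear_decomposition[OF h1 N']) (use a in \<open>auto simp: not_less\<close>)
   then show False using a(1) by simp
  qed
 qed measurable
 also have "... <= prob ?P1 + prob ?P2 + prob ?P3"
  by (intro order_trans[OF measure_Un_le] add_right_mono) measurable
 also have "... <= tail_bound n N l T c x tt z"
  unfolding tail_bound_def
 proof (intro add_mono)
  show "prob ?P1 <= (real n * c)^2" by (rule sum_abs_Xt_diff_tail[OF h1 T0 ap[OF h]])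
  show "prob ?P2 <= real (n + 1) * (real (l + 1) * (2 * exp (real n * moment_const 2 / (2 * T)^2 - x / (2 * T))))"
   by (rule partial_sum_tail[OF h1 T])
  show "prob ?P3 <= 2 * exp (tt^2 * (real N * ((real l * A n)^2 * moment_const 2)) - tt * z)"
   by (rule separated_tail[OF h1 T0 _ _ A_nonneg _ _ _ th, where w = "%_. cw n h"])
    (auto simp: cw_bound[OF h1 n] intro: gap_separated lb)
 qed
 finally show ?thesis .
qed

lemma max_tst_block_tail:
 assumes N': "n < (N + 1) * (b + l)" and lb: "l <= b"
  and th: "0 <= tt" "tt * (real l * (A n * (2 * T))) <= 1"
 shows "prob {w:space M. EX h:{1..d}. linear_err n b l T x z < abs (tst n h w - (\<Sum>B<N. YY B h w))} <= real d * tail_bound n N l T c x tt z"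
proof -
 let ?A = "%h w. abs (tst n h w - (\<Sum>B<N. YY B h w))"
 have ev: "{w:space M. linear_err n b l T x z < (?A h w)} : events" if "h : {1..d}" for h
 proof -
  have h: "h \<ge> 1" using that by simp
  note [measurable] = measurable_tst[OF h n] measurable_Y[OF h less_imp_le[OF T]]
  show ?thesis by measurable
 qed
 define E where "E h = {w:space M. linear_err n b l T x z < (?A h w)}" for h
 have "{w:space M. EX h:{1..d}. linear_err n b l T x z < (?A h w)} = (UN h:{1..d}. E h)"
  unfolding E_def by blast
 also have "prob (UN h:{1..d}. E h) <= (SUM h:{1..d}. prob (E h))"
  by (rule finite_measure_subadditive_finite) (use ev in \<open>auto simp: E_def\<close>)
 also have "... <= (SUM h:{1..d}. tail_bound n N l T c x tt z)"
  unfolding E_def by (rule sum_mono) (rule tst_block_tail[OF _ N' lb th])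
 finally show ?thesis by simp
qed

end

end

section \<open>Asymptotics\<close>

text \<open>The factor \<open>C\<close> absorbs constants and allows each of several error terms to
  be given a fixed share of the target.\<close>

lemma powr_dominated:
 assumes "a < b"
 shows "EV n. C * real n powr a <= real n powr b"
proof -
 have "((%n::nat. real n powr (a - b)) \<longlongrightarrow> 0) sequentially" using assms by real_asymp
 then have "(%n. C * real n powr (a - b)) ----> C * 0" by (intro tendsto_intros)
 then have "EV n. C * real n powr (a - b) < 1" by (intro order_tendstoD(2)) auto
 with eventually_gt_at_top[of 0] show ?thesis
  by eventually_elim (simp add: powr_diff field_simps)
qed

context
 fixes d :: "nat => nat" and C1 D :: real
 assumes C1: "0 < C1" and D: "0 < D" and d_approx: "\<And>n. n \<ge> 1 ==> abs (real (d n) - C1 * real n powr D) < 1"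
begin

lemma dim_at_top: "filterlim d at_top sequentially"
proof -
 have "filterlim (%n::nat. C1 * real n powr D - 1) at_top sequentially" using C1 D by real_asymp
 moreover have "EV n. C1 * real n powr D - 1 <= real (d n)"
  using eventually_ge_at_top[of 1] by eventually_elim (use d_approx in force)
 ultimately have "filterlim (%n. real (d n)) at_top sequentially" by (rule filterlim_at_top_mono)
 then have "EV n. real Z <= real (d n)" for Z unfolding filterlim_at_top by blast
 then show ?thesis unfolding filterlim_at_top by simp
qed

lemma dim_upper:
 assumes "D < a"
 shows "EV n. real (d n) <= real n powr a"
proof -
 have "((%n::nat. 1 / real n powr D) \<longlongrightarrow> 0) sequentially" using D by real_asymp
 then have "EV n. 1 / real n powr D < 1" by (rule order_tendstoD(2)) simp
 with powr_dominated[OF assms, of "C1 + 1"] eventually_ge_at_top[of 1] show ?thesis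
 proof eventually_elim
  case (elim n)
  have "real (d n) <= C1 * real n powr D + 1" using d_approx[OF elim(2)] by linarith
  also have "1 <= real n powr D" using elim(2) D by (simp add: ge_one_powr_ge_zero)
  finally show ?case using elim(1) by (simp add: distrib_right)
 qed
qed

lemma lam_at_top: "filterlim (%n. ln (real (d n))) at_top sequentially"
 by (intro filterlim_compose[OF ln_at_top] filterlim_compose[OF filterlim_real_sequentially dim_at_top])

lemma log_powr_small:
 assumes k: "0 <= k" and e: "0 < e"
 shows "(%n. ln (real (d n)) powr k * real n powr - e) ----> 0"
proof (rule tendsto_sandwich[OF _ _ tendsto_const])
 let ?A = "%n. (ln (real n) powr k * real n powr - e)"
 have "(%n::nat. (D + 1) powr k * ?A n) ----> (D + 1) powr k * 0"
  by (rule tendsto_mult_left) (use e in real_asymp)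
 then show "(%n::nat. (D + 1) powr k * ?A n) ----> 0" by simp
 have a: "D < D + 1" by simp
 show "EV n. ln (real (d n)) powr k * real n powr - e <= (D + 1) powr k * ?A n"
  using dim_upper[OF a] lam_at_top[unfolded filterlim_at_top_dense, rule_format, of 0] eventually_ge_at_top[of 2]
 proof eventually_elim
  case (elim n)
  have "0 < real (d n)" using elim(2) by (cases "d n = 0") auto
  then have "ln (real (d n)) <= ln (real n powr (D + 1))" using elim by (subst ln_le_cancel_iff) auto
  also have "... = (D + 1) * ln (real n)" using elim by (simp only: ln_powr)
  finally have "ln (real (d n)) <= (D + 1) * ln (real n)" .
  then have "ln (real (d n)) powr k <= ((D + 1) * ln (real n)) powr k" using elim k by (intro powr_mono2) auto
  also have "... = (D + 1) powr k * ln (real n) powr k" by (rule powr_mult)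
  finally show ?case unfolding mult.assoc[symmetric] by (rule mult_right_mono) simp
 qed
 show "EV n. 0 <= ln (real (d n)) powr k * real n powr - e" by simp
qed

lemma log_powr_le:
 assumes k: "0 <= k" and e: "0 < e"
 shows "EV n. C * ln (real (d n)) powr k <= real n powr e"
proof -
 have "(%n. C * (ln (real (d n)) powr k * real n powr - e)) ----> C * 0"
  by (intro tendsto_mult tendsto_const log_powr_small k e)
 then have "EV n. C * (ln (real (d n)) powr k * real n powr - e) < 1" by (intro order_tendstoD(2)) auto
 with eventually_gt_at_top[of 0] show ?thesis
  by eventually_elim (simp add: powr_minus field_simps)
qed

lemma swap_error_tendsto:
 fixes v m e :: "nat => real" and x C0 C2 Cm \<eta> tt r :: real and N L :: "nat => nat"
 assumes lev: "(%n. gumbel_a (d n) * (v n - gumbel_b (d n))) ----> x"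
  and C0: "0 < C0" and C2: "0 < C2" and \<eta>: "0 < \<eta>"
  and th: "0 < tt" "tt * D < 1/16" and r: "0 <= r" "1 + 2 * tt <= 2 / (1 + r)"
  and e: "0 < e0" and L: "\<And>n. real (L n) <= real (d n) powr tt"
  and N: "\<And>n. N n <= n" and m: "EV n. 0 <= m n \<and> m n <= Cm * real n powr (3/32 - 3/2)"
 shows "(%n. swap_error (d n) (L n) (N n) (m n) (C2 * (tt * ln (real (d n))) powr (- 2 - \<eta>) + real n powr - e0) r (v n)
      (C0 * ln (real (d n)) powr (1/2 + \<eta>/4))) ----> 0"
proof -
 let ?J = "%n. (- (v n)\<^sup>2 / (1 + r))"
 let ?G = "%n. (Cm * real n powr (3/32 - 3/2))"
 let ?C = "%n. (2 * real (L n) + 1)"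
 let ?B = "%n. (real (d n) * ?C n * exp 3 * exp (?J n))"
 let ?A = "(exp 1 + normal_cube_moment)"
 define l where "l n = ln (real (d n))" for n
 let ?D = "%n. (C2 * tt powr (- 2 - \<eta>) * l n powr - (\<eta>/2) + l n powr (2 + \<eta>/2) * real n powr - e0)"
 define kp where "kp n = C2 * (tt * l n) powr (- 2 - \<eta>) + real n powr - e0" for n
 define b where "b n = C0 * l n powr (1/2 + \<eta>/4)" for n
 define E where "E n = exp (- (v n)\<^sup>2 / 2)" for n
 let ?E = "%n. (real (d n) ^ 2 * kp n * exp 3 * E n ^ 2)"
 \<comment> \<open>\<open>G\<close> converges to the positive constant \<open>G0\<close>; below,
   \<open>d * exp (- v^2 / 2)\<close> therefore counts as \<open>sqrt (log d)\<close>.\<close>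
 define G where "G n = real (d n) * E n / sqrt (l n)" for n
 define G0 where "G0 = sqrt (4 * pi) * exp (- x)"
 define s where "s = 2 / (1 + r)"
 let ?I = "(s - 1 - tt)"
 let ?H = "(1 + \<eta>/2 + s/2)"
 let ?F = "%n. (l n powr ?H * exp (- ?I * l n))"
 have G0: "0 < G0" by (simp add: G0_def)
 have l: "filterlim l at_top sequentially" unfolding l_def by (rule lam_at_top)
 have lpos: "EV n. 1 < l n" using l by (simp add: filterlim_at_top_dense)
 have G: "G ----> G0"
  unfolding G_def E_def l_def G0_def by (rule gumbel_level_asymp(2)[OF dim_at_top lev])
 have lz: "(%n. l n powr k * real n powr - u) ----> 0" if "0 <= k" "0 < u" for k u
  unfolding l_def by (rule log_powr_small[OF that])
 have dE: "real (d n) * E n = G n * l n powr (1/2)" if "1 < l n" for n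
  using that by (simp add: G_def powr_half_sqrt)
 \<comment> \<open>Far pairs: \<open>b^2\<close> contributes the power \<open>1 + \<eta>/2\<close>
   of \<open>log d\<close>, the two tails contribute one more, and \<open>kp\<close> takes away
   \<open>2 + \<eta>\<close>, so \<open>- \<eta>/2\<close> remains. The part of \<open>kp\<close>
   that is a negative power of \<open>n\<close> beats the logarithms.\<close>
 have p1: "(%n. (b n)^2 / 2 * ?E n) ----> 0"
 proof (rule Lim_transform_eventually)
  have "(%n. l n powr - (\<eta>/2)) ----> 0" using \<eta> by (intro tendsto_neg_powr l) auto
  then have "(%n. C0^2 / 2 * exp 3 * (G n)^2 * ?D n)
    ----> C0\<^sup>2 / 2 * exp 3 * G0^2 * (C2 * tt powr (- 2 - \<eta>) * 0 + 0)"
   using \<eta> e by (intro tendsto_intros G lz) auto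
  then show "(%n. C0^2 / 2 * exp 3 * (G n)^2 * ?D n) ----> 0" by simp
  show "EV n. C0^2 / 2 * exp 3 * (G n)^2 * (?D n)
    = (b n)^2 / 2 * ?E n"
   using lpos
  proof eventually_elim
   case (elim n)
   have b2: "(b n)^2 = C0^2 * l n powr (1 + \<eta>/2)"
    using elim by (simp add: b_def power_mult_distrib powr_power)
   have d2: "real (d n) ^ 2 * E n ^ 2 = (G n)^2 * l n"
    unfolding power_mult_distrib[symmetric] dE[OF elim] using elim by (simp add: power_mult_distrib powr_power)
   have "l n powr (1 + \<eta>/2) * l n * kp n = l n powr (2 + \<eta>/2) * kp n"
    using elim by (simp add: powr_add[symmetric] powr_mult_base mult.commute)
   also have "... = C2 * tt powr (- 2 - \<eta>) * l n powr - (\<eta>/2) + l n powr (2 + \<eta>/2) * real n powr - e0"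
    using elim th unfolding kp_def by (simp add: powr_mult distrib_left powr_add[symmetric] mult_ac)
   finally have k: "l n powr (1 + \<eta>/2) * l n * kp n = C2 * tt powr (- 2 - \<eta>) * l n powr - (\<eta>/2) + l n powr (2 + \<eta>/2) * real n powr - e0" .
   have "(b n)^2 / 2 * ?E n = (b n)^2 / 2 * exp 3 * kp n * (real (d n) ^ 2 * E n ^ 2)" by (simp add: mult_ac)
   also have "... = C0^2 / 2 * exp 3 * (G n)^2 * (l n powr (1 + \<eta>/2) * l n * kp n)" unfolding b2 d2 by (simp add: mult_ac)
   finally show ?case unfolding k ..
  qed
 qed
 have L1: "EV n. 2 * real (L n) + 1 <= 3 * real (d n) powr tt"
  using lpos
 proof eventually_elim
  case (elim n)
  have "1 <= real (d n)" using elim by (cases "d n = 0") (auto simp: l_def)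
  then have "1 <= real (d n) powr tt" using th by (simp add: ge_one_powr_ge_zero)
  then show ?case using L[of n] by linarith
 qed
 \<comment> \<open>Close pairs: \<open>exp (- v^2 / (1 + r))\<close> is \<open>E\<close> to the
   power \<open>s = 2 / (1 + r)\<close>. Up to logarithms the term is of order
   \<open>d^(1 + tt - s)\<close>, and \<open>s >= 1 + 2 * tt\<close> makes the exponent
   negative.\<close>
 have p2: "(%n. (b n)^2 / 2 * ?B n) ----> 0"
 proof (rule tendsto_sandwich[OF _ _ tendsto_const])
  have s: "0 < s - 1 - tt" using r th by (simp add: s_def)
  then have "((%z::real. z powr ?H * exp (- ?I * z)) \<longlongrightarrow> 0) at_top" by real_asymp
  then have z: "(%n. l n powr ?H * exp (- ?I * l n)) ----> 0" by (rule filterlim_compose[OF _ l])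
  have "(%n. 3 * C0^2 / 2 * exp 3 * G n powr s * ?F n) ----> 3 * C0^2 / 2 * exp 3 * G0 powr s * 0"
   using G0 by (intro tendsto_intros G z) auto
  then show "(%n. 3 * C0^2 / 2 * exp 3 * G n powr s * ?F n) ----> 0" by simp
  show "EV n. 0 <= (b n)^2 / 2 * ?B n"
   by (rule always_eventually) auto
  show "EV n. (b n)^2 / 2 * (?B n)
    <= 3 * C0^2 / 2 * exp 3 * G n powr s * ?F n"
   using lpos L1
  proof eventually_elim
   case (elim n)
   have d0: "0 < real (d n)" using elim by (cases "d n = 0") (auto simp: l_def)
   have Gn: "0 <= G n" using elim by (simp add: G_def E_def)
   have dl: "real (d n) = exp (l n)" using d0 by (simp add: l_def)
   have b2: "(b n)^2 = C0^2 * l n powr (1 + \<eta>/2)"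
    using elim by (simp add: b_def power_mult_distrib powr_power)
   have "exp (?J n) = E n powr s" by (simp add: E_def s_def exp_powr_real)
   also have "E n = G n * l n powr (1/2) / real (d n)" using dE[of n] elim d0 by (simp add: field_simps)
   also have "... powr s = G n powr s * l n powr (s/2) * exp (- s * l n)"
   proof -
    have "exp (l n) powr s = exp (s * l n)" by (simp add: exp_powr_real mult.commute)
    moreover have "(G n * l n powr (1/2) / exp (l n)) powr s = G n powr s * (l n powr (1/2)) powr s / exp (l n) powr s"
     by (simp only: powr_divide powr_mult)
    moreover have "(l n powr (1/2)) powr s = l n powr (s/2)" by (simp add: powr_powr)
    ultimately have "(G n * l n powr (1/2) / exp (l n)) powr s = G n powr s * l n powr (s/2) / exp (s * l n)" by (simp only:)
    then show ?thesis unfolding dl by (simp only: mult_minus_left exp_minus divide_inverse)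
   qed
   finally have e: "exp (?J n) = G n powr s * l n powr (s/2) * exp (- s * l n)" .
   have "(b n)^2 / 2 * (?B n)
     <= (b n)^2 / 2 * (real (d n) * (3 * real (d n) powr tt) * exp 3 * exp (?J n))"
    using elim by (intro mult_left_mono mult_right_mono) auto
   also have "... = 3 * C0^2 / 2 * exp 3 * G n powr s * ((l n powr (1 + \<eta>/2) * l n powr (s/2)) * (exp (l n) * exp (tt * l n) * exp (- s * l n)))"
    unfolding e b2 unfolding dl by (simp add: exp_powr_real mult_ac)
   also have "l n powr (1 + \<eta>/2) * l n powr (s/2) = l n powr ?H" by (simp add: powr_add)
   also have "exp (l n) * exp (tt * l n) * exp (- s * l n) = exp (- ?I * l n)"
    by (simp add: mult_exp_exp algebra_simps)
   finally show ?case .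
  qed
 qed
 define Km where "Km = ?A * Cm"
 \<comment> \<open>Triples: at most \<open>n\<close> blocks, \<open>m\<close> of order
   \<open>n^(3/32 - 3/2)\<close>, and a factor of at most \<open>n^(1/8)\<close> from
   \<open>(2 * L + 1)^2\<close>. The exponent is \<open>1 + 3/32 - 3/2 + 1/8 = - 9/32\<close>, which
   beats the logarithms.\<close>
 have p3: "(%n. 2 * real (N n) * b n ^ 3 * (?A * m n) * (exp 7 *
    (real (d n) ^ 3 * E n ^ 3 + 3 * ?C n * real (d n) ^ 2 * E n ^ 2
    + ?C n ^ 2 * real (d n) * E n))) ----> 0"
 proof (rule tendsto_sandwich[OF _ _ tendsto_const])
  let ?u = "%k n. l n powr (3/2 + 3*\<eta>/4 + k/2) * real n powr - (9/32)"
  have "(%n. 2 * C0 ^ 3 * Km * exp 7 * ((G n)^3 * ?u 3 n + 3 * (G n)^2 * ?u 2 n + G n * ?u 1 n))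
   ----> 2 * C0 ^ 3 * Km * exp 7 * (G0^3 * 0 + 3 * G0^2 * 0 + G0 * 0)"
   using \<eta> by (intro tendsto_intros G lz) auto
  then show "(%n. 2 * C0 ^ 3 * Km * exp 7 * ((G n)^3 * ?u 3 n + 3 * (G n)^2 * ?u 2 n + G n * ?u 1 n)) ----> 0" by simp
  show "EV n. 0 <= 2 * real (N n) * b n ^ 3 * (?A * m n) * (exp 7 *
    (real (d n) ^ 3 * E n ^ 3 + 3 * ?C n * real (d n) ^ 2 * E n ^ 2
    + ?C n ^ 2 * real (d n) * E n))"
   using m by eventually_elim
    (use C0 normal_cube_moment_nonneg in \<open>auto simp: b_def E_def intro!: mult_nonneg_nonneg add_nonneg_nonneg\<close>)
  have L2: "EV n. 2 * real (L n) + 1 <= real n powr (1/16)"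
  proof -
   \<comment> \<open>The midpoint between \<open>D\<close> and \<open>1 / (16 * tt)\<close>: an
     exponent above \<open>D\<close> bounds the dimension, and staying below the other end keeps
     \<open>d^tt\<close> under \<open>n^(1/16)\<close>.\<close>
   define a where "a = (D + 1 / (16 * tt)) / 2"
   have a: "D < a" "a * tt < 1/16" using th D by (auto simp: a_def field_simps)
   show ?thesis
    using L1 dim_upper[OF a(1)] powr_dominated[OF a(2), of 3]
   proof eventually_elim
    case (elim n)
    have "real (d n) powr tt <= (real n powr a) powr tt" using elim th by (intro powr_mono2) auto
    then show ?case using elim by (simp add: powr_powr)
   qed
  qed
  show "EV n. 2 * real (N n) * b n ^ 3 * (?A * m n) * (exp 7 *
    (real (d n) ^ 3 * E n ^ 3 + 3 * ?C n * real (d n) ^ 2 * E n ^ 2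
    + ?C n ^ 2 * real (d n) * E n))
    <= 2 * C0 ^ 3 * Km * exp 7 * ((G n)^3 * ?u 3 n + 3 * (G n)^2 * ?u 2 n + G n * ?u 1 n)"
   using lpos L2 m eventually_ge_at_top[of 1]
  proof eventually_elim
   case (elim n)
   define F where "F = real (d n) * E n"
   define Q where "Q = real n powr (1/16)"
   have F0: "0 <= F" by (simp add: F_def E_def)
   have Q: "1 <= Q" "2 * real (L n) + 1 <= Q" using elim by (auto simp: Q_def ge_one_powr_ge_zero)
   have b0: "0 <= b n" using C0 by (simp add: b_def)
   have c0: "0 <= exp 1 + normal_cube_moment" using normal_cube_moment_nonneg by simp
   have "real (d n) ^ 3 * E n ^ 3 + 3 * ?C n * real (d n) ^ 2 * E n ^ 2 + ?C n ^ 2 * real (d n) * E n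
    = 1 * F ^ 3 + 3 * ?C n * F ^ 2 + ?C n ^ 2 * F"
    by (simp add: F_def power_mult_distrib mult_ac)
   also have "... <= Q^2 * F ^ 3 + 3 * Q^2 * F^2 + Q^2 * F"
    using Q F0 self_le_power[of Q 2] by (intro add_mono mult_right_mono mult_left_mono power_mono) auto
   finally have 1: "real (d n) ^ 3 * E n ^ 3 + 3 * ?C n * real (d n) ^ 2 * E n ^ 2 + ?C n ^ 2 * real (d n) * E n
    <= Q^2 * F ^ 3 + 3 * Q^2 * F^2 + Q^2 * F" .
   define W where "W = real (d n) ^ 3 * E n ^ 3 + 3 * ?C n * real (d n) ^ 2 * E n ^ 2 + ?C n ^ 2 * real (d n) * E n"
   have W: "0 <= W" "W <= Q^2 * F ^ 3 + 3 * Q^2 * F^2 + Q^2 * F" using 1 by (auto simp: W_def E_def)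
   have nn: "2 * real (N n) * b n ^ 3 <= 2 * real n * b n ^ 3" "0 <= 2 * real n * b n ^ 3" using b0 N[of n] by (auto intro: mult_right_mono)
   have mm: "?A * m n <= ?A * ?G n"
    "0 <= ?A * m n" using c0 elim by (auto intro!: mult_left_mono mult_nonneg_nonneg simp del: distrib_right_numeral)
   have t1: "2 * real (N n) * b n ^ 3 * (?A * m n)
     <= 2 * real n * b n ^ 3 * (?A * ?G n)"
    by (rule mult_mono[OF nn(1) mm(1) nn(2) mm(2)])
   have t2: "0 <= 2 * real n * b n ^ 3 * (?A * ?G n)"
    by (rule mult_nonneg_nonneg[OF nn(2) order_trans[OF mm(2,1)]])
   have t3: "exp 7 * W <= exp 7 * (Q^2 * F ^ 3 + 3 * Q^2 * F^2 + Q^2 * F)" "0 <= exp 7 * W"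
    using W by (auto intro!: mult_left_mono mult_nonneg_nonneg)
   have "2 * real (N n) * b n ^ 3 * (?A * m n) * (exp 7 * W)
    <= 2 * real n * b n ^ 3 * (?A * ?G n) * (exp 7 * (Q^2 * F ^ 3 + 3 * Q^2 * F^2 + Q^2 * F))"
    by (rule mult_mono[OF t1 t3(1) t2 t3(2)])
   also have "... = 2 * Km * exp 7 * (real n * real n powr (3/32 - 3/2) * Q^2) * (b n ^ 3 * (F ^ 3 + 3 * F^2 + F))"
    by (simp add: Km_def algebra_simps)
   also have "real n * real n powr (3/32 - 3/2) * Q^2 = real n powr - (9/32)"
    using elim by (simp add: Q_def powr_power powr_mult_base powr_add[symmetric])
   also have "b n ^ 3 * (F ^ 3 + 3 * F^2 + F) = C0 ^ 3 * (G n ^ 3 * l n powr (3/2 + 3*\<eta>/4 + 3/2) + 3 * (G n)^2 * l n powr (3/2 + 3*\<eta>/4 + 2/2) + G n * l n powr (3/2 + 3*\<eta>/4 + 1/2))"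
   proof -
    define w where "w = 3/2 + 3*\<eta>/4"
    have b3: "b n ^ 3 = C0 ^ 3 * l n powr w" using elim(1) by (simp add: b_def w_def power_mult_distrib powr_power algebra_simps)
    have Fk: "F ^ k = G n ^ k * l n powr (real k / 2)" for k
     unfolding F_def dE[OF elim(1)] using elim(1) by (simp add: power_mult_distrib powr_power)
    have F1: "F = G n * l n powr (1 / 2)" using Fk[of 1] by simp
    have "b n ^ 3 * (F ^ 3 + 3 * F^2 + F) = C0 ^ 3 * l n powr w * (G n ^ 3 * l n powr (3 / 2) + 3 * ((G n)^2 * l n powr (2 / 2)) + G n * l n powr (1 / 2))"
     unfolding b3 using Fk[of 3] Fk[of 2] F1 by (simp only: of_nat_numeral)
    also have "... = C0 ^ 3 * (G n ^ 3 * (l n powr w * l n powr (3 / 2)) + 3 * (G n)^2 * (l n powr w * l n powr (2 / 2)) + G n * (l n powr w * l n powr (1 / 2)))"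
     by (simp only: distrib_left mult_ac)
    finally show ?thesis unfolding w_def[symmetric] powr_add .
   qed
   finally show ?case unfolding W_def by (simp add: algebra_simps)
  qed
 qed
 have eq: "swap_error (d n) (L n) (N n) (m n) (kp n) r (v n) (b n) = (b n)^2 / 2 * (?E n)
   + (b n)^2 / 2 * (?B n)
   + 2 * real (N n) * b n ^ 3 * (?A * m n) * (exp 7 *
    (real (d n) ^ 3 * E n ^ 3 + 3 * ?C n * real (d n) ^ 2 * E n ^ 2
    + ?C n ^ 2 * real (d n) * E n))" for n
  unfolding swap_error_def E_def by (rule arg_cong2[where f = "(+)", OF distrib_left refl])
 have "(%n. swap_error (d n) (L n) (N n) (m n) (kp n) r (v n) (b n)) ----> 0 + 0 + 0"
  unfolding eq by (intro tendsto_add p1 p2 p3)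
 then show ?thesis by (simp only: b_def kp_def l_def add_0)
qed

end

section \<open>Choice of the scales and the limit theorem\<close>

locale change_point_model = cusum_array M S eps eps' g p K \<delta> \<mu>1 \<mu>2 t \<sigma>_lo tb Cl Cu
 for M :: "'w measure" and S :: "'s measure" and eps eps' g p K \<delta> \<mu>1 \<mu>2 t \<sigma>_lo tb Cl Cu +
 fixes d :: "nat => nat" and Mseq :: "nat => real" and C1 C2 C3 C4 D \<eta> \<rho>_hi m :: real
 assumes C1: "0 < C1" and D: "0 < D" and d_approx: "n \<ge> 1 ==> abs (real (d n) - C1 * real n powr D) < 1"
  and C2: "0 < C2" and C3: "0 < C3" and C4: "0 < C4" and \<eta>: "0 < \<eta>"
  and corr_bound: "0 < \<rho>_hi" "\<rho>_hi < 1" "h \<ge> 1 ==> i \<ge> 1 ==> h \<noteq> i ==> abs (lr_corr M (causal g eps) h i) <= \<rho>_hi"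
  and corr_decay: "h \<ge> 1 ==> i \<ge> 1 ==> abs (lr_corr M (causal g eps) h i) <= C2 * ln (abs (real h - real i) + 2) powr (- 2 - \<eta>)"
  and exp_moment: "k \<ge> 1 ==> 0 < Mseq k"
   "1 <= h ==> h <= k ==> integrable M (%u. exp (abs (causal g eps 1 h u) / Mseq k)) \<and>
    (LINT u|M. exp (abs (causal g eps 1 h u) / Mseq k)) <= C3"
  and scale: "n \<ge> 1 ==> Mseq (d n) <= C4 * real n powr m" "m < 3/8"
begin

text \<open>The gap length. The block length is its fourth power, so that gaps use up a vanishing
  fraction of the time while a block stays as short as \<open>n^(1/32)\<close>; any power of
  \<open>n\<close>, however small, suffices for the dependence to die out across a gap.\<close>

definition gl :: "nat => nat" where "gl n = nat \<lfloor>real n powr (1/128)\<rfloor>"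
definition bl :: "nat => nat" where "bl n = gl n ^ 4"
definition nb :: "nat => nat" where "nb n = n div (bl n + gl n)"
text \<open>The truncation level exceeds the scale \<open>n^(3/8)\<close> of the exponential moments
  by \<open>n^(1/16)\<close>, and stays below \<open>sqrt n\<close> by the same factor, which leaves
  room for the block length and for the level \<open>v\<close>.\<close>

definition Tr :: "nat => real" where "Tr n = real n powr (7/16)"
text \<open>Small enough for \<open>(n * ac n)^2\<close> to vanish even after summation over about
  \<open>n^D\<close> coordinates.\<close>

definition ac :: "nat => real" where "ac n = real n powr - (D + 2)"

lemma gl_bounds: "EV n. real n powr (1/256) <= real (gl n) \<and> real (gl n) <= real n powr (1/128) \<and> 1 <= gl n"
proof -
 have "EV n. 2 * real n powr (1/256) <= real n powr (1/128)" by (rule powr_dominated) simp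
 with eventually_ge_at_top[of 1] show ?thesis
 proof eventually_elim
  case (elim n)
  have 1: "1 <= real n powr (1/256)" using elim by (simp add: ge_one_powr_ge_zero)
  have "real (gl n) = of_int \<lfloor>real n powr (1/128)\<rfloor>" by (simp add: gl_def)
  then have 2: "real (gl n) <= real n powr (1/128)" "real n powr (1/128) - 1 < real (gl n)" by linarith+
  then have "real n powr (1/256) <= real (gl n)" using 1 elim by linarith
  then show ?case using 1 2 by auto
 qed
qed

lemma block_count:
 assumes "1 <= gl n"
 shows "nb n * (bl n + gl n) <= n" "n < (nb n + 1) * (bl n + gl n)"
 using dividend_less_div_times[of "bl n + gl n" n] div_times_less_eq_dividend[of n "bl n + gl n"] assms unfolding nb_def by auto

lemma bl_bounds:
 assumes "real n powr (1/256) <= real (gl n)" "real (gl n) <= real n powr (1/128)" "1 <= gl n" and n: "1 <= n"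
 shows "real (bl n) <= real n powr (1/32)" "gl n <= bl n" "real n powr (1/64) <= real (bl n)"
  "1 - real (nb n) * real (bl n) / real n <= real n powr - (3/256) + 2 * real n powr (1/32 - 1)"
  "real (nb n) <= real n / real (gl n) ^ 4"
proof -
 have "real (gl n) ^ 4 <= (real n powr (1/128)) ^ 4" using assms by (intro power_mono) auto
 then show b1: "real (bl n) <= real n powr (1/32)" using n by (simp add: bl_def powr_power)
 have "gl n ^ 1 <= gl n ^ 4" using assms by (intro power_increasing) auto
 then show b2: "gl n <= bl n" by (simp add: bl_def)
 have "(real n powr (1/256)) ^ 4 <= real (gl n) ^ 4" using assms by (intro power_mono) auto
 then show "real n powr (1/64) <= real (bl n)" using n by (simp add: bl_def powr_power)
 have g0: "0 < real (gl n)" using assms by simp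
 have "real (nb n * (bl n + gl n)) <= real n" using block_count(1)[OF assms(3)] by (simp only: of_nat_le_iff)
 then have nbb: "real (nb n) * real (bl n) <= real n"
  by (simp add: distrib_left) (meson add_increasing2 le_add_same_cancel1 mult_nonneg_nonneg of_nat_0_le_iff order_trans)
 then show "real (nb n) <= real n / real (gl n) ^ 4" using g0 by (simp add: bl_def field_simps)
 \<comment> \<open>There are at most \<open>n / gl^4\<close> gaps, so they occupy a fraction of at
   most \<open>gl^(-3)\<close> of the time. The incomplete last stretch adds at most
   \<open>2 * bl\<close>.\<close>
 then have "real (nb n) * real (gl n) <= real n / real (gl n) ^ 4 * real (gl n)" using g0 by (intro mult_right_mono) auto
 also have "... = real n / real (gl n) ^ 3" using g0 by (simp add: eval_nat_numeral)
 also have "... <= real n / (real n powr (1/256)) ^ 3" using assms g0 by (intro divide_left_mono power_mono) auto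
 also have "(real n powr (1/256)) ^ 3 = real n powr (3/256)" using n by (simp add: powr_power)
 finally have 1: "real (nb n) * real (gl n) / real n <= real n powr - (3/256)" using n by (simp add: powr_minus divide_simps)
 have "real n < real ((nb n + 1) * (bl n + gl n))" using block_count(2)[OF assms(3)] by (simp only: of_nat_less_iff)
 then have "real n - real (nb n) * real (bl n) <= real (nb n) * real (gl n) + 2 * real (bl n)" using b2 by (simp add: algebra_simps)
 also have "... <= real (nb n) * real (gl n) + 2 * real n powr (1/32)" using b1 by simp
 finally have "(real n - real (nb n) * real (bl n)) / real n <= (real (nb n) * real (gl n) + 2 * real n powr (1/32)) / real n"
  by (rule divide_right_mono) simp
 also have "... = real (nb n) * real (gl n) / real n + 2 * real n powr (1/32 - 1)"
 proof -
  have "real n powr (1/32 - 1) = real n powr (1/32) / real n powr 1" by (rule powr_diff)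
  then show ?thesis using n by (simp add: add_divide_distrib)
 qed
 finally show "1 - real (nb n) * real (bl n) / real n <= real n powr - (3/256) + 2 * real n powr (1/32 - 1)"
  using 1 n by (simp add: diff_divide_distrib)
qed

lemma A_powr: "A n = V / \<sigma>_lo * real n powr - (1/2)"
proof -
 have "real n powr - (1/2) = 1 / sqrt (real n)" unfolding powr_minus_divide by (simp add: powr_half_sqrt)
 then show ?thesis by (simp add: A_def)
qed

lemma dim_limit: "filterlim d at_top sequentially"
 by (rule dim_at_top[OF C1 D d_approx])

text \<open>The truncation error contains \<open>exp (- n^(1/16) / (2 * C4))\<close> and the
  forgotten past contributes \<open>\<delta>\<close> to the power \<open>2 * n^(1/256)\<close>. Both
  beat the polynomial \<open>n^(2 * (D + 2))\<close>.\<close>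

lemma approx_eventually:
 "EV n. ALL h:{1..d n}. \<forall>j. (LINT w|M. (Xt (gl n) (Tr n) j h w - X j h w)^2) <= (ac n)^2 \<and>
  integrable M (%w. (Xt (gl n) (Tr n) j h w - X j h w)^2)"
proof -
 let ?C = "%n. (- (1 / (2 * C4)) * real n powr (1/16))"
 let ?B = "%n. (2 * ln \<delta> * real n powr (1/256))"
 let ?A = "%n. (real n powr (3/4) * exp (?C n))"
 have l1: "((%n::nat. real n powr (2 * (D + 2)) * ?A n) \<longlongrightarrow> 0) sequentially"
  using C4 by real_asymp
 have l2: "((%n::nat. real n powr (2 * (D + 2)) * exp (?B n)) \<longlongrightarrow> 0) sequentially"
 proof -
  have "ln \<delta> < 0" using \<delta> by simp
  then show ?thesis by real_asymp
 qed
 have "(%n. 48 * C4^2 * C3 * (real n powr (2 * (D + 2)) * ?A n)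
  + 3 * moment_const 2 * (real n powr (2 * (D + 2)) * exp (?B n))) ----> 48 * C4^2 * C3 * 0 + 3 * moment_const 2 * 0"
  by (intro tendsto_intros l1 l2)
 then have small: "EV n. 48 * C4^2 * C3 * (real n powr (2 * (D + 2)) * ?A n)
  + 3 * moment_const 2 * (real n powr (2 * (D + 2)) * exp (?B n)) < 1"
  by (intro order_tendstoD(2)) auto
 have d1: "EV n. 1 <= d n" using dim_limit by (simp add: filterlim_at_top)
 show ?thesis using small gl_bounds d1 eventually_ge_at_top[of 1]
 proof eventually_elim
  case (elim n)
  have n: "1 <= real n" using elim by simp
  define mm where "mm = Mseq (d n)"
  have mm: "0 < mm" "mm <= C4 * real n powr (3/8)"
  proof -
   show "0 < mm" unfolding mm_def by (rule exp_moment(1)) (use elim in simp)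
   have "mm <= C4 * real n powr m" unfolding mm_def by (rule scale(1)) (use elim in simp)
   also have "... <= C4 * real n powr (3/8)" using C4 n scale(2) by (intro mult_left_mono powr_mono) auto
   finally show "mm <= C4 * real n powr (3/8)" .
  qed
  have T: "0 <= Tr n" by (simp add: Tr_def)
  have "8 * mm^2 * C3 * exp (- Tr n / (2 * mm)) <= 8 * (C4 * real n powr (3/8))^2 * C3 * exp (?C n)"
  proof (intro mult_mono mult_left_mono power_mono)
   have "real n powr (1/16) = Tr n / real n powr (3/8)" unfolding Tr_def by (simp add: powr_diff[symmetric])
   then have "1 / (2 * C4) * real n powr (1/16) = Tr n / (2 * (C4 * real n powr (3/8)))" by simp
   also have "... <= Tr n / (2 * mm)" using mm T C4 n by (intro divide_left_mono mult_left_mono mult_pos_pos) auto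
   finally show "exp (- Tr n / (2 * mm)) <= exp (?C n)" by simp
  qed (use mm C3 C4 in auto)
  also have "... = 8 * C4^2 * C3 * ?A n"
   using n by (simp add: power_mult_distrib powr_power)
  finally have b1: "8 * mm^2 * C3 * exp (- Tr n / (2 * mm)) <= 8 * C4^2 * C3 * ?A n" .
  have b2: "(\<delta> ^ gl n)^2 <= exp (?B n)"
  proof -
   have "\<delta> ^ gl n = exp (ln \<delta> * real (gl n))" using \<delta> by (simp add: exp_of_nat2_mult)
   also have "... <= exp (ln \<delta> * real n powr (1/256))" using \<delta> elim by (simp add: mult_left_mono_neg)
   finally have "(\<delta> ^ gl n)^2 <= (exp (ln \<delta> * real n powr (1/256)))^2" using \<delta> by (intro power_mono) auto
   then show ?thesis by (simp add: exp_double[symmetric] mult_ac)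
  qed
  have tot: "6 * (8 * mm^2 * C3 * exp (- Tr n / (2 * mm))) + 3 * moment_const 2 * (\<delta> ^ gl n)^2 <= (ac n)^2"
  proof -
   define z where "z = real n powr (2 * (D + 2))"
   have "z = (real n powr (D + 2))^2" using n by (simp add: z_def powr_power algebra_simps)
   moreover have "ac n = 1 / real n powr (D + 2)" unfolding ac_def by (rule powr_minus_divide)
   ultimately have z: "0 < z" "(ac n)^2 = 1 / z" using n by (auto simp: power_divide)
   have "6 * (8 * mm^2 * C3 * exp (- Tr n / (2 * mm))) + 3 * moment_const 2 * (\<delta> ^ gl n)^2
    <= 6 * (8 * C4^2 * C3 * ?A n) + 3 * moment_const 2 * exp (?B n)"
    using b1 b2 moment_const_nonneg[of 2] by (intro add_mono mult_left_mono) auto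
   also have "... = (48 * C4^2 * C3 * (z * ?A n)
     + 3 * moment_const 2 * (z * exp (?B n))) / z" using z by (simp add: field_simps)
   also have "... <= 1 / z" using elim z(1) unfolding z_def[symmetric] by (intro divide_right_mono) auto
   finally show ?thesis unfolding z(2) .
  qed
  show ?case
  proof (intro ballI allI)
   fix h j assume h: "h : {1..d n}"
   have h1: "h \<ge> 1" using h by simp
   have em: "integrable M (%w. exp (abs (X 1 h w) / mm))" "(LINT w|M. exp (abs (X 1 h w) / mm)) <= C3"
    using exp_moment(2)[of h "d n"] h by (auto simp: mm_def)
   note ct = clip_tail[OF h1 T mm(1) em]
   show "(LINT w|M. (Xt (gl n) (Tr n) j h w - X j h w)^2) <= (ac n)^2 \<and> integrable M (%w. (Xt (gl n) (Tr n) j h w - X j h w)^2)"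
    using Xt_approx[OF h1 T ct, of "gl n" j] tot by auto
  qed
 qed
qed

text \<open>The slowest of the six terms is the time lost in the gaps, bounded by a multiple of
  \<open>n^(-3/256)\<close>. The exponent \<open>-1/512\<close> leaves room for all constants, each
  term receiving one sixth.\<close>

lemma var_err_eventually: "EV n. var_err n (nb n) (bl n) (ac n) <= real n powr - (1/512)"
proof -
 let ?B = "(1/32 - (D + 2))"
 let ?A = "(moment_const 2 + 1)"
 define R where "R = V^2 / \<sigma>_lo^2"
 define K1 where "K1 = 2 * moment_const 2 / (1 - sqrt \<delta>)^2"
 define K2 where "K2 = 2 * moment_const 2 / (1 - \<delta>)^2"
 have R0: "0 <= R" "0 <= K1" "0 <= K2" using moment_const_nonneg[of 2] by (auto simp: R_def K1_def K2_def)
 have "EV n. (6 * (17 * V^2)) * real n powr - 1 <= real n powr - (1/512)" by (rule powr_dominated) simp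
 moreover have "EV n. (6 * V^2) * real n powr - (3/256) <= real n powr - (1/512)" by (rule powr_dominated) simp
 moreover have "EV n. (6 * (V^2 * 2)) * real n powr (1/32 - 1) <= real n powr - (1/512)" by (rule powr_dominated) simp
 moreover have "EV n. (6 * (R * K1)) * real n powr - 1 <= real n powr - (1/512)" by (rule powr_dominated) simp
 moreover have "EV n. (6 * (R * K2)) * real n powr - (1/64) <= real n powr - (1/512)" by (rule powr_dominated) simp
 moreover have "EV n. (6 * (R * ?A)) * real n powr ?B <= real n powr - (1/512)"
  using D by (intro powr_dominated) simp
 ultimately show ?thesis using gl_bounds eventually_ge_at_top[of 1]
 proof eventually_elim
  case (elim n)
  then have gb: "real n powr (1/256) <= real (gl n)" "real (gl n) <= real n powr (1/128)" "1 <= gl n" "1 <= n" by auto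
  note b = bl_bounds[OF gb]
  have n: "1 <= real n" using elim by simp
  have i1: "1 / real n = real n powr - 1" using n by (simp add: powr_minus_divide)
  have i2: "1 / real (bl n) <= real n powr - (1/64)"
   using b(3) n frac_le[of 1 1 "real n powr (1/64)" "real (bl n)"] by (simp add: powr_minus_divide)
  have i3: "real (bl n) * (?A * ac n) <= ?A * real n powr ?B"
  proof -
   have "real (bl n) * (?A * ac n) <= real n powr (1/32) * (?A * ac n)"
    using b(1) moment_const_nonneg[of 2] by (intro mult_right_mono) (auto simp: ac_def)
   also have "... = ?A * (real n powr (1/32) * real n powr - (D + 2))" by (simp add: ac_def)
   also have "real n powr (1/32) * real n powr - (D + 2) = real n powr ?B" by (simp only: powr_add[symmetric]) simp
   finally show ?thesis .
  qed
  have "cov_err n (bl n) (ac n) = R * (K1 * (1 / real n) + K2 * (1 / real (bl n)) + real (bl n) * (?A * ac n))"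
   by (simp add: cov_err_def R_def K1_def K2_def)
  also have "... <= R * (K1 * real n powr - 1 + K2 * real n powr - (1/64) + ?A * real n powr ?B)"
   unfolding i1 using R0 i2 i3 by (intro mult_left_mono add_mono) auto
  also have "... = R * K1 * real n powr - 1 + R * K2 * real n powr - (1/64) + R * ?A * real n powr ?B"
   by (simp add: algebra_simps)
  finally have c: "cov_err n (bl n) (ac n) <= R * K1 * real n powr - 1 + R * K2 * real n powr - (1/64) + R * ?A * real n powr ?B" .
  have "V^2 * (1 - real (nb n) * real (bl n) / real n) <= V^2 * (real n powr - (3/256) + 2 * real n powr (1/32 - 1))"
   using b(4) by (intro mult_left_mono) auto
  then have f: "V^2 * (1 - real (nb n) * real (bl n) / real n) <= V^2 * real n powr - (3/256) + V^2 * 2 * real n powr (1/32 - 1)"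
   by (simp add: algebra_simps)
  have v: "17 * V^2 / real n = 17 * V^2 * real n powr - 1" unfolding i1[symmetric] by simp
  have "6 * a <= e ==> 6 * b1 <= e ==> 6 * b2 <= e ==> 6 * c1 <= e ==> 6 * c2 <= e ==> 6 * c3 <= e ==>
   f <= b1 + b2 ==> c <= c1 + c2 + c3 ==> a + f + c <= e" for a b1 b2 c1 c2 c3 c e f :: real
   by linarith
  note this[OF elim(1-6)[unfolded mult.assoc[of 6]] f c]
  then show ?case unfolding var_err_def v .
 qed
qed

abbreviation "SY n h w \<equiv> (\<Sum>B<nb n. Y n (gl n) (Tr n) (bl n) B h w)"

lemma Tr_pos: "1 <= n ==> 0 < Tr n" and ac_pos: "1 <= n ==> 0 < ac n"
 by (simp_all add: Tr_def ac_def)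

lemma V_sigma: "0 <= V / \<sigma>_lo" using V_pos sd_lower by simp

lemma block_scale:
 assumes "real n powr (1/256) <= real (gl n)" "real (gl n) <= real n powr (1/128)" "1 <= gl n" and n: "1 <= n"
 shows "real (bl n) * A n <= V / \<sigma>_lo * real n powr (1/32 - 1/2)"
  and "A n * (2 * Tr n) = 2 * (V / \<sigma>_lo) * real n powr - (1/16)"
proof -
 have "real (bl n) * A n <= real n powr (1/32) * A n"
  by (intro mult_right_mono bl_bounds(1)[OF assms] A_nonneg)
 also have "... = V / \<sigma>_lo * (real n powr (1/32) * real n powr - (1/2))" by (simp add: A_powr)
 also have "real n powr (1/32) * real n powr - (1/2) = real n powr (1/32 - 1/2)" by (simp only: powr_add[symmetric] diff_conv_add_uminus)
 finally show "real (bl n) * A n <= V / \<sigma>_lo * real n powr (1/32 - 1/2)" .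
 have "real n powr - (1/2) * real n powr (7/16) = real n powr - (1/16)" by (simp add: powr_add[symmetric])
 then show "A n * (2 * Tr n) = 2 * (V / \<sigma>_lo) * real n powr - (1/16)" by (simp add: A_powr Tr_def)
qed

lemma bad_event_limit:
 "(%n. prob {y:space M. EX h:{1..d n}. 2 * real n powr - (1/512) < abs (tst n h y - SY n h y)}) ----> 0"
proof (rule tendsto_sandwich[OF _ _ tendsto_const])
 let ?F = "(tb * \<sigma>_lo * Cl)"
 let ?D = "%n. (- (real n powr (1/512)))"
 let ?C = "%n h y. abs (tst n h y - SY n h y)"
 let ?A = "%n. (- (1/4) * real n powr (11/64))"
 let ?B = "%n. ((real (gl n) * A n)^2 * moment_const 2)"
 \<comment> \<open>For the partial sums, \<open>x / Tr = n^(11/64)\<close> outgrows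
   \<open>n / Tr^2 = n^(8/64)\<close>, while the squared noise \<open>(gl * x)^2 / n^(3/2)\<close>
   is still of order \<open>n^(-17/64)\<close>. The variance of the gap sum is at most a multiple of
   \<open>gl^(-2)\<close>, so the tilt \<open>n^(1/256)\<close>, which is below \<open>gl\<close>,
   costs a constant and gains \<open>exp (- n^(1/512))\<close>.\<close>
 let ?x = "%n::nat. real n powr (39/64)" and ?th = "%n::nat. real n powr (1/256)" and ?z = "%n::nat. real n powr - (1/512)"
 let ?G = "%n. (real (gl n + 1) * ?x n + 1)"
 let ?E = "%n. (real n * moment_const 2 / (2 * Tr n)^2 - ?x n / (2 * Tr n))"
 define R where "R = V / \<sigma>_lo"
 define K where "K = R^2 * moment_const 2"
 have R0: "0 <= R" using V_sigma by (simp add: R_def)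
 let ?U = "%n. real n powr - (D + 1) + 8 * (real n powr (D + 3) * exp (?A n)) + 2 * exp K * (real n powr (D + 1) * exp (?D n))"
 have "((%n::nat. real n powr - (D + 1)) \<longlongrightarrow> 0) sequentially" using D by real_asymp
 moreover have "((%n::nat. real n powr (D + 3) * exp (?A n)) \<longlongrightarrow> 0) sequentially" by real_asymp
 moreover have "((%n::nat. real n powr (D + 1) * exp (?D n)) \<longlongrightarrow> 0) sequentially" by real_asymp
 ultimately have "?U ----> 0 + 8 * 0 + 2 * exp K * 0" by (intro tendsto_add tendsto_mult_left)
 then show "?U ----> 0" by simp
 show "EV n. 0 <= prob {y:space M. EX h:{1..d n}. 2 * real n powr - (1/512) < (?C n h y)}" by simp
 have "EV n. (5 * (54 * Cu / (tb * \<sigma>_lo))) * real n powr - (1/2) <= ?z n" by (rule powr_dominated) simp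
 moreover have "EV n. (5 * (36 / ?F * 9)) * real n powr - (17/64) <= ?z n" by (rule powr_dominated) simp
 moreover have "EV n. (5 * R) * real n powr - (1/2) <= ?z n" by (rule powr_dominated) simp
 moreover have "EV n. (5 * (4 * R)) * real n powr - (1/32) <= ?z n" by (rule powr_dominated) simp
 moreover have "EV n. moment_const 2 * real n powr (1/8) <= real n powr (11/64)" by (rule powr_dominated) simp
 moreover have "EV n. (2 * R) * real n powr - (13/256) <= real n powr 0" by (rule powr_dominated) simp
 moreover have "EV n. real (d n) <= real n powr (D + 1)" by (rule dim_upper[OF C1 D d_approx, of "D + 1"]) simp_all
 ultimately show "EV n. prob {y:space M. EX h:{1..d n}. 2 * ?z n < (?C n h y)} <= ?U n"
  using gl_bounds approx_eventually eventually_ge_at_top[of 1]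
 proof eventually_elim
  case (elim n)
  then have gb: "real n powr (1/256) <= real (gl n)" "real (gl n) <= real n powr (1/128)" "1 <= gl n" "1 <= n" by auto
  note b = bl_bounds[OF gb] and bs = block_scale[OF gb, folded R_def]
  have n: "1 <= real n" using gb by simp
  have padd: "real n powr u * real n powr w = real n powr (u + w)" for u w by (rule powr_add[symmetric])
  have th: "?th n * (real (gl n) * (A n * (2 * Tr n))) <= 1"
  proof -
   have "?th n * (real (gl n) * (A n * (2 * Tr n))) <= ?th n * (real n powr (1/128) * (2 * R * real n powr - (1/16)))"
    unfolding bs(2) using gb R0 by (intro mult_left_mono mult_right_mono) auto
   also have "... = 2 * R * (?th n * real n powr (1/128) * real n powr - (1/16))" by (simp add: mult_ac)
   also have "?th n * real n powr (1/128) * real n powr - (1/16) = real n powr - (13/256)" unfolding padd by simp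
   also have "2 * R * real n powr - (13/256) <= 1" using elim n by simp
   finally show ?thesis .
  qed
  have bl0: "0 < bl n" using gb b(2) by linarith
  have lin: "linear_err n (bl n) (gl n) (Tr n) (?x n) (?z n) <= 2 * ?z n"
  proof -
   have sq: "sqrt (real n) = real n powr (1/2)" using n by (simp add: powr_half_sqrt)
   have t1: "54 * Cu / (tb * \<sigma>_lo) / sqrt (real n) = 54 * Cu / (tb * \<sigma>_lo) * real n powr - (1/2)"
    unfolding sq by (simp add: powr_minus_divide)
   have "real (gl n + 1) * ?x n + 1 <= 2 * real n powr (1/128) * ?x n + 1 * 1"
    using gb by (intro add_mono mult_right_mono) auto
   also have "... <= 2 * real n powr (1/128) * ?x n + 1 * real n powr (79/128)" using n by (intro add_mono mult_left_mono) (auto intro: ge_one_powr_ge_zero)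
   also have "2 * real n powr (1/128) * ?x n = 2 * real n powr (79/128)" by (simp only: mult.assoc padd) simp
   finally have "(?G n)^2 <= (3 * real n powr (79/128))^2" by (intro power_mono) auto
   also have "... = 9 * real n powr (79/64)" using n by (simp add: power_mult_distrib powr_power)
   finally have "(?G n)^2 / real n powr (3/2) <= 9 * real n powr (79/64) / real n powr (3/2)"
    by (rule divide_right_mono) simp
   also have "9 * real n powr (79/64) / real n powr (3/2) = 9 * (real n powr (79/64) / real n powr (3/2))" by simp
   also have "real n powr (79/64) / real n powr (3/2) = real n powr - (17/64)" unfolding powr_diff[symmetric] by simp
   finally have "36 / ?F * ((?G n)^2 / real n powr (3/2)) <= 36 / ?F * (9 * real n powr - (17/64))"
    using change_point(1) sd_lower(1) jump(1) by (rule_tac mult_left_mono) simp_all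
   moreover have "real n * sqrt (real n) = real n powr (3/2)" unfolding sq using n by (simp add: powr_mult_base)
   ultimately have t2: "36 / ?F * (?G n)^2 / (real n * sqrt (real n)) <= 36 / ?F * 9 * real n powr - (17/64)"
    by (simp only: times_divide_eq_right mult.assoc)
   have t3: "A n = R * real n powr - (1/2)" by (simp add: A_powr R_def)
   have "real (bl n + gl n) * (A n * (2 * Tr n)) <= 2 * real n powr (1/32) * (2 * R * real n powr - (1/16))"
    unfolding bs(2) using b(1,2) R0 by (intro mult_right_mono) auto
   also have "... = 4 * R * (real n powr (1/32) * real n powr - (1/16))" by (simp add: mult_ac)
   also have "real n powr (1/32) * real n powr - (1/16) = real n powr - (1/32)" unfolding padd by simp
   finally have t4: "real (bl n + gl n) * (A n * (2 * Tr n)) <= 4 * R * real n powr - (1/32)" .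
   have "5 * a <= z ==> 5 * b1 <= z ==> 5 * c1 <= z ==> 5 * e1 <= z ==> b <= b1 ==> e <= e1 ==> 0 <= z ==> a + b + c1 + z + e <= 2 * z"
    for a b b1 c1 e e1 z :: real by linarith
   note this[OF elim(1-4)[unfolded mult.assoc[of 5]] t2 t4]
   then show ?thesis unfolding linear_err_def t1 t3 by simp
  qed
  have tail: "real (d n) * tail_bound n (nb n) (gl n) (Tr n) (ac n) (?x n) (?th n) (?z n) <= ?U n"
  proof -
   have dn: "0 <= real (d n)" "real (d n) <= real n powr (D + 1)" using elim by auto
   have e1: "(real n * ac n)^2 = real n powr - (2 * (D + 1))"
   proof -
    have "real n * ac n = real n powr (1 + - (D + 2))" unfolding powr_add ac_def using n by simp
    then have "(real n * ac n)^2 = real n powr ((1 + - (D + 2)) + (1 + - (D + 2)))" by (simp only: power2_eq_square padd)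
    also have "(1 + - (D + 2)) + (1 + - (D + 2)) = - (2 * (D + 1))" by simp
    finally show ?thesis .
   qed
   have e2: "real (n + 1) * (real (gl n + 1) * (2 * exp (?E n))) <= 8 * real n powr 2 * exp (?A n)"
   proof -
    have "real n * moment_const 2 / (2 * Tr n)^2 = moment_const 2 * real n powr (1/8) / 4"
    proof -
     have "(Tr n)^2 = real n powr (7/8)" using n by (simp add: Tr_def powr_power)
     moreover have "real n / real n powr (7/8) = real n powr (1/8)"
      using powr_diff[of "real n" 1 "7/8"] n by simp
     ultimately have "real n / (Tr n)^2 = real n powr (1/8)" by simp
     moreover have "real n * moment_const 2 / (2 * Tr n)^2 = real n / (Tr n)^2 * moment_const 2 / 4" by (simp add: power_mult_distrib)
     ultimately show ?thesis by simp
    qed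
    moreover have "?x n / (2 * Tr n) = real n powr (11/64) / 2"
     using powr_diff[of "real n" "39/64" "7/16"] by (simp add: Tr_def)
    ultimately have "real n * moment_const 2 / (2 * Tr n)^2 - ?x n / (2 * Tr n) <= - (1/4) * real n powr (11/64)" using elim(5) by linarith
    then have "exp (?E n) <= exp (?A n)" by simp
    moreover have "real (gl n) <= real n"
     using gb(2) n powr_mono[of "1/128" 1 "real n"] by simp
    ultimately have "real (n + 1) * (real (gl n + 1) * (2 * exp (?E n)))
      <= (2 * real n) * ((2 * real n) * (2 * exp (?A n)))"
     using n by (intro mult_mono) auto
    then show ?thesis using n by (simp add: power2_eq_square)
   qed
   have e3: "2 * exp ((?th n)^2 * (real (nb n) * ?B n) - ?th n * ?z n) <= 2 * exp K * exp (?D n)"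
   proof -
    have g0: "0 < real (gl n)" using gb by simp
    have "real (nb n) * ?B n <= real n / real (gl n) ^ 4 * ?B n"
     by (rule mult_right_mono[OF b(5)]) (use moment_const_nonneg in auto)
    also have "... = (real n * (A n)^2) * moment_const 2 / (real (gl n))^2"
     using g0 by (simp add: power_mult_distrib power2_eq_square power4_eq_xxxx)
    also have "real n * (A n)^2 = R^2" using A_square[of n] n by (simp add: R_def power_divide)
    finally have "(?th n)^2 * (real (nb n) * ?B n) <= (?th n)^2 * (K / (real (gl n))^2)"
     unfolding K_def by (rule mult_left_mono) simp
    also have "... = K * (?th n / real (gl n))^2" by (simp add: power_divide)
    also have "... <= K * 1^2" using gb(1) g0 moment_const_nonneg[of 2] by (intro mult_left_mono power_mono) (auto simp: K_def)
    finally have "(?th n)^2 * (real (nb n) * ?B n) - ?th n * ?z n <= K - real n powr (1/512)"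
     unfolding padd by simp
    then have "exp ((?th n)^2 * (real (nb n) * ?B n) - ?th n * ?z n) <= exp (K - real n powr (1/512))"
     by (simp only: exp_le_cancel_iff)
    moreover have "exp K * exp (?D n) = exp (K - real n powr (1/512))" by (simp add: mult_exp_exp)
    moreover have "2 * a <= 2 * b * c" if "a <= e" "b * c = e" for a b c e :: real using that by simp
    ultimately show ?thesis by blast
   qed
   have "tail_bound n (nb n) (gl n) (Tr n) (ac n) (?x n) (?th n) (?z n)
     <= real n powr - (2 * (D + 1)) + 8 * real n powr 2 * exp (?A n) + 2 * exp K * exp (?D n)"
    unfolding tail_bound_def e1 by (intro add_mono e2 e3 order_refl)
   then have "real (d n) * tail_bound n (nb n) (gl n) (Tr n) (ac n) (?x n) (?th n) (?z n)
     <= real n powr (D + 1) * (real n powr - (2 * (D + 1)) + 8 * real n powr 2 * exp (?A n) + 2 * exp K * exp (?D n))"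
    using dn moment_const_nonneg[of 2] by (intro mult_mono) (auto simp: tail_bound_def)
   also have "... = real n powr (D + 1) * real n powr - (2 * (D + 1)) + 8 * (real n powr (D + 1) * real n powr 2 * exp (?A n))
     + 2 * exp K * (real n powr (D + 1) * exp (?D n))" by (simp only: distrib_left mult_ac)
   also have "real n powr (D + 1) * real n powr - (2 * (D + 1)) = real n powr - (D + 1)" unfolding padd by (simp add: algebra_simps)
   also have "real n powr (D + 1) * real n powr 2 = real n powr (D + 3)" unfolding padd by (simp add: algebra_simps)
   finally show ?thesis .
  qed
  have "prob {y:space M. EX h:{1..d n}. 2 * ?z n < (?C n h y)}
   <= prob {y:space M. EX h:{1..d n}. linear_err n (bl n) (gl n) (Tr n) (?x n) (?z n) < (?C n h y)}"
  proof (rule finite_measure_mono)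
   show "{y:space M. EX h:{1..d n}. 2 * ?z n < (?C n h y)}
    \<subseteq> {y:space M. EX h:{1..d n}. linear_err n (bl n) (gl n) (Tr n) (?x n) (?z n) < (?C n h y)}"
    using lin by force
   have "tst n h : borel_measurable M" "(%y. SY n h y) : borel_measurable M" if "h : {1..d n}" for h
    using that gb Tr_pos[of n] by (auto intro!: measurable_tst borel_measurable_sum measurable_Y)
   then show "{y:space M. EX h:{1..d n}. linear_err n (bl n) (gl n) (Tr n) (?x n) (?z n) < (?C n h y)} : events"
    by measurable
  qed
  also have "... <= real (d n) * tail_bound n (nb n) (gl n) (Tr n) (ac n) (?x n) (?th n) (?z n)"
  proof (rule max_tst_block_tail[OF Tr_pos[OF gb(4)] ac_pos[OF gb(4)] _ bl0 block_count(1)[OF gb(3)] _ block_count(2)[OF gb(3)] b(2) _ th])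
   show "0 < n" using gb by simp
   show "(LINT y|M. (Xt (gl n) (Tr n) j h y - X j h y)^2) <= (ac n)^2 \<and> integrable M (%y. (Xt (gl n) (Tr n) j h y - X j h y)^2)"
    if "h : {1..d n}" for j h using elim that by blast
  qed simp
  also note tail
  finally show ?case .
 qed
qed

abbreviation "la n \<equiv> ln (real (d n))"

definition be :: "nat => real" where "be n = la n powr (1/2 + \<eta>/4)"

text \<open>\<open>gumbel_a\<close> is a multiple of \<open>sqrt (log d)\<close>, so a shift of
  smaller order than its reciprocal does not move the limit.\<close>

lemma gumbel_level_perturb:
 assumes lev: "(%n. gumbel_a (d n) * (v n - gumbel_b (d n))) ----> x"
  and w: "(%n. sqrt (la n) * (w n - v n)) ----> 0"
 shows "(%n. gumbel_a (d n) * (w n - gumbel_b (d n))) ----> x"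
proof -
 have "(%n. gumbel_a (d n) * (v n - gumbel_b (d n)) + sqrt 2 * (sqrt (la n) * (w n - v n))) ----> x + sqrt 2 * 0"
  by (intro tendsto_intros lev w)
 then show ?thesis by (simp add: gumbel_a_def real_sqrt_mult algebra_simps)
qed

lemma lam_limit: "filterlim (%n. la n) at_top sequentially"
 by (rule lam_at_top[OF C1 D d_approx])

lemma lam_powr_small: "0 <= k ==> 0 < e ==> (%n. la n powr k * real n powr - e) ----> 0"
 by (rule log_powr_small[OF C1 D d_approx])

lemma sqrt_lam_inverse_be: "(%n. sqrt (la n) * (1 / be n)) ----> 0"
proof (rule Lim_transform_eventually)
 show "(%n. la n powr - (\<eta>/4)) ----> 0" using \<eta> by (intro tendsto_neg_powr lam_limit) auto
 have "EV n. 0 < la n" using lam_limit by (simp add: filterlim_at_top_dense)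
 then show "EV n. la n powr - (\<eta>/4) = sqrt (la n) * (1 / be n)"
 proof eventually_elim
  case (elim n)
  have "sqrt (la n) * (1 / be n) = la n powr (1/2) / la n powr (1/2 + \<eta>/4)" using elim by (simp add: be_def powr_half_sqrt)
  also have "... = la n powr - (\<eta>/4)" by (simp only: powr_diff[symmetric]) simp
  finally show ?case ..
 qed
qed

context
 fixes v :: "nat => real" and x :: real
 assumes lev: "(%n. gumbel_a (d n) * (v n - gumbel_b (d n))) ----> x"
begin

lemma v_bounds: "EV n. 0 < v n \<and> v n <= 2 * sqrt (la n) \<and> 1 < la n"
proof -
 have "EV n. v n / sqrt (la n) < 2"
  by (rule order_tendstoD(2)[OF gumbel_level_asymp(1)[OF dim_limit lev]]) (simp add: real_less_lsqrt)
 moreover have "EV n. 0 < v n" using level_at_top[OF dim_limit lev] by (simp add: filterlim_at_top_dense)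
 moreover have "EV n. 1 < la n" using lam_limit by (simp add: filterlim_at_top_dense)
 ultimately show ?thesis by eventually_elim (auto simp: divide_less_eq)
qed

text \<open>Both levels differ from \<open>v\<close> by less than the order of
  \<open>1 / sqrt (log d)\<close>: the relative error \<open>n^(-1/512)\<close> beats the factor
  \<open>log d\<close>, and \<open>1 / be\<close> is small enough by the choice of
  \<open>be\<close>.\<close>

lemma gaussian_bounds_limit:
 shows "(%n. (1 - normal_tail (v n * (1 - real n powr - (1/512)))) ^ d n) ----> exp (- exp (- x))"
  and "(%n. (1 - normal_tail ((v n + 1 / be n) * (1 + 2 * real n powr - (1/512)))) ^ d n) ----> exp (- exp (- x))"
proof -
 let ?e = "%n::nat. real n powr - (1/512)"
 have ve: "(%n. v n / sqrt (la n) * (la n powr 1 * ?e n)) ----> sqrt 2 * 0"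
  by (intro tendsto_mult gumbel_level_asymp(1)[OF dim_limit lev] lam_powr_small) auto
 have eq: "EV n. v n / sqrt (la n) * (la n powr 1 * ?e n) = sqrt (la n) * v n * ?e n"
  using v_bounds by eventually_elim (simp add: field_simps real_sqrt_mult_self)
 have ve: "(%n. sqrt (la n) * v n * ?e n) ----> 0" using Lim_transform_eventually[OF ve eq] by simp
 have e0: "?e ----> 0" by real_asymp
 have "(%n. - (sqrt (la n) * v n * ?e n)) ----> - 0" by (intro tendsto_minus ve)
 then have "(%n. sqrt (la n) * (v n * (1 - ?e n) - v n)) ----> 0" by (simp add: algebra_simps)
 from gumbel_level_perturb[OF lev this]
 show "(%n. (1 - normal_tail (v n * (1 - ?e n))) ^ d n) ----> exp (- exp (- x))"
  by (rule normal_cdf_power_limit[OF dim_limit])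
 have "(%n. sqrt (la n) * (1 / be n) + 2 * (sqrt (la n) * v n * ?e n) + 2 * (sqrt (la n) * (1 / be n)) * ?e n) ----> 0 + 2 * 0 + 2 * 0 * 0"
  by (intro tendsto_add tendsto_mult tendsto_const sqrt_lam_inverse_be ve e0)
 then have "(%n. sqrt (la n) * ((v n + 1 / be n) * (1 + 2 * ?e n) - v n)) ----> 0" by (simp add: algebra_simps)
 from gumbel_level_perturb[OF lev this]
 show "(%n. (1 - normal_tail ((v n + 1 / be n) * (1 + 2 * ?e n))) ^ d n) ----> exp (- exp (- x))"
  by (rule normal_cdf_power_limit[OF dim_limit])
qed

lemma smoothed_limit:
 assumes C: "0 < C" and cut: "smooth_cutoff q q1 q2 q3 0 C"
  and ql: "\<And>x. x <= 0 ==> q x = 1" and qr: "\<And>x. 1 <= x ==> q x = 0"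
 shows "(%n. (LINT u|M. (PROD h:{1..d n}. q (be n * (SY n h u - v n))))) ----> exp (- exp (- x))"
proof -
 let ?E = "%h i. abs (real h - real i)"
 let ?B = "(exp 1 + normal_cube_moment)"
 let ?A = "%n z. (be n * (z - v n))"
 \<comment> \<open>Strictly between \<open>\<rho>_hi\<close> and 1, which leaves room for the
   covariance error \<open>e n\<close>.\<close>
 define r where "r = (1 + \<rho>_hi) / 2"
 \<comment> \<open>The first bound ensures \<open>1 + 2 * tt <= 2 / (1 + r)\<close>, so that the
   roughly \<open>d^(1 + tt)\<close> close pairs stay negligible. The second makes
   \<open>tt * D\<close> less than \<open>1/16\<close>, as the terms with triples require.\<close>
 define tt where "tt = min ((1 - r) / 4) (1 / (32 * D))"
 \<comment> \<open>Indices farther apart than \<open>d^tt\<close> have a log-distance of order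
   \<open>log d\<close>, so the logarithmic decay of the correlations turns into a power of
   \<open>log d\<close> for all far pairs.\<close>
 define L where "L n = nat \<lfloor>real (d n) powr tt\<rfloor>" for n
 define e where "e n = real n powr - (1/512)" for n :: nat
 let ?D = "%n. ((v n + 1 / be n) * (1 + 2 * e n))"
 define m3 where "m3 n = (real (bl n) * A n) ^ 3 * moment_const 3" for n
 define kp where "kp n = C2 * (tt * la n) powr (- 2 - \<eta>) + e n" for n
 define s2 where "s2 n h = (\<Sum>B<nb n. (LINT u|M. (Y n (gl n) (Tr n) (bl n) B h u)^2))" for n h
 define E where "E n = (LINT u|M. (PROD h:{1..d n}. q (be n * (SY n h u - v n))))" for n
 define G where "G n = (PROD h:{1..d n}. (LINT z|std_normal_distribution. q (be n * (sqrt (s2 n h) * z - v n))))" for n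
 have r: "0 < r" "r < 1" "\<rho>_hi < r" using corr_bound by (auto simp: r_def)
 have th: "0 < tt" "tt * D < 1/16"
 proof -
  show "0 < tt" using r D by (simp add: tt_def)
  have "tt * D <= 1 / (32 * D) * D" using D by (intro mult_right_mono) (auto simp: tt_def)
  then show "tt * D < 1/16" using D by simp
 qed
 have thr: "1 + 2 * tt <= 2 / (1 + r)"
 proof -
  have "(1 + 2 * tt) * (1 + r) <= (1 + 2 * ((1 - r) / 4)) * (1 + r)" using r min.cobounded1[of "(1 - r) / 4" "1 / (32 * D)"] unfolding tt_def by (intro mult_right_mono add_left_mono mult_left_mono) auto
  also have "... = 2 - (1 - r)^2 / 2" by (simp add: power2_eq_square field_simps)
  also have "... <= 2" by simp
  finally show ?thesis using r by (simp add: le_divide_eq)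
 qed
 have Lup: "real (L n) <= real (d n) powr tt" for n by (simp add: L_def)
 have e0: "0 <= e n" for n by (simp add: e_def)
 have elim0: "e ----> 0" unfolding e_def by real_asymp
 let ?R = "V / \<sigma>_lo"
 let ?C = "(?R ^ 3 * moment_const 3)"
 have m3_bound: "EV n. 0 <= m3 n \<and> m3 n <= ?C * real n powr (3/32 - 3/2)"
  using gl_bounds eventually_ge_at_top[of 1]
 proof eventually_elim
  case (elim n)
  then have gb: "real n powr (1/256) <= real (gl n)" "real (gl n) <= real n powr (1/128)" "1 <= gl n" "1 <= n" by auto
  have "(real (bl n) * A n) ^ 3 <= (?R * real n powr (1/32 - 1/2)) ^ 3"
   by (intro power_mono block_scale(1)[OF gb]) (simp add: A_nonneg)
  also have "... = ?R ^ 3 * real n powr ((1/32 - 1/2) * 3)" using elim by (simp only: power_mult_distrib powr_power) simp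
  also have "(1/32 - 1/2) * 3 = (3/32 - 3/2 :: real)" by simp
  finally have "m3 n <= ?R ^ 3 * real n powr (3/32 - 3/2) * moment_const 3"
   unfolding m3_def by (rule mult_right_mono[OF _ moment_const_nonneg])
  moreover have "0 <= m3 n" unfolding m3_def by (intro mult_nonneg_nonneg zero_le_power moment_const_nonneg) (auto simp: A_nonneg)
  ultimately show ?case by (simp only: mult_ac)
 qed
 have nbn: "nb n <= n" for n by (simp add: nb_def div_le_dividend)
 have kap: "(%n. la n * kp n) ----> 0"
 proof (rule Lim_transform_eventually)
  have "(%n. la n powr - (1 + \<eta>)) ----> 0" using \<eta> by (intro tendsto_neg_powr lam_limit) auto
  then have "(%n. C2 * tt powr (- 2 - \<eta>) * la n powr - (1 + \<eta>) + la n powr 1 * e n) ----> C2 * tt powr (- 2 - \<eta>) * 0 + 0"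
   unfolding e_def by (intro tendsto_add tendsto_mult_left lam_powr_small) auto
  then show "(%n. C2 * tt powr (- 2 - \<eta>) * la n powr - (1 + \<eta>) + la n powr 1 * e n) ----> 0" by simp
  show "EV n. C2 * tt powr (- 2 - \<eta>) * la n powr - (1 + \<eta>) + la n powr 1 * e n = la n * kp n"
   using v_bounds
  proof eventually_elim
   case (elim n)
   have "la n powr - (1 + \<eta>) = la n * la n powr (- 2 - \<eta>)" using elim by (simp add: powr_mult_base)
   then show ?case using elim by (simp add: kp_def powr_mult distrib_left mult_ac)
  qed
 qed
 have swap: "(%n. swap_error (d n) (L n) (nb n) (m3 n) (kp n) r (v n) (C * be n)) ----> 0"
  unfolding kp_def e_def be_def
  by (rule swap_error_tendsto[OF C1 D d_approx lev _ C2 \<eta> th _ thr _ Lup nbn m3_bound]) (use C r in auto)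
 have "EV n. abs (E n - G n) <= swap_error (d n) (L n) (nb n) (m3 n) (kp n) r (v n) (C * be n)
  \<and> (1 - normal_tail (v n * (1 - e n))) ^ d n <= G n \<and> G n <= (1 - normal_tail (?D n)) ^ d n"
 proof -
  have "EV n. 2 * la n powr (1/2) <= real n powr (1/64)" by (rule log_powr_le[OF C1 D d_approx]) auto
  moreover have "EV n. (6 * ?R) * real n powr - (1/64) <= real n powr 0"
   "EV n. (81 * (?B * ?C)) * real n powr - (23/64) <= real n powr 0"
   by (rule powr_dominated, simp)+
  moreover have "EV n. 4 * la n powr 1 <= real n powr (1/512)" by (rule log_powr_le[OF C1 D d_approx]) auto
  moreover have "EV n. la n * kp n < 1/4" by (rule order_tendstoD(2)[OF kap]) simp
  moreover have "EV n. e n < min (r - \<rho>_hi) (1/2)" using r by (intro order_tendstoD(2)[OF elim0]) auto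
  ultimately show ?thesis
   using v_bounds gl_bounds m3_bound approx_eventually var_err_eventually eventually_ge_at_top[of 1]
  proof eventually_elim
   case (elim n)
   then have gb: "real n powr (1/256) <= real (gl n)" "real (gl n) <= real n powr (1/128)" "1 <= gl n" "1 <= n" by auto
   have n: "0 < n" "1 <= real n" using gb by auto
   have bl0: "0 < bl n" using bl_bounds(2)[OF gb] gb by linarith
   have l1: "1 < la n" "0 < v n" "v n <= 2 * sqrt (la n)" using elim by auto
   have be0: "0 < be n" using l1 by (simp add: be_def)
   have d1: "1 <= real (d n)" using l1 by (cases "d n = 0") auto
   have vs: "v n <= real n powr (1/64)" using l1 elim(1) by (simp add: powr_half_sqrt)
   have v2: "(v n)^2 <= 4 * la n" using power_mono[OF l1(3), of 2] l1 by (simp add: power_mult_distrib)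
   have ap: "(LINT u|M. (Xt (gl n) (Tr n) j h u - X j h u)^2) <= (ac n)^2 \<and> integrable M (%u. (Xt (gl n) (Tr n) j h u - X j h u)^2)"
    if "h : {1..d n}" for j h using elim that by blast
   define qn where "qn z = q (?A n z)" for z
   have cmp: "abs (E n - G n) <= swap_error (d n) (L n) (nb n) (m3 n) (kp n) r (v n) (C * be n)"
    unfolding E_def G_def s2_def m3_def qn_def[symmetric]
   proof (rule Y_comparison[OF Tr_pos[OF gb(4)] ac_pos[OF gb(4)] n(1) bl0 block_count(1)[OF gb(3)] ap,
      where e = "e n"])
    show "smooth_cutoff qn (%z. be n * q1 (?A n z)) (%z. (be n)^2 * q2 (?A n z)) (%z. be n ^ 3 * q3 (?A n z)) (v n) (C * be n)"
     unfolding qn_def[abs_def] by (rule smooth_cutoff.rescale[OF cut]) (use be0 l1 in simp_all)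
    show "3 * v n * (real (bl n) * (A n * (2 * Tr n))) <= 1"
    proof -
     have "real (bl n) * (A n * (2 * Tr n)) <= real n powr (1/32) * (2 * ?R * real n powr - (1/16))"
      unfolding block_scale(2)[OF gb] using V_sigma by (intro mult_right_mono bl_bounds(1)[OF gb] mult_nonneg_nonneg) auto
     then have "3 * v n * (real (bl n) * (A n * (2 * Tr n))) <= 3 * real n powr (1/64) * (real n powr (1/32) * (2 * ?R * real n powr - (1/16)))"
      using vs l1 A_nonneg[of n] Tr_pos[OF gb(4)] by (rule_tac mult_mono) auto
     also have "... = 6 * ?R * (real n powr (1/64) * (real n powr (1/32) * real n powr - (1/16)))" by simp
     also have "real n powr (1/64) * (real n powr (1/32) * real n powr - (1/16)) = real n powr - (1/64)" by (simp only: powr_add[symmetric]) simp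
     also have "6 * ?R * real n powr - (1/64) <= 1" using elim(2) n by simp
     finally show ?thesis .
    qed
    show "var_err n (nb n) (bl n) (ac n) <= e n" using elim by (simp add: e_def)
    show "abs (lr_corr M X h i) + e n <= r" if "h : {1..d n}" "i : {1..d n}" "h \<noteq> i" for h i
     using corr_bound(3)[of h i] that elim by auto
    show "r <= 1" "0 <= r" using r by auto
    show "abs (lr_corr M X h i) + e n <= kp n" if hi: "h : {1..d n}" "i : {1..d n}" "\<not> index_close (L n) h i" for h i
    proof -
     have "real (L n) + 1 <= ?E h i" using hi(3) by (auto simp: index_close_def)
     moreover have "real (d n) powr tt < real (L n) + 1" unfolding L_def using floor_correct[of "real (d n) powr tt"] by simp
     ultimately have "real (d n) powr tt <= ?E h i + 2" by linarith
     then have "ln (real (d n) powr tt) <= ln (?E h i + 2)" using d1 by (subst ln_le_cancel_iff) auto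
     then have "tt * la n <= ln (?E h i + 2)" using d1 by (simp add: ln_powr)
     then have "ln (?E h i + 2) powr (- 2 - \<eta>) <= (tt * la n) powr (- 2 - \<eta>)"
      using th l1 \<eta> by (intro powr_mono2') auto
     then have "C2 * ln (?E h i + 2) powr (- 2 - \<eta>) <= C2 * (tt * la n) powr (- 2 - \<eta>)" using C2 by simp
     then show ?thesis using corr_decay[of h i] hi by (simp add: kp_def)
    qed
    show k0: "0 <= kp n" using C2 e0[of n] by (simp add: kp_def)
    show "81 * real (nb n) * v n ^ 3 * (?B * ((real (bl n) * A n) ^ 3 * moment_const 3)) <= 1"
    proof -
     have c0: "0 <= exp 1 + normal_cube_moment" using normal_cube_moment_nonneg by simp
     have m: "0 <= m3 n" "m3 n <= ?C * real n powr (3/32 - 3/2)" using elim by auto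
     have "v n ^ 3 <= (real n powr (1/64)) ^ 3" using vs l1 by (intro power_mono) auto
     also have "... = real n powr (3/64)" using n by (simp add: powr_power)
     finally have v3: "81 * real (nb n) * v n ^ 3 <= 81 * real n * real n powr (3/64)" using nbn[of n] l1 by (intro mult_mono) auto
     have "81 * real (nb n) * v n ^ 3 * (?B * m3 n)
       <= 81 * real n * real n powr (3/64) * (?B * (?C * real n powr (3/32 - 3/2)))"
      by (intro mult_mono[OF v3] mult_left_mono[OF m(2) c0] mult_nonneg_nonneg[OF c0 m(1)]) simp
     also have "... = 81 * (?B * ?C) * (real n powr 1 * (real n powr (3/64) * real n powr (3/32 - 3/2)))"
      using n by (simp only: mult_ac powr_one)
     also have "real n powr 1 * (real n powr (3/64) * real n powr (3/32 - 3/2)) = real n powr - (23/64)" by (simp only: powr_add[symmetric]) simp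
     also have "81 * (?B * ?C) * real n powr - (23/64) <= 1" using elim(3) n by simp
     finally show ?thesis unfolding m3_def .
    qed
    show "(v n)^2 * e n <= 1"
    proof -
     have "(v n)^2 * e n <= real n powr (1/512) * e n" using v2 elim(4) l1 e0[of n] by (intro mult_right_mono) auto
     also have "... = 1" using n by (simp add: e_def powr_minus)
     finally show ?thesis .
    qed
    show "(v n)^2 * kp n <= 1" using mult_right_mono[OF v2 k0] elim(5) by simp
   qed
   have en: "0 <= e n" "e n <= 1/2" using e0 elim by auto
   have gb2: "1 - normal_tail (v n * (1 - e n)) <= (LINT z|std_normal_distribution. qn (sqrt (s2 n h) * z))
     \<and> (LINT z|std_normal_distribution. qn (sqrt (s2 n h) * z)) <= 1 - normal_tail (?D n)" if h: "h : {1..d n}" for h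
   proof -
    note [measurable] = smooth_cutoff.borel_measurable_cutoff(1)[OF cut]
    have qm: "qn : borel_measurable borel" unfolding qn_def by measurable
    have qn01: "0 <= qn z \<and> qn z <= 1" for z using smooth_cutoff.c01[OF cut] by (simp add: qn_def)
    have qnl: "qn z = 1" if "z <= v n" for z unfolding qn_def using that be0 by (intro ql) (simp add: mult_nonneg_nonpos)
    have qnr: "qn z = 0" if "v n + 1 / be n <= z" for z unfolding qn_def using that be0 by (intro qr) (simp add: field_simps)
    have "abs (s2 n h - 1) <= e n" unfolding s2_def
     using Y_variance[OF Tr_pos[OF gb(4)] ac_pos[OF gb(4)] n(1) bl0 block_count(1)[OF gb(3)] ap h] elim by (simp add: e_def)
    then have s: "0 <= s2 n h" "1 - e n <= s2 n h" "s2 n h <= 1 + e n" using en by auto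
    have u0: "0 <= v n" "0 <= v n + 1 / be n" using l1 be0 by auto
    show ?thesis using cutoff_integral_bounds[OF qm qn01 qnl qnr u0 s en] by blast
   qed
   have nt: "0 <= 1 - normal_tail w" for w
    using prob_space.prob_le_1[OF prob_space_std_normal, of "{w<..}"] by simp
   have "(1 - normal_tail (v n * (1 - e n))) ^ d n <= G n"
   proof -
    have "(PROD h:{1..d n}. 1 - normal_tail (v n * (1 - e n))) <= G n"
     unfolding G_def qn_def[symmetric] using gb2 nt by (intro prod_mono) auto
    then show ?thesis by simp
   qed
   moreover have "G n <= (1 - normal_tail (?D n)) ^ d n"
   proof -
    have "G n <= (PROD h:{1..d n}. 1 - normal_tail (?D n))"
     unfolding G_def qn_def[symmetric] using gb2 nt by (intro prod_mono) (meson order_trans)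
    then show ?thesis by simp
   qed
   ultimately show ?case using cmp by blast
  qed
 qed
 then have ev: "EV n. abs (E n - G n) <= swap_error (d n) (L n) (nb n) (m3 n) (kp n) r (v n) (C * be n)"
  "EV n. (1 - normal_tail (v n * (1 - e n))) ^ d n <= G n"
  "EV n. G n <= (1 - normal_tail (?D n)) ^ d n"
  by (auto elim: eventually_mono)
 have "G ----> exp (- exp (- x))"
  by (rule tendsto_sandwich[OF ev(2,3)]) (unfold e_def, rule gaussian_bounds_limit, rule gaussian_bounds_limit)
 moreover have "(%n. E n - G n) ----> 0"
  by (rule Lim_null_comparison[OF _ swap]) (use ev(1) in simp)
 ultimately have "(%n. (E n - G n) + G n) ----> 0 + exp (- exp (- x))" by (intro tendsto_add)
 then show ?thesis by (simp add: E_def)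
qed

end

lemma max_cdf_limit:
 "(%n. prob {u:space M. gumbel_a (d n) * ((MAX h\<in>{1..d n}. tst n h u) - gumbel_b (d n)) <= x}) ----> exp (- exp (- x))"
proof -
 obtain q q1 q2 q3 C where q: "0 < C" "smooth_cutoff q q1 q2 q3 0 C" "\<And>x. x <= 0 ==> q x = 1" "\<And>x. 1 <= x ==> q x = 0"
  using smooth_cutoff_exists by blast
 define e where "e n = real n powr - (1/512)" for n :: nat
 define w where "w n = gumbel_b (d n) + x / gumbel_a (d n)" for n
 define bad where "bad n = {u:space M. EX h:{1..d n}. 2 * e n < abs (tst n h u - SY n h u)}" for n
 define F where "F v n u = (PROD h:{1..d n}. q (be n * (SY n h u - v)))" for v n u
 define good where "good n = {u:space M. ALL h:{1..d n}. tst n h u <= w n}" for n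
 \<comment> \<open>The cutoff placed at \<open>vu\<close> is 1 up to \<open>w + 2 * e\<close>, and
   the one placed at \<open>vl\<close> is 0 from \<open>w - 2 * e\<close> on. Outside the bad event
   the two products therefore enclose the indicator that the maximum is at most
   \<open>w\<close>.\<close>
 define vu where "vu n = w n + 2 * e n" for n
 define vl where "vl n = w n - 2 * e n - 1 / be n" for n
 have pos: "EV n. 0 < la n" using lam_limit by (simp add: filterlim_at_top_dense)
 have "(%n. gumbel_a (d n) * (w n - gumbel_b (d n))) ----> x"
 proof (rule Lim_transform_eventually[OF tendsto_const])
  show "EV n. x = gumbel_a (d n) * (w n - gumbel_b (d n))"
   using pos by eventually_elim (simp add: w_def gumbel_a_def)
 qed
 note pert = gumbel_level_perturb[OF this]
 have le: "(%n. sqrt (la n) * e n) ----> 0"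
 proof (rule Lim_transform_eventually)
  show "(%n. la n powr (1/2) * e n) ----> 0" unfolding e_def by (rule lam_powr_small) auto
  show "EV n. la n powr (1/2) * e n = sqrt (la n) * e n"
   using pos by eventually_elim (simp add: powr_half_sqrt)
 qed
 have "(%n. 2 * (sqrt (la n) * e n)) ----> 2 * 0" by (intro tendsto_mult_left le)
 then have "(%n. sqrt (la n) * (vu n - w n)) ----> 0" by (simp add: vu_def mult_ac)
 from smoothed_limit[OF pert[OF this] q]
 have up: "(%n. (LINT u|M. F (vu n) n u)) ----> exp (- exp (- x))" by (simp only: F_def)
 have "(%n. - (2 * (sqrt (la n) * e n)) - sqrt (la n) * (1 / be n)) ----> - (2 * 0) - 0"
  by (intro tendsto_diff tendsto_minus tendsto_mult_left le sqrt_lam_inverse_be)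
 then have "(%n. sqrt (la n) * (vl n - w n)) ----> 0" by (simp add: vl_def algebra_simps)
 from smoothed_limit[OF pert[OF this] q]
 have lo: "(%n. (LINT u|M. F (vl n) n u)) ----> exp (- exp (- x))" by (simp only: F_def)
 have badl: "(%n. prob (bad n)) ----> 0" unfolding bad_def e_def by (rule bad_event_limit)
 have sandwich: "EV n. (LINT u|M. F (vl n) n u) - prob (bad n) <= prob (good n) \<and> prob (good n) <= (LINT u|M. F (vu n) n u) + prob (bad n)"
  using pos eventually_ge_at_top[of 1]
 proof eventually_elim
  case (elim n)
  have be0: "0 < be n" using elim by (simp add: be_def)
  have n: "0 < n" "0 <= Tr n" using elim by (auto simp: Tr_def)
  have tm [measurable]: "tst n h : borel_measurable M" if "h : {1..d n}" for h using that n by (intro measurable_tst) auto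
  have Sm [measurable]: "(%u. SY n h u) : borel_measurable M" if "h : {1..d n}" for h
   using that n by (intro borel_measurable_sum measurable_Y) auto
  note [measurable] = smooth_cutoff.borel_measurable_cutoff(1)[OF q(2)]
  have F01: "0 <= F v n u \<and> F v n u <= 1" for v u unfolding F_def using smooth_cutoff.c01[OF q(2)] by (auto intro!: prod_nonneg prod_le_1)
  have Fm: "F v n : borel_measurable M" for v unfolding F_def by measurable
  have Fi: "integrable M (F v n)" for v by (rule integrable_const_bound[where B = 1]) (use F01 Fm in auto)
  have gm: "good n : events" "bad n : events" unfolding good_def bad_def by measurable
  have ii: "integrable M (indicator (good n) :: _ => real)" "integrable M (indicator (bad n) :: _ => real)"
   using gm by (auto simp: emeasure_eq_measure)
  have pr: "prob (good n) = (LINT u|M. indicator (good n) u)" "prob (bad n) = (LINT u|M. indicator (bad n) u)"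
   using gm by (simp_all add: Int_absorb2 sets.sets_into_space)
  have "(LINT u|M. indicator (good n) u) <= (LINT u|M. F (vu n) n u + indicator (bad n) u)"
  proof (rule Bochner_Integration.integral_mono)
   fix u assume w: "u : space M"
   show "indicator (good n) u <= F (vu n) n u + indicator (bad n) u"
   proof (cases "u : good n \<and> u \<notin> bad n")
    case True
    have "q (be n * (SY n h u - vu n)) = 1" if h: "h : {1..d n}" for h
    proof -
     have "abs (tst n h u - SY n h u) <= 2 * e n" "tst n h u <= w n"
      using True h w unfolding good_def bad_def by (auto simp: not_less)
     then have "SY n h u - vu n <= 0" unfolding vu_def by linarith
     then show ?thesis using be0 by (intro q(3)) (simp add: mult_nonneg_nonpos)
    qed
    then have "F (vu n) n u = 1" unfolding F_def by simp
    then show ?thesis by (simp add: indicator_def)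
   qed (use F01[of "vu n" u] in \<open>auto simp: indicator_def\<close>)
  qed (use ii Fi in auto)
  then have 1: "prob (good n) <= (LINT u|M. F (vu n) n u) + prob (bad n)"
   unfolding pr using ii Fi by simp
  have "(LINT u|M. F (vl n) n u) <= (LINT u|M. indicator (good n) u + indicator (bad n) u)"
  proof (rule Bochner_Integration.integral_mono)
   fix u assume w: "u : space M"
   show "F (vl n) n u <= indicator (good n) u + indicator (bad n) u"
   proof (cases "u : good n \<or> u : bad n")
    case False
    then obtain h where h: "h : {1..d n}" "w n < tst n h u" using w by (auto simp: good_def not_le)
    have "abs (tst n h u - SY n h u) <= 2 * e n" using False h w unfolding bad_def by (auto simp: not_less)
    then have "1 / be n <= SY n h u - vl n" using h unfolding vl_def by linarith
    then have "1 <= be n * (SY n h u - vl n)" using be0 by (simp add: field_simps)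
    then have "q (be n * (SY n h u - vl n)) = 0" by (rule q(4))
    then have "F (vl n) n u = 0" unfolding F_def using h(1) by (intro prod_zero) auto
    then show ?thesis by simp
   qed (use F01[of "vl n" u] in \<open>auto simp: indicator_def\<close>)
  qed (use ii Fi in auto)
  then have 2: "(LINT u|M. F (vl n) n u) - prob (bad n) <= prob (good n)"
   unfolding pr using ii Fi by simp
  show ?case using 1 2 by simp
 qed
 have g: "(%n. prob (good n)) ----> exp (- exp (- x))"
 proof (rule tendsto_sandwich)
  show "EV n. (LINT u|M. F (vl n) n u) - prob (bad n) <= prob (good n)"
   "EV n. prob (good n) <= (LINT u|M. F (vu n) n u) + prob (bad n)"
   using sandwich by (auto elim: eventually_mono)
  show "(%n. (LINT u|M. F (vl n) n u) - prob (bad n)) ----> exp (- exp (- x))"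
   "(%n. (LINT u|M. F (vu n) n u) + prob (bad n)) ----> exp (- exp (- x))"
   using tendsto_diff[OF lo badl] tendsto_add[OF up badl] by simp_all
 qed
 then show ?thesis
 proof (rule Lim_transform_eventually)
  show "EV n. prob (good n) = prob {u:space M. gumbel_a (d n) * ((MAX h\<in>{1..d n}. tst n h u) - gumbel_b (d n)) <= x}"
   using pos
  proof eventually_elim
   case (elim n)
   have a: "0 < gumbel_a (d n)" using elim by (simp add: gumbel_a_def)
   have d1: "1 <= d n" using elim by (cases "d n = 0") auto
   have "gumbel_a (d n) * (y - gumbel_b (d n)) <= x \<longleftrightarrow> y <= w n" for y
    using a by (auto simp: w_def field_simps)
   moreover have "(MAX h\<in>{1..d n}. tst n h u) <= w n \<longleftrightarrow> (ALL h:{1..d n}. tst n h u <= w n)" for u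
    using d1 by (subst Max_le_iff) auto
   ultimately show ?case unfolding good_def by simp
  qed
 qed
qed

lemma max_weak_conv:
 "weak_conv_m (%n. distr M borel (%w. gumbel_a (d n) * ((MAX h\<in>{1..d n}. tst n h w) - gumbel_b (d n)))) gumbel"
 unfolding weak_conv_m_def weak_conv_def cdf_gumbel
proof (intro allI impI)
 fix x
 let ?A = "%n w. ((MAX h\<in>{1..d n}. tst n h w) - gumbel_b (d n))"
 show "(%n. cdf (distr M borel (%w. gumbel_a (d n) * ?A n w)) x) ----> exp (- exp (- x))"
 proof (rule Lim_transform_eventually[OF max_cdf_limit])
  show "EV n. prob {w:space M. gumbel_a (d n) * ?A n w <= x}
   = cdf (distr M borel (%w. gumbel_a (d n) * ?A n w)) x"
   using eventually_gt_at_top[of 0]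
  proof eventually_elim
   case (elim n)
   have "(%w. tst n h w) : borel_measurable M" if "h : {1..d n}" for h using that elim by (intro measurable_tst) auto
   then have "(%w. MAX h\<in>{1..d n}. tst n h w) : borel_measurable M" by (intro borel_measurable_Max) auto
   then have "(%w. gumbel_a (d n) * ?A n w) : borel_measurable M" by measurable
   then show ?case unfolding cdf_def by (subst measure_distr) (auto intro!: arg_cong[where f = prob])
  qed
 qed
qed

end

theorem theorem3p5:
  fixes M :: "'w measure" and S :: "'s measure"
    and eps :: "int \<Rightarrow> 'w \<Rightarrow> 's" and eps' :: "'w \<Rightarrow> 's"
    and g :: "nat \<Rightarrow> (nat \<Rightarrow> 's) \<Rightarrow> real"
    and \<mu>1 \<mu>2 t :: "nat \<Rightarrow> real"
    and d :: "nat \<Rightarrow> nat" and Mseq :: "nat \<Rightarrow> real"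
    and p \<delta> K \<sigma>_lo \<sigma>_hi B C1 C2 C3 C4 D \<eta> \<rho>_hi m tb Cl Cu :: real
  defines "X \<equiv> causal g eps"
    and "\<sigma> \<equiv> lr_sd M (causal g eps)"
    and "\<rho> \<equiv> lr_corr M (causal g eps)"
    and "\<Delta> \<equiv> \<lambda>h. \<mu>1 h - \<mu>2 h"
  assumes "prob_space M"
    and eps_indep: "prob_space.indep_vars M (\<lambda>_. S) (case_option eps' eps) (UNIV :: int option set)"
    and eps_ident: "\<And>j. distr M S (eps j) = distr M S (eps 0)"
    and copy_ident: "distr M S eps' = distr M S (eps 0)"
    and g_meas: "\<And>h. h \<ge> 1 \<Longrightarrow> g h \<in> borel_measurable (Pi\<^sub>M UNIV (\<lambda>_. S))"
    and centered: "\<And>j h. h \<ge> 1 \<Longrightarrow> integrable M (X j h) \<and> (\<integral>\<omega>. X j h \<omega> \<partial>M) = 0"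
    and t_range: "\<And>h. h \<ge> 1 \<Longrightarrow> 0 < t h \<and> t h < 1"
    and t_conv: "\<And>h. h \<ge> 1 \<Longrightarrow> \<Delta> h = 0 \<Longrightarrow> t h = 1/2"
    and const_ranges: "p > 4" "0 < \<delta>" "\<delta> < 1" "0 < \<sigma>_lo" "0 < \<sigma>_hi" "0 < B" "B < 1/2"
      "0 < C1" "0 < C2" "1 < C3" "0 < C4" "0 < D" "0 < \<eta>" "0 < \<rho>_hi" "0 < tb" "tb < 1/2"
    and T1: "\<And>j h. h \<ge> 1 \<Longrightarrow>
        integrable M (\<lambda>\<omega>. \<bar>X (int j) h \<omega> - causal g (eps(0 := eps')) (int j) h \<omega>\<bar> powr p) \<and>
        phys_dep M g eps eps' j h p \<le> K * \<delta> ^ j"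
    and T2: "\<And>h. h \<ge> 1 \<Longrightarrow> \<sigma>_lo \<le> \<sigma> h \<and> \<sigma> h \<le> \<sigma>_hi"
    and S1: "\<And>n. n \<ge> 1 \<Longrightarrow> \<bar>real (d n) - C1 * real n powr D\<bar> < 1"
    and S2: "D < min (p / 4 - 1) (p / 4 - B * (p / 2 + 1) - 1)"
    and S3: "\<And>h i. h \<ge> 1 \<Longrightarrow> i \<ge> 1 \<Longrightarrow> h \<noteq> i \<Longrightarrow> \<bar>\<rho> h i\<bar> \<le> \<rho>_hi" "\<rho>_hi < 1"
    and S4: "\<And>h i. h \<ge> 1 \<Longrightarrow> i \<ge> 1 \<Longrightarrow>
        \<bar>\<rho> h i\<bar> \<le> C2 * ln (\<bar>real h - real i\<bar> + 2) powr (- 2 - \<eta>)"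
    and M1: "\<And>k. k \<ge> 1 \<Longrightarrow> Mseq k > 0"
      "\<And>k h. 1 \<le> h \<Longrightarrow> h \<le> k \<Longrightarrow>
        integrable M (\<lambda>\<omega>. exp (\<bar>X 1 h \<omega>\<bar> / Mseq k)) \<and>
        (\<integral>\<omega>. exp (\<bar>X 1 h \<omega>\<bar> / Mseq k) \<partial>M) \<le> C3"
    and M2: "\<And>n. n \<ge> 1 \<Longrightarrow> Mseq (d n) \<le> C4 * real n powr m" "m < 3/8"
    and C1': "\<And>h. h \<ge> 1 \<Longrightarrow> tb \<le> t h \<and> t h \<le> 1 - tb"
    and jump: "0 < Cl" "Cl \<le> Cu" "\<And>h. h \<ge> 1 \<Longrightarrow> Cl \<le> \<bar>\<Delta> h\<bar> \<and> \<bar>\<Delta> h\<bar> \<le> Cu"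
  shows "weak_conv_m
    (\<lambda>n. distr M borel (\<lambda>\<omega>. gumbel_a (d n) *
        ((MAX h\<in>{1..d n}. tstat n (t h) (\<sigma> h) (\<Delta> h) (\<lambda>j. obs n \<mu>1 \<mu>2 t X j h \<omega>))
          - gumbel_b (d n))))
    gumbel"
proof -
  interpret prob_space M by fact
  interpret iid_innovations M S eps eps'
    by unfold_locales (use eps_indep eps_ident copy_ident in auto)
  interpret causal_array M S eps eps' g p K \<delta>
    by unfold_locales (use g_meas centered T1 const_ranges in \<open>auto simp: X_def\<close>)
  interpret cusum_array M S eps eps' g p K \<delta> \<mu>1 \<mu>2 t \<sigma>_lo tb Cl Cu
    by unfold_locales (use T2 C1' jump const_ranges in \<open>auto simp: \<sigma>_def \<Delta>_def\<close>)
  interpret change_point_model M S eps eps' g p K \<delta> \<mu>1 \<mu>2 t \<sigma>_lo tb Cl Cu d Mseq C1 C2 C3 C4 D \<eta> \<rho>_hi m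
    by unfold_locales (use S1 S3 S4 M1 M2 const_ranges in \<open>auto simp: \<rho>_def X_def\<close>)
  show ?thesis using max_weak_conv unfolding tst_def X_def \<sigma>_def \<Delta>_def .
qed

end
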